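(* Let $\mathcal{A}$ be a unital C$^{*}$-algebra with pure state space $\mathcal{P}$ and spectrum $B$, let $X$ be a Hilbert C$^{*}$-module over $\mathcal{A}$, and let $(\mathcal{E}_{X},\Pi_{X},\mathcal{P})$ be its atomic bundle. For $b\in B$ let $(\mathcal{H}_{b},\pi_b)$ be a representative of $b$, let $\mathcal{E}_{X}^{b}= \Pi_{X}^{-1}(\mathcal{P}_{b})$ and $\Pi_{X}^{b}= \Pi_{X}|_{\mathcal{E}_{X}^{b}}$. Then $(\mathcal{E}_{X}^{b},\Pi_{X}^{b},\mathcal{P}_{b})$ (with the structure and the identification $\mathcal{P}_b\cong\mathcal{P}(\mathcal{H}_b)$ described in the context) is a locally trivial vector bundle which is isomorphic to the associated bundle $S(\mathcal{H}_b)\times_{U(1)}F_X^b\to\mathcal{P}(\mathcal{H}_b)$ of the Hopf bundle $(S(\mathcal{H}_{b}),\mu,\mathcal{P}(\mathcal{H}_{b}))$ by the Hilbert space $F_{X}^{b}$. Here an isomorphism means a bijection $\mathcal{E}_X^b\to S(\mathcal{H}_b)\times_{U(1)}F_X^b$ covering $\tau^b:\mathcal{P}_b\to\mathcal{P}(\mathcal{H}_b)$ which is unitary on each fiber and is an isomorphism of locally trivial bundles.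
   Context: Inner products are conjugate-linear in the first and linear in the second variable. Pure states. $\mathcal{P}$ is the set of all pure states of $\mathcal{A}$, $B$ the set of equivalence classes of irreducible representations of $\mathcal{A}$, $p:\mathcal{P}\to B$ the map sending a pure state to the class of its GNS representation, and $\mathcal{P}_b=p^{-1}(b)$. For an irreducible representation $(\mathcal{H}_b,\pi_b)$ in the class $b$, each $\rho\in\mathcal{P}_b$ is $\rho=\langle x_\rho|\pi_b(\cdot)x_\rho\rangle$ for a unit vector $x_\rho$ unique up to phase; $\tau^b:\mathcal{P}_b\to\mathcal{P}(\mathcal{H}_b)$, $\tau^b(\rho)=[x_\rho]$, is a bijection used to identify $\mathcal{P}_b$ with $\mathcal{P}(\mathcal{H}_b)$. Hilbert C$^*$-module. $X$ is a right $\mathcal{A}$-module with an $\mathcal{A}$-valued inner product $\langle\cdot|\cdot\rangle$ with $\langle\eta|\xi a\rangle=\langle\eta|\xi\rangle a$, complete for $\|\xi\|=\|\langle\xi|\xi\rangle\|^{1/2}$. Atomic bundle. For $\rho\in\mathcal{P}$ let $N_\rho=\{\xi\in X:\rho(\langle\xi|\xi\rangle)=0\}$, $\mathcal{E}^o_{X,\rho}=X/N_\rho$, $[\xi]_\rho=\xi+N_\rho$, with inner product $\langle[\xi]_\rho|[\eta]_\rho\rangle_\rho=\rho(\langle\xi|\eta\rangle)$; $\mathcal{E}_{X,\rho}$ is the Hilbert space completion of $\mathcal{E}^o_{X,\rho}$. $\mathcal{E}_X=\bigcup_{\rho\in\mathcal{P}}\mathcal{E}_{X,\rho}$ (disjoint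 union) with natural projection $\Pi_X:\mathcal{E}_X\to\mathcal{P}$. Hopf bundle. For a complex Hilbert space $\mathcal{H}\neq 0$: $\mathcal{P}(\mathcal{H})=(\mathcal{H}\setminus\{0\})/\mathbf{C}^\times$ (quotient topology), $S(\mathcal{H})=\{z\in\mathcal{H}:\|z\|=1\}$, $\mu(z)=[z]$. It is a principal $U(1)$-bundle. For a Hilbert space $F$, the associated bundle is $\pi_F:S(\mathcal{H})\times_{U(1)}F\to\mathcal{P}(\mathcal{H})$, where $S(\mathcal{H})\times_{U(1)}F$ is the set of orbits $[(z,f)]$ of the $U(1)$-action $(z,f)\cdot c=(\bar c z,\bar c f)$ on $S(\mathcal{H})\times F$, with quotient topology and $\pi_F([(z,f)])=[z]$. For $h\in S(\mathcal{H})$ its local trivialization over $\mathcal{V}_h=\{[z]:\langle h|z\rangle\neq0\}$ is $[(z,f)]\mapsto([z],\phi_h(z)f)$, $\phi_h(z)=\langle z|h\rangle\,|\langle h|z\rangle|^{-1}$. The Hilbert space $F_X^b$. Let $G=\mathcal{U}(\mathcal{A})$ be the unitary group of $\mathcal{A}$. $G$ acts on $\mathcal{P}$ by $\chi_u(\rho)=\rho\circ\mathrm{Ad}\,u^*$, where $\mathrm{Ad}\,u^*(a)=u^*au$, and on $\mathcal{E}_X$ by $t_u([\xi]_\rho)=[\xi u^*]_{\chi_u(\rho)}$ (extended to completions by continuity). Let $\mathcal{E}_X^b\times_{\mathcal{P}_b}S(\mathcal{H}_b)=\{(x,h)\in\mathcal{E}_X^b\times S(\mathcal{H}_b):\tau^b(\Pi_X^b(x))=[h]\}$,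 with $G$-action $\sigma^b_u(x,h)=(t_u(x),\pi_b(u)h)$. $F_X^b$ is the set of all $G$-orbits; $\mathcal{O}(x,h)$ denotes the orbit of $(x,h)$. It is a Hilbert space under $a\mathcal{O}(x,h)+c\,\mathcal{O}(y,h)=\mathcal{O}(ax+cy,h)$ ($a,c\in\mathbf{C}$) and $\langle\mathcal{O}(x,h)|\mathcal{O}(y,h)\rangle=\langle x|y\rangle_\rho$ for $\tau^b(\rho)=[h]$ and $x,y\in\mathcal{E}_{X,\rho}$ (these are independent of choices). Structure on $\mathcal{E}_X^b$. The bundle structure (topology, smooth structure) on $\mathcal{E}_X^b$ is the one induced by the map $\Phi^b:\mathcal{E}_X^b\to S(\mathcal{H}_b)\times_{U(1)}F_X^b$, $\Phi^b(x)=[(h_x,\mathcal{O}(x,h_x))]$, where $h_x\in S(\mathcal{H}_b)$ is any vector with $[h_x]=\tau^b(\Pi_X^b(x))$; part of the assertion is that $\Phi^b$ is a well-defined bijection with the stated properties. *)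

theory Defs
  imports "HOL-Analysis.Analysis"
begin

section \<open>Complex vector spaces, Hilbert spaces and C*-algebras as type classes\<close>

class complex_vector = real_vector +
  fixes scaleC :: "complex \<Rightarrow> 'a \<Rightarrow> 'a" (infixr "*\<^sub>C" 75)
  assumes scaleC_add_right: "c *\<^sub>C (x + y) = c *\<^sub>C x + c *\<^sub>C y"
    and scaleC_add_left: "(c + d) *\<^sub>C x = c *\<^sub>C x + d *\<^sub>C x"
    and scaleC_scaleC: "c *\<^sub>C d *\<^sub>C x = (c * d) *\<^sub>C x"
    and scaleC_one: "1 *\<^sub>C x = x"
    and scaleR_scaleC: "r *\<^sub>R x = complex_of_real r *\<^sub>C x"

text \<open>The inner product is conjugate-linear in the first variable; norm and topology are those of
  the underlying real inner product.\<close>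

class complex_hilbert_space = complex_vector + real_inner + complete_space +
  fixes cinner :: "'a \<Rightarrow> 'a \<Rightarrow> complex"
  assumes cinner_add_right: "cinner x (y + z) = cinner x y + cinner x z"
    and cinner_scaleC_right: "cinner x (c *\<^sub>C y) = c * cinner x y"
    and cinner_commute: "cinner x y = cnj (cinner y x)"
    and inner_eq_Re_cinner: "inner x y = Re (cinner x y)"

class cstar_algebra = complex_vector + real_normed_algebra_1 + complete_space +
  fixes star :: "'a \<Rightarrow> 'a"
  assumes mult_scaleC_left: "(c *\<^sub>C x) * y = c *\<^sub>C (x * y)"
    and mult_scaleC_right: "x * (c *\<^sub>C y) = c *\<^sub>C (x * y)"
    and norm_scaleC: "norm (c *\<^sub>C x) = cmod c * norm x"
    and star_star: "star (star x) = x"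
    and star_add: "star (x + y) = star x + star y"
    and star_scaleC: "star (c *\<^sub>C x) = cnj c *\<^sub>C star x"
    and star_mult: "star (x * y) = star y * star x"
    and cstar_identity: "norm (star x * x) = (norm x)\<^sup>2"


section \<open>Complex inner product spaces on a carrier set\<close>

text \<open>The spaces attached to pure states depend on the state, so they cannot be types.\<close>

record 'v ips =
  vcarrier :: "'v set"
  vadd :: "'v \<Rightarrow> 'v \<Rightarrow> 'v"
  vscale :: "complex \<Rightarrow> 'v \<Rightarrow> 'v"
  vinner :: "'v \<Rightarrow> 'v \<Rightarrow> complex"

definition vzero :: "'v ips \<Rightarrow> 'v" where
  "vzero V = (THE z. z \<in> vcarrier V \<and> (\<forall>u\<in>vcarrier V. vadd V z u = u))"

locale inner_product_space =
  fixes V :: "'v ips"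
  assumes zero_exists: "\<exists>z\<in>vcarrier V. \<forall>u\<in>vcarrier V. vadd V z u = u"
    and add_closed: "\<lbrakk>u \<in> vcarrier V; v \<in> vcarrier V\<rbrakk> \<Longrightarrow> vadd V u v \<in> vcarrier V"
    and scale_closed: "u \<in> vcarrier V \<Longrightarrow> vscale V c u \<in> vcarrier V"
    and add_assoc: "\<lbrakk>u \<in> vcarrier V; v \<in> vcarrier V; w \<in> vcarrier V\<rbrakk> \<Longrightarrow>
          vadd V (vadd V u v) w = vadd V u (vadd V v w)"
    and add_commute: "\<lbrakk>u \<in> vcarrier V; v \<in> vcarrier V\<rbrakk> \<Longrightarrow> vadd V u v = vadd V v u"
    and add_inverse: "u \<in> vcarrier V \<Longrightarrow> vadd V u (vscale V (-1) u) = vzero V"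
    and scale_add_right: "\<lbrakk>u \<in> vcarrier V; v \<in> vcarrier V\<rbrakk> \<Longrightarrow>
          vscale V c (vadd V u v) = vadd V (vscale V c u) (vscale V c v)"
    and scale_add_left: "u \<in> vcarrier V \<Longrightarrow>
          vscale V (c + d) u = vadd V (vscale V c u) (vscale V d u)"
    and scale_scale: "u \<in> vcarrier V \<Longrightarrow> vscale V c (vscale V d u) = vscale V (c * d) u"
    and scale_one: "u \<in> vcarrier V \<Longrightarrow> vscale V 1 u = u"
    and inner_add_right: "\<lbrakk>u \<in> vcarrier V; v \<in> vcarrier V; w \<in> vcarrier V\<rbrakk> \<Longrightarrow>
          vinner V u (vadd V v w) = vinner V u v + vinner V u w"
    and inner_scale_right: "\<lbrakk>u \<in> vcarrier V; v \<in> vcarrier V\<rbrakk> \<Longrightarrow>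
          vinner V u (vscale V c v) = c * vinner V u v"
    and inner_commute: "\<lbrakk>u \<in> vcarrier V; v \<in> vcarrier V\<rbrakk> \<Longrightarrow>
          vinner V u v = cnj (vinner V v u)"
    and inner_nonneg: "u \<in> vcarrier V \<Longrightarrow> vinner V u u \<in> \<real>\<^sub>\<ge>\<^sub>0"
    and inner_definite: "\<lbrakk>u \<in> vcarrier V; vinner V u u = 0\<rbrakk> \<Longrightarrow> u = vzero V"

text \<open>The value 0 off the carrier makes \<^term>\<open>vdist V\<close> fit \<^locale>\<open>Metric_space\<close>, which
  demands symmetry and nonnegativity also outside the carrier.\<close>

definition vdist :: "'v ips \<Rightarrow> 'v \<Rightarrow> 'v \<Rightarrow> real" where
  "vdist V u v =
    (if u \<in> vcarrier V \<and> v \<in> vcarrier V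
     then (let w = vadd V u (vscale V (-1) v) in sqrt (Re (vinner V w w))) else 0)"

definition vtopology :: "'v ips \<Rightarrow> 'v topology" where
  "vtopology V = Metric_space.mtopology (vcarrier V) (vdist V)"

locale hilbert_space = inner_product_space +
  assumes complete: "Metric_space.mcomplete (vcarrier V) (vdist V)"

definition type_ips :: "'h::complex_hilbert_space ips" where
  "type_ips = \<lparr>vcarrier = UNIV, vadd = (+), vscale = scaleC, vinner = cinner\<rparr>"

definition unitary_map :: "'v ips \<Rightarrow> 'w ips \<Rightarrow> ('v \<Rightarrow> 'w) \<Rightarrow> bool" where
  "unitary_map V W T \<longleftrightarrow>
     bij_betw T (vcarrier V) (vcarrier W) \<and>
     (\<forall>u\<in>vcarrier V. \<forall>v\<in>vcarrier V. T (vadd V u v) = vadd W (T u) (T v)) \<and>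
     (\<forall>c. \<forall>u\<in>vcarrier V. T (vscale V c u) = vscale W c (T u)) \<and>
     (\<forall>u\<in>vcarrier V. \<forall>v\<in>vcarrier V. vinner W (T u) (T v) = vinner V u v)"


subsection \<open>Quotient of a semi-inner product by its null space\<close>

definition coset :: "('x::complex_vector \<Rightarrow> 'x \<Rightarrow> complex) \<Rightarrow> 'x \<Rightarrow> 'x set" where
  "coset s \<xi> = {\<xi> + \<nu> |\<nu>. s \<nu> \<nu> = 0}"

text \<open>Operations on cosets are defined by taking the union over all representatives.\<close>

definition null_quotient :: "('x::complex_vector \<Rightarrow> 'x \<Rightarrow> complex) \<Rightarrow> 'x set ips" where
  "null_quotient s =
    \<lparr>vcarrier = range (coset s),
     vadd = (\<lambda>P Q. \<Union>\<xi>\<in>P. \<Union>\<eta>\<in>Q. coset s (\<xi> + \<eta>)),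
     vscale = (\<lambda>c P. \<Union>\<xi>\<in>P. coset s (c *\<^sub>C \<xi>)),
     vinner = (\<lambda>P Q. the_elem {s \<xi> \<eta> |\<xi> \<eta>. \<xi> \<in> P \<and> \<eta> \<in> Q})\<rparr>"

definition quotient_lift ::
    "('x::complex_vector \<Rightarrow> 'x \<Rightarrow> complex) \<Rightarrow> ('x \<Rightarrow> 'x) \<Rightarrow> 'x set \<Rightarrow> 'x set" where
  "quotient_lift s g P = (\<Union>\<xi>\<in>P. coset s (g \<xi>))"


subsection \<open>Completion of an inner product space\<close>

text \<open>Points of the completion are Cauchy sequences modulo sequences of vanishing distance.\<close>

definition cauchy_class :: "'v ips \<Rightarrow> (nat \<Rightarrow> 'v) \<Rightarrow> (nat \<Rightarrow> 'v) set" where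
  "cauchy_class V s =
     {t. Metric_space.MCauchy (vcarrier V) (vdist V) t \<and> (\<lambda>n. vdist V (s n) (t n)) \<longlonglongrightarrow> 0}"

definition completion_of :: "'v ips \<Rightarrow> (nat \<Rightarrow> 'v) set ips" where
  "completion_of V =
    \<lparr>vcarrier = cauchy_class V ` {s. Metric_space.MCauchy (vcarrier V) (vdist V) s},
     vadd = (\<lambda>S T. \<Union>s\<in>S. \<Union>t\<in>T. cauchy_class V (\<lambda>n. vadd V (s n) (t n))),
     vscale = (\<lambda>c S. \<Union>s\<in>S. cauchy_class V (\<lambda>n. vscale V c (s n))),
     vinner = (\<lambda>S T. the_elem {lim (\<lambda>n. vinner V (s n) (t n)) |s t. s \<in> S \<and> t \<in> T})\<rparr>"

text \<open>Continuous extension to the completions of a bounded linear map into \<open>W\<close>.\<close>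

definition completion_lift :: "'w ips \<Rightarrow> ('v \<Rightarrow> 'w) \<Rightarrow> (nat \<Rightarrow> 'v) set \<Rightarrow> (nat \<Rightarrow> 'w) set" where
  "completion_lift W T S = (\<Union>s\<in>S. cauchy_class W (\<lambda>n. T (s n)))"


section \<open>States, representations and the GNS construction\<close>

definition state :: "('a::cstar_algebra \<Rightarrow> complex) \<Rightarrow> bool" where
  "state \<rho> \<longleftrightarrow>
     (\<forall>a b. \<rho> (a + b) = \<rho> a + \<rho> b) \<and> (\<forall>c a. \<rho> (c *\<^sub>C a) = c * \<rho> a) \<and>
     (\<forall>a. \<rho> (star a * a) \<in> \<real>\<^sub>\<ge>\<^sub>0) \<and> \<rho> 1 = 1"

definition pure_states :: "('a::cstar_algebra \<Rightarrow> complex) set" where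
  "pure_states = {\<rho>. state \<rho> \<and>
     (\<forall>\<sigma> \<sigma>' t. state \<sigma> \<and> state \<sigma>' \<and> 0 < t \<and> t < 1 \<and>
        \<rho> = (\<lambda>a. complex_of_real t * \<sigma> a + complex_of_real (1 - t) * \<sigma>' a) \<longrightarrow>
        \<sigma> = \<rho> \<and> \<sigma>' = \<rho>)}"

definition csubspace :: "'h::complex_vector set \<Rightarrow> bool" where
  "csubspace M \<longleftrightarrow> 0 \<in> M \<and> (\<forall>x\<in>M. \<forall>y\<in>M. x + y \<in> M) \<and> (\<forall>c. \<forall>x\<in>M. c *\<^sub>C x \<in> M)"

locale representation =
  fixes \<pi> :: "'a::cstar_algebra \<Rightarrow> 'h::complex_hilbert_space \<Rightarrow> 'h"
  assumes rep_bounded: "bounded_linear (\<pi> a)"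
    and rep_clinear: "\<pi> a (c *\<^sub>C x) = c *\<^sub>C \<pi> a x"
    and rep_add: "\<pi> (a + b) x = \<pi> a x + \<pi> b x"
    and rep_scale: "\<pi> (c *\<^sub>C a) x = c *\<^sub>C \<pi> a x"
    and rep_mult: "\<pi> (a * b) x = \<pi> a (\<pi> b x)"
    and rep_one: "\<pi> 1 x = x"
    and rep_star: "cinner (\<pi> (star a) x) y = cinner x (\<pi> a y)"

locale irreducible_representation = representation \<pi>
  for \<pi> :: "'a::cstar_algebra \<Rightarrow> 'h::complex_hilbert_space \<Rightarrow> 'h" +
  assumes nonzero: "\<exists>x::'h. x \<noteq> 0"
    and irreducible: "\<lbrakk>csubspace M; closed M; \<And>a. \<pi> a ` M \<subseteq> M\<rbrakk> \<Longrightarrow> M = {0} \<or> M = UNIV"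

definition gns_form :: "('a::cstar_algebra \<Rightarrow> complex) \<Rightarrow> 'a \<Rightarrow> 'a \<Rightarrow> complex" where
  "gns_form \<rho> a b = \<rho> (star a * b)"

definition gns_space :: "('a::cstar_algebra \<Rightarrow> complex) \<Rightarrow> (nat \<Rightarrow> 'a set) set ips" where
  "gns_space \<rho> = completion_of (null_quotient (gns_form \<rho>))"

definition gns_rep ::
    "('a::cstar_algebra \<Rightarrow> complex) \<Rightarrow> 'a \<Rightarrow> (nat \<Rightarrow> 'a set) set \<Rightarrow> (nat \<Rightarrow> 'a set) set" where
  "gns_rep \<rho> a =
     completion_lift (null_quotient (gns_form \<rho>)) (quotient_lift (gns_form \<rho>) (\<lambda>b. a * b))"

text \<open>The set of pure states whose GNS representation is unitarily equivalent to \<open>\<pi>\<close>, i.e. the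
  fibre over the class of \<open>\<pi>\<close> in the spectrum.\<close>

definition pure_states_of ::
    "('a::cstar_algebra \<Rightarrow> 'h::complex_hilbert_space \<Rightarrow> 'h) \<Rightarrow> ('a \<Rightarrow> complex) set" where
  "pure_states_of \<pi> = {\<rho> \<in> pure_states. \<exists>T. unitary_map (gns_space \<rho>) type_ips T \<and>
     (\<forall>a. \<forall>v\<in>vcarrier (gns_space \<rho>). T (gns_rep \<rho> a v) = \<pi> a (T v))}"


section \<open>Hilbert C*-modules and the atomic bundle\<close>

definition module_norm :: "('x \<Rightarrow> 'x \<Rightarrow> 'a::cstar_algebra) \<Rightarrow> 'x \<Rightarrow> real" where
  "module_norm ip \<xi> = sqrt (norm (ip \<xi> \<xi>))"

locale hilbert_cstar_module =
  fixes act :: "'x::complex_vector \<Rightarrow> 'a::cstar_algebra \<Rightarrow> 'x"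
    and ip :: "'x \<Rightarrow> 'x \<Rightarrow> 'a"
  assumes act_add_left: "act (\<xi> + \<eta>) a = act \<xi> a + act \<eta> a"
    and act_add_right: "act \<xi> (a + b) = act \<xi> a + act \<xi> b"
    and act_mult: "act \<xi> (a * b) = act (act \<xi> a) b"
    and act_one: "act \<xi> 1 = \<xi>"
    and act_scaleC_left: "act (c *\<^sub>C \<xi>) a = c *\<^sub>C act \<xi> a"
    and act_scaleC_right: "act \<xi> (c *\<^sub>C a) = c *\<^sub>C act \<xi> a"
    and ip_add_right: "ip \<eta> (\<xi> + \<zeta>) = ip \<eta> \<xi> + ip \<eta> \<zeta>"
    and ip_scaleC_right: "ip \<eta> (c *\<^sub>C \<xi>) = c *\<^sub>C ip \<eta> \<xi>"
    and ip_act_right: "ip \<eta> (act \<xi> a) = ip \<eta> \<xi> * a"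
    and ip_star: "star (ip \<eta> \<xi>) = ip \<xi> \<eta>"
    and ip_positive: "\<exists>a. ip \<xi> \<xi> = star a * a"
    and ip_definite: "ip \<xi> \<xi> = 0 \<Longrightarrow> \<xi> = 0"
    and module_complete: "Metric_space.mcomplete UNIV (\<lambda>\<xi> \<eta>. module_norm ip (\<xi> - \<eta>))"

definition module_form ::
    "('x \<Rightarrow> 'x \<Rightarrow> 'a::cstar_algebra) \<Rightarrow> ('a \<Rightarrow> complex) \<Rightarrow> 'x \<Rightarrow> 'x \<Rightarrow> complex" where
  "module_form ip \<rho> \<xi> \<eta> = \<rho> (ip \<xi> \<eta>)"

definition pre_atomic_fibre ::
    "('x::complex_vector \<Rightarrow> 'x \<Rightarrow> 'a::cstar_algebra) \<Rightarrow> ('a \<Rightarrow> complex) \<Rightarrow> 'x set ips" where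
  "pre_atomic_fibre ip \<rho> = null_quotient (module_form ip \<rho>)"

definition atomic_fibre ::
    "('x::complex_vector \<Rightarrow> 'x \<Rightarrow> 'a::cstar_algebra) \<Rightarrow> ('a \<Rightarrow> complex) \<Rightarrow> (nat \<Rightarrow> 'x set) set ips" where
  "atomic_fibre ip \<rho> = completion_of (pre_atomic_fibre ip \<rho>)"

text \<open>Points of the atomic bundle are pairs \<open>(\<rho>, x)\<close> with \<open>x\<close> in the fibre over \<open>\<rho>\<close>; the bundle
  projection is \<^const>\<open>fst\<close>.\<close>

type_synonym ('a, 'x) atomic_point = "('a \<Rightarrow> complex) \<times> (nat \<Rightarrow> 'x set) set"

definition atomic_total ::
    "('x::complex_vector \<Rightarrow> 'x \<Rightarrow> 'a::cstar_algebra) \<Rightarrow> ('a, 'x) atomic_point set" where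
  "atomic_total ip = (SIGMA \<rho>:pure_states. vcarrier (atomic_fibre ip \<rho>))"

definition atomic_fibre_at ::
    "('x::complex_vector \<Rightarrow> 'x \<Rightarrow> 'a::cstar_algebra) \<Rightarrow> ('a \<Rightarrow> complex) \<Rightarrow> ('a, 'x) atomic_point ips" where
  "atomic_fibre_at ip \<rho> =
    \<lparr>vcarrier = Pair \<rho> ` vcarrier (atomic_fibre ip \<rho>),
     vadd = (\<lambda>x y. (\<rho>, vadd (atomic_fibre ip \<rho>) (snd x) (snd y))),
     vscale = (\<lambda>c x. (\<rho>, vscale (atomic_fibre ip \<rho>) c (snd x))),
     vinner = (\<lambda>x y. vinner (atomic_fibre ip \<rho>) (snd x) (snd y))\<rparr>"

definition atomic_part ::
    "('x::complex_vector \<Rightarrow> 'x \<Rightarrow> 'a::cstar_algebra) \<Rightarrow> ('a \<Rightarrow> 'h::complex_hilbert_space \<Rightarrow> 'h)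
      \<Rightarrow> ('a, 'x) atomic_point set" where
  "atomic_part ip \<pi> = {x \<in> atomic_total ip. fst x \<in> pure_states_of \<pi>}"

definition unitaries :: "'a::cstar_algebra set" where
  "unitaries = {u. star u * u = 1 \<and> u * star u = 1}"

definition state_act :: "'a::cstar_algebra \<Rightarrow> ('a \<Rightarrow> complex) \<Rightarrow> 'a \<Rightarrow> complex" where
  "state_act u \<rho> = (\<lambda>a. \<rho> (star u * a * u))"

definition atomic_act ::
    "('x::complex_vector \<Rightarrow> 'a::cstar_algebra \<Rightarrow> 'x) \<Rightarrow> ('x \<Rightarrow> 'x \<Rightarrow> 'a) \<Rightarrow> 'a
      \<Rightarrow> ('a, 'x) atomic_point \<Rightarrow> ('a, 'x) atomic_point" where
  "atomic_act act ip u = (\<lambda>(\<rho>, x).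
     (state_act u \<rho>,
      completion_lift (pre_atomic_fibre ip (state_act u \<rho>))
        (quotient_lift (module_form ip (state_act u \<rho>)) (\<lambda>\<xi>. act \<xi> (star u))) x))"


section \<open>Projective space and the Hopf bundle\<close>

definition ray :: "'h::complex_vector \<Rightarrow> 'h set" where
  "ray z = {c *\<^sub>C z |c. c \<noteq> 0}"

definition quotient_topology :: "'a topology \<Rightarrow> ('a \<Rightarrow> 'b) \<Rightarrow> 'b topology" where
  "quotient_topology X q =
     topology (\<lambda>U. U \<subseteq> q ` topspace X \<and> openin X {x \<in> topspace X. q x \<in> U})"

lemma istopology_quotient_topology:
  "istopology (\<lambda>U. U \<subseteq> q ` topspace X \<and> openin X {x \<in> topspace X. q x \<in> U})"
  unfolding istopology_def
proof (intro conjI allI impI)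
  fix S T
  assume S: "S \<subseteq> q ` topspace X \<and> openin X {x \<in> topspace X. q x \<in> S}"
    and T: "T \<subseteq> q ` topspace X \<and> openin X {x \<in> topspace X. q x \<in> T}"
  show "S \<inter> T \<subseteq> q ` topspace X" using S by blast
  have "{x \<in> topspace X. q x \<in> S \<inter> T} = {x \<in> topspace X. q x \<in> S} \<inter> {x \<in> topspace X. q x \<in> T}"
    by blast
  then show "openin X {x \<in> topspace X. q x \<in> S \<inter> T}" using S T by auto
next
  fix \<K>
  assume K: "\<forall>S\<in>\<K>. S \<subseteq> q ` topspace X \<and> openin X {x \<in> topspace X. q x \<in> S}"
  show "\<Union>\<K> \<subseteq> q ` topspace X" using K by blast
  have "{x \<in> topspace X. q x \<in> \<Union>\<K>} = (\<Union>S\<in>\<K>. {x \<in> topspace X. q x \<in> S})"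
    by blast
  then show "openin X {x \<in> topspace X. q x \<in> \<Union>\<K>}" using K by auto
qed

lemma openin_quotient_topology:
  "openin (quotient_topology X q) U \<longleftrightarrow>
     U \<subseteq> q ` topspace X \<and> openin X {x \<in> topspace X. q x \<in> U}"
  by (simp add: quotient_topology_def istopology_quotient_topology)

lemma topspace_quotient_topology: "topspace (quotient_topology X q) = q ` topspace X"
proof -
  have "{x \<in> topspace X. q x \<in> q ` topspace X} = topspace X" by blast
  then have "openin (quotient_topology X q) (q ` topspace X)"
    by (simp add: openin_quotient_topology)
  then show ?thesis
    by (metis openin_quotient_topology openin_subset openin_topspace subset_antisym)
qed

lemma quotient_map_quotient_topology: "quotient_map X (quotient_topology X q) q"
  by (simp add: quotient_map_def topspace_quotient_topology openin_quotient_topology)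

definition projective_topology :: "'h::complex_hilbert_space set topology" where
  "projective_topology = quotient_topology (top_of_set (- {0})) ray"

definition state_ray ::
    "('a::cstar_algebra \<Rightarrow> 'h::complex_hilbert_space \<Rightarrow> 'h) \<Rightarrow> ('a \<Rightarrow> complex) \<Rightarrow> 'h set" where
  "state_ray \<pi> \<rho> = ray (SOME x. norm x = 1 \<and> \<rho> = (\<lambda>a. cinner x (\<pi> a x)))"

definition affine_domain :: "'h::complex_hilbert_space \<Rightarrow> 'h set set" where
  "affine_domain h = {ray z |z. cinner h z \<noteq> 0}"

text \<open>The standard affine chart \<open>[z] \<mapsto> z / \<langle>h|z\<rangle> - h\<close> onto the orthogonal complement of the unit
  vector \<open>h\<close>.\<close>

definition affine_chart :: "'h::complex_hilbert_space \<Rightarrow> 'h set \<Rightarrow> 'h" where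
  "affine_chart h p = the_elem ((\<lambda>z. inverse (cinner h z) *\<^sub>C z - h) ` p)"

definition projective_charts :: "('h::complex_hilbert_space set set \<times> ('h set \<Rightarrow> 'h) \<times> 'h set) set" where
  "projective_charts = {(affine_domain h, affine_chart h, {w. cinner h w = 0}) |h. norm h = 1}"


section \<open>Smooth Hilbert bundles with structure group U(1)\<close>

text \<open>\<open>f\<close> is \<open>n\<close> times differentiable on \<open>U\<close>, a relatively open subset of the linear subspace \<open>K\<close>.
  Derivatives are Frechet derivatives along \<open>K\<close>, iterated for each fixed direction \<open>v \<in> K\<close>. If \<open>K\<close> is
  complete, the uniform boundedness principle shows that having such derivatives for all \<open>n\<close> is the
  same as being infinitely often Frechet differentiable.\<close>

primrec differentiable_times ::
    "nat \<Rightarrow> 'm::real_normed_vector set \<Rightarrow> 'm set \<Rightarrow> ('m \<Rightarrow> 'n::real_normed_vector) \<Rightarrow> bool" where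
  "differentiable_times 0 K U f \<longleftrightarrow> continuous_on U f"
| "differentiable_times (Suc n) K U f \<longleftrightarrow>
     (\<exists>f'. (\<forall>x\<in>U. (f has_derivative f' x) (at x within K)) \<and>
           (\<forall>v\<in>K. differentiable_times n K U (\<lambda>x. f' x v)))"

definition smooth_on ::
    "'m::real_normed_vector set \<Rightarrow> 'm set \<Rightarrow> ('m \<Rightarrow> 'n::real_normed_vector) \<Rightarrow> bool" where
  "smooth_on K U f \<longleftrightarrow> (\<forall>n. differentiable_times n K U f)"

text \<open>A chart \<open>(U, \<beta>, K)\<close> maps the open set \<open>U\<close> onto an open subset of the closed subspace \<open>K\<close>.\<close>

type_synonym ('b, 'm) chart = "'b set \<times> ('b \<Rightarrow> 'm) \<times> 'm set"

definition smooth_atlas :: "'b topology \<Rightarrow> ('b, 'm::real_normed_vector) chart set \<Rightarrow> bool" where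
  "smooth_atlas B \<A> \<longleftrightarrow>
     (\<Union>(U, \<beta>, K)\<in>\<A>. U) = topspace B \<and>
     (\<forall>(U, \<beta>, K)\<in>\<A>. openin B U \<and> subspace K \<and> closed K \<and> openin (top_of_set K) (\<beta> ` U) \<and>
        homeomorphic_map (subtopology B U) (top_of_set (\<beta> ` U)) \<beta>) \<and>
     (\<forall>(U, \<beta>, K)\<in>\<A>. \<forall>(U', \<beta>', K')\<in>\<A>.
        smooth_on K (\<beta> ` (U \<inter> U')) (\<beta>' \<circ> inv_into U \<beta>))"

text \<open>A map between manifolds with the given atlases, read on the subset \<open>D\<close> of its source, is
  smooth in charts.\<close>

definition smooth_between ::
    "('b, 'm::real_normed_vector) chart set \<Rightarrow> ('c, 'n::real_normed_vector) chart set \<Rightarrow> 'b set \<Rightarrow> ('b \<Rightarrow> 'c) \<Rightarrow> bool" where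
  "smooth_between \<A> \<B> D g \<longleftrightarrow>
     (\<forall>(U, \<beta>, K)\<in>\<A>. \<forall>(U', \<beta>', K')\<in>\<B>.
        smooth_on K (\<beta> ` (U \<inter> D \<inter> g -` U')) (\<beta>' \<circ> g \<circ> inv_into U \<beta>))"

definition smooth_function ::
    "('b, 'm::real_normed_vector) chart set \<Rightarrow> 'b set \<Rightarrow> ('b \<Rightarrow> complex) \<Rightarrow> bool" where
  "smooth_function \<A> D c \<longleftrightarrow> (\<forall>(U, \<beta>, K)\<in>\<A>. smooth_on K (\<beta> ` (U \<inter> D)) (c \<circ> inv_into U \<beta>))"

text \<open>The smooth structure of the total space is given by the family \<open>btrivs\<close> of local
  trivializations \<open>(U, \<psi>)\<close>, where \<open>\<psi>\<close> maps the part over \<open>U\<close> to \<open>U \<times> F\<close>, with \<open>F\<close> the typical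
  fibre \<open>bmodel\<close>.\<close>

record ('e, 'b, 'f, 'm) hilbert_bundle =
  btotal :: "'e topology"
  bbase :: "'b topology"
  bproj :: "'e \<Rightarrow> 'b"
  bfibre :: "'b \<Rightarrow> 'e ips"
  bmodel :: "'f ips"
  bcharts :: "('b, 'm) chart set"
  btrivs :: "('b set \<times> ('e \<Rightarrow> 'b \<times> 'f)) set"

definition local_trivialization ::
    "('e, 'b, 'f, 'm) hilbert_bundle \<Rightarrow> 'b set \<Rightarrow> ('e \<Rightarrow> 'b \<times> 'f) \<Rightarrow> bool" where
  "local_trivialization E U \<psi> \<longleftrightarrow>
     openin (bbase E) U \<and>
     homeomorphic_map (subtopology (btotal E) (bproj E -` U))
       (prod_topology (subtopology (bbase E) U) (vtopology (bmodel E))) \<psi> \<and>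
     (\<forall>x\<in>topspace (btotal E). bproj E x \<in> U \<longrightarrow> fst (\<psi> x) = bproj E x) \<and>
     (\<forall>p\<in>U. unitary_map (bfibre E p) (bmodel E) (\<lambda>x. snd (\<psi> x)))"

text \<open>In the trivializations \<open>\<psi>\<close> over \<open>U\<close> and \<open>\<psi>'\<close> over \<open>U'\<close>, the fibre-preserving map \<open>\<Phi>\<close> covering
  \<open>\<tau>\<close> is multiplication by a smooth U(1)-valued function.\<close>

definition smooth_transition ::
    "('e, 'b, 'f, 'm::real_normed_vector) hilbert_bundle \<Rightarrow> ('e \<Rightarrow> 'e2) \<Rightarrow> ('b \<Rightarrow> 'b2) \<Rightarrow>
     'b set \<times> ('e \<Rightarrow> 'b \<times> 'f) \<Rightarrow> 'b2 set \<times> ('e2 \<Rightarrow> 'b2 \<times> 'f) \<Rightarrow> bool" where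
  "smooth_transition E \<Phi> \<tau> = (\<lambda>(U, \<psi>) (U', \<psi>').
     \<exists>c. (\<forall>p\<in>U \<inter> \<tau> -` U'. cmod (c p) = 1) \<and>
         smooth_function (bcharts E) (U \<inter> \<tau> -` U') c \<and>
         (\<forall>x\<in>topspace (btotal E). bproj E x \<in> U \<inter> \<tau> -` U' \<longrightarrow>
            snd (\<psi>' (\<Phi> x)) = vscale (bmodel E) (c (bproj E x)) (snd (\<psi> x))))"

definition locally_trivial_bundle :: "('e, 'b, 'f, 'm::real_normed_vector) hilbert_bundle \<Rightarrow> bool" where
  "locally_trivial_bundle E \<longleftrightarrow>
     continuous_map (btotal E) (bbase E) (bproj E) \<and>
     bproj E ` topspace (btotal E) = topspace (bbase E) \<and>
     hilbert_space (bmodel E) \<and>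
     (\<forall>p\<in>topspace (bbase E). hilbert_space (bfibre E p) \<and>
        vcarrier (bfibre E p) = {x \<in> topspace (btotal E). bproj E x = p}) \<and>
     smooth_atlas (bbase E) (bcharts E) \<and>
     (\<Union>(U, \<psi>)\<in>btrivs E. U) = topspace (bbase E) \<and>
     (\<forall>(U, \<psi>)\<in>btrivs E. local_trivialization E U \<psi>) \<and>
     (\<forall>T\<in>btrivs E. \<forall>T'\<in>btrivs E. smooth_transition E id id T T')"

text \<open>Isomorphism of bundles with the same typical fibre, covering \<open>\<tau>\<close>.\<close>

definition bundle_isomorphism ::
    "('e, 'b, 'f, 'm::real_normed_vector) hilbert_bundle \<Rightarrow> ('e2, 'b2, 'f, 'm2::real_normed_vector) hilbert_bundle \<Rightarrow>
     ('e \<Rightarrow> 'e2) \<Rightarrow> ('b \<Rightarrow> 'b2) \<Rightarrow> bool" where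
  "bundle_isomorphism E E' \<Phi> \<tau> \<longleftrightarrow>
     bmodel E = bmodel E' \<and>
     bij_betw \<Phi> (topspace (btotal E)) (topspace (btotal E')) \<and>
     bij_betw \<tau> (topspace (bbase E)) (topspace (bbase E')) \<and>
     (\<forall>x\<in>topspace (btotal E). bproj E' (\<Phi> x) = \<tau> (bproj E x)) \<and>
     (\<forall>p\<in>topspace (bbase E). unitary_map (bfibre E p) (bfibre E' (\<tau> p)) \<Phi>) \<and>
     homeomorphic_map (btotal E) (btotal E') \<Phi> \<and>
     homeomorphic_map (bbase E) (bbase E') \<tau> \<and>
     smooth_between (bcharts E) (bcharts E') (topspace (bbase E)) \<tau> \<and>
     smooth_between (bcharts E') (bcharts E) (topspace (bbase E'))
       (inv_into (topspace (bbase E)) \<tau>) \<and>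
     (\<forall>T\<in>btrivs E. \<forall>T'\<in>btrivs E'. smooth_transition E \<Phi> \<tau> T T')"

text \<open>The bundle with total set \<open>X\<close>, base set \<open>P\<close>, projection \<open>p\<close> and fibres \<open>fib\<close> whose topologies,
  charts and local trivializations are transported from \<open>E'\<close> along \<open>\<Phi>\<close> and \<open>\<tau>\<close>.\<close>

definition induced_bundle ::
    "('e2, 'b2, 'f, 'm) hilbert_bundle \<Rightarrow> 'e set \<Rightarrow> 'b set \<Rightarrow> ('e \<Rightarrow> 'b) \<Rightarrow> ('b \<Rightarrow> 'e ips) \<Rightarrow>
     ('e \<Rightarrow> 'e2) \<Rightarrow> ('b \<Rightarrow> 'b2) \<Rightarrow> ('e, 'b, 'f, 'm) hilbert_bundle" where
  "induced_bundle E' X P p fib \<Phi> \<tau> =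
    \<lparr>btotal = pullback_topology X \<Phi> (btotal E'),
     bbase = pullback_topology P \<tau> (bbase E'),
     bproj = p,
     bfibre = fib,
     bmodel = bmodel E',
     bcharts = {(\<tau> -` U \<inter> P, \<beta> \<circ> \<tau>, K) |U \<beta> K. (U, \<beta>, K) \<in> bcharts E'},
     btrivs = {(\<tau> -` U \<inter> P, \<lambda>x. (p x, snd (\<psi> (\<Phi> x)))) |U \<psi>. (U, \<psi>) \<in> btrivs E'}\<rparr>"


section \<open>The bundle associated with the Hopf bundle\<close>

definition hopf_orbit :: "'f ips \<Rightarrow> 'h::complex_vector \<times> 'f \<Rightarrow> ('h \<times> 'f) set" where
  "hopf_orbit F = (\<lambda>(z, f). {(cnj c *\<^sub>C z, vscale F (cnj c) f) |c. cmod c = 1})"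

definition assoc_total :: "'f ips \<Rightarrow> ('h::complex_hilbert_space \<times> 'f) set set" where
  "assoc_total F = hopf_orbit F ` (sphere 0 1 \<times> vcarrier F)"

definition assoc_proj :: "('h::complex_vector \<times> 'f) set \<Rightarrow> 'h set" where
  "assoc_proj w = the_elem ((\<lambda>(z, f). ray z) ` w)"

definition assoc_fibre ::
    "'f ips \<Rightarrow> 'h::complex_hilbert_space set \<Rightarrow> ('h \<times> 'f) set ips" where
  "assoc_fibre F p =
    \<lparr>vcarrier = {w \<in> assoc_total F. assoc_proj w = p},
     vadd = (\<lambda>w w'. \<Union>{hopf_orbit F (z, vadd F f g) |z f g. (z, f) \<in> w \<and> (z, g) \<in> w'}),
     vscale = (\<lambda>a w. \<Union>{hopf_orbit F (z, vscale F a f) |z f. (z, f) \<in> w}),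
     vinner = (\<lambda>w w'. the_elem {vinner F f g |z f g. (z, f) \<in> w \<and> (z, g) \<in> w'})\<rparr>"

definition hopf_phase :: "'h::complex_hilbert_space \<Rightarrow> 'h \<Rightarrow> complex" where
  "hopf_phase h z = cinner z h / complex_of_real (cmod (cinner h z))"

definition assoc_triv ::
    "'f ips \<Rightarrow> 'h::complex_hilbert_space \<Rightarrow> ('h \<times> 'f) set \<Rightarrow> 'h set \<times> 'f" where
  "assoc_triv F h w = the_elem ((\<lambda>(z, f). (ray z, vscale F (hopf_phase h z) f)) ` w)"

definition associated_bundle ::
    "'f ips \<Rightarrow> (('h::complex_hilbert_space \<times> 'f) set, 'h set, 'f, 'h) hilbert_bundle" where
  "associated_bundle F =
    \<lparr>btotal = quotient_topology
       (prod_topology (top_of_set (sphere 0 1)) (vtopology F)) (hopf_orbit F),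
     bbase = projective_topology,
     bproj = assoc_proj,
     bfibre = assoc_fibre F,
     bmodel = F,
     bcharts = projective_charts,
     btrivs = {(affine_domain h, assoc_triv F h) |h. norm h = 1}\<rparr>"


section \<open>The Hilbert space of orbits and the bundle over one component\<close>

text \<open>In this section \<open>act\<close> and \<open>ip\<close> are the right action and inner product of the module.\<close>

definition fibre_product ::
    "('x::complex_vector \<Rightarrow> 'x \<Rightarrow> 'a::cstar_algebra) \<Rightarrow> ('a \<Rightarrow> 'h::complex_hilbert_space \<Rightarrow> 'h)
      \<Rightarrow> (('a, 'x) atomic_point \<times> 'h) set" where
  "fibre_product ip \<pi> =
     {(x, h). x \<in> atomic_part ip \<pi> \<and> norm h = 1 \<and> state_ray \<pi> (fst x) = ray h}"

definition unitary_orbit ::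
    "('x::complex_vector \<Rightarrow> 'a::cstar_algebra \<Rightarrow> 'x) \<Rightarrow> ('x \<Rightarrow> 'x \<Rightarrow> 'a)
      \<Rightarrow> ('a \<Rightarrow> 'h::complex_hilbert_space \<Rightarrow> 'h)
      \<Rightarrow> ('a, 'x) atomic_point \<times> 'h \<Rightarrow> (('a, 'x) atomic_point \<times> 'h) set" where
  "unitary_orbit act ip \<pi> = (\<lambda>(x, h). {(atomic_act act ip u x, \<pi> u h) |u. u \<in> unitaries})"

text \<open>Sums and inner products of two orbits are formed from representatives \<open>(x, h)\<close> and \<open>(y, h)\<close>
  with the same \<open>h\<close>; then \<open>x\<close> and \<open>y\<close> lie over the same pure state \<open>\<rho>\<close>.\<close>

definition orbit_space ::
    "('x::complex_vector \<Rightarrow> 'a::cstar_algebra \<Rightarrow> 'x) \<Rightarrow> ('x \<Rightarrow> 'x \<Rightarrow> 'a)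
      \<Rightarrow> ('a \<Rightarrow> 'h::complex_hilbert_space \<Rightarrow> 'h)
      \<Rightarrow> (('a, 'x) atomic_point \<times> 'h) set ips" where
  "orbit_space act ip \<pi> =
    \<lparr>vcarrier = unitary_orbit act ip \<pi> ` fibre_product ip \<pi>,
     vadd = (\<lambda>P Q. \<Union>{unitary_orbit act ip \<pi> ((\<rho>, vadd (atomic_fibre ip \<rho>) x y), h)
                       |\<rho> x y h. ((\<rho>, x), h) \<in> P \<and> ((\<rho>, y), h) \<in> Q}),
     vscale = (\<lambda>a P. \<Union>{unitary_orbit act ip \<pi> ((\<rho>, vscale (atomic_fibre ip \<rho>) a x), h)
                       |\<rho> x h. ((\<rho>, x), h) \<in> P}),
     vinner = (\<lambda>P Q. the_elem {vinner (atomic_fibre ip \<rho>) x y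
                       |\<rho> x y h. ((\<rho>, x), h) \<in> P \<and> ((\<rho>, y), h) \<in> Q})\<rparr>"

definition atomic_to_assoc ::
    "('x::complex_vector \<Rightarrow> 'a::cstar_algebra \<Rightarrow> 'x) \<Rightarrow> ('x \<Rightarrow> 'x \<Rightarrow> 'a)
      \<Rightarrow> ('a \<Rightarrow> 'h::complex_hilbert_space \<Rightarrow> 'h)
      \<Rightarrow> ('a, 'x) atomic_point \<Rightarrow> ('h \<times> (('a, 'x) atomic_point \<times> 'h) set) set" where
  "atomic_to_assoc act ip \<pi> x =
     (let h = (SOME h. norm h = 1 \<and> ray h = state_ray \<pi> (fst x))
      in hopf_orbit (orbit_space act ip \<pi>) (h, unitary_orbit act ip \<pi> (x, h)))"

definition atomic_bundle ::
    "('x::complex_vector \<Rightarrow> 'a::cstar_algebra \<Rightarrow> 'x) \<Rightarrow> ('x \<Rightarrow> 'x \<Rightarrow> 'a)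
      \<Rightarrow> ('a \<Rightarrow> 'h::complex_hilbert_space \<Rightarrow> 'h)
      \<Rightarrow> (('a, 'x) atomic_point, 'a \<Rightarrow> complex, (('a, 'x) atomic_point \<times> 'h) set, 'h) hilbert_bundle" where
  "atomic_bundle act ip \<pi> =
     induced_bundle (associated_bundle (orbit_space act ip \<pi>))
       (atomic_part ip \<pi>) (pure_states_of \<pi>) fst (atomic_fibre_at ip)
       (atomic_to_assoc act ip \<pi>) (state_ray \<pi>)"

end

theory Submission
  imports Defs
begin

text \<open>
  Fix a unit vector \<open>h\<close> of the representation space and let \<open>\<omega>\<^sub>h = \<langle>h|\<pi>(\<cdot>) h\<rangle>\<close> be its vector state. The
  pure states in the class of \<open>\<pi>\<close> are exactly these vector states, and \<open>\<omega>\<^sub>h\<close> determines \<open>h\<close> up to a phase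
  (\<open>pure_states_of_eq\<close>, \<open>vector_state_eqD\<close>). The theorem rests on the map \<open>x \<mapsto> \<O>(x, h)\<close> from the fibre
  over \<open>\<omega>\<^sub>h\<close> to the space \<open>F\<close> of orbits. It is injective because a unitary that fixes \<open>h\<close> acts trivially on
  that fibre (\<open>transport_fixed\<close>). It is surjective because the unitary group of the algebra acts transitively
  on the unit vectors (\<open>unitary_transitive\<close>). So \<open>F\<close> is a Hilbert space, isomorphic to every fibre
  (\<open>unitary_map_orbit\<close>). Replacing \<open>h\<close> by \<open>c h\<close> with \<open>\<bar>c\<bar> = 1\<close> multiplies \<open>\<O>(x, h)\<close> by \<open>c\<close>
  (\<open>orbit_phase\<close>). Hence the class of \<open>(h, \<O>(x, h))\<close> depends only on \<open>x\<close>, and it gives a fibrewise unitary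
  bijection onto the associated bundle of the Hopf bundle (\<open>bij_atomic_to_assoc\<close>). For every Hilbert space
  as typical fibre this associated bundle is locally trivial with smooth transition functions
  (\<open>locally_trivial_associated_bundle\<close>), and a structure transported along a bijection makes the bijection
  an isomorphism (\<open>locally_trivial_E\<close>, \<open>isomorphism_E\<close>).

  Transitivity is Kadison's theorem. Square roots given by the binomial series imply Schur's lemma
  (\<open>schur\<close>). Von Neumann's argument then shows that \<open>\<pi>(A)\<close> contains elements arbitrarily close, on
  finitely many vectors, to any given bounded operator, and self-adjoint elements that do so on two
  vectors if the operator is self-adjoint (\<open>density\<close>, \<open>selfadjoint_density\<close>). If a self-adjoint \<open>a\<close> nearly exchanges two orthogonal
  unit vectors, then \<open>exp (- i t a)\<close> nearly rotates their plane. This moves any unit vector close to any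
  other, and it also yields self-adjoint contractions that nearly exchange the two vectors, so that the
  remaining distance can be closed by unitaries close to \<open>1\<close> (\<open>unitary_correction_step\<close>). Self-adjoint
  density also proves directly, by the Cauchy-Schwarz inequality, that vector states are pure
  (\<open>vector_state_pure\<close>).

  Fibres and GNS spaces are completions of quotients by null spaces. The sections on inner product
  spaces show that these are Hilbert spaces and that isometric maps extend to them.
\<close>

section \<open>Complex vector spaces, Hilbert spaces and C*-algebras\<close>

lemma scaleC_zero_left [simp]: "0 *\<^sub>C (x::'v::complex_vector) = 0"
  using scaleR_scaleC[of 0 x] by simp

lemma scaleC_zero_right [simp]: "c *\<^sub>C (0::'v::complex_vector) = 0"
  using scaleC_add_right[of c "0::'v" 0] by simp

lemma scaleC_minus_one: "(-1) *\<^sub>C x = - (x::'v::complex_vector)"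
  using scaleR_scaleC[of "-1" x] by simp

lemma scaleC_minus_left: "(- c) *\<^sub>C x = - (c *\<^sub>C (x::'v::complex_vector))"
  by (metis scaleC_scaleC scaleC_minus_one mult_minus1)

lemma scaleC_minus_right: "c *\<^sub>C (- x) = - (c *\<^sub>C (x::'v::complex_vector))"
  by (metis scaleC_scaleC scaleC_minus_one mult.commute)

lemma scaleC_diff_right: "c *\<^sub>C (x - y) = c *\<^sub>C x - c *\<^sub>C (y::'v::complex_vector)"
  by (metis diff_conv_add_uminus scaleC_add_right scaleC_minus_right)

lemma scaleC_diff_left: "(c - d) *\<^sub>C x = c *\<^sub>C x - d *\<^sub>C (x::'v::complex_vector)"
  by (metis diff_conv_add_uminus scaleC_add_left scaleC_minus_left)

lemma scaleC_scaleR: "c *\<^sub>C (r *\<^sub>R x) = r *\<^sub>R (c *\<^sub>C (x::'v::complex_vector))"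
  by (simp add: scaleR_scaleC scaleC_scaleC mult.commute)

lemma scaleC_eq_0_iff: "c *\<^sub>C x = 0 \<longleftrightarrow> c = 0 \<or> (x::'v::complex_vector) = 0"
proof
  assume h: "c *\<^sub>C x = 0"
  show "c = 0 \<or> x = 0"
  proof (rule disjCI)
    assume "x \<noteq> 0"
    show "c = 0"
    proof (rule ccontr)
      assume "c \<noteq> 0"
      then have "x = (inverse c * c) *\<^sub>C x" by (simp add: scaleC_one)
      also have "\<dots> = 0" by (simp add: scaleC_scaleC [symmetric] h)
      finally show False using \<open>x \<noteq> 0\<close> by simp
    qed
  qed
qed auto

lemmas scaleC_simps = scaleC_add_right scaleC_add_left scaleC_scaleC scaleC_one
  scaleC_minus_left scaleC_minus_right scaleC_diff_right scaleC_diff_left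

subsection \<open>The complex inner product\<close>

lemma cinner_add_left: "cinner (x + y) z = cinner x z + cinner y (z::'h::complex_hilbert_space)"
  by (metis cinner_add_right cinner_commute complex_cnj_add)

lemma cinner_scaleC_left: "cinner (c *\<^sub>C x) y = cnj c * cinner x (y::'h::complex_hilbert_space)"
  by (metis cinner_scaleC_right cinner_commute complex_cnj_mult)

lemma cinner_scaleR_right: "cinner x (r *\<^sub>R y) = of_real r * cinner x (y::'h::complex_hilbert_space)"
  by (simp add: scaleR_scaleC cinner_scaleC_right)

lemma cinner_scaleR_left: "cinner (r *\<^sub>R x) y = of_real r * cinner x (y::'h::complex_hilbert_space)"
  by (simp add: scaleR_scaleC cinner_scaleC_left)

lemma cinner_zero [simp]: "cinner 0 y = 0" "cinner y (0::'h::complex_hilbert_space) = 0"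
  using cinner_scaleC_left[of 0 0 y] cinner_scaleC_right[of y 0 0] by auto

lemma cinner_minus: "cinner (- x) y = - cinner x (y::'h::complex_hilbert_space)"
  "cinner x (- y) = - cinner x (y::'h::complex_hilbert_space)"
  using cinner_scaleC_left[of "-1" x y] cinner_scaleC_right[of x "-1" y]
  by (auto simp: scaleC_minus_one)

lemma cinner_diff: "cinner (x - z) y = cinner x y - cinner z (y::'h::complex_hilbert_space)"
  "cinner x (y - z) = cinner x y - cinner x (z::'h::complex_hilbert_space)"
  using cinner_add_left[of x "- z" y] cinner_add_right[of x y "- z"] by (auto simp: cinner_minus)

lemmas cinner_simps = cinner_add_left cinner_add_right cinner_scaleC_left cinner_scaleC_right
  cinner_minus cinner_diff cinner_scaleR_right cinner_scaleR_left

lemma cinner_self: "cinner x x = of_real ((norm (x::'h::complex_hilbert_space))\<^sup>2)"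
proof -
  have "Im (cinner x x) = Im (cnj (cinner x x))" using cinner_commute[of x x] by metis
  then have "Im (cinner x x) = 0" by simp
  then show ?thesis
    by (simp add: complex_eq_iff inner_eq_Re_cinner [symmetric] power2_norm_eq_inner)
qed

lemma norm_scaleC_hilbert: "norm (c *\<^sub>C x) = cmod c * norm (x::'h::complex_hilbert_space)"
proof -
  have "complex_of_real ((norm (c *\<^sub>C x))\<^sup>2) = (c * cnj c) * of_real ((norm x)\<^sup>2)"
    by (simp only: cinner_self [symmetric]) (simp add: cinner_simps)
  also have "\<dots> = of_real ((cmod c * norm x)\<^sup>2)"
    by (simp add: complex_norm_square [symmetric] power_mult_distrib)
  finally have "complex_of_real ((norm (c *\<^sub>C x))\<^sup>2) = of_real ((cmod c * norm x)\<^sup>2)" .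
  then have "(norm (c *\<^sub>C x))\<^sup>2 = (cmod c * norm x)\<^sup>2" using of_real_eq_iff by blast
  then show ?thesis by (simp add: power2_eq_iff_nonneg)
qed

lemma cinner_Cauchy_Schwarz: "cmod (cinner x y) \<le> norm x * norm (y::'h::complex_hilbert_space)"
proof (cases "cinner x y = 0")
  case False
  define c where "c = cnj (cinner x y) / of_real (cmod (cinner x y))"
  have "cmod (cinner x y) = Re (cinner x (c *\<^sub>C y))"
    using False by (simp add: c_def cinner_simps complex_norm_square [symmetric] power2_eq_square mult.commute[of "cnj (cinner x y)"]
        flip: of_real_mult)
  also have "\<dots> \<le> norm x * norm (c *\<^sub>C y)"
    by (metis inner_eq_Re_cinner norm_cauchy_schwarz)
  also have "norm (c *\<^sub>C y) = norm y" using False by (simp add: norm_scaleC_hilbert c_def norm_divide)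
  finally show ?thesis .
qed (auto)

lemma bounded_linear_cinner_right: "bounded_linear (cinner (x::'h::complex_hilbert_space))"
  by (rule bounded_linear_intro[where K="norm x"])
     (use cinner_Cauchy_Schwarz[of x] in \<open>auto simp: cinner_simps scaleR_conv_of_real mult.commute\<close>)

lemma bounded_bilinear_cinner:
  "bounded_bilinear (cinner :: 'h::complex_hilbert_space \<Rightarrow> 'h \<Rightarrow> complex)"
proof
  show "\<exists>K. \<forall>a b. cmod (cinner a b) \<le> norm (a::'h) * norm b * K"
    by (rule exI[of _ 1]) (simp add: cinner_Cauchy_Schwarz)
qed (simp_all add: cinner_simps scaleR_conv_of_real)

lemma bounded_bilinear_scaleC:
  "bounded_bilinear (scaleC :: complex \<Rightarrow> 'h::complex_hilbert_space \<Rightarrow> 'h)"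
proof
  show "\<exists>K. \<forall>a b. norm (a *\<^sub>C (b::'h)) \<le> norm a * norm b * K"
    by (rule exI[of _ 1]) (simp add: norm_scaleC_hilbert)
qed (simp_all add: scaleC_simps scaleR_scaleC scaleR_conv_of_real mult.commute)

lemmas tendsto_cinner [tendsto_intros] = bounded_bilinear.tendsto[OF bounded_bilinear_cinner]
lemmas continuous_on_cinner [continuous_intros] = bounded_bilinear.continuous_on[OF bounded_bilinear_cinner]
lemmas tendsto_scaleC [tendsto_intros] = bounded_bilinear.tendsto[OF bounded_bilinear_scaleC]
lemmas continuous_on_scaleC [continuous_intros] = bounded_bilinear.continuous_on[OF bounded_bilinear_scaleC]

subsection \<open>The involution of a C*-algebra\<close>

subclass (in cstar_algebra) banach ..

lemma star_zero [simp]: "star (0::'a::cstar_algebra) = 0"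
  using star_scaleC[of 0 "0::'a"] by simp

lemma star_one [simp]: "star (1::'a::cstar_algebra) = 1"
  by (metis mult.right_neutral star_mult star_star)

lemma star_minus: "star (- a) = - star (a::'a::cstar_algebra)"
  using star_scaleC[of "-1" a] by (simp add: scaleC_minus_one)

lemma star_diff: "star (a - b) = star a - star (b::'a::cstar_algebra)"
  by (metis diff_conv_add_uminus star_add star_minus)

lemma star_scaleR: "star (r *\<^sub>R a) = r *\<^sub>R star (a::'a::cstar_algebra)"
  by (simp add: scaleR_scaleC star_scaleC)

lemma norm_star [simp]: "norm (star a) = norm (a::'a::cstar_algebra)"
proof -
  have le: "norm b \<le> norm (star b)" for b :: 'a
  proof (cases "b = 0")
    case False
    have "norm b * norm b \<le> norm (star b) * norm b"
      using norm_mult_ineq[of "star b" b] cstar_identity[of b] by (simp add: power2_eq_square)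
    then show ?thesis using False by simp
  qed simp
  show ?thesis using le[of a] le[of "star a"] by (simp add: star_star)
qed

lemma bounded_linear_star: "bounded_linear (star :: 'a::cstar_algebra \<Rightarrow> 'a)"
  by (rule bounded_linear_intro[where K=1]) (auto simp: star_add star_scaleR)

lemma norm_unitary_mult:
  assumes "u \<in> unitaries" shows "norm (u * a) = norm (a::'a::cstar_algebra)"
proof -
  have "(norm (u * a))\<^sup>2 = (norm a)\<^sup>2"
    using assms by (simp add: cstar_identity [symmetric] star_mult unitaries_def)
      (metis mult.assoc mult.left_neutral)
  then show ?thesis by (simp add: power2_eq_iff_nonneg)
qed

lemma one_in_unitaries: "1 \<in> unitaries"
  by (simp add: unitaries_def)

lemma unitaries_mult:
  assumes "u \<in> unitaries" "v \<in> unitaries"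
  shows "u * v \<in> (unitaries :: 'a::cstar_algebra set)"
proof -
  have "star v * star u * (u * v) = star v * (star u * u) * v" by (simp only: mult.assoc)
  moreover have "u * v * (star v * star u) = u * (v * star v) * star u" by (simp only: mult.assoc)
  ultimately show ?thesis using assms by (simp add: unitaries_def star_mult)
qed

lemma star_unitaries: "u \<in> unitaries \<Longrightarrow> star u \<in> unitaries"
  by (simp add: unitaries_def star_star)

lemma scalar_unitary: "cmod c = 1 \<Longrightarrow> c *\<^sub>C 1 \<in> (unitaries :: 'a::cstar_algebra set)"
  using complex_norm_square[of c]
  by (auto simp: unitaries_def star_scaleC mult_scaleC_left mult_scaleC_right scaleC_scaleC scaleC_one mult.commute)

section \<open>Square roots by the binomial series\<close>

text \<open>The Taylor coefficients of \<open>sqrt (1 - t)\<close> at \<open>0\<close>.\<close>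

definition sqrt_coeff :: "nat \<Rightarrow> real" where
  "sqrt_coeff n = (-1) ^ n * ((1/2) gchoose n)"

lemma sqrt_coeff_0 [simp]: "sqrt_coeff 0 = 1"
  by (simp add: sqrt_coeff_def)

lemma sqrt_coeff_convolution:
  "(\<Sum>i\<le>k. sqrt_coeff i * sqrt_coeff (k - i)) = (if k = 0 then 1 else if k = 1 then -1 else 0)"
proof -
  have "(\<Sum>i\<le>k. sqrt_coeff i * sqrt_coeff (k - i)) = (-1)^k * (\<Sum>i\<le>k. ((1/2) gchoose i) * ((1/2) gchoose (k - i)))"
    unfolding sqrt_coeff_def sum_distrib_left
    by (rule sum.cong) (auto simp: power_add [symmetric] algebra_simps)
  also have "\<dots> = (-1)^k * ((1::real) gchoose k)"
    using gbinomial_Vandermonde[of "1/2::real" "1/2" k] by (simp add: atMost_atLeast0)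
  also have "(1::real) gchoose k = of_nat (1 choose k)"
    by (metis binomial_gbinomial of_nat_1)
  finally show ?thesis by (auto simp: binomial_eq_0)
qed

lemma neg_half_gbinomial_sign: "(-1) ^ n * ((-1/2 :: real) gchoose n) \<ge> 0"
proof (induction n)
  case (Suc n)
  have "(-1/2 :: real) gchoose Suc n = ((-1/2) gchoose n) * (-1/2 - real n) / real (Suc n)"
    using gbinomial_mult_1[of "-1/2::real" n] by (simp add: field_simps)
  then have "(-1) ^ Suc n * ((-1/2 :: real) gchoose Suc n)
      = (-1) ^ Suc n * (((-1/2) gchoose n) * (-1/2 - real n) / real (Suc n))"
    by simp
  also have "\<dots> = ((-1) ^ n * ((-1/2) gchoose n)) * ((1/2 + real n) / real (Suc n))"
    by (simp add: field_simps)
  finally have "(-1) ^ Suc n * ((-1/2 :: real) gchoose Suc n)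
      = ((-1) ^ n * ((-1/2) gchoose n)) * ((1/2 + real n) / real (Suc n))" .
  then show ?case using Suc by simp
qed simp

lemma sqrt_coeff_nonpos: assumes "n > 0" shows "sqrt_coeff n \<le> 0"
proof -
  obtain m where m: "n = Suc m" using assms by (cases n) auto
  have "(1/2::real) gchoose Suc m = (1/2) / real (Suc m) * ((-1/2) gchoose m)"
    using gbinomial_factors[of "-1/2::real" m] by (simp add: field_simps)
  then have "sqrt_coeff n = - ((1/2) / real (Suc m) * ((-1)^m * ((-1/2) gchoose m)))"
    by (simp add: sqrt_coeff_def m)
  also have "\<dots> \<le> 0" using neg_half_gbinomial_sign[of m] by simp
  finally show ?thesis .
qed

text \<open>Apart from the first one the coefficients are not positive, and their partial sums are the
  nonnegative numbers \<open>(-1)^n (-1/2 choose n)\<close>. So the series converges absolutely up to the boundary of the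
  disc of convergence, which lets it be applied to contractions and not only to strict ones.\<close>

lemma sum_sqrt_coeff_tail: "(\<Sum>k<n. \<bar>sqrt_coeff (Suc k)\<bar>) \<le> 1"
proof -
  have "(\<Sum>k\<le>n. sqrt_coeff k) = (-1) ^ n * ((-1/2) gchoose n)"
    using gbinomial_sum_lower_neg[of "1/2::real" n] by (simp add: sqrt_coeff_def mult.commute)
  then have "(\<Sum>k\<le>n. sqrt_coeff k) \<ge> 0" using neg_half_gbinomial_sign[of n] by simp
  moreover have "(\<Sum>k\<le>n. sqrt_coeff k) = 1 + (\<Sum>k<n. sqrt_coeff (Suc k))"
    by (simp only: lessThan_Suc_atMost [symmetric] sum.lessThan_Suc_shift sqrt_coeff_0)
  moreover have "(\<Sum>k<n. \<bar>sqrt_coeff (Suc k)\<bar>) = - (\<Sum>k<n. sqrt_coeff (Suc k))"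
    by (simp add: sum_negf [symmetric] sqrt_coeff_nonpos abs_of_nonpos)
  ultimately show ?thesis by simp
qed

lemma summable_sqrt_coeff_Suc: "summable (\<lambda>n. \<bar>sqrt_coeff (Suc n)\<bar>)"
  by (rule summableI_nonneg_bounded[where x=1]) (auto simp: sum_sqrt_coeff_tail)

lemma suminf_sqrt_coeff_Suc_le: "(\<Sum>n. \<bar>sqrt_coeff (Suc n)\<bar>) \<le> 1"
  by (rule suminf_le_const[OF summable_sqrt_coeff_Suc]) (simp add: sum_sqrt_coeff_tail)

lemma summable_sqrt_coeff: "summable (\<lambda>n. \<bar>sqrt_coeff n\<bar>)"
  using summable_sqrt_coeff_Suc summable_Suc_iff by blast

text \<open>For a contraction \<open>B\<close> this is the operator square root of \<open>1 - B\<close>.\<close>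

definition sqrt_one_minus :: "('e::real_normed_vector \<Rightarrow> 'e) \<Rightarrow> 'e \<Rightarrow> 'e" where
  "sqrt_one_minus B x = (\<Sum>n. sqrt_coeff n *\<^sub>R (B ^^ n) x)"

text \<open>Working with a linear map on a Banach space covers at once left multiplication by an element of a
  C*-algebra and an operator on a Hilbert space.\<close>

locale linear_contraction =
  fixes B :: "'e::banach \<Rightarrow> 'e"
  assumes lin: "linear B" and contr: "norm (B x) \<le> norm x"
begin

lemma linear_pow: "linear (B ^^ n)"
  by (induction n) (auto simp: id_def o_def linear_iff linear_add[OF lin] linear_scale[OF lin])

lemma norm_pow: "norm ((B ^^ n) x) \<le> norm x"
  by (induction n) (auto intro: order_trans contr)

lemma summable_norm_series: "summable (\<lambda>n. norm (sqrt_coeff n *\<^sub>R (B ^^ n) x))"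
proof (rule summable_comparison_test')
  show "summable (\<lambda>n. \<bar>sqrt_coeff n\<bar> * norm x)" by (intro summable_mult2 summable_sqrt_coeff)
  show "norm (norm (sqrt_coeff n *\<^sub>R (B ^^ n) x)) \<le> \<bar>sqrt_coeff n\<bar> * norm x" for n
    by (simp add: mult_left_mono norm_pow)
qed

lemma summable_series: "summable (\<lambda>n. sqrt_coeff n *\<^sub>R (B ^^ n) x)"
  by (rule summable_norm_cancel[OF summable_norm_series])

lemma has_sum_series: "((\<lambda>n. sqrt_coeff n *\<^sub>R (B ^^ n) x) has_sum sqrt_one_minus B x) UNIV"
  unfolding sqrt_one_minus_def
  by (rule norm_summable_imp_has_sum[OF summable_norm_series summable_sums[OF summable_series]])

text \<open>Since \<open>T\<close> may intertwine \<open>B\<close> with another map \<open>B'\<close>, this also describes how the involution, which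
  exchanges left and right multiplication, acts on square roots.\<close>

lemma sqrt_one_minus_commute:
  assumes T: "bounded_linear T" and comm: "\<And>x. T (B x) = B' (T x)" 
    and B': "\<And>x. summable (\<lambda>n. sqrt_coeff n *\<^sub>R (B' ^^ n) x)"
  shows "T (sqrt_one_minus B x) = sqrt_one_minus B' (T x)"
proof -
  interpret T: bounded_linear T by (rule T)
  have pow: "T ((B ^^ n) x) = (B' ^^ n) (T x)" for n
    by (induction n) (auto simp: comm)
  show ?thesis
    by (simp add: sqrt_one_minus_def T.suminf[OF summable_series] T.scaleR pow)
qed

text \<open>The coefficients after the first one have total mass at most \<open>1\<close>.\<close>

lemma sqrt_one_minus_tail: "norm (sqrt_one_minus B x - x) \<le> norm (B x)"
proof -
  have eq: "sqrt_one_minus B x = x + (\<Sum>n. sqrt_coeff (Suc n) *\<^sub>R (B ^^ Suc n) x)"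
    unfolding sqrt_one_minus_def by (subst suminf_split_head[OF summable_series]) simp
  have s: "summable (\<lambda>n. \<bar>sqrt_coeff (Suc n)\<bar> * norm (B x))"
    by (intro summable_mult2 summable_sqrt_coeff_Suc)
  have "norm (\<Sum>n. sqrt_coeff (Suc n) *\<^sub>R (B ^^ Suc n) x) \<le> (\<Sum>n. \<bar>sqrt_coeff (Suc n)\<bar> * norm (B x))"
    by (rule norm_suminf_le[OF _ s])
       (simp add: funpow_Suc_right mult_left_mono norm_pow del: funpow.simps)
  also have "\<dots> = (\<Sum>n. \<bar>sqrt_coeff (Suc n)\<bar>) * norm (B x)"
    by (rule suminf_mult2[symmetric, OF summable_sqrt_coeff_Suc])
  also have "\<dots> \<le> norm (B x)" using suminf_sqrt_coeff_Suc_le by (simp add: mult_left_le_one_le suminf_nonneg summable_sqrt_coeff_Suc)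
  finally show ?thesis by (simp add: eq)
qed

lemma linear_sqrt_one_minus: "linear (sqrt_one_minus B)"
proof
  fix x y :: 'e and r :: real
  show "sqrt_one_minus B (x + y) = sqrt_one_minus B x + sqrt_one_minus B y"
    unfolding sqrt_one_minus_def
    by (subst suminf_add[OF summable_series summable_series])
       (simp add: linear_add[OF linear_pow] scaleR_add_right)
  show "sqrt_one_minus B (r *\<^sub>R x) = r *\<^sub>R sqrt_one_minus B x"
    unfolding sqrt_one_minus_def
    by (subst suminf_scaleR_right[OF summable_series])
       (simp add: linear_scale[OF linear_pow] mult.commute)
qed

lemma bounded_linear_sqrt_one_minus: "bounded_linear (sqrt_one_minus B)"
proof (rule bounded_linear_intro[where K=2])
  fix x
  have "norm (sqrt_one_minus B x) \<le> norm x + norm (sqrt_one_minus B x - x)"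
    by (metis add.commute diff_add_cancel norm_triangle_ineq)
  also have "\<dots> \<le> norm x * 2" using sqrt_one_minus_tail[of x] contr[of x] by simp
  finally show "norm (sqrt_one_minus B x) \<le> norm x * 2" .
qed (auto simp: linear_add[OF linear_sqrt_one_minus] linear_scale[OF linear_sqrt_one_minus])

text \<open>The Cauchy product of the series with itself collapses by \<open>sqrt_coeff_convolution\<close>; the
  rearrangement is an unconditional double sum.\<close>

lemma sqrt_one_minus_square: "sqrt_one_minus B (sqrt_one_minus B x) = x - B x"
proof -
  define f where "f = (\<lambda>(i,j). (sqrt_coeff i * sqrt_coeff j) *\<^sub>R (B ^^ (i + j)) x)"
  have c: "(\<lambda>n. \<bar>sqrt_coeff n\<bar>) summable_on UNIV"
    using summable_sqrt_coeff by (simp add: summable_on_UNIV_nonneg_real_iff)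
  have "(\<lambda>p. norm (case p of (i,j) \<Rightarrow> \<bar>sqrt_coeff i\<bar> * \<bar>sqrt_coeff j\<bar> * norm x)) summable_on (UNIV \<times> UNIV)"
    unfolding Infinite_Sum.abs_summable_on_Sigma_iff
    using c by (auto simp: abs_mult infsum_cmult_right' infsum_cmult_left' intro!: summable_on_cmult_left summable_on_cmult_right)
  then have "(\<lambda>p. norm (f p)) summable_on (UNIV \<times> UNIV)"
    by (rule Infinite_Sum.abs_summable_on_comparison_test)
       (auto simp: f_def abs_mult intro!: mult_left_mono norm_pow)
  then have fs: "f summable_on (UNIV \<times> UNIV)" by (rule Infinite_Sum.abs_summable_summable)
  have "(\<Sum>\<^sub>\<infinity>j. f (i, j)) = sqrt_coeff i *\<^sub>R (B ^^ i) (sqrt_one_minus B x)" for i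
  proof -
    have bl: "bounded_linear (\<lambda>y. sqrt_coeff i *\<^sub>R (B ^^ i) y)"
      by (rule bounded_linear_intro[where K="\<bar>sqrt_coeff i\<bar>"])
         (auto simp: linear_add[OF linear_pow] linear_scale[OF linear_pow] scaleR_add_right
            mult.commute[of _ "\<bar>sqrt_coeff i\<bar>"] intro: mult_left_mono norm_pow)
    have "((\<lambda>y. sqrt_coeff i *\<^sub>R (B ^^ i) y) \<circ> (\<lambda>n. sqrt_coeff n *\<^sub>R (B ^^ n) x)
        has_sum sqrt_coeff i *\<^sub>R (B ^^ i) (sqrt_one_minus B x)) UNIV"
      unfolding o_def by (rule has_sum_bounded_linear[OF bl has_sum_series])
    then show ?thesis
      by (intro infsumI) (simp add: f_def o_def linear_scale[OF linear_pow] funpow_add)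
  qed
  then have "sqrt_one_minus B (sqrt_one_minus B x) = (\<Sum>\<^sub>\<infinity>i. \<Sum>\<^sub>\<infinity>j. f (i, j))"
    using infsumI[OF has_sum_series[of "sqrt_one_minus B x"]] by simp
  also have "\<dots> = infsum f (UNIV \<times> UNIV)" by (rule infsum_Sigma_banach[OF fs])
  finally have 1: "sqrt_one_minus B (sqrt_one_minus B x) = infsum f (UNIV \<times> UNIV)" .
  \<comment> \<open>enumerates the pairs \<open>(i, j)\<close> along the diagonals \<open>i + j = k\<close>\<close>
  define g where "g = (\<lambda>(k::nat,i::nat). (i, k - i))"
  have bij: "bij_betw g (SIGMA k:UNIV. {..k}) (UNIV \<times> UNIV)"
    by (rule bij_betw_byWitness[where f'="\<lambda>(i,j). (i + j, i)"]) (auto simp: g_def)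
  have fgs: "(\<lambda>p. f (g p)) summable_on (SIGMA k:UNIV. {..k})"
    using fs summable_on_reindex_bij_betw[OF bij] by blast
  have "infsum f (UNIV \<times> UNIV) = infsum (\<lambda>p. f (g p)) (SIGMA k:UNIV. {..k})"
    using infsum_reindex_bij_betw[OF bij] by metis
  also have "\<dots> = (\<Sum>\<^sub>\<infinity>k. \<Sum>\<^sub>\<infinity>i\<in>{..k}. f (g (k, i)))"
    by (rule infsum_Sigma_banach[OF fgs, symmetric])
  also have "\<dots> = (\<Sum>\<^sub>\<infinity>k::nat. (if k = 0 then x else if k = 1 then - B x else 0))"
  proof (rule infsum_cong)
    fix k :: nat
    have "(\<Sum>\<^sub>\<infinity>i\<in>{..k}. f (g (k, i))) = (\<Sum>i\<le>k. (sqrt_coeff i * sqrt_coeff (k - i)) *\<^sub>R (B ^^ k) x)"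
      by (simp add: f_def g_def)
    also have "\<dots> = (\<Sum>i\<le>k. sqrt_coeff i * sqrt_coeff (k - i)) *\<^sub>R (B ^^ k) x"
      by (simp add: scaleR_sum_left)
    finally show "(\<Sum>\<^sub>\<infinity>i\<in>{..k}. f (g (k, i))) = (if k = 0 then x else if k = 1 then - B x else 0)"
      by (simp add: sqrt_coeff_convolution)
  qed
  also have "\<dots> = (\<Sum>\<^sub>\<infinity>k\<in>{0,1::nat}. (if k = 0 then x else if k = 1 then - B x else 0))"
    by (rule infsum_cong_neutral) auto
  also have "\<dots> = x - B x" by simp
  finally show ?thesis using 1 by simp
qed

end

section \<open>Square roots and positivity in a C*-algebra\<close>

text \<open>The root \<open>R\<close> of left multiplication by \<open>1 - x\<close> commutes with all right multiplications, so it is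
  left multiplication by \<open>y = R 1\<close>. The involution turns the series for \<open>R 1\<close> into the one formed with right
  multiplication by \<open>x\<close>, whose value at \<open>1\<close> is the same; hence \<open>y\<close> is self-adjoint.\<close>

lemma selfadjoint_sqrt:
  fixes x :: "'a::cstar_algebra"
  assumes sa: "star x = x" and le: "norm x \<le> 1"
  obtains y where "star y = y" "y * y = 1 - x" "norm (y - 1) \<le> norm x"
    "\<And>z. x * z = z * x \<Longrightarrow> y * z = z * y"
proof -
  define B where "B = (\<lambda>z. x * z)"
  define B' where "B' = (\<lambda>z. z * x)"
  have nB: "norm (x * z) \<le> norm z" "norm (z * x) \<le> norm z" for z
    using norm_mult_ineq[of x z] norm_mult_ineq[of z x] le
    by (smt (verit) mult_left_le_one_le norm_ge_zero mult_right_le_one_le)+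
  interpret B: linear_contraction B
    by unfold_locales (auto simp: B_def nB distrib_left)
  interpret B': linear_contraction B'
    by unfold_locales (auto simp: B'_def nB distrib_right)
  define y where "y = sqrt_one_minus B 1"
  have right: "y * z = sqrt_one_minus B z" for z
    using B.sqrt_one_minus_commute[OF bounded_linear_mult_left[of z] _ B.summable_series, of 1]
    by (simp add: y_def B_def mult.assoc)
  have pow: "(B' ^^ n) 1 = (B ^^ n) 1" for n
  proof -
    have "(B ^^ n) 1 = x ^ n" by (induction n) (auto simp: B_def)
    moreover have "(B' ^^ n) 1 = x ^ n" by (induction n) (auto simp: B'_def power_commutes)
    ultimately show ?thesis by simp
  qed
  have "star y = sqrt_one_minus B' 1"
    using B.sqrt_one_minus_commute[OF bounded_linear_star _ B'.summable_series, of 1]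
    by (simp add: y_def B_def B'_def star_mult sa)
  also have "\<dots> = y" by (simp add: y_def sqrt_one_minus_def pow)
  finally have 1: "star y = y" .
  have 2: "y * y = 1 - x"
    using B.sqrt_one_minus_square[of 1] by (simp add: right) (simp add: y_def B_def)
  have 3: "norm (y - 1) \<le> norm x" using B.sqrt_one_minus_tail[of 1] by (simp add: y_def B_def)
  have 4: "y * z = z * y" if "x * z = z * x" for z
  proof -
    have "z * sqrt_one_minus B 1 = sqrt_one_minus B (z * 1)"
    proof (rule B.sqrt_one_minus_commute)
      show "z * B v = B (z * v)" for v by (simp add: B_def mult.assoc [symmetric] that)
    qed (auto simp: bounded_linear_mult_right B.summable_series)
    then show ?thesis by (simp add: right y_def [symmetric])
  qed
  from 1 2 3 4 that show ?thesis by blast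
qed

text \<open>This form of \<open>a* a \<le> \<parallel>a\<parallel>\<^sup>2\<close> makes positive functionals and representations bounded.\<close>

lemma cstar_norm_gap:
  fixes a :: "'a::cstar_algebra"
  assumes "norm a < c"
  obtains y where "star y * y = complex_of_real (c\<^sup>2) *\<^sub>C 1 - star a * a"
proof -
  have c: "c > 0" using assms norm_ge_zero[of a] by linarith
  define x where "x = inverse (c\<^sup>2) *\<^sub>R (star a * a)"
  have sa: "star x = x" by (simp add: x_def star_scaleR star_mult star_star)
  have "(norm a)\<^sup>2 \<le> c\<^sup>2" using assms c by (intro power_mono) auto
  then have "norm x \<le> 1" using c by (simp add: x_def cstar_identity field_simps)
  with sa obtain y where y: "star y = y" "y * y = 1 - x" by (rule selfadjoint_sqrt)
  have "star (c *\<^sub>R y) * (c *\<^sub>R y) = c\<^sup>2 *\<^sub>R (1 - x)"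
    by (simp add: star_scaleR y power2_eq_square)
  also have "\<dots> = complex_of_real (c\<^sup>2) *\<^sub>C 1 - star a * a"
    using c by (simp add: x_def scaleR_diff_right scaleR_scaleC [symmetric] del: of_real_power)
  finally show ?thesis by (rule that)
qed

text \<open>The minimum of the quadratic is at \<open>c = - cnj B / C\<close>; for \<open>C = 0\<close> a large multiple of \<open>- cnj B\<close>
  shows that \<open>B\<close> vanishes.\<close>

lemma Cauchy_Schwarz_from_quadratic:
  assumes "\<And>c::complex. 0 \<le> A + 2 * Re (c * B) + (cmod c)\<^sup>2 * C" "C \<ge> 0"
  shows "(cmod B)\<^sup>2 \<le> A * C"
proof (cases "C = 0")
  case False
  then have C: "C > 0" using assms(2) by simp
  have "Re (- (cnj B / of_real C) * B) = - ((cmod B)\<^sup>2 / C)"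
    using cmod_power2[of B] C by (simp add: power2_eq_square field_simps)
  moreover have "(cmod (- (cnj B / of_real C)))\<^sup>2 * C = (cmod B)\<^sup>2 / C"
    using C by (simp add: norm_divide power_divide power2_eq_square)
  moreover have "0 \<le> A + 2 * Re (- (cnj B / of_real C) * B) + (cmod (- (cnj B / of_real C)))\<^sup>2 * C"
    by (rule assms(1))
  ultimately have "0 \<le> A + 2 * - ((cmod B)\<^sup>2 / C) + (cmod B)\<^sup>2 / C" by argo
  then have "0 \<le> A - (cmod B)\<^sup>2 / C" by simp
  then show ?thesis using C by (simp add: field_simps)
next
  case True
  have "B = 0"
  proof (rule ccontr)
    assume "B \<noteq> 0"
    define t where "t = (\<bar>A\<bar> + 1) / (cmod B)\<^sup>2"
    have "Re (- (of_real t * cnj B) * B) = - (t * (cmod B)\<^sup>2)"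
      using cmod_power2[of B] by (simp add: power2_eq_square algebra_simps)
    moreover have "0 \<le> A + 2 * Re (- (of_real t * cnj B) * B) + (cmod (- (of_real t * cnj B)))\<^sup>2 * C"
      by (rule assms(1))
    moreover have "t * (cmod B)\<^sup>2 = \<bar>A\<bar> + 1" using \<open>B \<noteq> 0\<close> by (simp add: t_def)
    ultimately have "0 \<le> A + 2 * - (\<bar>A\<bar> + 1) + (cmod (- (of_real t * cnj B)))\<^sup>2 * 0"
      unfolding True by argo
    then show False by simp
  qed
  then show ?thesis using True by simp
qed

text \<open>Both the GNS form of a state and the form \<open>\<rho>(\<langle>\<xi>|\<eta>\<rangle>)\<close> on a Hilbert module are of this kind.\<close>

locale semi_inner_product =
  fixes s :: "'x::complex_vector \<Rightarrow> 'x \<Rightarrow> complex"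
  assumes add_right: "s x (y + z) = s x y + s x z"
    and scale_right: "s x (c *\<^sub>C y) = c * s x y"
    and hermitian: "s x y = cnj (s y x)"
    and nonneg: "s x x \<in> \<real>\<^sub>\<ge>\<^sub>0"
begin

lemma add_left: "s (x + y) z = s x z + s y z"
  by (metis add_right hermitian complex_cnj_add)

lemma scale_left: "s (c *\<^sub>C x) y = cnj c * s x y"
  by (metis scale_right hermitian complex_cnj_mult)

lemma minus_right: "s x (- y) = - s x y"
  using scale_right[of x "-1" y] by (simp add: scaleC_minus_one)

lemma minus_left: "s (- x) y = - s x y"
  using scale_left[of "-1" x y] by (simp add: scaleC_minus_one)

lemma diff_right: "s x (y - z) = s x y - s x z"
  using add_right[of x y "- z"] by (simp add: minus_right)

lemma diff_left: "s (x - y) z = s x z - s y z"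
  using add_left[of x "- y" z] by (simp add: minus_left)

lemma zero [simp]: "s 0 x = 0" "s x 0 = 0"
  using scale_right[of x 0 0] scale_left[of 0 0 x] by auto

lemmas simps = add_right add_left scale_right scale_left minus_right minus_left diff_right diff_left

lemma Re_nonneg: "Re (s x x) \<ge> 0" and Im_zero: "Im (s x x) = 0"
  using nonneg[of x] by (auto simp: complex_nonneg_Reals_iff)

lemma self_eq: "s x x = of_real (Re (s x x))"
  by (simp add: complex_eq_iff Im_zero)

lemma Cauchy_Schwarz: "(cmod (s x y))\<^sup>2 \<le> Re (s x x) * Re (s y y)"
proof (rule Cauchy_Schwarz_from_quadratic)
  fix c :: complex
  have "Re (c * s x y) = Re (cnj c * s y x)"
    by (metis hermitian cnj.simps(1) complex_cnj_mult)
  moreover have "Re (cnj c * (c * s y y)) = (cmod c)\<^sup>2 * Re (s y y)"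
  proof -
    have "cnj c * (c * s y y) = (c * cnj c) * s y y" by (simp add: ac_simps)
    then show ?thesis by (simp only: complex_norm_square [symmetric]) simp
  qed
  moreover have "s (x + c *\<^sub>C y) (x + c *\<^sub>C y) = s x x + c * s x y + (cnj c * s y x + cnj c * (c * s y y))"
    by (simp add: simps distrib_left ac_simps)
  ultimately have "Re (s (x + c *\<^sub>C y) (x + c *\<^sub>C y)) = Re (s x x) + 2 * Re (c * s x y) + (cmod c)\<^sup>2 * Re (s y y)"
    by (simp only: plus_complex.sel)
  then show "0 \<le> Re (s x x) + 2 * Re (c * s x y) + (cmod c)\<^sup>2 * Re (s y y)"
    by (metis Re_nonneg)
qed (rule Re_nonneg)

lemma null_left: "s x x = 0 \<Longrightarrow> s x y = 0"
  using Cauchy_Schwarz[of x y] by simp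

lemma null_right: "s x x = 0 \<Longrightarrow> s y x = 0"
  by (metis null_left hermitian complex_cnj_zero)

end

text \<open>Hermitian symmetry follows from positivity: \<open>\<rho>\<close> is real at \<open>(1 + a)* (1 + a)\<close> and at
  \<open>(1 + i a)* (1 + i a)\<close>.\<close>

lemma state_semi_inner_product:
  assumes "state \<rho>"
  shows "semi_inner_product (gns_form (\<rho> :: 'a::cstar_algebra \<Rightarrow> complex))"
proof -
  have add: "\<rho> (a + b) = \<rho> a + \<rho> b" and sc: "\<rho> (c *\<^sub>C a) = c * \<rho> a"
    and pos: "\<rho> (star a * a) \<in> \<real>\<^sub>\<ge>\<^sub>0" for a b c
    using assms by (auto simp: state_def)
  have herm: "\<rho> (star a) = cnj (\<rho> a)" for a
  proof -
    have im: "Im (\<rho> (star b * b)) = 0" for b using pos[of b] by (simp add: complex_nonneg_Reals_iff)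
    have "\<rho> (star (1 + a) * (1 + a)) = \<rho> (star 1 * 1) + \<rho> a + \<rho> (star a) + \<rho> (star a * a)"
      by (simp add: star_add distrib_left distrib_right add)
    then have 1: "Im (\<rho> a) + Im (\<rho> (star a)) = 0"
      using im[of "1 + a"] im[of 1] im[of a] by simp
    have "\<rho> (star (1 + \<i> *\<^sub>C a) * (1 + \<i> *\<^sub>C a)) = \<rho> (star 1 * 1) + \<i> * \<rho> a - \<i> * \<rho> (star a) + \<rho> (star a * a)"
      by (simp add: star_add star_scaleC distrib_left distrib_right add sc mult_scaleC_left mult_scaleC_right
          scaleC_scaleC scaleC_one right_diff_distrib mult.assoc [symmetric])
    then have 2: "Re (\<rho> a) - Re (\<rho> (star a)) = 0"
      using im[of "1 + \<i> *\<^sub>C a"] im[of 1] im[of a] by simp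
    from 1 2 show ?thesis by (simp add: complex_eq_iff)
  qed
  show ?thesis
  proof
    fix x y z :: 'a and c
    show "gns_form \<rho> x y = cnj (gns_form \<rho> y x)"
      by (simp add: gns_form_def herm [symmetric] star_mult star_star)
  qed (auto simp: gns_form_def distrib_left add mult_scaleC_right sc pos)
qed

text \<open>For \<open>c > \<parallel>a\<parallel>\<close> the difference \<open>c\<^sup>2 - a* a\<close> is of the form \<open>y* y\<close>, and \<open>\<rho>(b* y* y b)\<close> is
  nonnegative; then \<open>c\<close> tends to \<open>\<parallel>a\<parallel>\<close>.\<close>

lemma gns_form_mult_bound:
  assumes "state \<rho>"
  shows "Re (gns_form \<rho> (a * b) (a * b)) \<le> (norm (a::'a::cstar_algebra))\<^sup>2 * Re (gns_form \<rho> b b)"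
proof -
  interpret semi_inner_product "gns_form \<rho>" by (rule state_semi_inner_product[OF assms])
  have le: "Re (gns_form \<rho> (a * b) (a * b)) \<le> c\<^sup>2 * Re (gns_form \<rho> b b)" if lt: "norm a < c" for c
  proof -
    obtain y where y: "star y * y = complex_of_real (c\<^sup>2) *\<^sub>C 1 - star a * a"
      using cstar_norm_gap[OF lt] .
    have "gns_form \<rho> (y * b) (y * b) = gns_form \<rho> b (star y * y * b)"
      by (simp add: gns_form_def star_mult mult.assoc)
    also have "\<dots> = of_real (c\<^sup>2) * gns_form \<rho> b b - gns_form \<rho> b (star a * a * b)"
      by (simp only: y left_diff_distrib mult_scaleC_left diff_right scale_right mult_1_left)
    also have "gns_form \<rho> b (star a * a * b) = gns_form \<rho> (a * b) (a * b)"
      by (simp add: gns_form_def star_mult mult.assoc)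
    finally show ?thesis using Re_nonneg[of "y * b"] self_eq[of b] by simp
  qed
  have "((\<lambda>c. c\<^sup>2 * Re (gns_form \<rho> b b)) \<longlongrightarrow> (norm a)\<^sup>2 * Re (gns_form \<rho> b b)) (at_right (norm a))"
    by (intro tendsto_intros)
  then show ?thesis
    by (rule tendsto_lowerbound) (auto simp: eventually_at_right_field intro!: le exI[of _ "norm a + 1"])
qed

section \<open>Orthogonal projections\<close>

subclass (in complex_hilbert_space) banach ..

text \<open>By the parallelogram identity the points of \<open>M\<close> at almost minimal distance form sets of small
  diameter, so their intersection is a point.\<close>

lemma nearest_point_exists:
  fixes M :: "'e::{real_inner,complete_space} set"
  assumes sub: "subspace M" and cl: "closed M"
  obtains p where "p \<in> M" "\<And>m. m \<in> M \<Longrightarrow> norm (x - p) \<le> norm (x - m)"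
proof -
  define d where "d = Inf ((\<lambda>m. norm (x - m)) ` M)"
  have ne: "M \<noteq> {}" using subspace_0[OF sub] by auto
  have bdd: "bdd_below ((\<lambda>m. norm (x - m)) ` M)" by (rule bdd_belowI2[of _ 0]) simp
  have low: "d \<le> norm (x - m)" if "m \<in> M" for m
    unfolding d_def using that bdd by (intro cInf_lower) auto
  have d0: "d \<ge> 0" unfolding d_def using ne by (intro cInf_greatest) auto
  define S where "S = (\<lambda>n::nat. {m \<in> M. norm (x - m) \<le> d + 1 / real (Suc n)})"
  have "\<exists>a. \<forall>n. a \<in> S n"
  proof (rule decreasing_closed_nest)
    fix n :: nat
    have "closed ({m. norm (x - m) \<le> d + 1 / real (Suc n)} \<inter> M)"
      by (intro closed_Int cl closed_Collect_le continuous_intros)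
    then show "closed (S n)" unfolding S_def by (simp add: Int_def conj_commute)
    have "Inf ((\<lambda>m. norm (x - m)) ` M) < d + 1 / real (Suc n)" by (simp add: d_def)
    then obtain m where "m \<in> M" "norm (x - m) < d + 1 / real (Suc n)"
      using cInf_lessD[of "(\<lambda>m. norm (x - m)) ` M"] ne by auto
    then show "S n \<noteq> {}" unfolding S_def by force
  next
    fix m n :: nat assume "m \<le> n"
    then have "1 / real (Suc n) \<le> 1 / real (Suc m)" by (simp add: frac_le)
    then show "S n \<subseteq> S m" unfolding S_def by auto
  next
    fix e :: real assume e: "e > 0"
    have "(\<lambda>n. 4 * (2 * d * (1 / real (Suc n)) + (1 / real (Suc n))\<^sup>2)) \<longlonglongrightarrow> 4 * (2 * d * 0 + 0\<^sup>2)"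
      by (intro tendsto_intros LIMSEQ_Suc[OF lim_1_over_n] )
    then have "\<forall>\<^sub>F n in sequentially. 4 * (2 * d * (1 / real (Suc n)) + (1 / real (Suc n))\<^sup>2) < e\<^sup>2"
      using e by (intro order_tendstoD(2)) auto
    then obtain n where n: "4 * (2 * d * (1 / real (Suc n)) + (1 / real (Suc n))\<^sup>2) < e\<^sup>2"
      by (auto simp: eventually_sequentially)
    define \<delta> where "\<delta> = 1 / real (Suc n)"
    have \<delta>: "\<delta> \<ge> 0" by (simp add: \<delta>_def)
    have "dist p q < e" if p: "p \<in> S n" and q: "q \<in> S n" for p q
    proof -
      have pM: "p \<in> M" "q \<in> M" and pd: "norm (x - p) \<le> d + \<delta>" "norm (x - q) \<le> d + \<delta>"
        using p q by (auto simp: S_def \<delta>_def)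
      have "(1/2) *\<^sub>R (p + q) \<in> M" by (intro subspace_scale subspace_add sub pM)
      then have mid: "d \<le> norm (x - (1/2) *\<^sub>R (p + q))" by (rule low)
      have "(norm (p - q))\<^sup>2 = 2 * (norm (x - p))\<^sup>2 + 2 * (norm (x - q))\<^sup>2 - 4 * (norm (x - (1/2) *\<^sub>R (p + q)))\<^sup>2"
        by (simp add: power2_norm_eq_inner inner_simps inner_commute) (simp add: algebra_simps)
      also have "\<dots> \<le> 2 * (d + \<delta>)\<^sup>2 + 2 * (d + \<delta>)\<^sup>2 - 4 * d\<^sup>2"
        using power_mono[OF pd(1), of 2] power_mono[OF pd(2), of 2] power_mono[OF mid d0, of 2] by simp
      also have "\<dots> = 4 * (2 * d * \<delta> + \<delta>\<^sup>2)" by (simp add: power2_eq_square algebra_simps)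
      also have "\<dots> < e\<^sup>2" using n by (simp add: \<delta>_def)
      finally show ?thesis using e by (simp add: dist_norm power2_less_imp_less)
    qed
    then show "\<exists>n. \<forall>x\<in>S n. \<forall>y\<in>S n. dist x y < e" by blast
  qed blast
  then obtain p where p: "\<And>n. p \<in> S n" by blast
  have "norm (x - p) \<le> d"
  proof (rule field_le_epsilon)
    fix e :: real assume "e > 0"
    then obtain n where "1 / real (Suc n) < e" using nat_approx_posE by blast
    then show "norm (x - p) \<le> d + e" using p[of n] by (auto simp: S_def)
  qed
  then show ?thesis using p[of 0] low that[of p] by (force simp: S_def)
qed

lemma orthogonal_projection_exists:
  fixes M :: "'e::{real_inner,complete_space} set"
  assumes sub: "subspace M" and cl: "closed M"
  obtains P where "bounded_linear P" "\<And>x. P x \<in> M" "\<And>x m. m \<in> M \<Longrightarrow> inner (x - P x) m = 0"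
    "\<And>x p. p \<in> M \<Longrightarrow> (\<And>m. m \<in> M \<Longrightarrow> inner (x - p) m = 0) \<Longrightarrow> P x = p"
    "\<And>x y. inner (P x) y = inner x (P y)"
proof -
  have "\<exists>p\<in>M. \<forall>m\<in>M. inner (x - p) m = 0" for x
  proof -
    obtain p where p: "p \<in> M" "\<And>m. m \<in> M \<Longrightarrow> norm (x - p) \<le> norm (x - m)"
      using nearest_point_exists[OF assms] by blast
    have "inner (x - p) m = 0" if m: "m \<in> M" for m
    proof (cases "m = 0")
      case False
      define t where "t = inner (x - p) m / inner m m"
      have "norm (x - p) \<le> norm (x - (p + t *\<^sub>R m))"
        by (intro p subspace_add subspace_scale sub m)
      then have "(norm (x - p))\<^sup>2 \<le> (norm ((x - p) - t *\<^sub>R m))\<^sup>2"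
        by (simp add: diff_diff_eq)
      also have "\<dots> = (norm (x - p))\<^sup>2 - (inner (x - p) m)\<^sup>2 / inner m m"
      proof -
        have "(norm ((x - p) - t *\<^sub>R m))\<^sup>2 = (norm (x - p))\<^sup>2 - 2 * t * inner (x - p) m + t\<^sup>2 * inner m m"
          unfolding power2_norm_eq_inner
          by (simp add: inner_diff_left[of "x - p"] inner_diff_right[of _ "x - p"] inner_commute[of m "x - p"]
              power2_eq_square algebra_simps inner_commute)
        also have "\<dots> = (norm (x - p))\<^sup>2 - (inner (x - p) m)\<^sup>2 / inner m m"
          using False by (simp add: t_def power2_eq_square)
        finally show ?thesis .
      qed
      finally have "(inner (x - p) m)\<^sup>2 / inner m m \<le> 0" by simp
      moreover have "inner m m > 0" using False by simp
      ultimately show ?thesis by (simp add: divide_le_0_iff)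
    qed simp
    with p(1) show ?thesis by blast
  qed
  then obtain P where P: "\<And>x. P x \<in> M" "\<And>x m. m \<in> M \<Longrightarrow> inner (x - P x) m = 0"
    by metis
  have uniq: "P x = p" if p: "p \<in> M" "\<And>m. m \<in> M \<Longrightarrow> inner (x - p) m = 0" for x p
  proof -
    have m: "P x - p \<in> M" by (intro subspace_diff sub P p)
    have "inner (P x - p) (P x - p) = inner (x - p) (P x - p) - inner (x - P x) (P x - p)"
      by (simp add: inner_diff_left)
    also have "\<dots> = 0" by (simp add: P(2)[OF m] p(2)[OF m])
    finally show ?thesis by simp
  qed
  have sym: "inner (P x) y = inner x (P y)" for x y
    using P(2)[OF P(1)[of y], of x] P(2)[OF P(1)[of x], of y]
    by (simp add: inner_diff_left inner_diff_right inner_commute[of y] inner_commute[of "P y"])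
  have "bounded_linear P"
  proof (rule bounded_linear_intro[where K=1])
    show "P (x + y) = P x + P y" for x y
    proof (rule uniq)
      show "P x + P y \<in> M" by (intro subspace_add sub P(1))
      show "inner (x + y - (P x + P y)) m = 0" if "m \<in> M" for m
        using P(2)[OF that, of x] P(2)[OF that, of y] by (simp add: add_diff_add inner_add_left)
    qed
    show "P (r *\<^sub>R x) = r *\<^sub>R P x" for r x
    proof (rule uniq)
      show "r *\<^sub>R P x \<in> M" by (intro subspace_scale sub P(1))
      show "inner (r *\<^sub>R x - r *\<^sub>R P x) m = 0" if "m \<in> M" for m
        using P(2)[OF that, of x] by (simp flip: scaleR_diff_right)
    qed
    show "norm (P x) \<le> norm x * 1" for x
    proof -
      have "(norm (P x))\<^sup>2 = inner x (P x)"
        using P(2)[OF P(1)[of x], of x] by (simp add: power2_norm_eq_inner inner_diff_left)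
      also have "\<dots> \<le> norm x * norm (P x)" by (rule norm_cauchy_schwarz)
      finally show ?thesis by (cases "norm (P x) = 0") (auto simp: power2_eq_square)
    qed
  qed
  then show ?thesis using that P uniq sym by blast
qed

section \<open>Representations: boundedness and Schur's lemma\<close>

context representation
begin

lemma rep_zero [simp]: "\<pi> 0 x = 0"
  using rep_scale[of 0 0 x] by simp

lemma rep_zero_right [simp]: "\<pi> a 0 = 0"
  using rep_clinear[of a 0 0] by simp

lemma rep_add_right: "\<pi> a (x + y) = \<pi> a x + \<pi> a y"
  by (rule linear_add[OF bounded_linear.linear[OF rep_bounded]])

lemma rep_diff_right: "\<pi> a (x - y) = \<pi> a x - \<pi> a y"
  by (rule linear_diff[OF bounded_linear.linear[OF rep_bounded]])

lemma rep_minus: "\<pi> (- a) x = - \<pi> a x"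
  using rep_scale[of "-1" a x] by (simp add: scaleC_minus_one)

lemma rep_diff: "\<pi> (a - b) x = \<pi> a x - \<pi> b x"
  using rep_add[of a "- b" x] by (simp add: rep_minus)

lemma rep_scaleR: "\<pi> (r *\<^sub>R a) x = r *\<^sub>R \<pi> a x"
  by (simp add: scaleR_scaleC rep_scale)

lemma rep_star_right: "cinner x (\<pi> (star a) y) = cinner (\<pi> a x) y"
  using rep_star[of "star a" x y] by (simp add: star_star)

lemma inner_rep_star: "inner (\<pi> (star a) x) y = inner x (\<pi> a y)"
  by (simp add: inner_eq_Re_cinner rep_star)

lemma rep_scalar: "\<pi> (c *\<^sub>C 1) x = c *\<^sub>C x"
  by (simp add: rep_scale rep_one)

lemma cinner_rep_rep: "cinner (\<pi> a x) (\<pi> b y) = cinner x (\<pi> (star a * b) y)"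
  using rep_star[of "star a" x "\<pi> b y"] by (simp add: rep_mult star_star)

lemma norm_rep_square: "complex_of_real ((norm (\<pi> a x))\<^sup>2) = cinner x (\<pi> (star a * a) x)"
  by (simp add: cinner_self [symmetric] cinner_rep_rep del: of_real_power)

text \<open>As for states, \<open>c\<^sup>2 - a* a = y* y\<close> gives \<open>\<parallel>\<pi>(a) x\<parallel>\<^sup>2 \<le> c\<^sup>2 \<parallel>x\<parallel>\<^sup>2\<close> for all \<open>c > \<parallel>a\<parallel>\<close>.\<close>

lemma norm_rep_le: "norm (\<pi> a x) \<le> norm a * norm x"
proof -
  have le: "norm (\<pi> a x) \<le> c * norm x" if lt: "norm a < c" for c
  proof -
    have c: "c \<ge> 0" using lt norm_ge_zero[of a] by linarith
    obtain y where y: "star y * y = complex_of_real (c\<^sup>2) *\<^sub>C 1 - star a * a"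
      using cstar_norm_gap[OF lt] .
    have "complex_of_real ((norm (\<pi> y x))\<^sup>2) = of_real ((c * norm x)\<^sup>2 - (norm (\<pi> a x))\<^sup>2)"
      unfolding norm_rep_square y rep_diff rep_scalar cinner_diff cinner_scaleC_right
      by (simp add: norm_rep_square [symmetric] cinner_self power_mult_distrib del: of_real_power)
    then have "(norm (\<pi> y x))\<^sup>2 = (c * norm x)\<^sup>2 - (norm (\<pi> a x))\<^sup>2" using of_real_eq_iff by blast
    then have "(norm (\<pi> a x))\<^sup>2 \<le> (c * norm x)\<^sup>2" using zero_le_power2[of "norm (\<pi> y x)"] by linarith
    then show ?thesis by (rule power2_le_imp_le) (simp add: c)
  qed
  have "((\<lambda>c. c * norm x) \<longlongrightarrow> norm a * norm x) (at_right (norm a))"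
    by (intro tendsto_intros)
  then show ?thesis
    by (rule tendsto_lowerbound) (auto simp: eventually_at_right_field intro!: le exI[of _ "norm a + 1"])
qed

lemma bounded_linear_rep_left: "bounded_linear (\<lambda>a. \<pi> a x)"
  by (rule bounded_linear_intro[where K="norm x"]) (auto simp: rep_add rep_scaleR norm_rep_le)

lemma norm_rep_unitary: "u \<in> unitaries \<Longrightarrow> norm (\<pi> u x) = norm x"
  using norm_rep_square[of u x] 
  by (simp add: unitaries_def rep_one cinner_self power2_eq_iff_nonneg flip: of_real_power)

lemma rep_star_unitary: "u \<in> unitaries \<Longrightarrow> \<pi> (star u) (\<pi> u x) = x" "u \<in> unitaries \<Longrightarrow> \<pi> u (\<pi> (star u) x) = x"
  by (simp_all add: rep_mult [symmetric] unitaries_def rep_one)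

end

context irreducible_representation
begin

lemma commutant_scaleC:
  assumes "\<And>a x. S (\<pi> a x) = \<pi> a (S x)"
  shows "S (c *\<^sub>C x) = c *\<^sub>C S x"
  using assms[of "c *\<^sub>C 1" x] by (simp add: rep_scalar)

text \<open>With \<open>R = |S|\<close> the square root of \<open>S\<^sup>2\<close>, the kernel of \<open>R - S\<close> is an invariant subspace and
  contains the range of \<open>R + S\<close>, so \<open>S = R\<close> or \<open>S = - R\<close>.\<close>

lemma commutant_definite:
  assumes S: "bounded_linear S" and comm: "\<And>a x. S (\<pi> a x) = \<pi> a (S x)"
    and sa: "\<And>x y. inner (S x) y = inner x (S y)" and contr: "\<And>x. norm (S x) \<le> norm x"
  shows "(\<forall>x. inner (S x) x \<ge> 0) \<or> (\<forall>x. inner (S x) x \<le> 0)"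
proof -
  interpret S: bounded_linear S by (rule S)
  define B where "B = (\<lambda>x. x - S (S x))"
  interpret B: linear_contraction B
  proof
    show "norm (B x) \<le> norm x" for x
    proof -
      have "(norm (B x))\<^sup>2 = (norm x)\<^sup>2 - 2 * (norm (S x))\<^sup>2 + (norm (S (S x)))\<^sup>2"
        unfolding B_def power2_norm_eq_inner
        by (simp add: inner_diff_left inner_diff_right sa[of x] sa[of "S x" x])
      also have "\<dots> \<le> (norm x)\<^sup>2"
        using power_mono[OF contr[of "S x"] norm_ge_zero, of 2] zero_le_power2[of "norm (S x)"] by linarith
      finally show ?thesis by (rule power2_le_imp_le) simp
    qed
  qed (auto simp: B_def S.add S.scaleR algebra_simps)
  define R where "R = sqrt_one_minus B"
  interpret R: bounded_linear R unfolding R_def by (rule B.bounded_linear_sqrt_one_minus)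
  have RR: "R (R x) = S (S x)" for x
    unfolding R_def B.sqrt_one_minus_square by (simp add: B_def)
  have SR: "S (R x) = R (S x)" for x
    unfolding R_def by (rule B.sqrt_one_minus_commute[OF S _ B.summable_series]) (simp add: B_def S.diff)
  have \<pi>R: "\<pi> a (R x) = R (\<pi> a x)" for a x
    unfolding R_def by (rule B.sqrt_one_minus_commute[OF rep_bounded _ B.summable_series])
      (simp add: B_def rep_diff_right comm)
  have cR: "R (c *\<^sub>C x) = c *\<^sub>C R x" for c x
    using \<pi>R[of "c *\<^sub>C 1" x] by (simp add: rep_scalar)
  have pos: "inner (R x) x \<ge> 0" for x
  proof -
    have "inner (x - R x) x \<le> norm (x - R x) * norm x" by (rule norm_cauchy_schwarz)
    also have "norm (x - R x) \<le> norm (B x)" 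
      unfolding R_def using B.sqrt_one_minus_tail[of x] by (simp add: norm_minus_commute)
    also have "\<dots> \<le> norm x" by (rule B.contr)
    finally have "inner (x - R x) x \<le> norm x * norm x" by (simp add: mult_right_mono)
    then show ?thesis by (simp add: inner_diff_left norm_eq_sqrt_inner)
  qed
  define K where "K = {x. R x = S x}"
  have "K = {0} \<or> K = UNIV"
  proof (rule irreducible)
    show "csubspace K" 
      by (auto simp: csubspace_def K_def R.zero S.zero R.add S.add cR commutant_scaleC[OF comm])
    show "closed K" unfolding K_def
      by (intro closed_Collect_eq R.continuous_on S.continuous_on continuous_intros)
    show "\<pi> a ` K \<subseteq> K" for a by (auto simp: K_def \<pi>R [symmetric] comm)
  qed
  then show ?thesis
  proof
    assume K: "K = {0}"
    have "R x + S x \<in> K" for x by (simp add: K_def R.add S.add RR SR)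
    then have "S x = - R x" for x using K by (simp add: eq_neg_iff_add_eq_0 add.commute)
    then show ?thesis using pos by simp
  next
    assume "K = UNIV"
    then have "x \<in> K" for x by simp
    then have "S x = R x" for x by (simp add: K_def)
    then show ?thesis using pos by simp
  qed
qed

text \<open>Every \<open>S - t\<close> is positive or negative; the scalar is the supremum of the \<open>t\<close> for which it is
  positive.\<close>

lemma selfadjoint_commutant_scalar:
  assumes S: "bounded_linear S" and comm: "\<And>a x. S (\<pi> a x) = \<pi> a (S x)"
    and sa: "\<And>x y. inner (S x) y = inner x (S y)"
  obtains r where "\<And>x. S x = r *\<^sub>R x"
proof -
  interpret S: bounded_linear S by (rule S)
  obtain K where K: "K > 0" "\<And>x. norm (S x) \<le> norm x * K"
    using S.pos_bounded by blast
  have dich: "(\<forall>x. inner (S x) x \<ge> t * (norm x)\<^sup>2) \<or> (\<forall>x. inner (S x) x \<le> t * (norm x)\<^sup>2)" for t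
  proof -
    define L where "L = K + \<bar>t\<bar>"
    have L: "L > 0" using K by (simp add: L_def)
    define T where "T = (\<lambda>x. (1 / L) *\<^sub>R (S x - t *\<^sub>R x))"
    have "(\<forall>x. inner (T x) x \<ge> 0) \<or> (\<forall>x. inner (T x) x \<le> 0)"
    proof (rule commutant_definite)
      show "bounded_linear T" unfolding T_def
        by (intro bounded_linear_scaleR_right[THEN bounded_linear_compose] bounded_linear_sub S
            bounded_linear_scaleR_right)
      show "T (\<pi> a x) = \<pi> a (T x)" for a x
        by (simp add: T_def comm rep_diff_right linear_scale[OF bounded_linear.linear[OF rep_bounded]])
      show "inner (T x) y = inner x (T y)" for x y
        by (simp add: T_def sa inner_diff_left inner_diff_right)
      show "norm (T x) \<le> norm x" for x
      proof -
        have "norm (S x - t *\<^sub>R x) \<le> norm x * K + \<bar>t\<bar> * norm x"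
          using norm_triangle_ineq4[of "S x" "t *\<^sub>R x"] K(2)[of x] by simp
        also have "\<dots> = L * norm x" by (simp add: L_def algebra_simps)
        finally show ?thesis using L
          unfolding T_def norm_scaleR by (simp add: divide_le_eq mult.commute)
      qed
    qed
    then show ?thesis using L
      by (simp add: T_def inner_diff_left zero_le_mult_iff mult_le_0_iff power2_norm_eq_inner divide_le_0_iff zero_le_divide_iff)
  qed
  define A where "A = {t. \<forall>x. t * (norm x)\<^sup>2 \<le> inner (S x) x}"
  have bound: "\<bar>inner (S x) x\<bar> \<le> K * (norm x)\<^sup>2" for x
    using Cauchy_Schwarz_ineq2[of "S x" x] mult_right_mono[OF K(2)[of x] norm_ge_zero[of x]]
    by (simp add: power2_eq_square algebra_simps)
  have "- K \<in> A" unfolding A_def using bound by (auto simp: abs_le_iff) (metis minus_le_iff)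
  then have neA: "A \<noteq> {}" by auto
  obtain x0 :: 'h where x0: "x0 \<noteq> 0" using nonzero by blast
  have bddA: "bdd_above A"
  proof (rule bdd_aboveI[of _ K])
    fix t assume "t \<in> A"
    then have "t * (norm x0)\<^sup>2 \<le> inner (S x0) x0" by (simp add: A_def)
    also have "\<dots> \<le> K * (norm x0)\<^sup>2" using bound[of x0] by simp
    finally have "t * (norm x0)\<^sup>2 \<le> K * (norm x0)\<^sup>2" .
    then show "t \<le> K" using x0 by simp
  qed
  define r where "r = Sup A"
  have low: "r * (norm x)\<^sup>2 \<le> inner (S x) x" for x
  proof (cases "x = 0")
    case False
    have "r \<le> inner (S x) x / (norm x)\<^sup>2" unfolding r_def
      using False by (intro cSup_least neA) (auto simp: A_def field_simps)
    then show ?thesis using False by (simp add: field_simps)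
  qed (simp add: S.zero)
  have up: "inner (S x) x \<le> r * (norm x)\<^sup>2" for x
  proof -
    have "inner (S x) x \<le> t * (norm x)\<^sup>2" if "t > r" for t
    proof -
      have "t \<notin> A" using that cSup_upper[OF _ bddA, of t] by (auto simp: r_def)
      then show ?thesis using dich[of t] by (auto simp: A_def)
    qed
    moreover have "((\<lambda>t. t * (norm x)\<^sup>2) \<longlongrightarrow> r * (norm x)\<^sup>2) (at_right r)"
      by (intro tendsto_intros)
    ultimately show ?thesis
      by (intro tendsto_lowerbound[of "\<lambda>t. t * (norm x)\<^sup>2" _ "at_right r"]) 
         (auto simp: eventually_at_right_field intro!: exI[of _ "r + 1"])
  qed
  have q: "inner (S x) x = r * inner x x" for x
    using low[of x] up[of x] by (simp add: power2_norm_eq_inner)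
  have "S x = r *\<^sub>R x" for x
  proof -
    define y where "y = S x - r *\<^sub>R x"
    have "inner (S (x + y)) (x + y) = r * inner (x + y) (x + y)" by (rule q)
    then have "2 * inner (S x) y = 2 * (r * inner x y)"
      using q[of x] q[of y] sa[of y x] by (simp add: S.add inner_simps inner_commute algebra_simps)
    then have "inner y y = 0" by (simp add: y_def inner_diff_left)
    then show ?thesis by (simp add: y_def)
  qed
  then show ?thesis by (rule that)
qed

text \<open>The operator \<open>T'\<close> is the adjoint of \<open>T\<close>; the self-adjoint operators \<open>T + T'\<close> and \<open>i (T - T')\<close> are real
  scalars.\<close>

lemma schur:
  assumes T: "bounded_linear T" "\<And>a x. T (\<pi> a x) = \<pi> a (T x)"
    and T': "bounded_linear T'" "\<And>a x. T' (\<pi> a x) = \<pi> a (T' x)"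
    and adj: "\<And>x y. inner (T x) y = inner x (T' y)"
  obtains c where "\<And>x. T x = c *\<^sub>C x"
proof -
  have adj': "inner (T' x) y = inner x (T y)" for x y
    by (metis adj inner_commute)
  have i: "inner (\<i> *\<^sub>C x) y = - inner x (\<i> *\<^sub>C (y::'h))" for x y
    by (simp add: inner_eq_Re_cinner cinner_simps)
  have Ti: "T (\<i> *\<^sub>C x) = \<i> *\<^sub>C T x" "T' (\<i> *\<^sub>C x) = \<i> *\<^sub>C T' x" for x
    using commutant_scaleC[of T, OF T(2)] commutant_scaleC[of T', OF T'(2)] by auto
  obtain r where r: "\<And>x. T x + T' x = r *\<^sub>R x"
  proof (rule selfadjoint_commutant_scalar)
    show "bounded_linear (\<lambda>x. T x + T' x)" by (intro bounded_linear_add T T')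
  qed (auto simp: T(2) T'(2) rep_add_right inner_add_left inner_add_right adj adj')
  obtain t where t: "\<And>x. \<i> *\<^sub>C (T x - T' x) = t *\<^sub>R x"
  proof (rule selfadjoint_commutant_scalar)
    show "bounded_linear (\<lambda>x. \<i> *\<^sub>C (T x - T' x))"
      by (intro bounded_bilinear.bounded_linear_right[OF bounded_bilinear_scaleC, THEN bounded_linear_compose]
          bounded_linear_sub T T')
    show "inner (\<i> *\<^sub>C (T x - T' x)) y = inner x (\<i> *\<^sub>C (T y - T' y))" for x y
      by (simp add: i inner_diff_left inner_diff_right scaleC_diff_right adj adj' Ti)
  qed (auto simp: T(2) T'(2) rep_diff_right rep_clinear)
  have "T x = ((of_real r - \<i> * of_real t) / 2) *\<^sub>C x" for x
  proof -
    have "T x - T' x = (- \<i>) *\<^sub>C (\<i> *\<^sub>C (T x - T' x))" by (simp add: scaleC_scaleC scaleC_one)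
    also have "\<dots> = (- \<i> * of_real t) *\<^sub>C x" by (simp only: t) (simp add: scaleR_scaleC scaleC_scaleC)
    finally have "(T x + T' x) + (T x - T' x) = (of_real r - \<i> * of_real t) *\<^sub>C x"
      by (simp only: r) (simp add: scaleR_scaleC scaleC_simps)
    then have "2 *\<^sub>R T x = (of_real r - \<i> * of_real t) *\<^sub>C x" by (simp add: scaleR_2)
    then have "(1/2) *\<^sub>R (2 *\<^sub>R T x) = (1/2) *\<^sub>R ((of_real r - \<i> * of_real t) *\<^sub>C x)" by simp
    then show ?thesis by (simp add: scaleR_scaleC scaleC_scaleC scaleC_one)
  qed
  then show ?thesis by (rule that)
qed

end

section \<open>The density theorem\<close>

lemma sum_axis: "(\<Sum>j\<in>UNIV. axis j (w $ j)) = (w :: 'h::real_normed_vector ^ 'n)"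
  by (simp add: vec_eq_iff axis_def if_distrib[of "\<lambda>f. f _"] cong: if_cong)

lemma bounded_linear_axis: "bounded_linear (axis j :: 'h::real_normed_vector \<Rightarrow> 'h ^ 'n)"
proof (rule bounded_linear_intro[where K=1])
  show "norm (axis j x :: 'h ^ 'n) \<le> norm x * 1" for x
    by (simp add: norm_vec_def L2_set_def axis_def if_distrib[of norm] if_distrib[of "\<lambda>r. r\<^sup>2"] cong: if_cong)
qed (auto simp: vec_eq_iff axis_def)

lemma tendsto_vec_nth_iff:
  fixes f :: "nat \<Rightarrow> 'h::real_normed_vector ^ 'n"
  shows "f \<longlonglongrightarrow> l \<longleftrightarrow> (\<forall>i. (\<lambda>n. f n $ i) \<longlonglongrightarrow> l $ i)"
  by (auto intro: tendsto_vec_nth vec_tendstoI)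

lemma subspace_closure:
  fixes S :: "'e::real_normed_vector set"
  assumes S: "subspace S" shows "subspace (closure S)"
  unfolding subspace_def
proof (intro conjI ballI allI)
  show "0 \<in> closure S" using subspace_0[OF S] closure_subset by blast
  fix x assume "x \<in> closure S"
  then obtain f where f: "\<And>n. f n \<in> S" "f \<longlonglongrightarrow> x" unfolding closure_sequential by blast
  show "c *\<^sub>R x \<in> closure S" for c
    unfolding closure_sequential
    by (rule exI[of _ "\<lambda>n. c *\<^sub>R f n"]) (auto intro!: tendsto_intros f subspace_scale[OF S])
  fix y assume "y \<in> closure S"
  then obtain g where g: "\<And>n. g n \<in> S" "g \<longlonglongrightarrow> y" unfolding closure_sequential by blast
  show "x + y \<in> closure S"
    unfolding closure_sequential
    by (rule exI[of _ "\<lambda>n. f n + g n"]) (auto intro!: tendsto_intros f g subspace_add[OF S])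
qed

context irreducible_representation
begin

text \<open>Von Neumann's argument: the projection onto the closed orbit of the tuple \<open>v\<close> commutes with the
  amplified representation, so by Schur's lemma it is a matrix of scalars and hence commutes with
  the amplification of every complex linear \<open>S\<close>.\<close>

lemma density:
  fixes v :: "'n::finite \<Rightarrow> 'h"
  assumes S: "bounded_linear S" "\<And>c x. S (c *\<^sub>C x) = c *\<^sub>C S x"
  shows "\<exists>a. \<forall>i. (\<lambda>n. \<pi> (a n) (v i)) \<longlonglongrightarrow> S (v i)"
proof -
  interpret S: bounded_linear S by (rule S)
  define Am where "Am = (\<lambda>a (w :: 'h ^ 'n). \<chi> i. \<pi> a (w $ i))"
  define M where "M = closure (range (\<lambda>a. Am a (\<chi> i. v i)))"
  have Am_bl: "bounded_linear (Am a)" for a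
  proof -
    have "(\<lambda>w. \<Sum>j\<in>UNIV. axis j (\<pi> a (w $ j))) = Am a"
      using sum_axis[of "Am a _"] by (auto simp: Am_def)
    moreover have "bounded_linear (\<lambda>w::'h ^ 'n. \<Sum>j\<in>UNIV. axis j (\<pi> a (w $ j)) :: 'h ^ 'n)"
      by (intro bounded_linear_sum bounded_linear_axis[THEN bounded_linear_compose]
          rep_bounded[THEN bounded_linear_compose] bounded_linear_vec_nth)
    ultimately show ?thesis by simp
  qed
  have sub: "subspace M" unfolding M_def
  proof (rule subspace_closure)
    show "subspace (range (\<lambda>a. Am a (\<chi> i. v i)))"
      unfolding subspace_def
    proof (intro conjI ballI allI)
      have "0 = Am 0 (\<chi> i. v i)" by (simp add: Am_def vec_eq_iff)
      then show "0 \<in> range (\<lambda>a. Am a (\<chi> i. v i))" by blast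
      fix x assume "x \<in> range (\<lambda>a. Am a (\<chi> i. v i))"
      then obtain a where a: "x = Am a (\<chi> i. v i)" by auto
      have "c *\<^sub>R x = Am (c *\<^sub>R a) (\<chi> i. v i)" for c by (simp add: a Am_def vec_eq_iff rep_scaleR)
      then show "c *\<^sub>R x \<in> range (\<lambda>a. Am a (\<chi> i. v i))" for c by blast
      fix y assume "y \<in> range (\<lambda>a. Am a (\<chi> i. v i))"
      then obtain b where b: "y = Am b (\<chi> i. v i)" by auto
      have "x + y = Am (a + b) (\<chi> i. v i)" by (simp add: a b Am_def vec_eq_iff rep_add)
      then show "x + y \<in> range (\<lambda>a. Am a (\<chi> i. v i))" by blast
    qed
  qed
  have cl: "closed M" by (simp add: M_def)
  obtain P where P: "bounded_linear P" "\<And>x. P x \<in> M" "\<And>x m. m \<in> M \<Longrightarrow> inner (x - P x) m = 0"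
    and uniq: "\<And>x p. p \<in> M \<Longrightarrow> (\<And>m. m \<in> M \<Longrightarrow> inner (x - p) m = 0) \<Longrightarrow> P x = p"
    and sym: "\<And>x y. inner (P x) y = inner x (P y)"
    using orthogonal_projection_exists[OF sub cl] by blast
  interpret P: bounded_linear P by (rule P(1))
  have inv: "Am a m \<in> M" if "m \<in> M" for a m
  proof -
    have "Am a ` closure (range (\<lambda>a. Am a (\<chi> i. v i))) \<subseteq> closure (Am a ` range (\<lambda>a. Am a (\<chi> i. v i)))"
      by (rule closure_bounded_linear_image_subset[OF Am_bl])
    also have "\<dots> \<subseteq> M" unfolding M_def
    proof (rule closure_mono)
      have "Am a (Am b w) = Am (a * b) w" for b w by (simp add: Am_def rep_mult)
      then show "Am a ` range (\<lambda>a. Am a (\<chi> i. v i)) \<subseteq> range (\<lambda>a. Am a (\<chi> i. v i))" by auto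
    qed
    finally show ?thesis using that by (auto simp: M_def)
  qed
  have Am_star: "inner (Am a w) m = inner w (Am (star a) m)" for a w m
    using inner_rep_star[of "star a"] by (simp add: inner_vec_def Am_def star_star)
  have comm: "P (Am a w) = Am a (P w)" for a w
  proof (rule uniq)
    show "Am a (P w) \<in> M" by (rule inv[OF P(2)])
    show "inner (Am a w - Am a (P w)) m = 0" if "m \<in> M" for m
      using P(3)[OF inv[OF that, of "star a"], of w]
      by (simp add: linear_diff[OF bounded_linear.linear[OF Am_bl], symmetric] Am_star)
  qed
  have "\<exists>c. \<forall>x. P (axis j x) $ i = c *\<^sub>C x" for i j
  proof -
    have bl: "bounded_linear (\<lambda>x. P (axis j x) $ i)" for i j
      by (intro bounded_linear_vec_nth[THEN bounded_linear_compose] P(1)[THEN bounded_linear_compose]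
          bounded_linear_axis)
    have cm: "P (axis j (\<pi> a x)) $ i = \<pi> a (P (axis j x) $ i)" for i j a x
    proof -
      have "axis j (\<pi> a x) = Am a (axis j x)" by (simp add: Am_def vec_eq_iff axis_def)
      then show ?thesis by (simp add: comm) (simp add: Am_def)
    qed
    obtain c where "\<And>x. P (axis j x) $ i = c *\<^sub>C x"
    proof (rule schur[OF bl cm bl cm])
      show "inner (P (axis j x) $ i) y = inner x (P (axis i y) $ j)" for x y
        by (metis sym inner_axis inner_commute)
    qed blast
    then show ?thesis by blast
  qed
  then have "\<forall>i j. \<exists>c. \<forall>x. P (axis j x) $ i = c *\<^sub>C x" by blast
  then have "\<exists>c. \<forall>i j x. P (axis j x) $ i = c i j *\<^sub>C x" unfolding choice_iff .
  then obtain c where c: "\<And>i j x. P (axis j x) $ i = c i j *\<^sub>C x" by blast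
  have Pw: "P w $ i = (\<Sum>j\<in>UNIV. c i j *\<^sub>C (w $ j))" for w i
    by (subst sum_axis[of w, symmetric]) (simp add: P.sum c)
  define w :: "'h ^ 'n" where "w = (\<chi> i. S (v i))"
  have "(\<chi> i. v i) \<in> M"
  proof -
    have "(\<chi> i. v i) = Am 1 (\<chi> i. v i)" by (simp add: Am_def rep_one)
    then have "(\<chi> i. v i) \<in> range (\<lambda>a. Am a (\<chi> i. v i))" by (rule range_eqI)
    then show ?thesis unfolding M_def by (rule subsetD[OF closure_subset])
  qed
  then have v: "P (\<chi> i. v i) = (\<chi> i. v i)" by (intro uniq) auto
  have "P w = w"
  proof -
    \<comment> \<open>a matrix of scalars commutes with the amplification of \<open>S\<close>\<close>
    have "P w $ i = S (P (\<chi> i. v i) $ i)" for i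
      by (simp add: Pw w_def S.sum S(2))
    then show ?thesis by (simp add: v vec_eq_iff) (simp add: w_def)
  qed
  then have "w \<in> M" using P(2)[of w] by simp
  then obtain f where f: "\<And>n. f n \<in> range (\<lambda>a. Am a (\<chi> i. v i))" "f \<longlonglongrightarrow> w"
    unfolding M_def closure_sequential by blast
  then have "\<forall>n. \<exists>a. f n = Am a (\<chi> i. v i)" by auto
  then obtain a where a: "\<And>n. f n = Am (a n) (\<chi> i. v i)" unfolding choice_iff by blast
  show ?thesis
    using f(2) by (intro exI[of _ a]) (simp add: tendsto_vec_nth_iff a Am_def w_def)
qed

text \<open>Four vectors are needed below: two whose images are prescribed and two that form a separating
  functional.\<close>

lemma density4:
  assumes S: "bounded_linear S" "\<And>c x. S (c *\<^sub>C x) = c *\<^sub>C S x"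
  obtains a where "(\<lambda>n. \<pi> (a n) v1) \<longlonglongrightarrow> S v1" "(\<lambda>n. \<pi> (a n) v2) \<longlonglongrightarrow> S v2"
    "(\<lambda>n. \<pi> (a n) v3) \<longlonglongrightarrow> S v3" "(\<lambda>n. \<pi> (a n) v4) \<longlonglongrightarrow> S v4"
proof -
  define v :: "4 \<Rightarrow> 'h" where "v = (\<lambda>i. if i = 1 then v1 else if i = 2 then v2 else if i = 3 then v3 else v4)"
  obtain a where a: "\<And>i. (\<lambda>n. \<pi> (a n) (v i)) \<longlonglongrightarrow> S (v i)" using density[OF S, of v] by blast
  show ?thesis
    using that[of a] a[of 1] a[of 2] a[of 3] a[of 4] by (simp add: v_def)
qed

text \<open>Self-adjoint elements suffice for a symmetric \<open>S\<close>: a pair \<open>y\<close> separating \<open>(S v1, S v2)\<close> from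
  their orbit annihilates all \<open>a + a*\<close>, and letting \<open>\<pi> a\<close> tend to \<open>S\<close> on \<open>v1, v2\<close> and both components
  of \<open>y\<close> shows that \<open>y\<close> does not separate.\<close>

lemma selfadjoint_density:
  assumes S: "bounded_linear S" "\<And>c x. S (c *\<^sub>C x) = c *\<^sub>C S x"
    and sym: "\<And>x y. inner (S x) y = inner x (S y)"
  obtains a where "\<And>n. star (a n) = a n"
    "(\<lambda>n. \<pi> (a n) v1) \<longlonglongrightarrow> S v1" "(\<lambda>n. \<pi> (a n) v2) \<longlonglongrightarrow> S v2"
proof -
  define E where "E = (\<lambda>a. (\<pi> a v1, \<pi> a v2)) ` {a. star a = a}"
  define M where "M = closure E"
  have sub: "subspace M" unfolding M_def
  proof (rule subspace_closure)
    show "subspace E" unfolding subspace_def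
    proof (intro conjI ballI allI)
      have "0 = (\<pi> 0 v1, \<pi> 0 v2)" by (simp add: zero_prod_def)
      then show "0 \<in> E" unfolding E_def using star_zero by blast
      fix x assume "x \<in> E"
      then obtain a where a: "x = (\<pi> a v1, \<pi> a v2)" "star a = a" by (auto simp: E_def)
      have "c *\<^sub>R x = (\<pi> (c *\<^sub>R a) v1, \<pi> (c *\<^sub>R a) v2)" "star (c *\<^sub>R a) = c *\<^sub>R a" for c
        by (simp_all add: a rep_scaleR star_scaleR)
      then show "c *\<^sub>R x \<in> E" for c unfolding E_def by blast
      fix y assume "y \<in> E"
      then obtain b where b: "y = (\<pi> b v1, \<pi> b v2)" "star b = b" by (auto simp: E_def)
      have "x + y = (\<pi> (a + b) v1, \<pi> (a + b) v2)" "star (a + b) = a + b"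
        by (simp_all add: a b rep_add star_add)
      then show "x + y \<in> E" unfolding E_def by blast
    qed
  qed
  have cl: "closed M" by (simp add: M_def)
  obtain P where P: "\<And>x. P x \<in> M" "\<And>x m. m \<in> M \<Longrightarrow> inner (x - P x) m = 0"
    using orthogonal_projection_exists[OF sub cl] by (metis (no_types))
  define w where "w = (S v1, S v2)"
  define y where "y = w - P w"
  obtain a where a: "(\<lambda>n. \<pi> (a n) v1) \<longlonglongrightarrow> S v1" "(\<lambda>n. \<pi> (a n) v2) \<longlonglongrightarrow> S v2"
    "(\<lambda>n. \<pi> (a n) (fst y)) \<longlonglongrightarrow> S (fst y)" "(\<lambda>n. \<pi> (a n) (snd y)) \<longlonglongrightarrow> S (snd y)"
    using density4[OF S] .
  have ann: "inner (fst y) (\<pi> b v1) + inner (snd y) (\<pi> b v2) + (inner (\<pi> b (fst y)) v1 + inner (\<pi> b (snd y)) v2) = 0" for b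
  proof -
    have "star (b + star b) = b + star b" by (simp add: star_add star_star add.commute)
    then have "(\<pi> (b + star b) v1, \<pi> (b + star b) v2) \<in> M"
      unfolding M_def using closure_subset by (force simp: E_def)
    then have "inner y (\<pi> (b + star b) v1, \<pi> (b + star b) v2) = 0"
      unfolding y_def by (rule P(2))
    moreover have "inner x (\<pi> (star b) z) = inner (\<pi> b x) z" for x z
      by (metis inner_rep_star inner_commute)
    ultimately show ?thesis
      by (simp add: inner_prod_def rep_add inner_add_right)
  qed
  have "(\<lambda>n. inner (fst y) (\<pi> (a n) v1) + inner (snd y) (\<pi> (a n) v2) + (inner (\<pi> (a n) (fst y)) v1 + inner (\<pi> (a n) (snd y)) v2))
      \<longlonglongrightarrow> inner (fst y) (S v1) + inner (snd y) (S v2) + (inner (S (fst y)) v1 + inner (S (snd y)) v2)"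
    by (intro tendsto_intros a)
  then have "inner (fst y) (S v1) + inner (snd y) (S v2) + (inner (S (fst y)) v1 + inner (S (snd y)) v2) = 0"
    by (simp add: ann LIMSEQ_const_iff)
  then have "inner y w = 0" by (simp add: sym w_def inner_prod_def)
  moreover have "inner y (P w) = 0" unfolding y_def by (rule P(2)[OF P(1)])
  ultimately have "inner y y = 0" by (simp add: y_def inner_diff_right)
  then have "w = P w" by (simp add: y_def)
  then have "w \<in> M" using P(1)[of w] by simp
  then obtain f where f: "\<And>n. f n \<in> E" "f \<longlonglongrightarrow> w"
    unfolding M_def closure_sequential by blast
  then have "\<forall>n. \<exists>a. star a = a \<and> f n = (\<pi> a v1, \<pi> a v2)" by (force simp: E_def)
  then obtain a where a: "\<And>n. star (a n) = a n" "\<And>n. f n = (\<pi> (a n) v1, \<pi> (a n) v2)" by metis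
  show ?thesis
    using that[OF a(1)] tendsto_fst[OF f(2)] tendsto_snd[OF f(2)] by (simp add: a(2) w_def)
qed

end

section \<open>Vector states of an irreducible representation\<close>

definition vector_state ::
    "('a::cstar_algebra \<Rightarrow> 'h::complex_hilbert_space \<Rightarrow> 'h) \<Rightarrow> 'h \<Rightarrow> 'a \<Rightarrow> complex" where
  "vector_state \<pi> x = (\<lambda>a. cinner x (\<pi> a x))"

lemma bounded_linear_rank_one:
  "bounded_linear (\<lambda>z. cinner y z *\<^sub>C (x::'h::complex_hilbert_space))"
  by (intro bounded_bilinear.bounded_linear_left[OF bounded_bilinear_scaleC, THEN bounded_linear_compose]
      bounded_linear_cinner_right)

context representation
begin

lemma state_vector_state: "norm x = 1 \<Longrightarrow> state (vector_state \<pi> x)"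
  by (auto simp: state_def vector_state_def rep_add rep_scale rep_one cinner_simps cinner_self
      norm_rep_square [symmetric] complex_nonneg_Reals_iff simp del: of_real_power)

lemma vector_state_mult: "vector_state \<pi> x (star a * b) = cinner (\<pi> a x) (\<pi> b x)"
  by (simp add: vector_state_def cinner_rep_rep)

lemma vector_state_phase: "cmod c = 1 \<Longrightarrow> vector_state \<pi> (c *\<^sub>C x) = vector_state \<pi> x"
  using complex_norm_square[of c]
  by (auto simp: vector_state_def rep_clinear cinner_simps mult.assoc [symmetric] mult.commute[of "cnj c"])

lemma state_act_vector_state: "state_act u (vector_state \<pi> x) = vector_state \<pi> (\<pi> u x)"
  by (simp add: state_act_def vector_state_def rep_mult rep_star_right)

end

context irreducible_representation
begin

text \<open>Self-adjoint density for the rank-one projection onto \<open>x\<close>.\<close>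

lemma selfadjoint_approx_projection:
  assumes "norm x = 1"
  obtains a where "\<And>n. star (a n) = a n" "(\<lambda>n. \<pi> (a n) x) \<longlonglongrightarrow> x" "(\<lambda>n. \<pi> (a n) y) \<longlonglongrightarrow> cinner x y *\<^sub>C x"
proof -
  obtain a where a: "\<And>n. star (a n) = a n" "(\<lambda>n. \<pi> (a n) x) \<longlonglongrightarrow> cinner x x *\<^sub>C x" 
     "(\<lambda>n. \<pi> (a n) y) \<longlonglongrightarrow> cinner x y *\<^sub>C x"
  proof (rule selfadjoint_density[OF bounded_linear_rank_one[of x x]])
    show "inner (cinner x z *\<^sub>C x) z' = inner z (cinner x z' *\<^sub>C x)" for z z'
    proof -
      have "cinner (cinner x z *\<^sub>C x) z' = cinner z x * cinner x z'"
        by (metis cinner_commute cinner_scaleC_left)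
      also have "\<dots> = cinner z (cinner x z' *\<^sub>C x)" by (simp add: cinner_scaleC_right)
      finally show ?thesis by (simp only: inner_eq_Re_cinner)
    qed
  qed (auto simp: cinner_simps scaleC_scaleC)
  then show ?thesis using that[of a] assms by (simp add: cinner_self scaleC_one)
qed

text \<open>If \<open>\<omega>\<^sub>x = t \<sigma> + (1 - t) \<sigma>'\<close> then \<open>\<sigma>\<close> is dominated by \<open>\<omega>\<^sub>x / t\<close>. For \<open>a\<close> with \<open>\<omega>\<^sub>x(a) = 0\<close> and \<open>c\<close>
  close to the projection onto \<open>x\<close> on the vectors \<open>x\<close> and \<open>\<pi>(a) x\<close>, both \<open>\<sigma>(c a)\<close> and \<open>\<sigma>((1 - c) a)\<close>
  are small by the Cauchy-Schwarz inequality, so \<open>\<sigma>(a) = 0\<close>.\<close>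

lemma dominated_state_eq:
  assumes x: "norm x = 1" and \<sigma>: "state \<sigma>" and t: "t > 0"
    and dom: "\<And>a. t * Re (\<sigma> (star a * a)) \<le> Re (vector_state \<pi> x (star a * a))"
  shows "\<sigma> = vector_state \<pi> x"
proof -
  interpret semi_inner_product "gns_form \<sigma>" by (rule state_semi_inner_product[OF \<sigma>])
  have lin: "\<sigma> (a + b) = \<sigma> a + \<sigma> b" "\<sigma> (c *\<^sub>C a) = c * \<sigma> a" "\<sigma> 1 = 1" for a b c
    using \<sigma> by (auto simp: state_def)
  have dom': "Re (gns_form \<sigma> a a) \<le> (norm (\<pi> a x))\<^sup>2 / t" for a
    using dom[of a] t by (simp add: vector_state_mult gns_form_def cinner_self field_simps del: of_real_power)
  have zero: "\<sigma> a = 0" if a0: "cinner x (\<pi> a x) = 0" for a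
  proof -
    obtain c where c: "\<And>n. star (c n) = c n" "(\<lambda>n. \<pi> (c n) x) \<longlonglongrightarrow> x" 
      "(\<lambda>n. \<pi> (c n) (\<pi> a x)) \<longlonglongrightarrow> cinner x (\<pi> a x) *\<^sub>C x"
      using selfadjoint_approx_projection[OF x, where y = "\<pi> a x"] by metis
    define L where "L = Re (gns_form \<sigma> a a)"
    have L: "L \<ge> 0" by (simp add: L_def Re_nonneg)
    have bound: "cmod (\<sigma> a) \<le> sqrt (1 / t) * norm (\<pi> (c n) (\<pi> a x)) + sqrt (L / t) * norm (x - \<pi> (c n) x)" for n
    proof -
      have "(cmod (\<sigma> (c n * a)))\<^sup>2 \<le> Re (gns_form \<sigma> 1 1) * Re (gns_form \<sigma> (c n * a) (c n * a))"
        using Cauchy_Schwarz[of 1 "c n * a"] by (simp add: gns_form_def)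
      also have "\<dots> \<le> (norm (\<pi> (c n) (\<pi> a x)))\<^sup>2 / t"
        using dom'[of "c n * a"] by (simp add: gns_form_def lin rep_mult)
      also have "\<dots> = (sqrt (1 / t) * norm (\<pi> (c n) (\<pi> a x)))\<^sup>2"
        using t by (simp add: power_mult_distrib real_sqrt_divide power_divide)
      finally have 1: "cmod (\<sigma> (c n * a)) \<le> sqrt (1 / t) * norm (\<pi> (c n) (\<pi> a x))"
        by (rule power2_le_imp_le) (use t in simp)
      have "\<sigma> ((1 - c n) * a) = gns_form \<sigma> (1 - c n) a"
        by (simp add: gns_form_def star_diff c(1))
      then have "(cmod (\<sigma> ((1 - c n) * a)))\<^sup>2 \<le> Re (gns_form \<sigma> (1 - c n) (1 - c n)) * L"
        using Cauchy_Schwarz[of "1 - c n" a] by (simp add: L_def)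
      also have "\<dots> \<le> (norm (x - \<pi> (c n) x))\<^sup>2 / t * L"
        using dom'[of "1 - c n"] L by (intro mult_right_mono) (auto simp: rep_diff rep_one)
      also have "\<dots> = (sqrt (L / t) * norm (x - \<pi> (c n) x))\<^sup>2"
        using t L by (simp add: power_mult_distrib real_sqrt_divide power_divide)
      finally have 2: "cmod (\<sigma> ((1 - c n) * a)) \<le> sqrt (L / t) * norm (x - \<pi> (c n) x)"
        by (rule power2_le_imp_le) (use t L in simp)
      have "\<sigma> a = \<sigma> (c n * a) + \<sigma> ((1 - c n) * a)"
        by (simp add: lin(1) [symmetric] left_diff_distrib)
      then show ?thesis using 1 2 norm_triangle_ineq[of "\<sigma> (c n * a)" "\<sigma> ((1 - c n) * a)"] by simp
    qed
    have "(\<lambda>n. sqrt (1 / t) * norm (\<pi> (c n) (\<pi> a x)) + sqrt (L / t) * norm (x - \<pi> (c n) x))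
        \<longlonglongrightarrow> sqrt (1 / t) * norm (cinner x (\<pi> a x) *\<^sub>C x) + sqrt (L / t) * norm (x - x)"
      by (intro tendsto_intros c)
    then have "cmod (\<sigma> a) \<le> sqrt (1 / t) * norm (cinner x (\<pi> a x) *\<^sub>C x) + sqrt (L / t) * norm (x - x)"
      by (rule LIMSEQ_le_const) (use bound in blast)
    then show ?thesis by (simp add: a0)
  qed
  show ?thesis
  proof
    fix a
    have "\<sigma> (a + (- vector_state \<pi> x a) *\<^sub>C 1) = 0"
      by (rule zero)
         (simp only: rep_add rep_scalar cinner_add_right cinner_scaleC_right cinner_self x vector_state_def, simp)
    then show "\<sigma> a = vector_state \<pi> x a" unfolding lin by simp
  qed
qed

lemma vector_state_pure:
  assumes x: "norm x = 1"
  shows "vector_state \<pi> x \<in> pure_states"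
proof -
  have pos: "Re (\<tau> (star a * a)) \<ge> 0" if "state \<tau>" for \<tau> and a :: 'a
    using that by (auto simp: state_def complex_nonneg_Reals_iff)
  have "\<sigma> = vector_state \<pi> x \<and> \<sigma>' = vector_state \<pi> x"
    if s: "state \<sigma>" "state \<sigma>'" and t: "0 < t" "t < 1"
      and e: "vector_state \<pi> x = (\<lambda>a. complex_of_real t * \<sigma> a + complex_of_real (1 - t) * \<sigma>' a)" for \<sigma> \<sigma>' t
  proof
    show "\<sigma> = vector_state \<pi> x"
      by (rule dominated_state_eq[OF x s(1) t(1)]) (use pos[OF s(2)] t in \<open>simp add: e\<close>)
    show "\<sigma>' = vector_state \<pi> x"
      by (rule dominated_state_eq[OF x s(2), of "1 - t"]) (use pos[OF s(1)] t in \<open>simp_all add: e\<close>)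
  qed
  then show ?thesis
    unfolding pure_states_def using state_vector_state[OF x] by blast
qed

text \<open>An element close to the projection onto \<open>x\<close> gives \<open>\<bar>\<langle>x|y\<rangle>\<bar> = 1\<close>, the case of equality in the
  Cauchy-Schwarz inequality.\<close>

lemma vector_state_eqD:
  assumes x: "norm x = 1" and y: "norm y = 1" and eq: "vector_state \<pi> x = vector_state \<pi> y"
  obtains c where "cmod c = 1" "y = c *\<^sub>C x"
proof -
  obtain a where a: "\<And>n. star (a n) = a n" "(\<lambda>n. \<pi> (a n) x) \<longlonglongrightarrow> x" "(\<lambda>n. \<pi> (a n) y) \<longlonglongrightarrow> cinner x y *\<^sub>C x"
    using selfadjoint_approx_projection[OF x] by metis
  have "norm (\<pi> b x) = norm (\<pi> b y)" for b
  proof -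
    have "complex_of_real ((norm (\<pi> b x))\<^sup>2) = of_real ((norm (\<pi> b y))\<^sup>2)"
      unfolding norm_rep_square using eq by (metis vector_state_def)
    then have "(norm (\<pi> b x))\<^sup>2 = (norm (\<pi> b y))\<^sup>2" using of_real_eq_iff by blast
    then show ?thesis by simp
  qed
  then have "(\<lambda>n. norm (\<pi> (a n) x)) \<longlonglongrightarrow> norm (cinner x y *\<^sub>C x)"
    using tendsto_norm[OF a(3)] by simp
  then have n1: "cmod (cinner x y) = 1"
    using LIMSEQ_unique[OF tendsto_norm[OF a(2)]] x by (simp add: norm_scaleC_hilbert)
  define d where "d = y - cinner x y *\<^sub>C x"
  have "cinner d d = 0"
  proof -
    have "cinner x y * cnj (cinner x y) = 1" using complex_norm_square[of "cinner x y"] n1 by simp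
    moreover have "cinner y x = cnj (cinner x y)" by (rule cinner_commute)
    ultimately show ?thesis
      unfolding d_def cinner_simps by (simp add: cinner_self x y mult.commute)
  qed
  then have "y = cinner x y *\<^sub>C x" by (simp add: cinner_self d_def)
  with n1 show ?thesis by (rule that)
qed

end

section \<open>Transitivity of the unitary group\<close>

lemma star_power: "star (a ^ n) = star a ^ n" for a :: "'a::cstar_algebra"
  by (induction n) (auto simp: star_mult power_commutes)

lemma star_exp: "star (exp a) = exp (star (a::'a::cstar_algebra))"
  unfolding exp_def
  by (subst bounded_linear.suminf[OF bounded_linear_star summable_exp_generic])
     (simp add: star_scaleR star_power)

lemma exp_skew_unitary:
  assumes "star x = - x" shows "exp x \<in> (unitaries :: 'a::cstar_algebra set)"
  using exp_minus_inverse[of x] exp_minus_inverse[of "- x"] 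
  by (auto simp: unitaries_def star_exp assms)

lemma norm_unitary: "u \<in> unitaries \<Longrightarrow> norm (u::'a::cstar_algebra) = 1"
  using norm_unitary_mult[of u 1] by simp

lemma unitaries_scaleC: "cmod c = 1 \<Longrightarrow> u \<in> unitaries \<Longrightarrow> c *\<^sub>C u \<in> (unitaries :: 'a::cstar_algebra set)"
  using unitaries_mult[OF scalar_unitary[of c], of u] by (simp add: mult_scaleC_left)

lemma closed_unitaries:
  assumes "\<And>n. v n \<in> (unitaries :: 'a::cstar_algebra set)" "v \<longlonglongrightarrow> u"
  shows "u \<in> unitaries"
proof -
  have s: "(\<lambda>n. star (v n)) \<longlonglongrightarrow> star u" by (rule bounded_linear.tendsto[OF bounded_linear_star assms(2)])
  have "(\<lambda>n. star (v n) * v n) \<longlonglongrightarrow> star u * u" "(\<lambda>n. v n * star (v n)) \<longlonglongrightarrow> u * star u"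
    by (intro tendsto_mult s assms(2))+
  then show ?thesis using assms(1) by (simp add: unitaries_def LIMSEQ_const_iff)
qed

text \<open>The phase \<open>p\<close> of \<open>\<langle>h|k\<rangle>\<close> is split off because scalars of modulus \<open>1\<close> are unitaries of the algebra. What
  remains is a real rotation in the plane of \<open>h\<close> and an orthogonal unit vector \<open>e\<close>; for
  \<open>s = 0\<close> there may be no such \<open>e\<close>, as the space may be one-dimensional.\<close>

lemma unit_vector_decomposition:
  fixes h k :: "'h::complex_hilbert_space"
  assumes h: "norm h = 1" and k: "norm k = 1"
  obtains p s e where "cmod p = 1" "of_real (cmod (cinner h k)) * p = cinner h k" "0 \<le> s"
    "s\<^sup>2 = 1 - (cmod (cinner h k))\<^sup>2" "cinner h e = 0" "s = 0 \<or> norm e = 1"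
    "k = p *\<^sub>C (cmod (cinner h k) *\<^sub>R h + s *\<^sub>R e)"
proof -
  define \<alpha> where "\<alpha> = cinner h k"
  define p where "p = (if \<alpha> = 0 then 1 else \<alpha> / of_real (cmod \<alpha>))"
  have p: "cmod p = 1" "of_real (cmod \<alpha>) * p = \<alpha>" by (auto simp: p_def norm_divide)
  have pp: "p * cnj p = 1" using complex_norm_square[of p] p by simp
  define r where "r = k - \<alpha> *\<^sub>C h"
  define s where "s = norm r"
  define e where "e = (if s = 0 then 0 else cnj p *\<^sub>C (1 / s) *\<^sub>R r)"
  have hr: "cinner h r = 0" by (simp add: r_def cinner_simps cinner_self h \<alpha>_def)
  have se: "s *\<^sub>R e = cnj p *\<^sub>C r"
    by (auto simp: e_def s_def scaleC_scaleR)
  have "complex_of_real (s\<^sup>2) = cinner r r" by (simp add: s_def cinner_self)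
  also have "\<dots> = cinner k r - cnj \<alpha> * cinner h r"
  proof -
    have "cinner r x = cinner k x - cnj \<alpha> * cinner h x" for x by (simp add: r_def cinner_simps)
    then show ?thesis .
  qed
  also have "\<dots> = 1 - \<alpha> * cnj \<alpha>"
  proof -
    have "cinner k h = cnj \<alpha>" unfolding \<alpha>_def by (rule cinner_commute)
    then show ?thesis unfolding hr unfolding r_def cinner_simps by (simp add: cinner_self k)
  qed
  also have "\<dots> = of_real (1 - (cmod \<alpha>)\<^sup>2)" by (simp add: complex_norm_square del: of_real_power)
  finally have s2: "s\<^sup>2 = 1 - (cmod \<alpha>)\<^sup>2" using of_real_eq_iff by blast
  have "p *\<^sub>C (cmod \<alpha> *\<^sub>R h + s *\<^sub>R e) = (of_real (cmod \<alpha>) * p) *\<^sub>C h + (p * cnj p) *\<^sub>C r"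
    unfolding scaleC_add_right se unfolding scaleC_scaleC scaleR_scaleC by (simp add: mult.commute)
  also have "\<dots> = k" unfolding p pp by (simp add: scaleC_one r_def)
  finally have "k = p *\<^sub>C (cmod \<alpha> *\<^sub>R h + s *\<^sub>R e)" ..
  moreover have "cinner h e = 0" by (simp add: e_def cinner_simps hr)
  moreover have "s = 0 \<or> norm e = 1" using p by (auto simp: e_def norm_scaleC_hilbert s_def)
  moreover have "0 \<le> s" by (simp add: s_def)
  ultimately show ?thesis using that p s2 unfolding \<alpha>_def by blast
qed

context representation
begin

lemma bounded_bilinear_rep: "bounded_bilinear \<pi>"
proof
  show "\<exists>K. \<forall>a b. norm (\<pi> a b) \<le> norm a * norm b * K"
    by (rule exI[of _ 1]) (simp add: norm_rep_le)
qed (simp_all add: rep_add rep_add_right rep_scaleR linear_scale[OF bounded_linear.linear[OF rep_bounded]])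

text \<open>If \<open>a\<close> exchanged \<open>h\<close> and \<open>k\<close> exactly, then \<open>exp (- i t a)\<close> would rotate \<open>cos t h + i sin t k\<close>
  back to \<open>h\<close>. In general the defect is the derivative of the curve \<open>g\<close>.\<close>

lemma exp_rotation_approx:
  assumes sa: "star a = a" and e: "norm (\<pi> a h - k) \<le> \<epsilon>" "norm (\<pi> a k - h) \<le> \<epsilon>"
  shows "norm (\<pi> (exp (s *\<^sub>R ((- \<i>) *\<^sub>C a))) (cos s *\<^sub>R h + sin s *\<^sub>R (\<i> *\<^sub>C k)) - h) \<le> 2 * \<epsilon> * \<bar>s\<bar>"
proof -
  define X where "X = (- \<i>) *\<^sub>C a"
  define w where "w = (\<lambda>t. cos t *\<^sub>R h + sin t *\<^sub>R (\<i> *\<^sub>C k))"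
  define w' where "w' = (\<lambda>t. (- sin t) *\<^sub>R h + cos t *\<^sub>R (\<i> *\<^sub>C k))"
  define g where "g = (\<lambda>t. \<pi> (exp (t *\<^sub>R X)) (w t))"
  define g' where "g' = (\<lambda>t. \<pi> (exp (t *\<^sub>R X)) (w' t) + \<pi> (exp (t *\<^sub>R X) * X) (w t))"
  have w: "(w has_vector_derivative w' t) (at t)" for t
    unfolding w_def w'_def
    by (auto intro!: derivative_eq_intros simp: has_vector_derivative_def)
       (auto simp: algebra_simps)
  have g: "(g has_vector_derivative g' t) (at t)" for t
    unfolding g_def g'_def
    by (rule bounded_bilinear.has_vector_derivative[OF bounded_bilinear_rep exp_scaleR_has_vector_derivative_right w])
  have star_tX: "star (t *\<^sub>R X) = - (t *\<^sub>R X)" for t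
    by (simp add: X_def star_scaleR star_scaleC star_minus sa scaleC_minus_left)
  have bound: "norm (g' t) \<le> 2 * \<epsilon>" for t
  proof -
    have "w' t + \<pi> X (w t) = cos t *\<^sub>R ((- \<i>) *\<^sub>C (\<pi> a h - k)) + sin t *\<^sub>R (\<pi> a k - h)"
      unfolding w_def w'_def X_def
      by (simp add: rep_scale rep_minus rep_add_right scaleC_simps rep_clinear linear_scale[OF bounded_linear.linear[OF rep_bounded]]
          scaleC_scaleR algebra_simps)
    also have "norm \<dots> \<le> \<bar>cos t\<bar> * norm (\<pi> a h - k) + \<bar>sin t\<bar> * norm (\<pi> a k - h)"
      by (rule order_trans[OF norm_triangle_ineq]) (simp add: norm_scaleC_hilbert)
    also have "\<dots> \<le> 1 * \<epsilon> + 1 * \<epsilon>" using e by (intro add_mono mult_mono) auto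
    finally have "norm (w' t + \<pi> X (w t)) \<le> 2 * \<epsilon>" by simp
    moreover have "g' t = \<pi> (exp (t *\<^sub>R X)) (w' t + \<pi> X (w t))" by (simp add: g'_def rep_mult rep_add_right)
    ultimately show ?thesis using norm_rep_unitary[OF exp_skew_unitary[OF star_tX]] by simp
  qed
  have "norm (g s - g 0) \<le> 2 * \<epsilon> * norm (s - 0)"
  proof (rule differentiable_bound[of UNIV g "\<lambda>t d. d *\<^sub>R g' t"])
    show "(g has_derivative (\<lambda>d. d *\<^sub>R g' t)) (at t within UNIV)" for t
      using g[of t] by (simp add: has_vector_derivative_def)
    show "onorm (\<lambda>d. d *\<^sub>R g' t) \<le> 2 * \<epsilon>" for t
      by (rule onorm_le) (metis bound mult.commute mult_left_mono norm_ge_zero norm_scaleR real_norm_def)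
  qed auto
  then show ?thesis by (simp add: g_def w_def X_def rep_one)
qed

end

context irreducible_representation
begin

text \<open>Self-adjoint density for the operator that exchanges \<open>h\<close> and \<open>k\<close> and vanishes on the orthogonal
  complement. Nothing is known about the norm of \<open>a\<close>.\<close>

lemma approx_exchange:
  assumes h: "norm h = 1" and k: "norm k = 1" and hk: "cinner h k = 0" and e: "\<epsilon> > 0"
  obtains a where "star a = a" "norm (\<pi> a h - k) \<le> \<epsilon>" "norm (\<pi> a k - h) \<le> \<epsilon>"
proof -
  define S where "S = (\<lambda>z. cinner h z *\<^sub>C k + cinner k z *\<^sub>C h)"
  have kh: "cinner k h = 0" using cinner_commute[of k h] hk by simp
  obtain a where a: "\<And>n. star (a n) = a n" "(\<lambda>n. \<pi> (a n) h) \<longlonglongrightarrow> S h" "(\<lambda>n. \<pi> (a n) k) \<longlonglongrightarrow> S k"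
  proof (rule selfadjoint_density)
    show "bounded_linear S" unfolding S_def by (intro bounded_linear_add bounded_linear_rank_one)
    show "S (c *\<^sub>C z) = c *\<^sub>C S z" for c z by (simp add: S_def cinner_simps scaleC_simps)
    show "inner (S z) z' = inner z (S z')" for z z'
    proof -
      have "cinner (S z) z' = cinner z (S z')"
        unfolding S_def cinner_simps using cinner_commute[of z k] cinner_commute[of z h]
        by (simp add: mult.commute)
      then show ?thesis by (simp only: inner_eq_Re_cinner)
    qed
  qed blast
  have "S h = k" "S k = h" by (simp_all add: S_def hk kh cinner_self h k scaleC_one)
  then have "\<forall>\<^sub>F n in sequentially. dist (\<pi> (a n) h) k < \<epsilon>" "\<forall>\<^sub>F n in sequentially. dist (\<pi> (a n) k) h < \<epsilon>"
    using a e by (auto intro!: tendstoD)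
  then have "\<forall>\<^sub>F n in sequentially. dist (\<pi> (a n) h) k < \<epsilon> \<and> dist (\<pi> (a n) k) h < \<epsilon>"
    by (rule eventually_conj)
  then obtain n where "dist (\<pi> (a n) h) k < \<epsilon>" "dist (\<pi> (a n) k) h < \<epsilon>"
    using eventually_happens'[OF sequentially_bot] by blast
  then show ?thesis using that[of "a n"] a(1) by (simp add: dist_norm)
qed

text \<open>The missing norm bound: rotating by a right angle gives a unitary \<open>u\<close> such that \<open>i u\<close> nearly
  exchanges \<open>h\<close> and \<open>k\<close>. So does its adjoint, and their mean is a self-adjoint contraction.\<close>

lemma approx_exchange_contraction:
  assumes h: "norm h = 1" and k: "norm k = 1" and hk: "cinner h k = 0" and e: "\<epsilon> > 0"
  obtains b where "star b = b" "norm b \<le> 1" "norm (\<pi> b h - k) \<le> \<epsilon>"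
proof -
  obtain a where a: "star a = a" "norm (\<pi> a h - k) \<le> \<epsilon> / pi" "norm (\<pi> a k - h) \<le> \<epsilon> / pi"
    using approx_exchange[OF h k hk, of "\<epsilon> / pi"] e by (auto simp: divide_pos_pos)
  define u where "u = exp ((pi/2) *\<^sub>R ((- \<i>) *\<^sub>C a))"
  have u: "u \<in> unitaries" unfolding u_def
    by (rule exp_skew_unitary) (simp add: star_scaleR star_scaleC star_minus a scaleC_minus_left)
  define v where "v = \<i> *\<^sub>C u"
  have v: "v \<in> unitaries" unfolding v_def by (rule unitaries_scaleC[OF _ u]) simp
  have "norm (\<pi> u (\<i> *\<^sub>C k) - h) \<le> \<epsilon>" "norm (\<pi> u (\<i> *\<^sub>C h) - k) \<le> \<epsilon>"
    using exp_rotation_approx[OF a(1) a(2,3), of "pi/2"] exp_rotation_approx[OF a(1) a(3,2), of "pi/2"]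
    by (auto simp: u_def)
  then have vk: "norm (\<pi> v k - h) \<le> \<epsilon>" and vh: "norm (\<pi> v h - k) \<le> \<epsilon>"
    by (simp_all add: v_def rep_scale rep_clinear)
  have "\<pi> (star v) h - k = \<pi> (star v) (h - \<pi> v k)"
    by (simp add: rep_diff_right rep_star_unitary v)
  then have vh': "norm (\<pi> (star v) h - k) \<le> \<epsilon>"
    using vk by (simp add: norm_rep_unitary star_unitaries v norm_minus_commute)
  define b where "b = (1/2) *\<^sub>R (v + star v)"
  show ?thesis
  proof (rule that)
    show "star b = b" by (simp add: b_def star_scaleR star_add star_star add.commute)
    show "norm b \<le> 1"
      using norm_triangle_ineq[of v "star v"] by (simp add: b_def norm_unitary v)
    have "\<pi> b h - k = (1/2) *\<^sub>R ((\<pi> v h - k) + (\<pi> (star v) h - k))"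
      by (simp add: b_def rep_scaleR rep_add algebra_simps) (simp flip: scaleR_left.add)
    then show "norm (\<pi> b h - k) \<le> \<epsilon>"
      using norm_triangle_ineq[of "\<pi> v h - k" "\<pi> (star v) h - k"] vh vh' by simp
  qed
qed

text \<open>The rotation that takes \<open>h\<close> to the direction of \<open>k\<close> is approximated by an exponential. The
  error grows with the angle, so the accuracy of the exchange is chosen after the angle.\<close>

lemma unitary_approx_transitive:
  assumes h: "norm h = 1" and k: "norm k = 1" and e: "\<epsilon> > 0"
  obtains u where "u \<in> unitaries" "norm (\<pi> u h - k) \<le> \<epsilon>"
proof -
  define c where "c = cmod (cinner h k)"
  obtain p s f where p: "cmod p = 1" and s: "0 \<le> s" "s\<^sup>2 = 1 - c\<^sup>2" and f: "cinner h f = 0" "s = 0 \<or> norm f = 1"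
    and k_eq: "k = p *\<^sub>C (c *\<^sub>R h + s *\<^sub>R f)"
    using unit_vector_decomposition[OF h k] unfolding c_def by metis
  show ?thesis
  proof (cases "s = 0")
    case True
    then have "c\<^sup>2 = 1\<^sup>2" "c \<ge> 0" using s by (auto simp: c_def)
    then have "c = 1" by (metis power2_eq_iff_nonneg zero_le_one)
    then have "\<pi> (p *\<^sub>C 1) h = k" using k_eq True by (simp add: rep_scalar)
    then show ?thesis using that[OF scalar_unitary[OF p]] e by simp
  next
    case False
    then have nf: "norm f = 1" using f by simp
    obtain \<theta> where \<theta>: "c = cos \<theta>" "s = sin \<theta>"
      using sincos_total_pi[OF s(1), of c] s(2) by force
    \<comment> \<open>the factor makes \<open>cos \<theta> h + i sin \<theta> k'\<close> the vector to be rotated\<close>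
    define k' where "k' = (- \<i>) *\<^sub>C f"
    have k': "norm k' = 1" "cinner h k' = 0" by (simp_all add: k'_def norm_scaleC_hilbert nf cinner_simps f)
    define \<delta> where "\<delta> = \<epsilon> / (2 * \<bar>\<theta>\<bar> + 1)"
    have \<delta>: "\<delta> > 0" using e by (simp add: \<delta>_def)
    obtain a where a: "star a = a" "norm (\<pi> a h - k') \<le> \<delta>" "norm (\<pi> a k' - h) \<le> \<delta>"
      using approx_exchange[OF h k' \<delta>] by blast
    define u where "u = exp (\<theta> *\<^sub>R ((- \<i>) *\<^sub>C a))"
    have u: "u \<in> unitaries" unfolding u_def
      by (rule exp_skew_unitary) (simp add: star_scaleR star_scaleC star_minus a scaleC_minus_left)
    have "\<i> *\<^sub>C k' = f" by (simp add: k'_def scaleC_scaleC scaleC_one)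
    then have "norm (\<pi> u (c *\<^sub>R h + s *\<^sub>R f) - h) \<le> 2 * \<delta> * \<bar>\<theta>\<bar>"
      using exp_rotation_approx[OF a, of \<theta>] by (simp add: u_def \<theta>)
    also have "\<dots> \<le> \<delta> * (2 * \<bar>\<theta>\<bar> + 1)" using \<delta> by (simp add: algebra_simps)
    also have "\<dots> = \<epsilon>" by (simp add: \<delta>_def)
    finally have le: "norm (\<pi> u (c *\<^sub>R h + s *\<^sub>R f) - h) \<le> \<epsilon>" .
    have "\<pi> (p *\<^sub>C star u) h - k = p *\<^sub>C \<pi> (star u) (h - \<pi> u (c *\<^sub>R h + s *\<^sub>R f))"
      by (subst k_eq) (simp add: rep_scale rep_diff_right rep_star_unitary u scaleC_diff_right)
    then have "norm (\<pi> (p *\<^sub>C star u) h - k) \<le> \<epsilon>"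
      using le p by (simp add: norm_scaleC_hilbert norm_rep_unitary star_unitaries u norm_minus_commute)
    then show ?thesis using that unitaries_scaleC[OF p star_unitaries[OF u]] by blast
  qed
qed

text \<open>One step of a Newton iteration: with \<open>b\<close> nearly mapping \<open>h\<close> to \<open>- i e\<close>, the unitary
  \<open>sqrt (1 - s\<^sup>2 b\<^sup>2) + i s b\<close> is within \<open>2 s\<close> of \<open>1\<close> and moves \<open>h\<close> to within \<open>O(s\<^sup>2)\<close> of
  \<open>sqrt (1 - s\<^sup>2) h + s e\<close>.\<close>

lemma unitary_correction_step:
  assumes h: "norm h = 1" and k: "norm k = 1" and small: "norm (h - k) \<le> 1/6"
  obtains u where "u \<in> unitaries" "norm (u - 1) \<le> 4 * norm (h - k)" "norm (\<pi> u h - k) \<le> norm (h - k) / 2"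
proof -
  define \<delta> where "\<delta> = norm (h - k)"
  define \<alpha> where "\<alpha> = cinner h k"
  define c where "c = cmod \<alpha>"
  obtain p s f where p: "cmod p = 1" "of_real c * p = \<alpha>" and s: "0 \<le> s" "s\<^sup>2 = 1 - c\<^sup>2" 
    and f: "cinner h f = 0" "s = 0 \<or> norm f = 1"
    and k_eq: "k = p *\<^sub>C (c *\<^sub>R h + s *\<^sub>R f)"
    using unit_vector_decomposition[OF h k] unfolding c_def \<alpha>_def by metis
  have c1: "c \<le> 1" using cinner_Cauchy_Schwarz[of h k] by (simp add: c_def \<alpha>_def h k)
  have c0: "c \<ge> 0" by (simp add: c_def)
  have \<delta>0: "\<delta> \<ge> 0" and \<delta>1: "\<delta> \<le> 1/6" using small by (simp_all add: \<delta>_def)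
  have "\<delta>\<^sup>2 = 2 - 2 * Re \<alpha>"
    unfolding \<delta>_def \<alpha>_def power2_norm_eq_inner using h k
    by (simp add: inner_diff_left inner_diff_right inner_commute[of k h] norm_eq_sqrt_inner inner_eq_Re_cinner[of h k])
  moreover have "Re \<alpha> \<le> c" unfolding c_def by (rule complex_Re_le_cmod)
  moreover have "s\<^sup>2 \<le> 2 - 2 * c"
  proof -
    have "s\<^sup>2 = (1 - c) * (1 + c)" unfolding s by (simp add: power2_eq_square algebra_simps)
    also have "\<dots> \<le> (1 - c) * 2" using c1 by (intro mult_left_mono) auto
    finally show ?thesis by simp
  qed
  ultimately have "s\<^sup>2 \<le> \<delta>\<^sup>2" by linarith
  then have s\<delta>: "s \<le> \<delta>" using \<delta>0 by (rule power2_le_imp_le)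
  have cs: "1 - c \<le> s\<^sup>2" unfolding s using c0 c1 by (simp add: power2_eq_square mult_left_le_one_le)
  have \<alpha>1: "cmod (1 - \<alpha>) \<le> \<delta>"
  proof -
    have "1 - \<alpha> = cinner h (h - k)" by (simp add: cinner_simps \<alpha>_def cinner_self h)
    then show ?thesis using cinner_Cauchy_Schwarz[of h "h - k"] by (simp add: h \<delta>_def)
  qed
  have p1: "cmod (p - 1) \<le> 2 * \<delta>"
  proof -
    have "p - 1 = of_real (1 - c) * p - (1 - \<alpha>)" by (simp add: p(2) [symmetric] algebra_simps)
    then have "cmod (p - 1) \<le> cmod (of_real (1 - c) * p) + cmod (1 - \<alpha>)" by (metis norm_triangle_ineq4)
    moreover have "cmod (of_real (1 - c) * p) = 1 - c"
      using c1 p(1) by (simp only: norm_mult norm_of_real) simp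
    moreover have "1 - c \<le> cmod (1 - \<alpha>)"
      using norm_triangle_ineq2[of 1 \<alpha>] by (simp add: c_def)
    ultimately show ?thesis using \<alpha>1 by linarith
  qed
  show ?thesis
  proof (cases "s = 0")
    case True
    then have "c = 1" using s c0 by (simp add: power2_eq_1_iff)
    then have "\<pi> (p *\<^sub>C 1) h = k" using k_eq True by (simp add: rep_scalar)
    moreover have "norm (p *\<^sub>C (1::'a) - 1) = cmod (p - 1)"
      using norm_scaleC[of "p - 1" "1::'a"] by (simp add: scaleC_diff_left scaleC_one)
    moreover have "cmod (p - 1) \<le> 4 * \<delta>" using p1 \<delta>0 by linarith
    ultimately show ?thesis using that[OF scalar_unitary[OF p(1)]] by (simp add: \<delta>_def)
  next
    case False
    then have nf: "norm f = 1" and s0: "s > 0" using f s by auto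
    have "norm ((- \<i>) *\<^sub>C f) = 1" "cinner h ((- \<i>) *\<^sub>C f) = 0" by (simp_all add: norm_scaleC_hilbert nf cinner_simps f)
    then obtain b where b: "star b = b" "norm b \<le> 1" "norm (\<pi> b h - (- \<i>) *\<^sub>C f) \<le> s"
      using approx_exchange_contraction[OF h _ _ s0] by blast
    define x where "x = s\<^sup>2 *\<^sub>R (b * b)"
    have xs: "star x = x" by (simp add: x_def star_scaleR star_mult b)
    have "norm (b * b) \<le> 1" using norm_mult_ineq[of b b] mult_mono[OF b(2) b(2)] by simp
    then have nx: "norm x \<le> s\<^sup>2" by (simp add: x_def mult_left_le)
    have "s\<^sup>2 \<le> 1" unfolding s by simp
    with nx have "norm x \<le> 1" by simp
    then obtain y where y: "star y = y" "y * y = 1 - x" "norm (y - 1) \<le> norm x" "\<And>z. x * z = z * x \<Longrightarrow> y * z = z * y"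
      using selfadjoint_sqrt[OF xs] by blast
    have yb: "y * b = b * y" by (rule y(4)) (simp add: x_def mult.assoc)
    define w where "w = y + (\<i> * of_real s) *\<^sub>C b"
    have sw: "star w = y - (\<i> * of_real s) *\<^sub>C b"
      by (simp add: w_def star_add star_scaleC y b scaleC_minus_left)
    have bb: "(\<i> * of_real s) *\<^sub>C b * ((\<i> * of_real s) *\<^sub>C b) = - x"
      by (simp add: x_def mult_scaleC_left mult_scaleC_right scaleC_scaleC scaleR_scaleC power2_eq_square
          algebra_simps flip: scaleC_minus_left)
    have w: "w \<in> unitaries"
      unfolding unitaries_def mem_Collect_eq sw 
      by (simp add: w_def distrib_left distrib_right left_diff_distrib right_diff_distrib bb y(2))
         (simp add: mult_scaleC_left mult_scaleC_right yb)
    have nw: "norm (w - 1) \<le> 2 * \<delta>"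
    proof -
      have "norm (w - 1) \<le> norm (y - 1) + norm ((\<i> * of_real s) *\<^sub>C b)"
        using norm_triangle_ineq[of "y - 1" "(\<i> * of_real s) *\<^sub>C b"] by (simp add: w_def algebra_simps)
      also have "norm ((\<i> * of_real s) *\<^sub>C b) \<le> s" using b(2) s(1) by (simp add: norm_scaleC norm_mult mult_left_le)
      also have "norm (y - 1) \<le> s" 
      proof -
        have "s * s \<le> s * 1" using s\<delta> \<delta>1 s(1) by (intro mult_left_mono) auto
        then show ?thesis using y(3) nx by (simp add: power2_eq_square)
      qed
      finally show ?thesis using s\<delta> by simp
    qed
    have "norm (p *\<^sub>C w - 1) \<le> 4 * \<delta>"
    proof -
      have "p *\<^sub>C w - 1 = p *\<^sub>C (w - 1) + (p - 1) *\<^sub>C 1" by (simp add: scaleC_simps)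
      then have "norm (p *\<^sub>C w - 1) \<le> norm (p *\<^sub>C (w - 1)) + norm ((p - 1) *\<^sub>C (1::'a))"
        by (metis norm_triangle_ineq)
      then show ?thesis using nw p1 by (simp add: norm_scaleC p)
    qed
    moreover have "norm (\<pi> (p *\<^sub>C w) h - k) \<le> \<delta> / 2"
    proof -
      have "\<pi> (p *\<^sub>C w) h - k = p *\<^sub>C (\<pi> w h - (c *\<^sub>R h + s *\<^sub>R f))"
        by (subst k_eq) (simp add: rep_scale scaleC_diff_right)
      then have "norm (\<pi> (p *\<^sub>C w) h - k) = norm (\<pi> w h - (c *\<^sub>R h + s *\<^sub>R f))"
        by (simp add: norm_scaleC_hilbert p)
      also have "\<pi> w h - (c *\<^sub>R h + s *\<^sub>R f) = \<pi> (y - 1) h + ((1 - c) *\<^sub>R h + (\<i> * of_real s) *\<^sub>C (\<pi> b h - (- \<i>) *\<^sub>C f))"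
        by (simp add: w_def rep_add rep_diff rep_scale rep_one scaleC_simps scaleR_scaleC scaleR_diff_left algebra_simps)
      also have "norm \<dots> \<le> norm (\<pi> (y - 1) h) + (norm ((1 - c) *\<^sub>R h) + norm ((\<i> * of_real s) *\<^sub>C (\<pi> b h - (- \<i>) *\<^sub>C f)))"
        by (meson norm_triangle_ineq add_left_mono order_trans)
      also have "\<dots> \<le> s\<^sup>2 + (s\<^sup>2 + s * s)"
      proof (intro add_mono)
        show "norm (\<pi> (y - 1) h) \<le> s\<^sup>2" using norm_rep_le[of "y - 1" h] y(3) nx h by simp
        show "norm ((1 - c) *\<^sub>R h) \<le> s\<^sup>2" using cs c1 h by simp
        show "norm ((\<i> * of_real s) *\<^sub>C (\<pi> b h - (- \<i>) *\<^sub>C f)) \<le> s * s"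
          using b(3) s(1) by (simp add: norm_scaleC_hilbert norm_mult mult_left_mono)
      qed
      also have "\<dots> = 3 * (s * s)" by (simp add: power2_eq_square)
      also have "\<dots> \<le> 3 * (\<delta> * \<delta>)" using s\<delta> s(1) by (simp add: mult_mono)
      also have "\<dots> \<le> 3 * (1/6 * \<delta>)" using \<delta>1 \<delta>0 by (intro mult_left_mono mult_right_mono) auto
      finally show ?thesis by simp
    qed
    ultimately show ?thesis
      using that[OF unitaries_scaleC[OF p(1) w]] by (simp add: \<delta>_def)
  qed
qed

text \<open>Kadison's transitivity theorem for single vectors. After one approximate solution the correction
  step is iterated. The distances to \<open>k\<close> halve each time and bound, up to a factor, the distances of the
  corrections from \<open>1\<close>, so the products of the corrections converge in norm.\<close>

theorem unitary_transitive:
  assumes h: "norm h = 1" and k: "norm k = 1"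
  obtains u where "u \<in> unitaries" "\<pi> u h = k"
proof -
  define Q where "Q = (\<lambda>(n::nat) v. v \<in> unitaries \<and> norm (\<pi> v h - k) \<le> (1/6) * (1/2) ^ n)"
  have "\<exists>v. \<forall>n. Q n (v n) \<and> norm (v (Suc n) - v n) \<le> (1/2) ^ n"
  proof (rule dependent_nat_choice)
    obtain u where "u \<in> unitaries" "norm (\<pi> u h - k) \<le> 1/6"
      using unitary_approx_transitive[OF h k, of "1/6"] by auto
    then show "\<exists>v. Q 0 v" by (auto simp: Q_def)
  next
    fix v n assume v: "Q n v"
    then have vu: "v \<in> unitaries" and d: "norm (\<pi> v h - k) \<le> (1/6) * (1/2) ^ n" by (auto simp: Q_def)
    have "(1/2::real) ^ n \<le> 1" by (simp add: power_le_one)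
    then have "norm (\<pi> v h - k) \<le> 1/6" using d by simp
    moreover have "norm (\<pi> v h) = 1" using h vu by (simp add: norm_rep_unitary)
    ultimately obtain u where u: "u \<in> unitaries" "norm (u - 1) \<le> 4 * norm (\<pi> v h - k)"
        "norm (\<pi> u (\<pi> v h) - k) \<le> norm (\<pi> v h - k) / 2"
      using unitary_correction_step[of "\<pi> v h" k] k by blast
    have "Q (Suc n) (u * v)"
      unfolding Q_def using u d by (auto simp: unitaries_mult vu rep_mult)
    moreover have "norm (u * v - v) \<le> (1/2) ^ n"
    proof -
      have "norm (u * v - v) = norm ((u - 1) * v)" by (simp add: left_diff_distrib)
      also have "\<dots> \<le> norm (u - 1) * norm v" by (rule norm_mult_ineq)
      also have "\<dots> \<le> 4 * ((1/6) * (1/2) ^ n)" using u(2) d by (simp add: norm_unitary vu)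
      also have "\<dots> \<le> (1/2) ^ n" by simp
      finally show ?thesis .
    qed
    ultimately show "\<exists>v'. Q (Suc n) v' \<and> norm (v' - v) \<le> (1/2) ^ n" by blast
  qed
  then obtain v where v: "\<And>n. v n \<in> unitaries" "\<And>n. norm (\<pi> (v n) h - k) \<le> (1/6) * (1/2) ^ n"
    "\<And>n. norm (v (Suc n) - v n) \<le> (1/2) ^ n" unfolding Q_def by blast
  have "summable (\<lambda>n. v (Suc n) - v n)"
    by (rule summable_comparison_test'[of "\<lambda>n. (1/2::real) ^ n"]) (auto simp: v(3) summable_geometric)
  then have "(\<lambda>n. v 0 + (\<Sum>i<n. v (Suc i) - v i)) \<longlonglongrightarrow> v 0 + (\<Sum>n. v (Suc n) - v n)"
    by (intro tendsto_add tendsto_const summable_LIMSEQ)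
  then obtain u where u: "v \<longlonglongrightarrow> u" by (auto simp: sum_lessThan_telescope)
  have "(\<lambda>n. \<pi> (v n) h) \<longlonglongrightarrow> \<pi> u h"
    by (rule bounded_linear.tendsto[OF bounded_linear_rep_left u])
  moreover have "(\<lambda>n. \<pi> (v n) h) \<longlonglongrightarrow> k"
  proof (rule Lim_null_comparison[where f="\<lambda>n. \<pi> (v n) h - k" and g="\<lambda>n. (1/6) * (1/2::real) ^ n", THEN LIM_zero_cancel])
    show "(\<lambda>n. (1/6) * (1/2::real) ^ n) \<longlonglongrightarrow> 0"
      using tendsto_mult_left[OF LIMSEQ_realpow_zero[of "1/2"], of "1/6"] by simp
    show "\<forall>\<^sub>F n in sequentially. norm (\<pi> (v n) h - k) \<le> (1/6) * (1/2::real) ^ n"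
      by (intro always_eventually allI v(2))
  qed
  ultimately have "\<pi> u h = k" by (rule LIMSEQ_unique)
  then show ?thesis using that[OF closed_unitaries[OF v(1) u]] by simp
qed

end

section \<open>Inner product spaces on a carrier\<close>

definition vnorm :: "'v ips \<Rightarrow> 'v \<Rightarrow> real" where
  "vnorm V u = sqrt (Re (vinner V u u))"

lemma vzero_eqI:
  assumes "z \<in> vcarrier V" "\<And>u. u \<in> vcarrier V \<Longrightarrow> vadd V z u = u"
    and "\<And>u v. u \<in> vcarrier V \<Longrightarrow> v \<in> vcarrier V \<Longrightarrow> vadd V u v = vadd V v u"
  shows "vzero V = z"
  unfolding vzero_def
proof (rule the_equality)
  show "z \<in> vcarrier V \<and> (\<forall>u\<in>vcarrier V. vadd V z u = u)" using assms by blast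
  show "z' = z" if "z' \<in> vcarrier V \<and> (\<forall>u\<in>vcarrier V. vadd V z' u = u)" for z'
    using that assms by metis
qed

context inner_product_space
begin

lemma zero_closed: "vzero V \<in> vcarrier V"
  and add_zero_left: "u \<in> vcarrier V \<Longrightarrow> vadd V (vzero V) u = u"
proof -
  obtain z where z: "z \<in> vcarrier V" "\<And>u. u \<in> vcarrier V \<Longrightarrow> vadd V z u = u"
    using zero_exists by blast
  have "vzero V = z" by (rule vzero_eqI[OF z add_commute])
  then show "vzero V \<in> vcarrier V" "u \<in> vcarrier V \<Longrightarrow> vadd V (vzero V) u = u" using z by auto
qed

lemma add_zero_right: "u \<in> vcarrier V \<Longrightarrow> vadd V u (vzero V) = u"
  using add_commute add_zero_left zero_closed by metis

lemma inner_add_left: "\<lbrakk>u \<in> vcarrier V; v \<in> vcarrier V; w \<in> vcarrier V\<rbrakk> \<Longrightarrow>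
    vinner V (vadd V u v) w = vinner V u w + vinner V v w"
  using inner_commute[of "vadd V u v" w] inner_commute[of u w] inner_commute[of v w]
  by (simp add: add_closed inner_add_right)

lemma inner_scale_left: "\<lbrakk>u \<in> vcarrier V; w \<in> vcarrier V\<rbrakk> \<Longrightarrow>
    vinner V (vscale V c u) w = cnj c * vinner V u w"
  using inner_commute[of "vscale V c u" w] inner_commute[of u w]
  by (simp add: scale_closed inner_scale_right)

lemma inner_zero_right: "u \<in> vcarrier V \<Longrightarrow> vinner V u (vzero V) = 0"
  using inner_add_right[of u "vzero V" "vzero V"] by (simp add: zero_closed add_zero_left)

lemma inner_zero_left: "u \<in> vcarrier V \<Longrightarrow> vinner V (vzero V) u = 0"
  using inner_commute[of "vzero V" u] by (simp add: zero_closed inner_zero_right)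

lemmas ips_simps = add_closed scale_closed zero_closed inner_add_right inner_add_left
  inner_scale_right inner_scale_left inner_zero_right inner_zero_left

text \<open>Vectors are determined by their inner products, which reduces all vector identities to the
  arithmetic of complex numbers.\<close>

lemma ext:
  assumes u: "u \<in> vcarrier V" and v: "v \<in> vcarrier V"
    and eq: "\<And>w. w \<in> vcarrier V \<Longrightarrow> vinner V w u = vinner V w v"
  shows "u = v"
proof -
  define d where "d = vadd V u (vscale V (-1) v)"
  have d: "d \<in> vcarrier V" by (simp add: d_def u v ips_simps)
  have "vinner V d d = vinner V d u - vinner V d v"
    by (subst (2) d_def) (simp add: u v d ips_simps)
  then have "d = vzero V" using eq[OF d] inner_definite[OF d] by simp
  have "u = vadd V u (vadd V (vscale V (-1) v) v)"
    using add_inverse[OF v] add_commute[of v "vscale V (-1) v"] by (simp add: u v scale_closed add_zero_right)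
  also have "\<dots> = vadd V d v" by (simp add: d_def add_assoc u v scale_closed)
  also have "\<dots> = v" by (simp add: \<open>d = vzero V\<close> add_zero_left v)
  finally show ?thesis .
qed

lemma inner_self: "u \<in> vcarrier V \<Longrightarrow> vinner V u u = of_real ((vnorm V u)\<^sup>2)"
  using inner_nonneg[of u] by (auto simp: vnorm_def complex_nonneg_Reals_iff complex_eq_iff)

lemma vnorm_nonneg: "u \<in> vcarrier V \<Longrightarrow> vnorm V u \<ge> 0"
  using inner_nonneg[of u] by (auto simp: vnorm_def complex_nonneg_Reals_iff)

lemma vnorm_eq_0: "u \<in> vcarrier V \<Longrightarrow> vnorm V u = 0 \<longleftrightarrow> u = vzero V"
  using inner_self[of u] inner_definite[of u] inner_zero_left[OF zero_closed]
  by (auto simp: vnorm_def)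

lemma inner_expand:
  assumes "u \<in> vcarrier V" "v \<in> vcarrier V"
  shows "vinner V (vadd V u (vscale V c v)) (vadd V u (vscale V c v)) =
    vinner V u u + c * vinner V u v + cnj c * vinner V v u + c * cnj c * vinner V v v"
  by (simp add: assms ips_simps distrib_left ac_simps)

lemma Cauchy_Schwarz:
  assumes u: "u \<in> vcarrier V" and v: "v \<in> vcarrier V"
  shows "cmod (vinner V u v) \<le> vnorm V u * vnorm V v"
proof (rule power2_le_imp_le)
  have "(cmod (vinner V u v))\<^sup>2 \<le> (vnorm V u)\<^sup>2 * (vnorm V v)\<^sup>2"
  proof (rule Cauchy_Schwarz_from_quadratic)
    fix c
    define w where "w = vadd V u (vscale V c v)"
    have w: "w \<in> vcarrier V" by (simp add: w_def u v ips_simps)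
    have "Re (c * vinner V u v) = Re (cnj c * vinner V v u)"
      using inner_commute[OF u v] by simp
    moreover have "c * cnj c * vinner V v v = of_real ((cmod c)\<^sup>2 * (vnorm V v)\<^sup>2)"
      by (simp only: complex_norm_square [symmetric] inner_self v of_real_mult)
    ultimately have "Re (vinner V w w) = (vnorm V u)\<^sup>2 + 2 * Re (c * vinner V u v) + (cmod c)\<^sup>2 * (vnorm V v)\<^sup>2"
      unfolding w_def inner_expand[OF u v] inner_self[OF u] by (simp only: plus_complex.sel Re_complex_of_real)
    then show "0 \<le> (vnorm V u)\<^sup>2 + 2 * Re (c * vinner V u v) + (cmod c)\<^sup>2 * (vnorm V v)\<^sup>2"
      using inner_nonneg[OF w] by (simp add: complex_nonneg_Reals_iff)
  qed simp
  then show "(cmod (vinner V u v))\<^sup>2 \<le> (vnorm V u * vnorm V v)\<^sup>2" by (simp add: power_mult_distrib)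
qed (simp add: u v vnorm_nonneg)

lemma vnorm_triangle:
  assumes u: "u \<in> vcarrier V" and v: "v \<in> vcarrier V"
  shows "vnorm V (vadd V u v) \<le> vnorm V u + vnorm V v"
proof (rule power2_le_imp_le)
  have w: "vadd V u v \<in> vcarrier V" by (simp add: u v ips_simps)
  have "complex_of_real ((vnorm V (vadd V u v))\<^sup>2) = vinner V u u + vinner V u v + vinner V v u + vinner V v v"
    unfolding inner_self[OF w, symmetric] by (simp add: u v ips_simps)
  also have "\<dots> = of_real ((vnorm V u)\<^sup>2 + 2 * Re (vinner V u v) + (vnorm V v)\<^sup>2)"
    using inner_commute[OF u v] by (simp add: inner_self u v complex_eq_iff)
  finally have "(vnorm V (vadd V u v))\<^sup>2 = (vnorm V u)\<^sup>2 + 2 * Re (vinner V u v) + (vnorm V v)\<^sup>2"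
    using of_real_eq_iff by blast
  moreover have "Re (vinner V u v) \<le> vnorm V u * vnorm V v"
    using Cauchy_Schwarz[OF u v] complex_Re_le_cmod[of "vinner V u v"] by linarith
  ultimately show "(vnorm V (vadd V u v))\<^sup>2 \<le> (vnorm V u + vnorm V v)\<^sup>2"
    by (simp add: power2_sum)
qed (simp add: u v vnorm_nonneg)

lemma vnorm_scale: assumes u: "u \<in> vcarrier V" shows "vnorm V (vscale V c u) = cmod c * vnorm V u"
proof -
  have "complex_of_real ((vnorm V (vscale V c u))\<^sup>2) = (c * cnj c) * vinner V u u"
    by (simp only: inner_self [symmetric] u scale_closed) (simp add: u ips_simps)
  also have "\<dots> = of_real ((cmod c * vnorm V u)\<^sup>2)"
    by (simp only: complex_norm_square [symmetric] inner_self u power_mult_distrib of_real_mult)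
  finally have "(vnorm V (vscale V c u))\<^sup>2 = (cmod c * vnorm V u)\<^sup>2" using of_real_eq_iff by blast
  then show ?thesis by (simp add: power2_eq_iff_nonneg u vnorm_nonneg scale_closed)
qed

lemma vdist_eq: "u \<in> vcarrier V \<Longrightarrow> v \<in> vcarrier V \<Longrightarrow> vdist V u v = vnorm V (vadd V u (vscale V (-1) v))"
  by (simp add: vdist_def vnorm_def Let_def)

lemma diff_closed: "u \<in> vcarrier V \<Longrightarrow> v \<in> vcarrier V \<Longrightarrow> vadd V u (vscale V (-1) v) \<in> vcarrier V"
  by (simp add: ips_simps)

lemma vdist_nonneg: "vdist V u v \<ge> 0"
  by (cases "u \<in> vcarrier V \<and> v \<in> vcarrier V")
     (auto simp: vdist_eq vnorm_nonneg diff_closed, auto simp: vdist_def)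

lemma vdist_commute: "vdist V u v = vdist V v u"
proof (cases "u \<in> vcarrier V \<and> v \<in> vcarrier V")
  case True
  then have "vadd V u (vscale V (-1) v) = vscale V (-1) (vadd V v (vscale V (-1) u))"
    by (intro ext) (simp_all add: ips_simps)
  then show ?thesis using True by (simp add: vdist_eq vnorm_scale diff_closed)
next
  case False
  then show ?thesis by (auto simp: vdist_def)
qed

lemma vdist_eq_0: assumes "u \<in> vcarrier V" "v \<in> vcarrier V" shows "vdist V u v = 0 \<longleftrightarrow> u = v"
proof -
  have "vadd V u (vscale V (-1) v) = vzero V \<longleftrightarrow> u = v"
  proof
    assume z: "vadd V u (vscale V (-1) v) = vzero V"
    show "u = v"
    proof (rule ext[OF assms])
      fix w assume w: "w \<in> vcarrier V"
      have "vinner V w (vadd V u (vscale V (-1) v)) = 0" using w by (simp add: z ips_simps)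
      then show "vinner V w u = vinner V w v" using w assms by (simp add: ips_simps)
    qed
  qed (simp add: assms add_inverse)
  then show ?thesis by (simp add: vdist_eq assms vnorm_eq_0 diff_closed)
qed

lemma vdist_self: "u \<in> vcarrier V \<Longrightarrow> vdist V u u = 0"
  by (simp add: vdist_eq_0)

lemma vdist_triangle:
  assumes "u \<in> vcarrier V" "v \<in> vcarrier V" "w \<in> vcarrier V"
  shows "vdist V u w \<le> vdist V u v + vdist V v w"
proof -
  have "vadd V u (vscale V (-1) w) = vadd V (vadd V u (vscale V (-1) v)) (vadd V v (vscale V (-1) w))"
    by (rule ext) (simp_all add: assms ips_simps)
  then show ?thesis using vnorm_triangle assms by (simp add: vdist_eq diff_closed)
qed

lemma metric: "Metric_space (vcarrier V) (vdist V)"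
  by unfold_locales (auto simp: vdist_nonneg vdist_commute vdist_eq_0 vdist_triangle)

lemma vdist_add:
  assumes "u \<in> vcarrier V" "v \<in> vcarrier V" "u' \<in> vcarrier V" "v' \<in> vcarrier V"
  shows "vdist V (vadd V u v) (vadd V u' v') \<le> vdist V u u' + vdist V v v'"
proof -
  have "vadd V (vadd V u v) (vscale V (-1) (vadd V u' v')) =
      vadd V (vadd V u (vscale V (-1) u')) (vadd V v (vscale V (-1) v'))"
    by (rule ext) (simp_all add: assms ips_simps)
  then show ?thesis using vnorm_triangle assms by (simp add: vdist_eq diff_closed add_closed)
qed

lemma vdist_scale:
  assumes "u \<in> vcarrier V" "v \<in> vcarrier V"
  shows "vdist V (vscale V c u) (vscale V c v) = cmod c * vdist V u v"
proof -
  have "vadd V (vscale V c u) (vscale V (-1) (vscale V c v)) = vscale V c (vadd V u (vscale V (-1) v))"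
    by (rule ext) (simp_all add: assms ips_simps algebra_simps)
  then show ?thesis using assms by (simp add: vdist_eq vnorm_scale diff_closed scale_closed)
qed

lemma vnorm_diff_le:
  assumes "u \<in> vcarrier V" "v \<in> vcarrier V"
  shows "\<bar>vnorm V u - vnorm V v\<bar> \<le> vdist V u v"
proof -
  have le: "vnorm V u \<le> vdist V u v + vnorm V v" if "u \<in> vcarrier V" "v \<in> vcarrier V" for u v
  proof -
    have "u = vadd V (vadd V u (vscale V (-1) v)) v" by (rule ext) (simp_all add: that ips_simps)
    then show ?thesis using vnorm_triangle[of "vadd V u (vscale V (-1) v)" v] that by (simp add: vdist_eq diff_closed)
  qed
  show ?thesis using le[of u v] le[of v u] assms vdist_commute[of u v] by simp
qed

text \<open>Through this identity the inner product of two Cauchy sequences converges because the norms of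
  Cauchy sequences do.\<close>

lemma polarization:
  assumes "u \<in> vcarrier V" "v \<in> vcarrier V"
  shows "vinner V u v = (of_real ((vnorm V (vadd V u (vscale V 1 v)))\<^sup>2) - of_real ((vnorm V (vadd V u (vscale V (-1) v)))\<^sup>2)
     - \<i> * (of_real ((vnorm V (vadd V u (vscale V \<i> v)))\<^sup>2) - of_real ((vnorm V (vadd V u (vscale V (-\<i>) v)))\<^sup>2))) / 4"
proof -
  have c: "complex_of_real ((vnorm V (vadd V u (vscale V c v)))\<^sup>2)
      = vinner V u u + c * vinner V u v + cnj c * vinner V v u + c * cnj c * vinner V v v" for c
    by (subst inner_self[symmetric]) (simp_all only: inner_expand assms add_closed scale_closed)
  show ?thesis unfolding c by (simp add: algebra_simps)
qed

lemma type_ips_isometry_dist: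
  assumes "\<And>u v. u \<in> vcarrier V \<Longrightarrow> v \<in> vcarrier V \<Longrightarrow> J (vadd V u v) = J u + (J v :: 'h::complex_hilbert_space)"
    and "\<And>c u. u \<in> vcarrier V \<Longrightarrow> J (vscale V c u) = c *\<^sub>C J u"
    and "\<And>u v. u \<in> vcarrier V \<Longrightarrow> v \<in> vcarrier V \<Longrightarrow> cinner (J u) (J v) = vinner V u v"
    and "u \<in> vcarrier V" "v \<in> vcarrier V"
  shows "vdist V u v = dist (J u) (J v)"
proof -
  have n: "vnorm V w = norm (J w)" if "w \<in> vcarrier V" for w
    using assms(3)[OF that that, symmetric] by (simp add: vnorm_def cinner_self)
  have "J (vadd V u (vscale V (-1) v)) = J u - J v" by (simp add: assms scale_closed scaleC_minus_one)
  then show ?thesis by (simp add: vdist_eq assms(4,5) n diff_closed dist_norm)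
qed

subsection \<open>Cauchy sequences\<close>

abbreviation cauchy :: "(nat \<Rightarrow> 'v) \<Rightarrow> bool" where
  "cauchy \<equiv> Metric_space.MCauchy (vcarrier V) (vdist V)"

lemma cauchy_iff: "cauchy s \<longleftrightarrow> (\<forall>n. s n \<in> vcarrier V) \<and> (\<forall>e>0. \<exists>N. \<forall>m\<ge>N. \<forall>n\<ge>N. vdist V (s m) (s n) < e)"
  using Metric_space.MCauchy_def[OF metric, of s] by (auto simp: image_subset_iff)

lemma cauchy_in: "cauchy s \<Longrightarrow> s n \<in> vcarrier V"
  by (simp add: cauchy_iff)

lemma cauchyI:
  assumes "\<And>n. s n \<in> vcarrier V" "cauchy a" "cauchy b" "K \<ge> 0"
    and "\<And>m n. vdist V (s m) (s n) \<le> vdist V (a m) (a n) + K * vdist V (b m) (b n)"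
  shows "cauchy s"
  unfolding cauchy_iff
proof (intro conjI allI impI assms(1))
  fix e :: real assume e: "e > 0"
  obtain N where N: "\<forall>m\<ge>N. \<forall>n\<ge>N. vdist V (a m) (a n) < e / 2" 
    using assms(2) e unfolding cauchy_iff by (meson half_gt_zero)
  have "e / (2 * (K + 1)) > 0" using e assms(4) by simp
  then obtain N' where N': "\<forall>m\<ge>N'. \<forall>n\<ge>N'. vdist V (b m) (b n) < e / (2 * (K + 1))"
    using assms(3) unfolding cauchy_iff by meson
  have "vdist V (s m) (s n) < e" if "m \<ge> max N N'" "n \<ge> max N N'" for m n
  proof -
    have "K * vdist V (b m) (b n) \<le> K * (e / (2 * (K + 1)))"
    proof (rule mult_left_mono)
      show "vdist V (b m) (b n) \<le> e / (2 * (K + 1))" using N' that by (intro less_imp_le) auto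
    qed (rule assms(4))
    also have "\<dots> \<le> e / 2" using e assms(4) by (simp add: field_simps)
    finally show ?thesis using assms(5)[of m n] N that by (smt (verit) field_sum_of_halves max.boundedE)
  qed
  then show "\<exists>N. \<forall>m\<ge>N. \<forall>n\<ge>N. vdist V (s m) (s n) < e" by blast
qed

lemma cauchy_const: "u \<in> vcarrier V \<Longrightarrow> cauchy (\<lambda>n. u)"
  by (simp add: cauchy_iff vdist_self)

lemma cauchy_add: "cauchy s \<Longrightarrow> cauchy t \<Longrightarrow> cauchy (\<lambda>n. vadd V (s n) (t n))"
  by (rule cauchyI[of _ s t 1]) (auto simp: cauchy_in add_closed vdist_add)

lemma cauchy_scale: assumes "cauchy s" shows "cauchy (\<lambda>n. vscale V c (s n))"
proof (rule cauchyI[of _ s s "cmod c"])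
  fix m n
  show "vdist V (vscale V c (s m)) (vscale V c (s n)) \<le> vdist V (s m) (s n) + cmod c * vdist V (s m) (s n)"
    using vdist_nonneg[of "s m" "s n"] by (simp add: vdist_scale cauchy_in[OF assms])
qed (auto simp: cauchy_in assms scale_closed)

lemma cauchy_vnorm_convergent:
  assumes "cauchy s" shows "convergent (\<lambda>n. vnorm V (s n))"
proof (rule Cauchy_convergent, rule metric_CauchyI)
  fix e :: real assume "e > 0"
  then obtain N where N: "\<forall>m\<ge>N. \<forall>n\<ge>N. vdist V (s m) (s n) < e" using assms unfolding cauchy_iff by blast
  have "dist (vnorm V (s m)) (vnorm V (s n)) < e" if "m \<ge> N" "n \<ge> N" for m n
  proof -
    have "dist (vnorm V (s m)) (vnorm V (s n)) \<le> vdist V (s m) (s n)"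
      unfolding dist_real_def by (rule vnorm_diff_le[OF cauchy_in cauchy_in]) (rule assms)+
    then show ?thesis using N that by fastforce
  qed
  then show "\<exists>N. \<forall>m\<ge>N. \<forall>n\<ge>N. dist (vnorm V (s m)) (vnorm V (s n)) < e" by blast
qed

lemma cauchy_inner_convergent:
  assumes "cauchy s" "cauchy t"
  shows "convergent (\<lambda>n. vinner V (s n) (t n))"
proof -
  have "\<exists>l. (\<lambda>n. vnorm V (vadd V (s n) (vscale V c (t n)))) \<longlonglongrightarrow> l" for c
    using cauchy_vnorm_convergent[OF cauchy_add[OF assms(1) cauchy_scale[OF assms(2)]]]
    by (simp add: convergent_def)
  then obtain l where l: "\<And>c. (\<lambda>n. vnorm V (vadd V (s n) (vscale V c (t n)))) \<longlonglongrightarrow> l c" by metis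
  have "(\<lambda>n. vinner V (s n) (t n)) = (\<lambda>n. (of_real ((vnorm V (vadd V (s n) (vscale V 1 (t n))))\<^sup>2) - of_real ((vnorm V (vadd V (s n) (vscale V (-1) (t n))))\<^sup>2)
     - \<i> * (of_real ((vnorm V (vadd V (s n) (vscale V \<i> (t n))))\<^sup>2) - of_real ((vnorm V (vadd V (s n) (vscale V (-\<i>) (t n))))\<^sup>2))) / 4)"
    by (rule HOL.ext, rule polarization) (use assms cauchy_in in auto)
  moreover have "\<dots> \<longlonglongrightarrow> (of_real ((l 1)\<^sup>2) - of_real ((l (-1))\<^sup>2) - \<i> * (of_real ((l \<i>)\<^sup>2) - of_real ((l (-\<i>))\<^sup>2))) / 4"
    by (intro tendsto_intros l) simp
  ultimately show ?thesis by (auto simp: convergent_def)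
qed

abbreviation eqv :: "(nat \<Rightarrow> 'v) \<Rightarrow> (nat \<Rightarrow> 'v) \<Rightarrow> bool" where
  "eqv s t \<equiv> (\<lambda>n. vdist V (s n) (t n)) \<longlonglongrightarrow> 0"

lemma eqv_sym: "eqv s t \<Longrightarrow> eqv t s"
  by (simp add: vdist_commute)

lemma eqv_trans:
  assumes "eqv s t" "eqv t r" "cauchy s" "cauchy t" "cauchy r" shows "eqv s r"
proof (rule tendsto_sandwich[of "\<lambda>n. 0" _ _ "\<lambda>n. vdist V (s n) (t n) + vdist V (t n) (r n)"])
  show "(\<lambda>n. vdist V (s n) (t n) + vdist V (t n) (r n)) \<longlonglongrightarrow> 0"
    using tendsto_add[OF assms(1,2)] by simp
qed (auto simp: vdist_nonneg intro!: always_eventually vdist_triangle cauchy_in assms)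

lemma eqv_refl: "cauchy s \<Longrightarrow> eqv s s"
  by (simp add: vdist_self cauchy_in)

lemma eqv_add:
  assumes "eqv s s'" "eqv t t'" "cauchy s" "cauchy t" "cauchy s'" "cauchy t'"
  shows "eqv (\<lambda>n. vadd V (s n) (t n)) (\<lambda>n. vadd V (s' n) (t' n))"
proof (rule tendsto_sandwich[of "\<lambda>n. 0" _ _ "\<lambda>n. vdist V (s n) (s' n) + vdist V (t n) (t' n)"])
  show "(\<lambda>n. vdist V (s n) (s' n) + vdist V (t n) (t' n)) \<longlonglongrightarrow> 0"
    using tendsto_add[OF assms(1,2)] by simp
qed (auto simp: vdist_nonneg intro!: always_eventually vdist_add cauchy_in assms)

lemma eqv_scale:
  assumes "eqv s s'" "cauchy s" "cauchy s'"
  shows "eqv (\<lambda>n. vscale V c (s n)) (\<lambda>n. vscale V c (s' n))"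
  using tendsto_mult_right_zero[OF assms(1), of "cmod c"] by (simp add: vdist_scale cauchy_in assms)

lemma eqv_vnorm:
  assumes "eqv s s'" "cauchy s" "cauchy s'"
  shows "(\<lambda>n. vnorm V (s n) - vnorm V (s' n)) \<longlonglongrightarrow> 0"
  by (rule Lim_null_comparison[OF always_eventually assms(1)])
     (auto intro!: vnorm_diff_le cauchy_in assms)

lemma eqv_inner:
  assumes "eqv s s'" "eqv t t'" and c: "cauchy s" "cauchy t" "cauchy s'" "cauchy t'"
  shows "lim (\<lambda>n. vinner V (s n) (t n)) = lim (\<lambda>n. vinner V (s' n) (t' n))"
proof -
  have "\<exists>l. (\<lambda>n. vnorm V (vadd V (s n) (vscale V c (t n)))) \<longlonglongrightarrow> l" for c
    using cauchy_vnorm_convergent[OF cauchy_add[OF assms(3) cauchy_scale[OF assms(4)]]]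
    by (simp add: convergent_def)
  then obtain l where l: "\<And>c. (\<lambda>n. vnorm V (vadd V (s n) (vscale V c (t n)))) \<longlonglongrightarrow> l c" by metis
  have l': "(\<lambda>n. vnorm V (vadd V (s' n) (vscale V c (t' n)))) \<longlonglongrightarrow> l c" for c
  proof -
    have "eqv (\<lambda>n. vadd V (s n) (vscale V c (t n))) (\<lambda>n. vadd V (s' n) (vscale V c (t' n)))"
      by (intro eqv_add eqv_scale assms cauchy_scale)
    then have "(\<lambda>n. vnorm V (vadd V (s n) (vscale V c (t n))) - vnorm V (vadd V (s' n) (vscale V c (t' n)))) \<longlonglongrightarrow> 0"
      by (rule eqv_vnorm) (intro cauchy_add cauchy_scale assms)+
    from tendsto_diff[OF l[of c] this] show ?thesis by simp
  qed
  have pol: "(\<lambda>n. vinner V (a n) (b n)) \<longlonglongrightarrow> (of_real ((l 1)\<^sup>2) - of_real ((l (-1))\<^sup>2) - \<i> * (of_real ((l \<i>)\<^sup>2) - of_real ((l (-\<i>))\<^sup>2))) / 4"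
    if "cauchy a" "cauchy b" "\<And>c. (\<lambda>n. vnorm V (vadd V (a n) (vscale V c (b n)))) \<longlonglongrightarrow> l c" for a b
  proof -
    have "(\<lambda>n. vinner V (a n) (b n)) = (\<lambda>n. (of_real ((vnorm V (vadd V (a n) (vscale V 1 (b n))))\<^sup>2) - of_real ((vnorm V (vadd V (a n) (vscale V (-1) (b n))))\<^sup>2)
       - \<i> * (of_real ((vnorm V (vadd V (a n) (vscale V \<i> (b n))))\<^sup>2) - of_real ((vnorm V (vadd V (a n) (vscale V (-\<i>) (b n))))\<^sup>2))) / 4)"
      by (rule HOL.ext, rule polarization) (use that cauchy_in in auto)
    moreover have "\<dots> \<longlonglongrightarrow> (of_real ((l 1)\<^sup>2) - of_real ((l (-1))\<^sup>2) - \<i> * (of_real ((l \<i>)\<^sup>2) - of_real ((l (-\<i>))\<^sup>2))) / 4"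
      by (intro tendsto_intros that(3)) simp
    ultimately show ?thesis by simp
  qed
  show ?thesis unfolding limI[OF pol[OF c(1,2) l]] limI[OF pol[OF c(3,4) l']] ..
qed

lemma cauchy_class_iff: "t \<in> cauchy_class V s \<longleftrightarrow> cauchy t \<and> eqv s t"
  by (simp add: cauchy_class_def)

lemma cauchy_class_self: "cauchy s \<Longrightarrow> s \<in> cauchy_class V s"
  by (simp add: cauchy_class_iff eqv_refl)

lemma cauchy_class_eq_iff:
  assumes "cauchy s" "cauchy t" shows "cauchy_class V s = cauchy_class V t \<longleftrightarrow> eqv s t"
proof
  assume "cauchy_class V s = cauchy_class V t"
  then have "t \<in> cauchy_class V s" using cauchy_class_self[OF assms(2)] by simp
  then show "eqv s t" by (simp add: cauchy_class_iff)
next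
  assume e: "eqv s t"
  show "cauchy_class V s = cauchy_class V t"
    using eqv_trans[OF e _ assms] eqv_trans[OF eqv_sym[OF e] _ assms(2,1)]
    by (auto simp: cauchy_class_iff)
qed

end

text \<open>Unions over all representatives are how operations on classes are defined; they are evaluated at
  one representative.\<close>

lemma UN_eq_constI: "a \<in> A \<Longrightarrow> (\<And>x. x \<in> A \<Longrightarrow> f x = c) \<Longrightarrow> (\<Union>x\<in>A. f x) = c"
  by auto

subsection \<open>The completion is a Hilbert space\<close>

context inner_product_space
begin

lemma completion_carrier: "vcarrier (completion_of V) = cauchy_class V ` {s. cauchy s}"
  by (simp add: completion_of_def)

lemma completion_add:
  assumes "cauchy s" "cauchy t"
  shows "vadd (completion_of V) (cauchy_class V s) (cauchy_class V t) = cauchy_class V (\<lambda>n. vadd V (s n) (t n))"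
proof -
  have "cauchy_class V (\<lambda>n. vadd V (s' n) (t' n)) = cauchy_class V (\<lambda>n. vadd V (s n) (t n))"
    if "s' \<in> cauchy_class V s" "t' \<in> cauchy_class V t" for s' t'
  proof -
    have "cauchy s'" "cauchy t'" "eqv s' s" "eqv t' t" using that by (auto simp: cauchy_class_iff intro: eqv_sym)
    then show ?thesis by (subst cauchy_class_eq_iff) (auto intro: cauchy_add eqv_add assms)
  qed
  then have "(\<Union>s'\<in>cauchy_class V s. \<Union>t'\<in>cauchy_class V t. cauchy_class V (\<lambda>n. vadd V (s' n) (t' n)))
      = cauchy_class V (\<lambda>n. vadd V (s n) (t n))"
    by (intro UN_eq_constI[OF cauchy_class_self[OF assms(1)]] UN_eq_constI[OF cauchy_class_self[OF assms(2)]])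
  then show ?thesis by (simp add: completion_of_def)
qed

lemma completion_scale:
  assumes "cauchy s"
  shows "vscale (completion_of V) c (cauchy_class V s) = cauchy_class V (\<lambda>n. vscale V c (s n))"
proof -
  have "cauchy_class V (\<lambda>n. vscale V c (s' n)) = cauchy_class V (\<lambda>n. vscale V c (s n))"
    if "s' \<in> cauchy_class V s" for s'
  proof -
    have "cauchy s'" "eqv s' s" using that by (auto simp: cauchy_class_iff intro: eqv_sym)
    then show ?thesis by (subst cauchy_class_eq_iff) (auto intro: cauchy_scale eqv_scale assms)
  qed
  then have "(\<Union>s'\<in>cauchy_class V s. cauchy_class V (\<lambda>n. vscale V c (s' n))) = cauchy_class V (\<lambda>n. vscale V c (s n))"
    by (rule UN_eq_constI[OF cauchy_class_self[OF assms]])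
  then show ?thesis by (simp add: completion_of_def)
qed

lemma completion_inner:
  assumes "cauchy s" "cauchy t"
  shows "vinner (completion_of V) (cauchy_class V s) (cauchy_class V t) = lim (\<lambda>n. vinner V (s n) (t n))"
proof -
  have "lim (\<lambda>n. vinner V (s' n) (t' n)) = lim (\<lambda>n. vinner V (s n) (t n))"
    if "s' \<in> cauchy_class V s" "t' \<in> cauchy_class V t" for s' t'
    using that by (intro eqv_inner assms) (auto simp: cauchy_class_iff intro: eqv_sym)
  then have "{lim (\<lambda>n. vinner V (s' n) (t' n)) |s' t'. s' \<in> cauchy_class V s \<and> t' \<in> cauchy_class V t}
      = {lim (\<lambda>n. vinner V (s n) (t n))}"
    using cauchy_class_self[OF assms(1)] cauchy_class_self[OF assms(2)] by blast
  then show ?thesis by (simp add: completion_of_def)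
qed

lemma completion_inner_tendsto:
  assumes "cauchy s" "cauchy t"
  shows "(\<lambda>n. vinner V (s n) (t n)) \<longlonglongrightarrow> vinner (completion_of V) (cauchy_class V s) (cauchy_class V t)"
  unfolding completion_inner[OF assms] using cauchy_inner_convergent[OF assms] by (simp add: convergent_LIMSEQ_iff)

lemma completion_in: "cauchy s \<Longrightarrow> cauchy_class V s \<in> vcarrier (completion_of V)"
  by (simp add: completion_carrier)

lemma completionE:
  assumes "S \<in> vcarrier (completion_of V)" obtains s where "cauchy s" "S = cauchy_class V s"
  using assms by (auto simp: completion_carrier)

lemma completion_vzero: "vzero (completion_of V) = cauchy_class V (\<lambda>n. vzero V)"
proof (rule vzero_eqI)
  show "cauchy_class V (\<lambda>n. vzero V) \<in> vcarrier (completion_of V)"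
    by (intro completion_in cauchy_const zero_closed)
  show "vadd (completion_of V) (cauchy_class V (\<lambda>n. vzero V)) u = u" if "u \<in> vcarrier (completion_of V)" for u
    using that by (elim completionE) (simp add: completion_add cauchy_const zero_closed add_zero_left cauchy_in)
  show "vadd (completion_of V) u v = vadd (completion_of V) v u"
    if "u \<in> vcarrier (completion_of V)" "v \<in> vcarrier (completion_of V)" for u v
    using that by (elim completionE) (simp add: completion_add add_commute cauchy_in)
qed

lemma inner_product_space_completion: "inner_product_space (completion_of V)"
proof
  show "\<exists>z\<in>vcarrier (completion_of V). \<forall>u\<in>vcarrier (completion_of V). vadd (completion_of V) z u = u"
    by (intro bexI[of _ "cauchy_class V (\<lambda>n. vzero V)"] ballI completion_in)
       (auto elim!: completionE simp: completion_add cauchy_const zero_closed add_zero_left cauchy_in)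
  fix u v w c d
  assume u: "u \<in> vcarrier (completion_of V)"
  then obtain s where s: "cauchy s" "u = cauchy_class V s" by (rule completionE)
  note S = s cauchy_in completion_add completion_scale cauchy_add cauchy_scale completion_in
  show "vscale (completion_of V) c u \<in> vcarrier (completion_of V)" by (simp add: S)
  show "vadd (completion_of V) u (vscale (completion_of V) (-1) u) = vzero (completion_of V)"
    by (simp add: S completion_vzero add_inverse)
  show "vscale (completion_of V) (c + d) u = vadd (completion_of V) (vscale (completion_of V) c u) (vscale (completion_of V) d u)"
    by (simp add: S scale_add_left)
  show "vscale (completion_of V) c (vscale (completion_of V) d u) = vscale (completion_of V) (c * d) u"
    by (simp add: S scale_scale)
  show "vscale (completion_of V) 1 u = u" by (simp add: S scale_one)
  have uu: "(\<lambda>n. vinner V (s n) (s n)) \<longlonglongrightarrow> vinner (completion_of V) u u"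
    unfolding s(2) by (rule completion_inner_tendsto[OF s(1) s(1)])
  show "vinner (completion_of V) u u \<in> \<real>\<^sub>\<ge>\<^sub>0"
    by (rule closed_sequentially[OF closed_nonneg_Reals_complex _ uu]) (auto intro: inner_nonneg cauchy_in s)
  show "u = vzero (completion_of V)" if "vinner (completion_of V) u u = 0"
  proof -
    have "(\<lambda>n. sqrt (cmod (vinner V (s n) (s n)))) \<longlonglongrightarrow> sqrt (cmod 0)"
      using uu that by (intro tendsto_intros) simp
    then have "(\<lambda>n. vnorm V (s n)) \<longlonglongrightarrow> 0"
      by (simp add: inner_self cauchy_in s vnorm_nonneg norm_power)
    moreover have "vdist V (s n) (vzero V) = vnorm V (s n)" for n
    proof -
      have "vadd V (s n) (vscale V (-1) (vzero V)) = s n"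
        by (rule ext) (simp_all add: cauchy_in s ips_simps)
      then show ?thesis by (simp add: vdist_eq cauchy_in s zero_closed)
    qed
    ultimately show ?thesis
      by (simp add: s completion_vzero cauchy_class_eq_iff cauchy_const zero_closed)
  qed
  assume v: "v \<in> vcarrier (completion_of V)"
  then obtain t where t: "cauchy t" "v = cauchy_class V t" by (rule completionE)
  note S = S t
  show "vadd (completion_of V) u v \<in> vcarrier (completion_of V)" by (simp add: S)
  show "vadd (completion_of V) u v = vadd (completion_of V) v u" by (simp add: S add_commute)
  show "vscale (completion_of V) c (vadd (completion_of V) u v) = vadd (completion_of V) (vscale (completion_of V) c u) (vscale (completion_of V) c v)"
    by (simp add: S scale_add_right)
  have uv: "(\<lambda>n. vinner V (s n) (t n)) \<longlonglongrightarrow> vinner (completion_of V) u v"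
    unfolding s(2) t(2) by (rule completion_inner_tendsto[OF s(1) t(1)])
  have vu: "(\<lambda>n. vinner V (t n) (s n)) \<longlonglongrightarrow> vinner (completion_of V) v u"
    unfolding s(2) t(2) by (rule completion_inner_tendsto[OF t(1) s(1)])
  have "(\<lambda>n. vinner V (s n) (vscale V c (t n))) \<longlonglongrightarrow> c * vinner (completion_of V) u v"
    using tendsto_mult_left[OF uv, of c] by (simp add: inner_scale_right cauchy_in s t)
  moreover have "(\<lambda>n. vinner V (s n) (vscale V c (t n))) \<longlonglongrightarrow> vinner (completion_of V) u (vscale (completion_of V) c v)"
    using completion_inner_tendsto[OF s(1) cauchy_scale[OF t(1)], of c] by (simp add: S)
  ultimately show "vinner (completion_of V) u (vscale (completion_of V) c v) = c * vinner (completion_of V) u v"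
    by (rule LIMSEQ_unique[symmetric])
  have "(\<lambda>n. vinner V (s n) (t n)) \<longlonglongrightarrow> cnj (vinner (completion_of V) v u)"
    using tendsto_cnj[OF vu] by (simp add: inner_commute[symmetric] cauchy_in s t)
  then show "vinner (completion_of V) u v = cnj (vinner (completion_of V) v u)"
    by (rule LIMSEQ_unique[OF uv])
  assume w: "w \<in> vcarrier (completion_of V)"
  then obtain r where r: "cauchy r" "w = cauchy_class V r" by (rule completionE)
  note S = S r
  show "vadd (completion_of V) (vadd (completion_of V) u v) w = vadd (completion_of V) u (vadd (completion_of V) v w)"
    by (simp add: S add_assoc)
  have uw: "(\<lambda>n. vinner V (s n) (r n)) \<longlonglongrightarrow> vinner (completion_of V) u w"
    unfolding s(2) r(2) by (rule completion_inner_tendsto[OF s(1) r(1)])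
  have "(\<lambda>n. vinner V (s n) (vadd V (t n) (r n))) \<longlonglongrightarrow> vinner (completion_of V) u v + vinner (completion_of V) u w"
    using tendsto_add[OF uv uw] by (simp add: inner_add_right cauchy_in s t r)
  moreover have "(\<lambda>n. vinner V (s n) (vadd V (t n) (r n))) \<longlonglongrightarrow> vinner (completion_of V) u (vadd (completion_of V) v w)"
    using completion_inner_tendsto[OF s(1) cauchy_add[OF t(1) r(1)]] by (simp add: S)
  ultimately show "vinner (completion_of V) u (vadd (completion_of V) v w) = vinner (completion_of V) u v + vinner (completion_of V) u w"
    by (rule LIMSEQ_unique[symmetric])
qed

lemma completion_vdist_tendsto:
  assumes s: "cauchy s" and t: "cauchy t"
  shows "(\<lambda>n. vdist V (s n) (t n)) \<longlonglongrightarrow> vdist (completion_of V) (cauchy_class V s) (cauchy_class V t)"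
proof -
  interpret C: inner_product_space "completion_of V" by (rule inner_product_space_completion)
  define r where "r = (\<lambda>n. vadd V (s n) (vscale V (-1) (t n)))"
  have r: "cauchy r" unfolding r_def by (intro cauchy_add cauchy_scale s t)
  have "vadd (completion_of V) (cauchy_class V s) (vscale (completion_of V) (-1) (cauchy_class V t)) = cauchy_class V r"
    by (simp add: completion_scale completion_add s t cauchy_scale r_def)
  then have "vdist (completion_of V) (cauchy_class V s) (cauchy_class V t) = sqrt (Re (vinner (completion_of V) (cauchy_class V r) (cauchy_class V r)))"
    by (simp add: C.vdist_eq completion_in s t vnorm_def)
  moreover have "(\<lambda>n. sqrt (Re (vinner V (r n) (r n)))) \<longlonglongrightarrow> sqrt (Re (vinner (completion_of V) (cauchy_class V r) (cauchy_class V r)))"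
    by (intro tendsto_intros completion_inner_tendsto r)
  moreover have "sqrt (Re (vinner V (r n) (r n))) = vdist V (s n) (t n)" for n
    by (simp add: vdist_eq cauchy_in s t r_def vnorm_def)
  ultimately show ?thesis by simp
qed

text \<open>A Cauchy sequence of classes converges to the class of a diagonal sequence, whose \<open>k\<close>-th term is
  within \<open>1 / (k + 1)\<close> of the \<open>k\<close>-th class.\<close>

lemma hilbert_space_completion: "hilbert_space (completion_of V)"
proof -
  interpret C: inner_product_space "completion_of V" by (rule inner_product_space_completion)
  have "Metric_space.mcomplete (vcarrier (completion_of V)) (vdist (completion_of V))"
    unfolding Metric_space.mcomplete_def[OF C.metric]
  proof (intro allI impI)
    fix S assume S: "C.cauchy S"
    have "\<forall>k. \<exists>s. cauchy s \<and> S k = cauchy_class V s" using C.cauchy_in[OF S] by (meson completionE)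
    then obtain s where s: "\<And>k. cauchy (s k)" "\<And>k. S k = cauchy_class V (s k)" by metis
    have "\<exists>N. \<forall>n\<ge>N. vdist V (s k N) (s k n) < 1 / real (Suc k)" for k
      using s(1)[of k] unfolding cauchy_iff by (metis order_refl zero_less_divide_1_iff of_nat_0_less_iff zero_less_Suc)
    then obtain N where N: "\<And>k n. n \<ge> N k \<Longrightarrow> vdist V (s k (N k)) (s k n) < 1 / real (Suc k)" by metis
    define t where "t = (\<lambda>k. s k (N k))"
    have t: "t k \<in> vcarrier V" for k using s(1) by (simp add: t_def cauchy_in)
    define T where "T = (\<lambda>k. cauchy_class V (\<lambda>n. t k))"
    have T: "T k \<in> vcarrier (completion_of V)" for k unfolding T_def by (intro completion_in cauchy_const t)
    have TS: "vdist (completion_of V) (T k) (S k) \<le> 1 / real (Suc k)" for k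
      unfolding T_def s(2)
      by (rule LIMSEQ_le_const2[OF completion_vdist_tendsto[OF cauchy_const[OF t] s(1)]])
         (use N[of k] in \<open>auto simp: t_def intro!: exI[of _ "N k"] less_imp_le\<close>)
    have TT: "vdist (completion_of V) (T k) (T l) = vdist V (t k) (t l)" for k l
      using LIMSEQ_unique[OF completion_vdist_tendsto[OF cauchy_const[OF t] cauchy_const[OF t]] tendsto_const]
      by (simp add: T_def)
    have tt: "vdist V (t k) (t l) \<le> 1 / real (Suc k) + vdist (completion_of V) (S k) (S l) + 1 / real (Suc l)" for k l
    proof -
      have "vdist (completion_of V) (T k) (T l) \<le> vdist (completion_of V) (T k) (S k) + vdist (completion_of V) (S k) (T l)"
        by (intro C.vdist_triangle T C.cauchy_in[OF S])
      moreover have "vdist (completion_of V) (S k) (T l) \<le> vdist (completion_of V) (S k) (S l) + vdist (completion_of V) (S l) (T l)"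
        by (intro C.vdist_triangle T C.cauchy_in[OF S])
      ultimately show ?thesis using TS[of k] TS[of l] C.vdist_commute[of "S l" "T l"] TT[of k l] by linarith
    qed
    have tc: "cauchy t"
      unfolding cauchy_iff
    proof (intro conjI allI impI t)
      fix e :: real assume e: "e > 0"
      obtain M where M: "\<forall>m\<ge>M. \<forall>n\<ge>M. vdist (completion_of V) (S m) (S n) < e / 3"
        using S e unfolding C.cauchy_iff by (meson divide_pos_pos zero_less_numeral)
      obtain K where K: "1 / real (Suc K) < e / 3" using e nat_approx_posE[of "e / 3"] by auto
      have "vdist V (t m) (t n) < e" if "m \<ge> max M K" "n \<ge> max M K" for m n
      proof -
        have "1 / real (Suc m) \<le> 1 / real (Suc K)" "1 / real (Suc n) \<le> 1 / real (Suc K)"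
          using that by (auto simp: frac_le)
        moreover have "vdist (completion_of V) (S m) (S n) < e / 3" using M that by auto
        ultimately show ?thesis using tt[of m n] K by linarith
      qed
      then show "\<exists>N. \<forall>m\<ge>N. \<forall>n\<ge>N. vdist V (t m) (t n) < e" by blast
    qed
    have "limitin (Metric_space.mtopology (vcarrier (completion_of V)) (vdist (completion_of V))) S (cauchy_class V t) sequentially"
      unfolding Metric_space.limit_metric_sequentially[OF C.metric]
    proof (intro conjI allI impI completion_in tc)
      fix e :: real assume e: "e > 0"
      obtain M where M: "\<forall>m\<ge>M. \<forall>n\<ge>M. vdist V (t m) (t n) < e / 3"
        using tc e unfolding cauchy_iff by (meson divide_pos_pos zero_less_numeral)
      obtain K where K: "1 / real (Suc K) < e / 3" using e nat_approx_posE[of "e / 3"] by auto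
      have "S n \<in> vcarrier (completion_of V) \<and> vdist (completion_of V) (S n) (cauchy_class V t) < e" if n: "n \<ge> max M K" for n
      proof
        show "S n \<in> vcarrier (completion_of V)" by (rule C.cauchy_in[OF S])
        have "vdist (completion_of V) (T n) (cauchy_class V t) \<le> e / 3"
          unfolding T_def
          by (rule LIMSEQ_le_const2[OF completion_vdist_tendsto[OF cauchy_const[OF t] tc]])
             (use M n in \<open>auto intro!: exI[of _ M] less_imp_le\<close>)
        moreover have "1 / real (Suc n) \<le> 1 / real (Suc K)" using n by (auto simp: frac_le)
        ultimately show "vdist (completion_of V) (S n) (cauchy_class V t) < e"
          using C.vdist_triangle[OF C.cauchy_in[OF S] T completion_in[OF tc], of n n] TS[of n]
            C.vdist_commute[of "S n" "T n"] K e by linarith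
      qed
      then show "\<exists>N. \<forall>n\<ge>N. S n \<in> vcarrier (completion_of V) \<and> vdist (completion_of V) (S n) (cauchy_class V t) < e" by blast
    qed
    then show "\<exists>x. limitin (Metric_space.mtopology (vcarrier (completion_of V)) (vdist (completion_of V))) S x sequentially" by blast
  qed
  then show ?thesis by (intro hilbert_space.intro hilbert_space_axioms.intro C.inner_product_space_axioms)
qed

end

section \<open>Unitary maps\<close>

lemma unitary_mapD:
  assumes "unitary_map V W T"
  shows "bij_betw T (vcarrier V) (vcarrier W)"
    and "\<And>u v. u \<in> vcarrier V \<Longrightarrow> v \<in> vcarrier V \<Longrightarrow> T (vadd V u v) = vadd W (T u) (T v)"
    and "\<And>c u. u \<in> vcarrier V \<Longrightarrow> T (vscale V c u) = vscale W c (T u)"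
    and "\<And>u v. u \<in> vcarrier V \<Longrightarrow> v \<in> vcarrier V \<Longrightarrow> vinner W (T u) (T v) = vinner V u v"
    and "\<And>u. u \<in> vcarrier V \<Longrightarrow> T u \<in> vcarrier W"
  using assms by (auto simp: unitary_map_def bij_betw_def)

lemma unitary_mapI:
  assumes "bij_betw T (vcarrier V) (vcarrier W)"
    and "\<And>u v. u \<in> vcarrier V \<Longrightarrow> v \<in> vcarrier V \<Longrightarrow> T (vadd V u v) = vadd W (T u) (T v)"
    and "\<And>c u. u \<in> vcarrier V \<Longrightarrow> T (vscale V c u) = vscale W c (T u)"
    and "\<And>u v. u \<in> vcarrier V \<Longrightarrow> v \<in> vcarrier V \<Longrightarrow> vinner W (T u) (T v) = vinner V u v"
  shows "unitary_map V W T"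
  using assms by (simp add: unitary_map_def)

lemma unitary_map_compose:
  assumes S: "unitary_map V W S" and T: "unitary_map W Z T"
  shows "unitary_map V Z (\<lambda>x. T (S x))"
proof (rule unitary_mapI)
  show "bij_betw (\<lambda>x. T (S x)) (vcarrier V) (vcarrier Z)"
    using bij_betw_trans[OF unitary_mapD(1)[OF S] unitary_mapD(1)[OF T]] by (simp add: o_def)
qed (simp_all add: unitary_mapD(2-5)[OF S] unitary_mapD(2-5)[OF T])

lemma unitary_map_cong:
  assumes "unitary_map V W S" "\<And>x. x \<in> vcarrier V \<Longrightarrow> T x = S x"
    and "inner_product_space V"
  shows "unitary_map V W T"
proof -
  interpret inner_product_space V by fact
  show ?thesis
  proof (rule unitary_mapI)
    show "bij_betw T (vcarrier V) (vcarrier W)"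
      using bij_betw_cong[of "vcarrier V" T S] assms unitary_mapD(1) by blast
  qed (simp_all add: assms(2) add_closed scale_closed unitary_mapD[OF assms(1)])
qed

lemma unitary_map_inverse:
  assumes T: "unitary_map V W T" and V: "inner_product_space V"
  shows "unitary_map W V (inv_into (vcarrier V) T)"
proof -
  interpret inner_product_space V by (rule V)
  let ?I = "inv_into (vcarrier V) T"
  have bij: "bij_betw T (vcarrier V) (vcarrier W)" by (rule unitary_mapD(1)[OF T])
  have I: "?I w \<in> vcarrier V" "T (?I w) = w" if "w \<in> vcarrier W" for w
    using that bij bij_betw_inv_into_right[OF bij] by (auto simp: bij_betw_def inv_into_into)
  have IT: "?I (T v) = v" if "v \<in> vcarrier V" for v
    by (rule bij_betw_inv_into_left[OF bij that])
  show ?thesis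
  proof (rule unitary_mapI)
    show "bij_betw ?I (vcarrier W) (vcarrier V)" by (rule bij_betw_inv_into[OF bij])
    fix u v c assume u: "u \<in> vcarrier W"
    show "?I (vscale W c u) = vscale V c (?I u)"
      using IT[of "vscale V c (?I u)"] by (simp add: unitary_mapD(3)[OF T] I u scale_closed)
    assume v: "v \<in> vcarrier W"
    show "?I (vadd W u v) = vadd V (?I u) (?I v)"
      using IT[of "vadd V (?I u) (?I v)"] by (simp add: unitary_mapD(2)[OF T] I u v add_closed)
    show "vinner V (?I u) (?I v) = vinner W u v"
      using unitary_mapD(4)[OF T, of "?I u" "?I v"] by (simp add: I u v)
  qed
qed

text \<open>A space that receives a unitary map inherits all axioms. This is how the fibres of the associated
  bundle and the space of orbits are recognised as Hilbert spaces.\<close>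

lemma inner_product_space_transport:
  assumes V: "inner_product_space V" and T: "unitary_map V W T"
  shows "inner_product_space W"
proof -
  interpret inner_product_space V by (rule V)
  note U = unitary_mapD(2-5)[OF T]
  have ex: "\<exists>x. x \<in> vcarrier V \<and> w = T x" if "w \<in> vcarrier W" for w
    using unitary_mapD(1)[OF T] that by (auto simp: bij_betw_def)
  have z: "vzero W = T (vzero V)"
  proof (rule vzero_eqI)
    show "vadd W (T (vzero V)) u = u" if "u \<in> vcarrier W" for u
      using ex[OF that] by (auto simp: U(1)[symmetric] zero_closed add_zero_left)
    show "vadd W u v = vadd W v u" if "u \<in> vcarrier W" "v \<in> vcarrier W" for u v
      using ex[OF that(1)] ex[OF that(2)] by (auto simp: U(1)[symmetric] add_commute)
  qed (simp add: U zero_closed)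
  show ?thesis
  proof
    show "\<exists>z\<in>vcarrier W. \<forall>u\<in>vcarrier W. vadd W z u = u"
      by (rule bexI[of _ "T (vzero V)"])
         (auto dest!: ex simp: U(1)[symmetric] zero_closed add_zero_left U(4))
    fix u v w c d
    assume "u \<in> vcarrier W"
    then obtain x where x: "x \<in> vcarrier V" "u = T x" using ex by blast
    note S = U(1-3)[symmetric] x add_closed scale_closed zero_closed
    show "vscale W c u \<in> vcarrier W" by (simp add: S U(4))
    show "vadd W u (vscale W (-1) u) = vzero W" by (simp add: S z add_inverse)
    show "vscale W (c + d) u = vadd W (vscale W c u) (vscale W d u)" by (simp add: S scale_add_left)
    show "vscale W c (vscale W d u) = vscale W (c * d) u" by (simp add: S scale_scale)
    show "vscale W 1 u = u" by (simp add: S scale_one)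
    show "vinner W u u \<in> \<real>\<^sub>\<ge>\<^sub>0" using U(3)[OF x(1) x(1)] inner_nonneg[OF x(1)] by (simp add: x)
    show "u = vzero W" if "vinner W u u = 0"
      using that U(3)[OF x(1) x(1)] inner_definite[OF x(1)] by (simp add: x z)
    assume "v \<in> vcarrier W"
    then obtain y where y: "y \<in> vcarrier V" "v = T y" using ex by blast
    note S = S y
    show "vadd W u v \<in> vcarrier W" by (simp add: S U(4))
    show "vadd W u v = vadd W v u" by (simp add: S add_commute)
    show "vscale W c (vadd W u v) = vadd W (vscale W c u) (vscale W c v)" by (simp add: S scale_add_right)
    show "vinner W u (vscale W c v) = c * vinner W u v"
      by (simp add: U(3) x y U(2)[symmetric] scale_closed inner_scale_right)
    show "vinner W u v = cnj (vinner W v u)"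
      by (simp add: U(3) x y inner_commute[of x y])
    assume "w \<in> vcarrier W"
    then obtain r where r: "r \<in> vcarrier V" "w = T r" using ex by blast
    note S = S r
    show "vadd W (vadd W u v) w = vadd W u (vadd W v w)" by (simp add: S add_assoc)
    show "vinner W u (vadd W v w) = vinner W u v + vinner W u w"
      by (simp add: U(3) x y r U(1)[symmetric] add_closed inner_add_right)
  qed
qed

lemma unitary_map_vdist:
  assumes V: "inner_product_space V" and T: "unitary_map V W T"
    and u: "u \<in> vcarrier V" and v: "v \<in> vcarrier V"
  shows "vdist W (T u) (T v) = vdist V u v"
proof -
  interpret V: inner_product_space V by (rule V)
  interpret W: inner_product_space W by (rule inner_product_space_transport[OF V T])
  have "vadd W (T u) (vscale W (-1) (T v)) = T (vadd V u (vscale V (-1) v))"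
    by (simp add: unitary_mapD(2,3)[OF T] u v V.scale_closed)
  then show ?thesis
    by (simp add: V.vdist_eq W.vdist_eq u v unitary_mapD(5)[OF T] vnorm_def unitary_mapD(4)[OF T] V.diff_closed)
qed

lemma hilbert_space_transport:
  assumes V: "hilbert_space V" and T: "unitary_map V W T"
  shows "hilbert_space W"
proof -
  interpret V: hilbert_space V by (rule V)
  interpret W: inner_product_space W by (rule inner_product_space_transport[OF V.inner_product_space_axioms T])
  let ?I = "inv_into (vcarrier V) T"
  note I = unitary_map_inverse[OF T V.inner_product_space_axioms]
  have "Metric_space.mcomplete (vcarrier W) (vdist W)"
    unfolding Metric_space.mcomplete_def[OF W.metric]
  proof (intro allI impI)
    fix \<sigma> assume \<sigma>: "W.cauchy \<sigma>"
    have "V.cauchy (\<lambda>n. ?I (\<sigma> n))"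
      using \<sigma> unfolding V.cauchy_iff W.cauchy_iff
      by (simp add: unitary_map_vdist[OF W.inner_product_space_axioms I] unitary_mapD(5)[OF I])
    then obtain x where x: "limitin (Metric_space.mtopology (vcarrier V) (vdist V)) (\<lambda>n. ?I (\<sigma> n)) x sequentially"
      using V.complete unfolding Metric_space.mcomplete_def[OF V.metric] by blast
    then have xV: "x \<in> vcarrier V" unfolding Metric_space.limit_metric_sequentially[OF V.metric] by blast
    have "vdist W (\<sigma> n) (T x) = vdist V (?I (\<sigma> n)) x" for n
      using unitary_map_vdist[OF V.inner_product_space_axioms T unitary_mapD(5)[OF I W.cauchy_in[OF \<sigma>]] xV]
        bij_betw_inv_into_right[OF unitary_mapD(1)[OF T] W.cauchy_in[OF \<sigma>]] by simp
    then have "limitin (Metric_space.mtopology (vcarrier W) (vdist W)) \<sigma> (T x) sequentially"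
      using x unfolding Metric_space.limit_metric_sequentially[OF V.metric] Metric_space.limit_metric_sequentially[OF W.metric]
      by (simp add: unitary_mapD(5)[OF T] W.cauchy_in[OF \<sigma>] unitary_mapD(5)[OF I])
    then show "\<exists>x. limitin (Metric_space.mtopology (vcarrier W) (vdist W)) \<sigma> x sequentially" by blast
  qed
  then show ?thesis by (intro hilbert_space.intro hilbert_space_axioms.intro W.inner_product_space_axioms)
qed

section \<open>Quotients by the null space\<close>

context semi_inner_product
begin

lemma null_add: "s a a = 0 \<Longrightarrow> s b b = 0 \<Longrightarrow> s (a + b) (a + b) = 0"
  using null_left[of a b] null_left[of b a] by (simp add: simps)

lemma null_scale: "s a a = 0 \<Longrightarrow> s (c *\<^sub>C a) (c *\<^sub>C a) = 0"
  by (simp add: simps)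

lemma null_minus: "s (- a) (- a) = s a a"
  by (simp add: simps)

lemma mem_coset: "\<eta> \<in> coset s \<xi> \<longleftrightarrow> s (\<eta> - \<xi>) (\<eta> - \<xi>) = 0"
proof
  show "\<eta> \<in> coset s \<xi> \<Longrightarrow> s (\<eta> - \<xi>) (\<eta> - \<xi>) = 0" by (auto simp: coset_def)
  show "s (\<eta> - \<xi>) (\<eta> - \<xi>) = 0 \<Longrightarrow> \<eta> \<in> coset s \<xi>"
    unfolding coset_def mem_Collect_eq by (rule exI[of _ "\<eta> - \<xi>"]) simp
qed

lemma coset_self: "\<xi> \<in> coset s \<xi>"
  by (simp add: mem_coset)

lemma coset_eq_iff: "coset s \<xi> = coset s \<eta> \<longleftrightarrow> s (\<xi> - \<eta>) (\<xi> - \<eta>) = 0"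
proof
  show "coset s \<xi> = coset s \<eta> \<Longrightarrow> s (\<xi> - \<eta>) (\<xi> - \<eta>) = 0"
    using coset_self[of \<xi>] by (simp add: mem_coset)
next
  assume n: "s (\<xi> - \<eta>) (\<xi> - \<eta>) = 0"
  have "s (\<zeta> - \<xi>) (\<zeta> - \<xi>) = 0 \<longleftrightarrow> s (\<zeta> - \<eta>) (\<zeta> - \<eta>) = 0" for \<zeta>
    using null_add[OF n, of "\<zeta> - \<xi>"] null_add[of "- (\<xi> - \<eta>)" "\<zeta> - \<eta>"] n
    unfolding null_minus by (auto simp: algebra_simps)
  then show "coset s \<xi> = coset s \<eta>" by (auto simp: mem_coset)
qed

lemma null_quotient_carrier: "vcarrier (null_quotient s) = range (coset s)"
  by (simp add: null_quotient_def)

lemma null_quotient_in: "coset s \<xi> \<in> vcarrier (null_quotient s)"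
  by (simp add: null_quotient_carrier)

lemma null_quotient_add: "vadd (null_quotient s) (coset s \<xi>) (coset s \<eta>) = coset s (\<xi> + \<eta>)"
proof -
  have "coset s (\<xi>' + \<eta>') = coset s (\<xi> + \<eta>)" if "\<xi>' \<in> coset s \<xi>" "\<eta>' \<in> coset s \<eta>" for \<xi>' \<eta>'
    using null_add[of "\<xi>' - \<xi>" "\<eta>' - \<eta>"] that by (simp add: mem_coset coset_eq_iff algebra_simps)
  then have "(\<Union>\<xi>'\<in>coset s \<xi>. \<Union>\<eta>'\<in>coset s \<eta>. coset s (\<xi>' + \<eta>')) = coset s (\<xi> + \<eta>)"
    by (intro UN_eq_constI[OF coset_self[of \<xi>]] UN_eq_constI[OF coset_self[of \<eta>]])
  then show ?thesis by (simp add: null_quotient_def)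
qed

lemma null_quotient_scale: "vscale (null_quotient s) c (coset s \<xi>) = coset s (c *\<^sub>C \<xi>)"
proof -
  have "coset s (c *\<^sub>C \<xi>') = coset s (c *\<^sub>C \<xi>)" if "\<xi>' \<in> coset s \<xi>" for \<xi>'
    using null_scale[of "\<xi>' - \<xi>" c] that by (simp add: mem_coset coset_eq_iff scaleC_diff_right)
  then have "(\<Union>\<xi>'\<in>coset s \<xi>. coset s (c *\<^sub>C \<xi>')) = coset s (c *\<^sub>C \<xi>)"
    by (rule UN_eq_constI[OF coset_self])
  then show ?thesis by (simp add: null_quotient_def)
qed

lemma form_coset:
  assumes "\<xi>' \<in> coset s \<xi>" "\<eta>' \<in> coset s \<eta>" shows "s \<xi>' \<eta>' = s \<xi> \<eta>"
proof -
  have "s (\<xi>' - \<xi>) \<eta>' = 0" "s \<xi> (\<eta>' - \<eta>) = 0"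
    using assms by (auto simp: mem_coset intro: null_left null_right)
  then show ?thesis by (simp add: simps)
qed

lemma null_quotient_inner: "vinner (null_quotient s) (coset s \<xi>) (coset s \<eta>) = s \<xi> \<eta>"
proof -
  have "{s \<xi>' \<eta>' |\<xi>' \<eta>'. \<xi>' \<in> coset s \<xi> \<and> \<eta>' \<in> coset s \<eta>} = {s \<xi> \<eta>}"
    using coset_self[of \<xi>] coset_self[of \<eta>] form_coset[of _ \<xi> _ \<eta>] by blast
  then show ?thesis by (simp add: null_quotient_def)
qed

lemmas null_quotient_simps = null_quotient_add null_quotient_scale null_quotient_inner

lemma inner_product_space_null_quotient: "inner_product_space (null_quotient s)"
proof -
  have z: "vzero (null_quotient s) = coset s 0"
    by (rule vzero_eqI) (auto simp: null_quotient_carrier null_quotient_add add.commute)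
  have zero: "\<exists>z\<in>vcarrier (null_quotient s). \<forall>u\<in>vcarrier (null_quotient s). vadd (null_quotient s) z u = u"
    by (rule bexI[of _ "coset s 0"]) (auto simp: null_quotient_carrier null_quotient_add)
  show ?thesis
  proof
    fix u assume "u \<in> vcarrier (null_quotient s)" "vinner (null_quotient s) u u = 0"
    then obtain x where "u = coset s x" "s x x = 0" by (auto simp: null_quotient_carrier null_quotient_inner)
    then have "coset s x = coset s 0" by (simp add: coset_eq_iff)
    with \<open>u = coset s x\<close> show "u = vzero (null_quotient s)" by (simp only: z)
  next
    fix u v assume "u \<in> vcarrier (null_quotient s)" "v \<in> vcarrier (null_quotient s)"
    then obtain x y where xy: "u = coset s x" "v = coset s y" unfolding null_quotient_carrier by blast
    show "vadd (null_quotient s) u v = vadd (null_quotient s) v u"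
      by (simp add: xy null_quotient_add add.commute)
    show "vinner (null_quotient s) u v = cnj (vinner (null_quotient s) v u)"
      by (simp add: xy null_quotient_inner hermitian[symmetric])
  qed (use zero in \<open>auto simp: null_quotient_carrier null_quotient_simps simps add.assoc scaleC_simps nonneg z\<close>)
qed

lemma vdist_null_quotient: "vdist (null_quotient s) (coset s \<xi>) (coset s \<eta>) = sqrt (Re (s (\<xi> - \<eta>) (\<xi> - \<eta>)))"
proof -
  interpret inner_product_space "null_quotient s" by (rule inner_product_space_null_quotient)
  show ?thesis by (simp add: vdist_eq null_quotient_in null_quotient_simps vnorm_def scaleC_minus_one)
qed

end

text \<open>By the bound null vectors are mapped to null vectors.\<close>

lemma quotient_lift_coset:
  assumes s: "semi_inner_product s" and t: "semi_inner_product t"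
    and diff: "\<And>x y. g (x - y) = g x - g y" and bound: "\<And>x. Re (t (g x) (g x)) \<le> K * Re (s x x)"
  shows "quotient_lift t g (coset s \<xi>) = coset t (g \<xi>)"
proof -
  interpret s: semi_inner_product s by (rule s)
  interpret t: semi_inner_product t by (rule t)
  have "coset t (g \<xi>') = coset t (g \<xi>)" if "\<xi>' \<in> coset s \<xi>" for \<xi>'
  proof -
    have "s (\<xi>' - \<xi>) (\<xi>' - \<xi>) = 0" using that by (simp add: s.mem_coset)
    then have "Re (t (g (\<xi>' - \<xi>)) (g (\<xi>' - \<xi>))) = 0"
      using bound[of "\<xi>' - \<xi>"] t.Re_nonneg[of "g (\<xi>' - \<xi>)"] by simp
    then have "t (g (\<xi>' - \<xi>)) (g (\<xi>' - \<xi>)) = 0" using t.self_eq[of "g (\<xi>' - \<xi>)"] by simp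
    then show ?thesis by (simp add: t.coset_eq_iff diff)
  qed
  then show ?thesis unfolding quotient_lift_def by (rule UN_eq_constI[OF s.coset_self[of \<xi>]])
qed

section \<open>Extension of maps to completions\<close>

lemma completion_lift_class:
  assumes V: "inner_product_space V" and W: "inner_product_space W"
    and J: "\<And>u. u \<in> vcarrier V \<Longrightarrow> J u \<in> vcarrier W" and K: "K \<ge> 0"
    and lip: "\<And>u v. u \<in> vcarrier V \<Longrightarrow> v \<in> vcarrier V \<Longrightarrow> vdist W (J u) (J v) \<le> K * vdist V u v"
    and s: "Metric_space.MCauchy (vcarrier V) (vdist V) s"
  shows "completion_lift W J (cauchy_class V s) = cauchy_class W (\<lambda>n. J (s n))"
    and "Metric_space.MCauchy (vcarrier W) (vdist W) (\<lambda>n. J (s n))"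
proof -
  interpret V: inner_product_space V by (rule V)
  interpret W: inner_product_space W by (rule W)
  have c: "W.cauchy (\<lambda>n. J (t n))" if t: "V.cauchy t" for t
    unfolding W.cauchy_iff
  proof (intro conjI allI impI J V.cauchy_in t)
    fix e :: real assume "e > 0"
    then have "e / (K + 1) > 0" using K by simp
    then obtain N where N: "\<forall>m\<ge>N. \<forall>n\<ge>N. vdist V (t m) (t n) < e / (K + 1)"
      using t unfolding V.cauchy_iff by meson
    have "vdist W (J (t m)) (J (t n)) < e" if "m \<ge> N" "n \<ge> N" for m n
    proof -
      have "vdist W (J (t m)) (J (t n)) \<le> K * vdist V (t m) (t n)" by (intro lip V.cauchy_in t)
      also have "\<dots> \<le> (K + 1) * vdist V (t m) (t n)" using V.vdist_nonneg by (simp add: mult_right_mono)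
      also have "\<dots> < e" using N that K by (simp add: pos_less_divide_eq mult.commute)
      finally show ?thesis .
    qed
    then show "\<exists>N. \<forall>m\<ge>N. \<forall>n\<ge>N. vdist W (J (t m)) (J (t n)) < e" by blast
  qed
  then show "W.cauchy (\<lambda>n. J (s n))" using s by blast
  have "cauchy_class W (\<lambda>n. J (t n)) = cauchy_class W (\<lambda>n. J (s n))" if "t \<in> cauchy_class V s" for t
  proof -
    have t: "V.cauchy t" and e: "V.eqv t s" using that by (auto simp: V.cauchy_class_iff intro: V.eqv_sym)
    have "W.eqv (\<lambda>n. J (t n)) (\<lambda>n. J (s n))"
    proof (rule tendsto_sandwich[of "\<lambda>n. 0" _ _ "\<lambda>n. K * vdist V (t n) (s n)"])
      show "(\<lambda>n. K * vdist V (t n) (s n)) \<longlonglongrightarrow> 0" by (rule tendsto_mult_right_zero[OF e])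
    qed (auto simp: W.vdist_nonneg intro!: always_eventually lip V.cauchy_in t s)
    then show ?thesis by (simp add: W.cauchy_class_eq_iff c t s)
  qed
  then show "completion_lift W J (cauchy_class V s) = cauchy_class W (\<lambda>n. J (s n))"
    unfolding completion_lift_def by (rule UN_eq_constI[OF V.cauchy_class_self[OF s]])
qed

lemma unitary_map_completion_lift:
  assumes V: "inner_product_space V" and T: "unitary_map V W T"
  shows "unitary_map (completion_of V) (completion_of W) (completion_lift W T)"
proof -
  interpret V: inner_product_space V by (rule V)
  interpret W: inner_product_space W by (rule inner_product_space_transport[OF V T])
  interpret CV: inner_product_space "completion_of V" by (rule V.inner_product_space_completion)
  let ?I = "inv_into (vcarrier V) T"
  note I = unitary_map_inverse[OF T V]
  have lift: "completion_lift W T (cauchy_class V s) = cauchy_class W (\<lambda>n. T (s n))" 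
    and c: "W.cauchy (\<lambda>n. T (s n))" if "V.cauchy s" for s
    using completion_lift_class[OF V W.inner_product_space_axioms, of T 1 s] unitary_map_vdist[OF V T] unitary_mapD(5)[OF T] that
    by auto
  show ?thesis
  proof (rule unitary_mapI)
    show "bij_betw (completion_lift W T) (vcarrier (completion_of V)) (vcarrier (completion_of W))"
      unfolding bij_betw_def
    proof
      show "inj_on (completion_lift W T) (vcarrier (completion_of V))"
      proof (rule inj_onI)
        fix S S' assume "S \<in> vcarrier (completion_of V)" "S' \<in> vcarrier (completion_of V)"
        then obtain s s' where s: "V.cauchy s" "S = cauchy_class V s" "V.cauchy s'" "S' = cauchy_class V s'"
          by (meson V.completionE)
        assume "completion_lift W T S = completion_lift W T S'"
        then have "W.eqv (\<lambda>n. T (s n)) (\<lambda>n. T (s' n))" by (simp add: s lift W.cauchy_class_eq_iff c)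
        then have "V.eqv s s'" by (simp add: unitary_map_vdist[OF V T] V.cauchy_in s)
        then show "S = S'" by (simp add: s V.cauchy_class_eq_iff)
      qed
      show "completion_lift W T ` vcarrier (completion_of V) = vcarrier (completion_of W)"
      proof (intro equalityI subsetI)
        fix R assume "R \<in> completion_lift W T ` vcarrier (completion_of V)"
        then show "R \<in> vcarrier (completion_of W)" by (auto elim!: V.completionE simp: lift W.completion_in c)
      next
        fix R assume "R \<in> vcarrier (completion_of W)"
        then obtain r where r: "W.cauchy r" "R = cauchy_class W r" by (rule W.completionE)
        have "V.cauchy (\<lambda>n. ?I (r n))"
          using completion_lift_class(2)[OF W.inner_product_space_axioms V, of ?I 1 r] 
            unitary_map_vdist[OF W.inner_product_space_axioms I] unitary_mapD(5)[OF I] r by auto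
        moreover have "T (?I (r n)) = r n" for n
          by (rule bij_betw_inv_into_right[OF unitary_mapD(1)[OF T] W.cauchy_in[OF r(1)]])
        ultimately have "R = completion_lift W T (cauchy_class V (\<lambda>n. ?I (r n)))"
          "cauchy_class V (\<lambda>n. ?I (r n)) \<in> vcarrier (completion_of V)"
          by (simp_all add: lift r V.completion_in)
        then show "R \<in> completion_lift W T ` vcarrier (completion_of V)" by blast
      qed
    qed
    fix S S' k assume "S \<in> vcarrier (completion_of V)"
    then obtain s where s: "V.cauchy s" "S = cauchy_class V s" by (rule V.completionE)
    show "completion_lift W T (vscale (completion_of V) k S) = vscale (completion_of W) k (completion_lift W T S)"
      by (simp add: s V.completion_scale lift W.completion_scale V.cauchy_scale c unitary_mapD(3)[OF T] V.cauchy_in)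
    assume "S' \<in> vcarrier (completion_of V)"
    then obtain s' where s': "V.cauchy s'" "S' = cauchy_class V s'" by (rule V.completionE)
    show "completion_lift W T (vadd (completion_of V) S S') = vadd (completion_of W) (completion_lift W T S) (completion_lift W T S')"
      by (simp add: s s' V.completion_add lift W.completion_add V.cauchy_add c unitary_mapD(2)[OF T] V.cauchy_in)
    show "vinner (completion_of W) (completion_lift W T S) (completion_lift W T S') = vinner (completion_of V) S S'"
      by (simp add: s s' V.completion_inner lift W.completion_inner c unitary_mapD(4)[OF T] V.cauchy_in)
  qed
qed

lemma null_quotient_unitary:
  assumes s: "semi_inner_product s" and t: "semi_inner_product t"
    and add: "\<And>x y. g (x + y) = g x + g y" and sc: "\<And>c x. g (c *\<^sub>C x) = c *\<^sub>C g x"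
    and iso: "\<And>x y. t (g x) (g y) = s x y" and "surj g"
  shows "unitary_map (null_quotient s) (null_quotient t) (quotient_lift t g)"
proof -
  interpret s: semi_inner_product s by (rule s)
  interpret t: semi_inner_product t by (rule t)
  have diff: "g (x - y) = g x - g y" for x y
    using add[of x "- y"] sc[of "-1" y] by (simp add: scaleC_minus_one)
  have lift: "quotient_lift t g (coset s x) = coset t (g x)" for x
    by (rule quotient_lift_coset[OF s t, where K=1]) (simp_all add: diff iso)
  show ?thesis
  proof (rule unitary_mapI)
    show "bij_betw (quotient_lift t g) (vcarrier (null_quotient s)) (vcarrier (null_quotient t))"
      unfolding bij_betw_def
    proof
      show "inj_on (quotient_lift t g) (vcarrier (null_quotient s))"
      proof (rule inj_onI)
        fix P Q assume "P \<in> vcarrier (null_quotient s)" "Q \<in> vcarrier (null_quotient s)"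
        then obtain x y where xy: "P = coset s x" "Q = coset s y" unfolding s.null_quotient_carrier by blast
        assume "quotient_lift t g P = quotient_lift t g Q"
        then have "coset t (g x) = coset t (g y)" by (simp only: xy lift)
        then have "coset s x = coset s y" unfolding t.coset_eq_iff s.coset_eq_iff diff[symmetric] iso .
        then show "P = Q" by (simp only: xy)
      qed
      have "range (\<lambda>x. coset t (g x)) = range (coset t)"
        using \<open>surj g\<close> by (metis image_image)
      then show "quotient_lift t g ` vcarrier (null_quotient s) = vcarrier (null_quotient t)"
        by (simp add: s.null_quotient_carrier t.null_quotient_carrier image_image lift)
    qed
  qed (auto simp: s.null_quotient_carrier s.null_quotient_simps t.null_quotient_simps lift add sc iso)
qed

text \<open>The continuous extension to the completion of a map into a Hilbert space; the limit does not
  depend on the chosen Cauchy sequence.\<close>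

definition hilbert_extension :: "('v \<Rightarrow> 'h::complex_hilbert_space) \<Rightarrow> (nat \<Rightarrow> 'v) set \<Rightarrow> 'h" where
  "hilbert_extension J S = lim (\<lambda>n. J ((SOME s. s \<in> S) n))"

lemma hilbert_extension:
  fixes J :: "'v \<Rightarrow> 'h::complex_hilbert_space"
  assumes V: "inner_product_space V"
    and add: "\<And>u v. u \<in> vcarrier V \<Longrightarrow> v \<in> vcarrier V \<Longrightarrow> J (vadd V u v) = J u + J v"
    and sc: "\<And>c u. u \<in> vcarrier V \<Longrightarrow> J (vscale V c u) = c *\<^sub>C J u"
    and iso: "\<And>u v. u \<in> vcarrier V \<Longrightarrow> v \<in> vcarrier V \<Longrightarrow> cinner (J u) (J v) = vinner V u v"
    and dense: "\<And>y. \<exists>s. (\<forall>n. s n \<in> vcarrier V) \<and> (\<lambda>n. J (s n)) \<longlonglongrightarrow> y"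
  shows hilbert_extension_tendsto: "Metric_space.MCauchy (vcarrier V) (vdist V) s \<Longrightarrow>
      (\<lambda>n. J (s n)) \<longlonglongrightarrow> hilbert_extension J (cauchy_class V s)"
    and unitary_map_hilbert_extension: "unitary_map (completion_of V) type_ips (hilbert_extension J)"
proof -
  interpret V: inner_product_space V by (rule V)
  note d = V.type_ips_isometry_dist[of J, OF add sc iso]
  have cau: "Cauchy (\<lambda>n. J (s n)) \<longleftrightarrow> V.cauchy s" if "\<And>n. s n \<in> vcarrier V" for s
    unfolding Cauchy_def V.cauchy_iff using that by (simp add: d)
  show lim: "(\<lambda>n. J (s n)) \<longlonglongrightarrow> hilbert_extension J (cauchy_class V s)" if s: "V.cauchy s" for s
  proof -
    define t where "t = (SOME t. t \<in> cauchy_class V s)"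
    have "t \<in> cauchy_class V s" unfolding t_def by (rule someI[of _ s]) (rule V.cauchy_class_self[OF s])
    then have t: "V.cauchy t" "V.eqv s t" by (auto simp: V.cauchy_class_iff)
    have "(\<lambda>n. J (t n)) \<longlonglongrightarrow> lim (\<lambda>n. J (t n))"
      using cau[of t] t V.cauchy_in by (simp add: Cauchy_convergent_iff convergent_LIMSEQ_iff)
    moreover have "(\<lambda>n. dist (J (t n)) (J (s n))) \<longlonglongrightarrow> 0"
      using V.eqv_sym[OF t(2)] by (simp only: d V.cauchy_in s t)
    then have "(\<lambda>n. J (t n) - J (s n)) \<longlonglongrightarrow> 0"
      unfolding dist_norm by (rule tendsto_norm_zero_cancel)
    ultimately have "(\<lambda>n. J (t n) - (J (t n) - J (s n))) \<longlonglongrightarrow> lim (\<lambda>n. J (t n)) - 0" by (rule tendsto_diff)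
    then have "(\<lambda>n. J (s n)) \<longlonglongrightarrow> lim (\<lambda>n. J (t n))" by simp
    then show ?thesis by (simp add: hilbert_extension_def t_def)
  qed
  show "unitary_map (completion_of V) type_ips (hilbert_extension J)"
  proof (rule unitary_mapI)
    show "bij_betw (hilbert_extension J) (vcarrier (completion_of V)) (vcarrier type_ips)"
      unfolding bij_betw_def
    proof
      show "inj_on (hilbert_extension J) (vcarrier (completion_of V))"
      proof (rule inj_onI)
        fix S S' assume "S \<in> vcarrier (completion_of V)" "S' \<in> vcarrier (completion_of V)"
        then obtain s s' where s: "V.cauchy s" "S = cauchy_class V s" "V.cauchy s'" "S' = cauchy_class V s'"
          by (meson V.completionE)
        assume "hilbert_extension J S = hilbert_extension J S'"
        then have "(\<lambda>n. dist (J (s n)) (J (s' n))) \<longlonglongrightarrow> 0"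
          using tendsto_dist[OF lim[OF s(1)] lim[OF s(3)]] by (simp add: s)
        then show "S = S'" by (simp add: s V.cauchy_class_eq_iff d V.cauchy_in)
      qed
      have "\<exists>S\<in>vcarrier (completion_of V). y = hilbert_extension J S" for y
      proof -
        obtain s where s: "\<And>n. s n \<in> vcarrier V" "(\<lambda>n. J (s n)) \<longlonglongrightarrow> y" using dense by blast
        then have "V.cauchy s" using cau[of s] LIMSEQ_imp_Cauchy by blast
        then show ?thesis using LIMSEQ_unique[OF s(2) lim] V.completion_in by blast
      qed
      then show "hilbert_extension J ` vcarrier (completion_of V) = vcarrier type_ips"
        by (auto simp: type_ips_def)
    qed
    fix S S' k assume "S \<in> vcarrier (completion_of V)"
    then obtain s where s: "V.cauchy s" "S = cauchy_class V s" by (rule V.completionE)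
    have "(\<lambda>n. J (vscale V k (s n))) \<longlonglongrightarrow> k *\<^sub>C hilbert_extension J S"
      using tendsto_scaleC[OF tendsto_const lim[OF s(1)], of k] by (simp add: sc V.cauchy_in s)
    then show "hilbert_extension J (vscale (completion_of V) k S) = vscale type_ips k (hilbert_extension J S)"
      using LIMSEQ_unique[OF lim[OF V.cauchy_scale[OF s(1)]]] by (simp add: s V.completion_scale type_ips_def)
    assume "S' \<in> vcarrier (completion_of V)"
    then obtain s' where s': "V.cauchy s'" "S' = cauchy_class V s'" by (rule V.completionE)
    have "(\<lambda>n. J (vadd V (s n) (s' n))) \<longlonglongrightarrow> hilbert_extension J S + hilbert_extension J S'"
      using tendsto_add[OF lim[OF s(1)] lim[OF s'(1)]] by (simp add: add V.cauchy_in s s')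
    then show "hilbert_extension J (vadd (completion_of V) S S') = vadd type_ips (hilbert_extension J S) (hilbert_extension J S')"
      using LIMSEQ_unique[OF lim[OF V.cauchy_add[OF s(1) s'(1)]]] by (simp add: s s' V.completion_add type_ips_def)
    have "(\<lambda>n. vinner V (s n) (s' n)) \<longlonglongrightarrow> cinner (hilbert_extension J S) (hilbert_extension J S')"
      using tendsto_cinner[OF lim[OF s(1)] lim[OF s'(1)]] by (simp add: iso V.cauchy_in s s')
    then show "vinner type_ips (hilbert_extension J S) (hilbert_extension J S') = vinner (completion_of V) S S'"
      using LIMSEQ_unique V.completion_inner_tendsto[OF s(1) s'(1)] by (simp add: s s' type_ips_def)
  qed
qed

section \<open>The pure states over the class of an irreducible representation\<close>

text \<open>Left multiplication passes to the quotient and to the completion since it is bounded for the GNS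
  form.\<close>

lemma gns_left_mult:
  fixes \<rho> :: "'a::cstar_algebra \<Rightarrow> complex"
  assumes \<rho>: "state \<rho>"
    and b: "Metric_space.MCauchy (vcarrier (null_quotient (gns_form \<rho>))) (vdist (null_quotient (gns_form \<rho>)))
      (\<lambda>n. coset (gns_form \<rho>) (b n))"
  shows "gns_rep \<rho> a (cauchy_class (null_quotient (gns_form \<rho>)) (\<lambda>n. coset (gns_form \<rho>) (b n))) =
      cauchy_class (null_quotient (gns_form \<rho>)) (\<lambda>n. coset (gns_form \<rho>) (a * b n))" (is ?eq)
    and "Metric_space.MCauchy (vcarrier (null_quotient (gns_form \<rho>))) (vdist (null_quotient (gns_form \<rho>)))
      (\<lambda>n. coset (gns_form \<rho>) (a * b n))" (is ?cauchy)
proof -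
  interpret s: semi_inner_product "gns_form \<rho>" by (rule state_semi_inner_product[OF \<rho>])
  interpret V: inner_product_space "null_quotient (gns_form \<rho>)" by (rule s.inner_product_space_null_quotient)
  let ?V = "null_quotient (gns_form \<rho>)"
  let ?J = "quotient_lift (gns_form \<rho>) (\<lambda>b. a * b)"
  have J: "?J (coset (gns_form \<rho>) c) = coset (gns_form \<rho>) (a * c)" for c
    by (rule quotient_lift_coset[OF s.semi_inner_product_axioms s.semi_inner_product_axioms _ gns_form_mult_bound[OF \<rho>]])
       (simp add: right_diff_distrib)
  have lip: "vdist ?V (?J u) (?J v) \<le> norm a * vdist ?V u v" if uv: "u \<in> vcarrier ?V" "v \<in> vcarrier ?V" for u v
  proof -
    obtain x y where xy: "u = coset (gns_form \<rho>) x" "v = coset (gns_form \<rho>) y"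
      using uv unfolding s.null_quotient_carrier by blast
    have "sqrt (Re (gns_form \<rho> (a * (x - y)) (a * (x - y)))) \<le> sqrt ((norm a)\<^sup>2 * Re (gns_form \<rho> (x - y) (x - y)))"
      by (rule real_sqrt_le_mono[OF gns_form_mult_bound[OF \<rho>]])
    then show ?thesis
      by (simp add: xy J s.vdist_null_quotient right_diff_distrib real_sqrt_mult)
  qed
  have Jin: "?J u \<in> vcarrier ?V" if "u \<in> vcarrier ?V" for u
    using that by (auto simp: s.null_quotient_carrier J)
  note L = completion_lift_class[OF V.inner_product_space_axioms V.inner_product_space_axioms Jin norm_ge_zero[of a] lip b]
  show ?eq using L(1) by (simp add: gns_rep_def J)
  show ?cauchy using L(2) by (simp add: J)
qed

context irreducible_representation
begin

text \<open>The vector \<open>x\<close> is the image of the cyclic GNS vector, the class of the unit of the algebra.\<close>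

lemma pure_states_of_subset:
  assumes "\<rho> \<in> pure_states_of \<pi>"
  obtains x where "norm x = 1" "\<rho> = vector_state \<pi> x"
proof -
  have \<rho>: "state \<rho>" using assms by (auto simp: pure_states_of_def pure_states_def)
  obtain T where T: "unitary_map (gns_space \<rho>) type_ips T"
    and int: "\<And>a v. v \<in> vcarrier (gns_space \<rho>) \<Longrightarrow> T (gns_rep \<rho> a v) = \<pi> a (T v)"
    using assms unfolding pure_states_of_def by blast
  interpret s: semi_inner_product "gns_form \<rho>" by (rule state_semi_inner_product[OF \<rho>])
  interpret V: inner_product_space "null_quotient (gns_form \<rho>)" by (rule s.inner_product_space_null_quotient)
  define \<Omega> where "\<Omega> = cauchy_class (null_quotient (gns_form \<rho>)) (\<lambda>n. coset (gns_form \<rho>) 1)"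
  have c: "V.cauchy (\<lambda>n. coset (gns_form \<rho>) a)" for a by (rule V.cauchy_const[OF s.null_quotient_in])
  have \<Omega>: "\<Omega> \<in> vcarrier (gns_space \<rho>)" unfolding \<Omega>_def gns_space_def by (rule V.completion_in[OF c])
  have a\<Omega>: "gns_rep \<rho> a \<Omega> = cauchy_class (null_quotient (gns_form \<rho>)) (\<lambda>n. coset (gns_form \<rho>) a)" for a
    unfolding \<Omega>_def using gns_left_mult(1)[OF \<rho> c[of 1], of a] by simp
  have in2: "gns_rep \<rho> a \<Omega> \<in> vcarrier (gns_space \<rho>)" for a
    unfolding a\<Omega> gns_space_def by (rule V.completion_in[OF c])
  have "cinner (T \<Omega>) (\<pi> a (T \<Omega>)) = \<rho> a" for a
  proof -
    have "cinner (T \<Omega>) (\<pi> a (T \<Omega>)) = vinner (gns_space \<rho>) \<Omega> (gns_rep \<rho> a \<Omega>)"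
      using unitary_mapD(4)[OF T \<Omega> in2[of a]] by (simp add: type_ips_def int[OF \<Omega>])
    also have "\<dots> = \<rho> a"
      unfolding a\<Omega> unfolding \<Omega>_def gns_space_def V.completion_inner[OF c c] s.null_quotient_inner
      by (simp add: gns_form_def)
    finally show ?thesis .
  qed
  then have "\<rho> = vector_state \<pi> (T \<Omega>)" by (auto simp: vector_state_def)
  moreover have "norm (T \<Omega>) = 1"
  proof -
    have "complex_of_real ((norm (T \<Omega>))\<^sup>2) = cinner (T \<Omega>) (\<pi> 1 (T \<Omega>))" by (simp add: rep_one cinner_self)
    also have "\<dots> = \<rho> 1" by fact
    also have "\<dots> = of_real 1" using \<rho> by (simp add: state_def)
    finally have "(norm (T \<Omega>))\<^sup>2 = 1" using of_real_eq_iff by blast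
    then show ?thesis by (metis norm_ge_zero one_power2 power2_eq_iff_nonneg zero_le_one)
  qed
  ultimately show ?thesis using that by blast
qed

lemma rep_orbit_dense:
  assumes "norm x = 1" obtains a where "(\<lambda>n. \<pi> (a n) x) \<longlonglongrightarrow> y"
proof -
  obtain a where "(\<lambda>n. \<pi> (a n) x) \<longlonglongrightarrow> cinner x x *\<^sub>C y"
    by (rule density4[OF bounded_linear_rank_one, of x y x x x x]) (simp_all add: cinner_simps scaleC_scaleC)
  then show ?thesis using that assms by (simp add: cinner_self scaleC_one)
qed

text \<open>The map \<open>a \<mapsto> \<pi>(a) x\<close> is isometric for the GNS form of the vector state and has dense range, so it
  extends to a unitary intertwiner from the GNS space.\<close>

lemma vector_state_in_pure_states_of:
  assumes x: "norm x = 1"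
  shows "vector_state \<pi> x \<in> pure_states_of \<pi>"
proof -
  define \<rho> where "\<rho> = vector_state \<pi> x"
  have \<rho>: "state \<rho>" unfolding \<rho>_def by (rule state_vector_state[OF x])
  interpret s: semi_inner_product "gns_form \<rho>" by (rule state_semi_inner_product[OF \<rho>])
  interpret V: inner_product_space "null_quotient (gns_form \<rho>)" by (rule s.inner_product_space_null_quotient)
  let ?V = "null_quotient (gns_form \<rho>)"
  let ?c = "coset (gns_form \<rho>)"
  have form: "gns_form \<rho> a b = cinner (\<pi> a x) (\<pi> b x)" for a b
    by (simp add: gns_form_def \<rho>_def vector_state_mult)
  define J where "J = (\<lambda>P. \<pi> (SOME a. a \<in> P) x)"
  have J: "J (?c a) = \<pi> a x" for a
  proof -
    have "(SOME b. b \<in> ?c a) \<in> ?c a" by (rule someI) (rule s.coset_self)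
    then have "\<pi> ((SOME b. b \<in> ?c a) - a) x = 0" by (simp add: s.mem_coset form cinner_self)
    then show ?thesis by (simp add: J_def rep_diff)
  qed
  have dense: "\<exists>s. (\<forall>n. s n \<in> vcarrier ?V) \<and> (\<lambda>n. J (s n)) \<longlonglongrightarrow> y" for y
  proof -
    obtain a where "(\<lambda>n. \<pi> (a n) x) \<longlonglongrightarrow> y" using rep_orbit_dense[OF x] by blast
    then show ?thesis by (intro exI[of _ "\<lambda>n. ?c (a n)"]) (simp add: J s.null_quotient_in)
  qed
  have Jadd: "J (vadd ?V u v) = J u + J v" if "u \<in> vcarrier ?V" "v \<in> vcarrier ?V" for u v
    using that by (auto simp: s.null_quotient_carrier s.null_quotient_add J rep_add)
  have Jsc: "J (vscale ?V c u) = c *\<^sub>C J u" if "u \<in> vcarrier ?V" for u c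
    using that by (auto simp: s.null_quotient_carrier s.null_quotient_scale J rep_scale)
  have Jiso: "cinner (J u) (J v) = vinner ?V u v" if "u \<in> vcarrier ?V" "v \<in> vcarrier ?V" for u v
    using that by (auto simp: s.null_quotient_carrier s.null_quotient_inner J form)
  have lim: "(\<lambda>n. J (s n)) \<longlonglongrightarrow> hilbert_extension J (cauchy_class ?V s)" if "V.cauchy s" for s
    by (rule hilbert_extension_tendsto[OF V.inner_product_space_axioms _ _ _ dense that]) (simp_all add: Jadd Jsc Jiso)
  define T where "T = hilbert_extension J"
  have "unitary_map (gns_space \<rho>) type_ips T"
    unfolding gns_space_def T_def
    by (rule unitary_map_hilbert_extension[OF V.inner_product_space_axioms Jadd Jsc Jiso dense])
  moreover have "T (gns_rep \<rho> a v) = \<pi> a (T v)" if v: "v \<in> vcarrier (gns_space \<rho>)" for a v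
  proof -
    obtain s where s: "V.cauchy s" "v = cauchy_class ?V s"
      using v unfolding gns_space_def by (rule V.completionE)
    have "\<forall>n. \<exists>b. s n = ?c b" using V.cauchy_in[OF s(1)] by (auto simp: s.null_quotient_carrier)
    then obtain b where "\<And>n. s n = ?c (b n)" by metis
    then have b: "s = (\<lambda>n. ?c (b n))" by auto
    note G = gns_left_mult[OF \<rho> s(1)[unfolded b], of a]
    have "(\<lambda>n. \<pi> a (\<pi> (b n) x)) \<longlonglongrightarrow> T (gns_rep \<rho> a v)"
      using lim[OF G(2)] by (simp add: T_def s(2) b G(1) J rep_mult)
    moreover have "(\<lambda>n. \<pi> a (\<pi> (b n) x)) \<longlonglongrightarrow> \<pi> a (T v)"
      using bounded_linear.tendsto[OF rep_bounded lim[OF s(1)], of a] by (simp add: T_def s(2) b J)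
    ultimately show ?thesis by (rule LIMSEQ_unique)
  qed
  ultimately show ?thesis
    unfolding pure_states_of_def \<rho>_def[symmetric] using vector_state_pure[OF x] by (auto simp: \<rho>_def[symmetric])
qed

lemma pure_states_of_eq: "pure_states_of \<pi> = vector_state \<pi> ` {x. norm x = 1}"
proof (intro equalityI subsetI)
  fix \<rho> assume "\<rho> \<in> pure_states_of \<pi>"
  then obtain x where "norm x = 1" "\<rho> = vector_state \<pi> x" by (rule pure_states_of_subset)
  then show "\<rho> \<in> vector_state \<pi> ` {x. norm x = 1}" by blast
qed (auto intro: vector_state_in_pure_states_of)

end

section \<open>Rays and pure states\<close>

lemma ray_self: "z \<in> ray (z :: 'h::complex_vector)"
  unfolding ray_def by (rule CollectI, rule exI[of _ 1]) (simp add: scaleC_one)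

lemma ray_scaleC: "c \<noteq> 0 \<Longrightarrow> ray (c *\<^sub>C z) = ray (z :: 'h::complex_vector)"
proof -
  assume c: "c \<noteq> 0"
  have "\<exists>d. d \<noteq> 0 \<and> e *\<^sub>C z = d *\<^sub>C c *\<^sub>C z" if "e \<noteq> 0" for e
    using c that by (intro exI[of _ "e / c"]) (simp add: scaleC_scaleC)
  moreover have "\<exists>d. d \<noteq> 0 \<and> e *\<^sub>C c *\<^sub>C z = d *\<^sub>C z" if "e \<noteq> 0" for e
    using c that by (intro exI[of _ "e * c"]) (simp add: scaleC_scaleC)
  ultimately show ?thesis unfolding ray_def by auto
qed

lemma ray_eqE:
  assumes "ray y = ray (x :: 'h::complex_vector)" obtains c where "c \<noteq> 0" "y = c *\<^sub>C x"
  using ray_self[of y] assms by (auto simp: ray_def)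

lemma ray_eq_unitE:
  assumes "ray y = ray (x :: 'h::complex_hilbert_space)" "norm x = 1" "norm y = 1"
  obtains c where "cmod c = 1" "y = c *\<^sub>C x"
  using ray_eqE[OF assms(1)] assms(2,3) by (metis mult.right_neutral norm_scaleC_hilbert)

context irreducible_representation
begin

lemma state_ray_vector_state:
  assumes x: "norm x = 1" shows "state_ray \<pi> (vector_state \<pi> x) = ray x"
proof -
  define y where "y = (SOME y. norm y = 1 \<and> vector_state \<pi> x = (\<lambda>a. cinner y (\<pi> a y)))"
  have "norm y = 1 \<and> vector_state \<pi> x = (\<lambda>a. cinner y (\<pi> a y))"
    unfolding y_def by (rule someI[of _ x]) (simp add: x vector_state_def)
  then have y: "norm y = 1" "vector_state \<pi> x = vector_state \<pi> y" by (auto simp: vector_state_def)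
  obtain c where "cmod c = 1" "y = c *\<^sub>C x" by (rule vector_state_eqD[OF x y])
  then have "ray y = ray x" by (metis norm_zero ray_scaleC zero_neq_one)
  then show ?thesis by (simp add: state_ray_def y_def)
qed

lemma state_ray_eq_iff:
  assumes "\<rho> \<in> pure_states_of \<pi>" "norm h = 1"
  shows "state_ray \<pi> \<rho> = ray h \<longleftrightarrow> \<rho> = vector_state \<pi> h"
proof
  assume r: "state_ray \<pi> \<rho> = ray h"
  obtain x where x: "norm x = 1" "\<rho> = vector_state \<pi> x" using pure_states_of_subset[OF assms(1)] .
  then have "ray h = ray x" using r by (simp add: state_ray_vector_state)
  then obtain c where "cmod c = 1" "h = c *\<^sub>C x" using x(1) assms(2) by (rule ray_eq_unitE)
  then show "\<rho> = vector_state \<pi> h" by (simp add: x vector_state_phase)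
qed (simp add: state_ray_vector_state assms(2))

end

section \<open>Smooth functions on open subsets of a closed subspace\<close>

lemma differentiable_times_Suc_imp:
  "differentiable_times (Suc n) K U f \<Longrightarrow> U \<subseteq> K \<Longrightarrow> differentiable_times n K U f"
proof (induction n arbitrary: f)
  case 0
  then obtain f' where "\<forall>x\<in>U. (f has_derivative f' x) (at x within K)" by auto
  then show ?case
    using 0(2) by (auto simp: continuous_on_eq_continuous_within
        intro: continuous_within_subset[OF has_derivative_continuous])
next
  case (Suc n)
  then obtain f' where "\<forall>x\<in>U. (f has_derivative f' x) (at x within K)"
      "\<forall>v\<in>K. differentiable_times (Suc n) K U (\<lambda>x. f' x v)"
    by (subst (asm) differentiable_times.simps) blast
  then show ?case using Suc by (subst differentiable_times.simps) blast
qed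

lemma differentiable_times_const: "differentiable_times n K U (\<lambda>x. c)"
proof (induction n arbitrary: c)
  case (Suc n)
  show ?case by (simp, rule exI[of _ "\<lambda>x v. 0"]) (simp add: Suc)
qed simp

lemma differentiable_times_bounded_linear:
  assumes L: "bounded_linear L" shows "differentiable_times n K U L"
proof (cases n)
  case 0
  then show ?thesis using L by (simp add: linear_continuous_on)
next
  case (Suc m)
  show ?thesis unfolding Suc differentiable_times.simps
    by (rule exI[of _ "\<lambda>x. L"])
       (auto simp: differentiable_times_const intro: bounded_linear_imp_has_derivative L)
qed

lemma differentiable_times_add:
  "differentiable_times n K U f \<Longrightarrow> differentiable_times n K U g \<Longrightarrow> differentiable_times n K U (\<lambda>x. f x + g x)"
proof (induction n arbitrary: f g)
  case 0 then show ?case by (auto intro: continuous_on_add)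
next
  case (Suc n)
  from Suc.prems obtain f' g' where
    "\<forall>x\<in>U. (f has_derivative f' x) (at x within K)" "\<forall>v\<in>K. differentiable_times n K U (\<lambda>x. f' x v)"
    "\<forall>x\<in>U. (g has_derivative g' x) (at x within K)" "\<forall>v\<in>K. differentiable_times n K U (\<lambda>x. g' x v)"
    by auto
  then show ?case unfolding differentiable_times.simps
    by (intro exI[of _ "\<lambda>x v. f' x v + g' x v"]) (auto intro: has_derivative_add Suc.IH)
qed

lemma differentiable_times_bilinear:
  assumes B: "bounded_bilinear B" and U: "U \<subseteq> K"
  shows "differentiable_times n K U f \<Longrightarrow> differentiable_times n K U g \<Longrightarrow> differentiable_times n K U (\<lambda>x. B (f x) (g x))"
proof (induction n arbitrary: f g)
  case 0 then show ?case by (auto intro: bounded_bilinear.continuous_on[OF B])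
next
  case (Suc n)
  from Suc.prems obtain f' g' where
    d: "\<forall>x\<in>U. (f has_derivative f' x) (at x within K)" "\<forall>v\<in>K. differentiable_times n K U (\<lambda>x. f' x v)"
    "\<forall>x\<in>U. (g has_derivative g' x) (at x within K)" "\<forall>v\<in>K. differentiable_times n K U (\<lambda>x. g' x v)"
    by auto
  have fg: "differentiable_times n K U f" "differentiable_times n K U g"
    using Suc.prems U by (auto intro: differentiable_times_Suc_imp simp del: differentiable_times.simps)
  have "differentiable_times n K U (\<lambda>x. B (f x) (g' x v) + B (f' x v) (g x))" if "v \<in> K" for v
    by (intro differentiable_times_add Suc.IH fg d(2)[rule_format, OF that] d(4)[rule_format, OF that])
  then show ?case unfolding differentiable_times.simps
    by (intro exI[of _ "\<lambda>x v. B (f x) (g' x v) + B (f' x v) (g x)"])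
       (use d(1,3) in \<open>auto intro: bounded_bilinear.FDERIV[OF B]\<close>)
qed

lemma differentiable_times_inverse:
  fixes f :: "'m::real_normed_vector \<Rightarrow> complex"
  assumes U: "U \<subseteq> K" and nz: "\<And>x. x \<in> U \<Longrightarrow> f x \<noteq> 0"
  shows "differentiable_times n K U f \<Longrightarrow> differentiable_times n K U (\<lambda>x. inverse (f x))"
proof (induction n)
  case 0 then show ?case using nz by (auto intro!: continuous_intros)
next
  case (Suc n)
  from Suc.prems obtain f' where
    d: "\<forall>x\<in>U. (f has_derivative f' x) (at x within K)" "\<forall>v\<in>K. differentiable_times n K U (\<lambda>x. f' x v)"
    by auto
  have i: "differentiable_times n K U (\<lambda>x. inverse (f x))"
    by (rule Suc.IH[OF differentiable_times_Suc_imp[OF Suc.prems U]])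
  note mult = differentiable_times_bilinear[OF bounded_bilinear_mult U]
  have "differentiable_times n K U (\<lambda>x. - (inverse (f x) * f' x v * inverse (f x)))" if "v \<in> K" for v
    using mult[OF differentiable_times_const[of n K U "- 1"] mult[OF mult[OF i d(2)[rule_format, OF that]] i]] by simp
  then show ?case unfolding differentiable_times.simps
    by (intro exI[of _ "\<lambda>x v. - (inverse (f x) * f' x v * inverse (f x))"]) (use d nz in \<open>auto intro: has_derivative_inverse\<close>)
qed

text \<open>The derivative of \<open>r = f^(-1/2)\<close> is \<open>- r\<^sup>3 f' / 2\<close>, which involves \<open>r\<close> only to an order of
  differentiability that the induction has already reached.\<close>

lemma differentiable_times_inverse_sqrt:
  fixes f :: "'m::real_normed_vector \<Rightarrow> real"
  assumes U: "U \<subseteq> K" and pos: "\<And>x. x \<in> U \<Longrightarrow> f x > 0"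
  shows "differentiable_times n K U f \<Longrightarrow> differentiable_times n K U (\<lambda>x. inverse (sqrt (f x)))"
proof (induction n)
  case 0 then show ?case using pos by (force intro!: continuous_intros)
next
  case (Suc n)
  from Suc.prems obtain f' where
    d: "\<forall>x\<in>U. (f has_derivative f' x) (at x within K)" "\<forall>v\<in>K. differentiable_times n K U (\<lambda>x. f' x v)"
    by auto
  define r where "r = (\<lambda>x. inverse (sqrt (f x)))"
  have i: "differentiable_times n K U r" unfolding r_def
    by (rule Suc.IH[OF differentiable_times_Suc_imp[OF Suc.prems U]])
  note mult = differentiable_times_bilinear[OF bounded_bilinear_mult U]
  have "differentiable_times n K U (\<lambda>x. (- (1/2)) * (r x * (r x * r x)) * f' x v)" if "v \<in> K" for v
    by (intro mult differentiable_times_const i d(2)[rule_format, OF that])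
  moreover have "(r has_derivative (\<lambda>v. (- (1/2)) * (r x * (r x * r x)) * f' x v)) (at x within K)" if "x \<in> U" for x
  proof -
    have "((\<lambda>t. inverse (sqrt t)) has_field_derivative (- (1/2)) * (r x * (r x * r x))) (at (f x))"
      using pos[OF that] by (auto intro!: derivative_eq_intros simp: r_def divide_simps)
    from has_derivative_compose[OF d(1)[rule_format, OF that] this[unfolded has_field_derivative_def]]
    show ?thesis by (simp add: r_def)
  qed
  ultimately show ?case unfolding differentiable_times.simps r_def[symmetric]
    by (intro exI[of _ "\<lambda>x v. (- (1/2)) * (r x * (r x * r x)) * f' x v"]) blast
qed

text \<open>Derivatives along \<open>K\<close> look at the nearby points of \<open>K\<close>, so agreement on \<open>U\<close> suffices only because \<open>U\<close> is
  open in \<open>K\<close>.\<close>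

lemma differentiable_times_cong:
  assumes U: "openin (top_of_set K) U" and eq: "\<And>x. x \<in> U \<Longrightarrow> f x = g x"
    and f: "differentiable_times n K U f"
  shows "differentiable_times n K U g"
proof (cases n)
  case 0
  then show ?thesis using f continuous_on_cong[of U U f g] eq by simp
next
  case (Suc m)
  then obtain f' where f': "\<forall>x\<in>U. (f has_derivative f' x) (at x within K)" "\<forall>v\<in>K. differentiable_times m K U (\<lambda>x. f' x v)"
    using f by auto
  obtain T where T: "open T" "U = K \<inter> T" using U by (auto simp: openin_open)
  have "(g has_derivative f' x) (at x within K)" if x: "x \<in> U" for x
  proof -
    obtain e where e: "e > 0" "ball x e \<subseteq> T" using T x open_contains_ball by blast
    show ?thesis
    proof (rule has_derivative_transform_within[OF f'(1)[rule_format, OF x] e(1)])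
      show "x \<in> K" using x T by auto
      show "f y = g y" if "y \<in> K" "dist y x < e" for y
        using that e T by (intro eq) (auto simp: dist_commute subset_iff)
    qed
  qed
  then show ?thesis using f'(2) by (auto simp: Suc)
qed

lemma smooth_on_cong:
  assumes "openin (top_of_set K) U" "\<And>x. x \<in> U \<Longrightarrow> f x = g x" "smooth_on K U f"
  shows "smooth_on K U g"
  unfolding smooth_on_def
  by (intro allI differentiable_times_cong[OF assms(1,2)]) (use assms(3) in \<open>simp_all add: smooth_on_def\<close>)

section \<open>The smooth structure of projective space\<close>

lemma topspace_projective: "topspace projective_topology = ray ` (- {0 :: 'h::complex_hilbert_space})"
  by (simp add: projective_topology_def topspace_quotient_topology)

lemma quotient_map_ray: "quotient_map (top_of_set (- {0 :: 'h::complex_hilbert_space})) projective_topology ray"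
  unfolding projective_topology_def by (rule quotient_map_quotient_topology)

lemma ray_in_affine_domain: "ray z \<in> affine_domain h \<longleftrightarrow> cinner h (z::'h::complex_hilbert_space) \<noteq> 0"
proof
  assume "ray z \<in> affine_domain h"
  then obtain y where "ray z = ray y" "cinner h y \<noteq> 0" by (auto simp: affine_domain_def)
  then show "cinner h z \<noteq> 0" by (auto elim!: ray_eqE simp: cinner_simps)
qed (auto simp: affine_domain_def)

lemma affine_domain_subset: "affine_domain h \<subseteq> ray ` (- {0 :: 'h::complex_hilbert_space})"
proof
  fix p assume "p \<in> affine_domain h"
  then obtain z where "p = ray z" "cinner h z \<noteq> 0" unfolding affine_domain_def by blast
  then have "z \<in> - {0}" by auto
  then show "p \<in> ray ` (- {0})" unfolding \<open>p = ray z\<close> by (rule imageI)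
qed

lemma affine_domain_preimage:
  "{z \<in> topspace (top_of_set (- {0 :: 'h::complex_hilbert_space})). ray z \<in> affine_domain h} = {z. cinner h z \<noteq> 0}"
  by (auto simp: ray_in_affine_domain)

lemma open_affine_cone: "open {z :: 'h::complex_hilbert_space. cinner h z \<noteq> 0}"
  by (intro open_Collect_neq continuous_intros)

lemma openin_affine_domain: "openin projective_topology (affine_domain (h :: 'h::complex_hilbert_space))"
proof -
  have "openin (top_of_set (- {0})) {z :: 'h. cinner h z \<noteq> 0}"
    by (rule open_subset[OF _ open_affine_cone]) auto
  then show ?thesis
    unfolding projective_topology_def openin_quotient_topology affine_domain_preimage
    using affine_domain_subset by (intro conjI) simp_all
qed

lemma affine_chart_ray:
  assumes "cinner h z \<noteq> 0"
  shows "affine_chart h (ray z) = inverse (cinner h z) *\<^sub>C z - (h::'h::complex_hilbert_space)"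
proof -
  have "inverse (cinner h y) *\<^sub>C y - h = inverse (cinner h z) *\<^sub>C z - h" if y: "y \<in> ray z" for y
  proof -
    obtain c where c: "c \<noteq> 0" "y = c *\<^sub>C z" using y by (auto simp: ray_def)
    then have "inverse (c * cinner h z) * c = inverse (cinner h z)" by simp
    then show ?thesis by (simp only: c(2) cinner_scaleC_right scaleC_scaleC)
  qed
  then have "(\<lambda>z. inverse (cinner h z) *\<^sub>C z - h) ` ray z = {inverse (cinner h z) *\<^sub>C z - h}"
    using ray_self[of z] by blast
  then show ?thesis by (simp add: affine_chart_def)
qed

lemma affine_chart_inverse:
  assumes h: "norm h = 1" and w: "cinner h w = 0"
  shows "ray (w + h) \<in> affine_domain h" "affine_chart h (ray (w + h)) = (w::'h::complex_hilbert_space)"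
proof -
  have "cinner h (w + h) = 1" using h w by (simp add: cinner_simps cinner_self)
  then show "ray (w + h) \<in> affine_domain h" "affine_chart h (ray (w + h)) = w"
    by (simp_all add: ray_in_affine_domain affine_chart_ray scaleC_one)
qed

lemma ray_affine_chart:
  assumes "p \<in> affine_domain h"
  shows "ray (affine_chart h p + h) = p" "cinner h (affine_chart h p + h) = 1"
proof -
  obtain z where z: "p = ray z" "cinner h z \<noteq> 0" using assms by (auto simp: affine_domain_def)
  then show "ray (affine_chart h p + h) = p" "cinner h (affine_chart h p + h) = 1"
    by (simp_all add: affine_chart_ray ray_scaleC cinner_simps)
qed

lemma affine_chart_in:
  assumes "norm h = 1" "p \<in> affine_domain h" shows "cinner h (affine_chart h p) = 0"
  using ray_affine_chart(2)[OF assms(2)] assms(1) by (simp add: cinner_simps cinner_self)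

lemma affine_chart_image:
  assumes "norm h = 1"
  shows "affine_chart h ` affine_domain h = {w :: 'h::complex_hilbert_space. cinner h w = 0}"
proof (intro equalityI subsetI)
  fix w assume "w \<in> {w. cinner h w = 0}"
  then have "ray (w + h) \<in> affine_domain h" "w = affine_chart h (ray (w + h))"
    using affine_chart_inverse[OF assms, of w] by simp_all
  then show "w \<in> affine_chart h ` affine_domain h" by (intro image_eqI)
next
  fix w assume "w \<in> affine_chart h ` affine_domain h"
  then obtain p where "p \<in> affine_domain h" "w = affine_chart h p" by (rule imageE)
  then show "w \<in> {w. cinner h w = 0}" by (simp add: affine_chart_in assms)
qed

lemma inj_on_affine_chart: "inj_on (affine_chart h) (affine_domain (h :: 'h::complex_hilbert_space))"
  by (rule inj_on_inverseI[where g = "\<lambda>w. ray (w + h)"]) (rule ray_affine_chart(1))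

lemma inv_into_affine_chart:
  assumes "norm h = 1" "cinner h w = 0"
  shows "inv_into (affine_domain h) (affine_chart h) w = ray (w + (h :: 'h::complex_hilbert_space))"
  using inv_into_f_f[OF inj_on_affine_chart affine_chart_inverse(1)[OF assms]]
  by (simp add: affine_chart_inverse(2)[OF assms])

lemma continuous_map_affine_chart:
  "continuous_map (subtopology projective_topology (affine_domain h)) euclidean (affine_chart (h :: 'h::complex_hilbert_space))"
proof (rule continuous_compose_quotient_map)
  show "quotient_map (subtopology (top_of_set (- {0})) {z. cinner h z \<noteq> 0}) (subtopology projective_topology (affine_domain h)) ray"
    by (rule quotient_map_restriction[OF quotient_map_ray affine_domain_preimage]) (simp add: openin_affine_domain)
  have e: "subtopology (top_of_set (- {0})) {z. cinner h z \<noteq> 0} = top_of_set {z. cinner h z \<noteq> 0}"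
    unfolding subtopology_subtopology by (rule arg_cong[of _ _ top_of_set]) auto
  have "continuous_on {z. cinner h z \<noteq> 0} (\<lambda>z. inverse (cinner h z) *\<^sub>C z - h)"
    by (intro continuous_intros) auto
  then have "continuous_on {z. cinner h z \<noteq> 0} (affine_chart h \<circ> ray)"
    by (rule continuous_on_eq) (simp add: affine_chart_ray)
  then show "continuous_map (subtopology (top_of_set (- {0})) {z. cinner h z \<noteq> 0}) euclidean (affine_chart h \<circ> ray)"
    by (simp add: e)
qed

lemma continuous_map_ray: "continuous_map (top_of_set (- {0 :: 'h::complex_hilbert_space})) projective_topology ray"
  by (rule quotient_imp_continuous_map[OF quotient_map_ray])

lemma homeomorphic_affine_chart:
  assumes h: "norm (h :: 'h::complex_hilbert_space) = 1"
  shows "homeomorphic_map (subtopology projective_topology (affine_domain h))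
    (top_of_set {w. cinner h w = 0}) (affine_chart h)"
proof -
  have top: "topspace (subtopology projective_topology (affine_domain h)) = affine_domain h"
    unfolding topspace_subtopology topspace_projective by (rule Int_absorb1[OF affine_domain_subset])
  have c1: "continuous_map (subtopology projective_topology (affine_domain h)) (top_of_set {w. cinner h w = 0}) (affine_chart h)"
    unfolding continuous_map_in_subtopology top
    using continuous_map_affine_chart affine_chart_in[OF h] by auto
  have "continuous_map (top_of_set {w. cinner h w = 0}) (top_of_set (- {0})) (\<lambda>w. w + h)"
    unfolding continuous_map_in_subtopology
  proof
    show "(\<lambda>w. w + h) \<in> topspace (top_of_set {w. cinner h w = 0}) \<rightarrow> - {0}"
    proof
      fix w assume "w \<in> topspace (top_of_set {w. cinner h w = 0})"
      then have "cinner h (w + h) = 1" using h by (simp add: cinner_simps cinner_self)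
      then show "w + h \<in> - {0}" by auto
    qed
  qed (auto intro!: continuous_intros)
  then have "continuous_map (top_of_set {w. cinner h w = 0}) projective_topology (ray \<circ> (\<lambda>w. w + h))"
    by (rule continuous_map_compose[OF _ continuous_map_ray])
  then have c2: "continuous_map (top_of_set {w. cinner h w = 0}) (subtopology projective_topology (affine_domain h)) (ray \<circ> (\<lambda>w. w + h))"
    unfolding continuous_map_in_subtopology using affine_chart_inverse(1)[OF h] by auto
  have "homeomorphic_maps (subtopology projective_topology (affine_domain h)) (top_of_set {w. cinner h w = 0})
      (affine_chart h) (ray \<circ> (\<lambda>w. w + h))"
    unfolding homeomorphic_maps_def top using c1 c2
    by (simp add: ray_affine_chart(1) affine_chart_inverse(2)[OF h])
  then show ?thesis unfolding homeomorphic_map_maps by blast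
qed

lemma subspace_orthogonal: "subspace {w :: 'h::complex_hilbert_space. cinner h w = 0}"
  by (auto simp: subspace_def cinner_simps)

lemma closed_orthogonal: "closed {w :: 'h::complex_hilbert_space. cinner h w = 0}"
  by (intro closed_Collect_eq continuous_intros)

lemma affine_chart_image_Int:
  assumes h: "norm (h :: 'h::complex_hilbert_space) = 1"
  shows "affine_chart h ` (affine_domain h \<inter> affine_domain k) = {w. cinner h w = 0} \<inter> {w. cinner k (w + h) \<noteq> 0}"
proof (intro equalityI subsetI)
  fix w assume "w \<in> affine_chart h ` (affine_domain h \<inter> affine_domain k)"
  then obtain p where p: "p \<in> affine_domain h" "p \<in> affine_domain k" "w = affine_chart h p" by blast
  then show "w \<in> {w. cinner h w = 0} \<inter> {w. cinner k (w + h) \<noteq> 0}"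
    using affine_chart_in[OF h p(1)] ray_affine_chart(1)[OF p(1)] p(2) 
      ray_in_affine_domain[of "affine_chart h p + h" k] by (simp add: p(3))
next
  fix w assume w: "w \<in> {w. cinner h w = 0} \<inter> {w. cinner k (w + h) \<noteq> 0}"
  then have "ray (w + h) \<in> affine_domain h \<inter> affine_domain k"
    using affine_chart_inverse(1)[OF h] by (simp add: ray_in_affine_domain)
  moreover have "w = affine_chart h (ray (w + h))" using affine_chart_inverse(2)[OF h, of w] w by simp
  ultimately show "w \<in> affine_chart h ` (affine_domain h \<inter> affine_domain k)" by (intro image_eqI)
qed

lemma openin_affine_chart_image_Int:
  assumes h: "norm (h :: 'h::complex_hilbert_space) = 1"
  shows "openin (top_of_set {w. cinner h w = 0}) (affine_chart h ` (affine_domain h \<inter> affine_domain k))"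
  unfolding affine_chart_image_Int[OF h]
  by (intro openin_open_Int open_Collect_neq continuous_intros)

lemma differentiable_times_affine_cinner:
  "differentiable_times n K U (\<lambda>w. cinner k (w + (h :: 'h::complex_hilbert_space)))"
  unfolding cinner_add_right
  by (intro differentiable_times_add differentiable_times_const differentiable_times_bounded_linear bounded_linear_cinner_right)

text \<open>In the charts at \<open>h\<close> and \<open>k\<close> the transition is \<open>w \<mapsto> (w + h) / \<langle>k|w + h\<rangle> - k\<close>.\<close>

lemma smooth_affine_transition:
  assumes h: "norm (h :: 'h::complex_hilbert_space) = 1"
  shows "smooth_on {w. cinner h w = 0} (affine_chart h ` (affine_domain h \<inter> affine_domain k))
    (affine_chart k \<circ> inv_into (affine_domain h) (affine_chart h))"
proof (rule smooth_on_cong[OF openin_affine_chart_image_Int[OF h]])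
  let ?U = "affine_chart h ` (affine_domain h \<inter> affine_domain k)"
  fix w assume "w \<in> ?U"
  then have w: "cinner h w = 0" "cinner k (w + h) \<noteq> 0" unfolding affine_chart_image_Int[OF h] by auto
  show "inverse (cinner k (w + h)) *\<^sub>C (w + h) + - k = (affine_chart k \<circ> inv_into (affine_domain h) (affine_chart h)) w"
    by (simp add: inv_into_affine_chart[OF h w(1)] affine_chart_ray w)
next
  let ?U = "affine_chart h ` (affine_domain h \<inter> affine_domain k)"
  have U: "?U \<subseteq> {w. cinner h w = 0}" unfolding affine_chart_image_Int[OF h] by auto
  have nz: "cinner k (w + h) \<noteq> 0" if "w \<in> ?U" for w using that unfolding affine_chart_image_Int[OF h] by auto
  have id: "differentiable_times n {w. cinner h w = 0} ?U (\<lambda>w. w)" for n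
    by (rule differentiable_times_bounded_linear[OF bounded_linear_ident])
  show "smooth_on {w. cinner h w = 0} ?U (\<lambda>w. inverse (cinner k (w + h)) *\<^sub>C (w + h) + - k)"
    unfolding smooth_on_def
    by (intro allI differentiable_times_add differentiable_times_const id
        differentiable_times_bilinear[OF bounded_bilinear_scaleC U]
        differentiable_times_inverse[OF U nz] differentiable_times_affine_cinner)
qed

lemma affine_domain_cover:
  "(\<Union>h\<in>{h. norm h = 1}. affine_domain h) = ray ` (- {0 :: 'h::complex_hilbert_space})"
proof (intro equalityI subsetI)
  fix p assume "p \<in> ray ` (- {0 :: 'h})"
  then obtain z where z: "z \<noteq> 0" "p = ray z" by blast
  define h where "h = (1 / norm z) *\<^sub>R z"
  have "norm h = 1" "cinner h z \<noteq> 0" using z by (simp_all add: h_def cinner_simps cinner_self)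
  then have "p \<in> affine_domain h" by (simp add: ray_in_affine_domain z)
  then show "p \<in> (\<Union>h\<in>{h. norm h = 1}. affine_domain h)" using \<open>norm h = 1\<close> by blast
next
  fix p assume "p \<in> (\<Union>h\<in>{h::'h. norm h = 1}. affine_domain h)"
  then obtain h where "p \<in> affine_domain h" by blast
  then show "p \<in> ray ` (- {0 :: 'h})" by (rule subsetD[OF affine_domain_subset])
qed

lemma smooth_atlas_projective:
  "smooth_atlas projective_topology (projective_charts :: ('h::complex_hilbert_space set set \<times> ('h set \<Rightarrow> 'h) \<times> 'h set) set)"
  unfolding smooth_atlas_def
proof (intro conjI ballI)
  show "(\<Union>(U, \<beta>, K)\<in>projective_charts. U) = topspace (projective_topology :: 'h set topology)"
    unfolding topspace_projective affine_domain_cover[symmetric] projective_charts_def by blast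
next
  fix C :: "'h set set \<times> ('h set \<Rightarrow> 'h) \<times> 'h set" assume "C \<in> projective_charts"
  then obtain h where h: "norm h = 1" "C = (affine_domain h, affine_chart h, {w. cinner h w = 0})"
    by (auto simp: projective_charts_def)
  show "case C of (U, \<beta>, K) \<Rightarrow> openin projective_topology U \<and> subspace K \<and> closed K \<and> openin (top_of_set K) (\<beta> ` U) \<and>
        homeomorphic_map (subtopology projective_topology U) (top_of_set (\<beta> ` U)) \<beta>"
    by (simp add: h affine_chart_image openin_affine_domain subspace_orthogonal closed_orthogonal homeomorphic_affine_chart)
  show "case C of (U, \<beta>, K) \<Rightarrow> \<forall>(U', \<beta>', K')\<in>projective_charts. smooth_on K (\<beta> ` (U \<inter> U')) (\<beta>' \<circ> inv_into U \<beta>)"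
    using smooth_affine_transition[OF h(1)] by (auto simp: h(2) projective_charts_def)
qed

section \<open>The bundle associated with the Hopf bundle\<close>

lemma cmod_1_cnj: "cmod c = 1 \<Longrightarrow> c * cnj c = 1" "cmod c = 1 \<Longrightarrow> cnj c * c = 1"
  using complex_norm_square[of c] by (simp_all add: mult.commute)

lemma topspace_vtopology:
  assumes "inner_product_space F" shows "topspace (vtopology F) = vcarrier F"
  using Metric_space.topspace_mtopology[OF inner_product_space.metric[OF assms]] by (simp add: vtopology_def)

lemma continuous_map_vscale:
  assumes F: "inner_product_space F"
  shows "continuous_map (prod_topology euclidean (vtopology F)) (vtopology F) (\<lambda>(c, f). vscale F c f)"
proof -
  interpret inner_product_space F by (rule F)
  interpret M: Metric_space "vcarrier F" "vdist F" by (rule metric)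
  show ?thesis
    unfolding vtopology_def M.continuous_map_to_metric
  proof (intro ballI allI impI)
    fix x :: "complex \<times> 'a" and \<epsilon> :: real
    assume x: "x \<in> topspace (prod_topology euclidean M.mtopology)" and e: "\<epsilon> > 0"
    obtain c f where cf: "x = (c, f)" by (cases x)
    have f: "f \<in> vcarrier F" using x by (simp add: cf)
    define \<delta> where "\<delta> = min 1 (\<epsilon> / (2 * (vnorm F f + 1)))"
    define \<delta>' where "\<delta>' = \<epsilon> / (2 * (cmod c + 1))"
    have nf: "vnorm F f \<ge> 0" by (rule vnorm_nonneg[OF f])
    have c1: "cmod c + 1 > 0" by (simp add: add_nonneg_pos)
    have d: "\<delta> > 0" "\<delta>' > 0" using e nf c1 by (simp_all add: \<delta>_def \<delta>'_def)
    define U where "U = ball c \<delta> \<times> M.mball f \<delta>'"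
    have "openin (prod_topology euclidean M.mtopology) U"
      unfolding U_def openin_prod_Times_iff by (auto simp: open_openin[symmetric])
    moreover have "x \<in> U" using d f by (simp add: U_def cf)
    moreover have "(case y of (c, f) \<Rightarrow> vscale F c f) \<in> M.mball (case x of (c, f) \<Rightarrow> vscale F c f) \<epsilon>" if "y \<in> U" for y
    proof -
      obtain c' f' where y: "y = (c', f')" by (cases y)
      have c': "cmod (c - c') < \<delta>" and f': "f' \<in> vcarrier F" and ff: "vdist F f f' < \<delta>'"
        using that by (auto simp: U_def y dist_norm)
      have cc: "cmod c' \<le> cmod c + 1" using c' norm_triangle_ineq2[of c' c] by (simp add: \<delta>_def norm_minus_commute)
      have "vadd F (vscale F c f) (vscale F (-1) (vscale F c' f)) = vscale F (c - c') f"
        by (rule ext) (simp_all add: f ips_simps algebra_simps)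
      then have 1: "vdist F (vscale F c f) (vscale F c' f) = cmod (c - c') * vnorm F f"
        by (simp add: vdist_eq f scale_closed vnorm_scale)
      have "vdist F (vscale F c f) (vscale F c' f') \<le> cmod (c - c') * vnorm F f + cmod c' * vdist F f f'"
        using vdist_triangle[of "vscale F c f" "vscale F c' f" "vscale F c' f'"] 1
        by (simp add: f f' scale_closed vdist_scale)
      also have "\<dots> < \<epsilon>"
      proof -
        have "cmod (c - c') * vnorm F f \<le> (\<epsilon> / (2 * (vnorm F f + 1))) * vnorm F f"
          using c' nf by (intro mult_right_mono) (auto simp: \<delta>_def)
        also have "\<dots> \<le> \<epsilon> / 2" using e nf by (simp add: field_simps)
        finally have a: "cmod (c - c') * vnorm F f \<le> \<epsilon> / 2" .
        have "cmod c' * vdist F f f' \<le> (cmod c + 1) * vdist F f f'"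
          by (rule mult_right_mono[OF cc vdist_nonneg])
        also have "\<dots> < (cmod c + 1) * \<delta>'" using ff c1 by (rule mult_strict_left_mono)
        also have "\<dots> = \<epsilon> / 2"
        proof -
          have "a * (\<epsilon> / (2 * a)) = \<epsilon> / 2" if "a > 0" for a :: real using that by simp
          from this[OF c1] show ?thesis unfolding \<delta>'_def .
        qed
        finally show ?thesis using a by simp
      qed
      finally show ?thesis by (simp add: y cf f f' scale_closed)
    qed
    ultimately show "\<exists>U. openin (prod_topology euclidean M.mtopology) U \<and> x \<in> U \<and>
        (\<forall>y\<in>U. (case y of (c, f) \<Rightarrow> vscale F c f) \<in> M.mball (case x of (c, f) \<Rightarrow> vscale F c f) \<epsilon>)" by blast
  qed
qed

lemma differentiable_times_compose_linear:
  assumes L: "bounded_linear L"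
  shows "differentiable_times n K U f \<Longrightarrow> differentiable_times n K U (\<lambda>x. L (f x))"
proof (induction n arbitrary: f)
  case 0
  then show ?case using bounded_linear.continuous_on[OF L] by auto
next
  case (Suc n)
  then obtain f' where d: "\<forall>x\<in>U. (f has_derivative f' x) (at x within K)" "\<forall>v\<in>K. differentiable_times n K U (\<lambda>x. f' x v)"
    by auto
  show ?case unfolding differentiable_times.simps
    by (intro exI[of _ "\<lambda>x v. L (f' x v)"]) (use d Suc.IH in \<open>auto intro: bounded_linear.has_derivative[OF L]\<close>)
qed

lemma image_eq_singletonI: "a \<in> A \<Longrightarrow> (\<And>x. x \<in> A \<Longrightarrow> f x = c) \<Longrightarrow> f ` A = {c}"
  by auto

locale hopf_associated = hilbert_space F for F :: "'f ips"
begin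

abbreviation orb :: "'h::complex_hilbert_space \<times> 'f \<Rightarrow> ('h \<times> 'f) set" where
  "orb \<equiv> hopf_orbit F"

lemma in_orb: "(y, g) \<in> orb (z, f) \<longleftrightarrow> (\<exists>c. cmod c = 1 \<and> y = c *\<^sub>C z \<and> g = vscale F c f)"
proof
  assume "(y, g) \<in> orb (z, f)"
  then obtain c where "cmod c = 1" "y = cnj c *\<^sub>C z" "g = vscale F (cnj c) f" by (auto simp: hopf_orbit_def)
  then show "\<exists>c. cmod c = 1 \<and> y = c *\<^sub>C z \<and> g = vscale F c f" by (intro exI[of _ "cnj c"]) simp
next
  assume "\<exists>c. cmod c = 1 \<and> y = c *\<^sub>C z \<and> g = vscale F c f"
  then obtain c where "cmod c = 1" "y = c *\<^sub>C z" "g = vscale F c f" by blast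
  then show "(y, g) \<in> orb (z, f)" by (auto simp: hopf_orbit_def intro!: exI[of _ "cnj c"])
qed

lemma orb_self: "f \<in> vcarrier F \<Longrightarrow> (z, f) \<in> orb (z, f)"
  unfolding in_orb by (rule exI[of _ 1]) (simp add: scaleC_one scale_one)

lemma orb_scale:
  fixes z :: "'h::complex_hilbert_space"
  assumes c: "cmod c = 1" and f: "f \<in> vcarrier F"
  shows "orb (c *\<^sub>C z, vscale F c f) = orb (z, f)"
proof (rule set_eqI)
  fix p :: "'h \<times> 'f" obtain y g where p: "p = (y, g)" by (cases p)
  have "(\<exists>d. cmod d = 1 \<and> y = d *\<^sub>C c *\<^sub>C z \<and> g = vscale F d (vscale F c f)) \<longleftrightarrow>
        (\<exists>d. cmod d = 1 \<and> y = d *\<^sub>C z \<and> g = vscale F d f)" (is "?l \<longleftrightarrow> ?r")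
  proof
    assume ?l
    then obtain d where "cmod d = 1" "y = d *\<^sub>C c *\<^sub>C z" "g = vscale F d (vscale F c f)" by blast
    then show ?r by (intro exI[of _ "d * c"]) (simp add: norm_mult c scaleC_scaleC scale_scale f)
  next
    assume ?r
    then obtain d where "cmod d = 1" "y = d *\<^sub>C z" "g = vscale F d f" by blast
    then show ?l
      by (intro exI[of _ "d * cnj c"]) (simp add: norm_mult c scaleC_scaleC scale_scale f mult.assoc cmod_1_cnj)
  qed
  then show "p \<in> orb (c *\<^sub>C z, vscale F c f) \<longleftrightarrow> p \<in> orb (z, f)" by (simp add: p in_orb)
qed

lemma orb_eqD:
  assumes "orb (y, g) = orb (z, f)" "g \<in> vcarrier F"
  obtains c where "cmod c = 1" "y = c *\<^sub>C z" "g = vscale F c f"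
  using orb_self[OF assms(2), of y] assms(1) by (auto simp: in_orb)

text \<open>The circle acts freely on the sphere, so a point of the base sphere selects a unique representative.\<close>

lemma orb_same_base:
  assumes "orb (z, g) = orb (z, f)" "g \<in> vcarrier F" "f \<in> vcarrier F" "norm z = 1"
  shows "g = f"
proof -
  obtain c where c: "cmod c = 1" "z = c *\<^sub>C z" "g = vscale F c f" using orb_eqD[OF assms(1,2)] .
  have "(c - 1) *\<^sub>C z = 0" using c(2) by (simp add: scaleC_diff_left scaleC_one)
  then have "c = 1" using assms(4) by (auto simp: scaleC_eq_0_iff)
  then show ?thesis using c assms(3) by (simp add: scale_one)
qed

lemma ray_unit_image_orb: "cmod c = 1 \<Longrightarrow> ray (c *\<^sub>C z) = ray (z::'h::complex_vector)"
  by (rule ray_scaleC) auto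

lemma assoc_proj_orb: "f \<in> vcarrier F \<Longrightarrow> assoc_proj (orb (z, f)) = ray z"
proof -
  assume f: "f \<in> vcarrier F"
  have "(\<lambda>(z, f). ray z) ` orb (z, f) = {ray z}"
    by (rule image_eq_singletonI[OF orb_self[OF f, of z]]) (auto simp: in_orb ray_unit_image_orb)
  then show ?thesis by (simp add: assoc_proj_def)
qed

lemma hopf_phase_scale:
  assumes "cmod c = 1" shows "hopf_phase h (c *\<^sub>C z) = cnj c * hopf_phase h (z::'h::complex_hilbert_space)"
  by (simp add: hopf_phase_def cinner_simps norm_mult assms)

lemma cmod_hopf_phase: "cinner h z \<noteq> 0 \<Longrightarrow> cmod (hopf_phase h (z::'h::complex_hilbert_space)) = 1"
  using cinner_commute[of z h] by (simp add: hopf_phase_def norm_divide)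

lemma assoc_triv_orb:
  assumes f: "f \<in> vcarrier F"
  shows "assoc_triv F h (orb (z, f)) = (ray z, vscale F (hopf_phase h z) f)"
proof -
  have "(ray y, vscale F (hopf_phase h y) g) = (ray z, vscale F (hopf_phase h z) f)" if yg: "(y, g) \<in> orb (z, f)" for y g
  proof -
    obtain c where c: "cmod c = 1" "y = c *\<^sub>C z" "g = vscale F c f" using yg by (auto simp: in_orb)
    have "cnj c * hopf_phase h z * c = hopf_phase h z" using cmod_1_cnj[OF c(1)] by (simp add: algebra_simps)
    then have "vscale F (cnj c * hopf_phase h z) (vscale F c f) = vscale F (hopf_phase h z) f"
      by (simp only: scale_scale f)
    then show ?thesis by (simp add: c ray_unit_image_orb hopf_phase_scale)
  qed
  then have "(\<lambda>(z, f). (ray z, vscale F (hopf_phase h z) f)) ` orb (z, f) = {(ray z, vscale F (hopf_phase h z) f)}"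
    by (intro image_eq_singletonI[OF orb_self[OF f, of z]]) (simp only: split_paired_all prod.case)
  then show ?thesis by (simp add: assoc_triv_def)
qed

lemma assoc_totalE:
  assumes "w \<in> assoc_total F" obtains z f where "norm z = 1" "f \<in> vcarrier F" "w = orb (z, f)"
  using assms by (auto simp: assoc_total_def)

lemma orb_in_total: "norm z = 1 \<Longrightarrow> f \<in> vcarrier F \<Longrightarrow> orb (z, f) \<in> assoc_total F"
  by (auto simp: assoc_total_def)

lemma assoc_total_over:
  assumes "w \<in> assoc_total F" "assoc_proj w = ray z" "norm z = 1"
  obtains f where "f \<in> vcarrier F" "w = orb (z, f)"
proof -
  obtain y g where y: "norm y = 1" "g \<in> vcarrier F" "w = orb (y, g)" using assms(1) by (rule assoc_totalE)
  then have "ray z = ray y" using assms(2) by (simp add: assoc_proj_orb)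
  then obtain c where c: "cmod c = 1" "z = c *\<^sub>C y" by (rule ray_eq_unitE) (use y assms in auto)
  have "w = orb (z, vscale F c g)" by (simp add: c orb_scale y)
  then show ?thesis by (rule that[rotated]) (simp add: scale_closed y)
qed

text \<open>Two orbits over the same ray have representatives with the same \<open>z\<close>, and freeness of the action makes
  them move by the same scalar when \<open>z\<close> moves.\<close>

lemma unitary_map_assoc_fibre:
  assumes z: "norm (z::'h::complex_hilbert_space) = 1"
  shows "unitary_map F (assoc_fibre F (ray z)) (\<lambda>f. orb (z, f))"
proof -
  have in2: "\<exists>c. cmod c = 1 \<and> y = c *\<^sub>C z \<and> f' = vscale F c f \<and> g' = vscale F c g"
    if yy: "(y, f') \<in> orb (z, f)" "(y, g') \<in> orb (z, g)" for y f f' g g'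
  proof -
    obtain c where c: "cmod c = 1" "y = c *\<^sub>C z" "f' = vscale F c f" using yy(1) by (auto simp: in_orb)
    obtain d where d: "cmod d = 1" "y = d *\<^sub>C z" "g' = vscale F d g" using yy(2) by (auto simp: in_orb)
    have "(c - d) *\<^sub>C z = 0" using c d by (simp add: scaleC_diff_left)
    then have "c = d" using z by (auto simp: scaleC_eq_0_iff)
    then show ?thesis using c d by blast
  qed
  show ?thesis
  proof (rule unitary_mapI)
    show "bij_betw (\<lambda>f. orb (z, f)) (vcarrier F) (vcarrier (assoc_fibre F (ray z)))"
      unfolding bij_betw_def
    proof
      show "inj_on (\<lambda>f. orb (z, f)) (vcarrier F)" using orb_same_base z by (auto intro!: inj_onI)
      show "(\<lambda>f. orb (z, f)) ` vcarrier F = vcarrier (assoc_fibre F (ray z))"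
      proof (intro equalityI subsetI)
        fix w assume "w \<in> vcarrier (assoc_fibre F (ray z))"
        then show "w \<in> (\<lambda>f. orb (z, f)) ` vcarrier F"
          using assoc_total_over[of w z] z by (auto simp: assoc_fibre_def)
      qed (auto simp: assoc_fibre_def assoc_proj_orb orb_in_total z)
    qed
    fix f g c assume f: "f \<in> vcarrier F"
    have s: "orb (y, vscale F a f') = orb (z, vscale F a f)" if yf: "(y, f') \<in> orb (z, f)" for y f' a
    proof -
      obtain c where c: "cmod c = 1" "y = c *\<^sub>C z" "f' = vscale F c f" using yf by (auto simp: in_orb)
      have "vscale F a (vscale F c f) = vscale F c (vscale F a f)" by (simp add: scale_scale f mult.commute)
      then show ?thesis by (simp add: c orb_scale scale_closed f)
    qed
    have "{orb (z', vscale F c f') |z' f'. (z', f') \<in> orb (z, f)} = {orb (z, vscale F c f)}"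
      using s orb_self[OF f, of z] by blast
    then show "orb (z, vscale F c f) = vscale (assoc_fibre F (ray z)) c (orb (z, f))"
      by (simp add: assoc_fibre_def)
    assume g: "g \<in> vcarrier F"
    have a: "orb (y, vadd F f' g') = orb (z, vadd F f g)" and i: "vinner F f' g' = vinner F f g"
      if yy: "(y, f') \<in> orb (z, f)" "(y, g') \<in> orb (z, g)" for y f' g'
    proof -
      obtain c where c: "cmod c = 1" "y = c *\<^sub>C z" "f' = vscale F c f" "g' = vscale F c g" using in2[OF yy] by blast
      have "vadd F (vscale F c f) (vscale F c g) = vscale F c (vadd F f g)" by (simp add: scale_add_right f g)
      then show "orb (y, vadd F f' g') = orb (z, vadd F f g)" by (simp add: c orb_scale add_closed f g)
      show "vinner F f' g' = vinner F f g"
        by (simp add: c ips_simps f g mult.assoc[symmetric] cmod_1_cnj)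
    qed
    have "{orb (z', vadd F f' g') |z' f' g'. (z', f') \<in> orb (z, f) \<and> (z', g') \<in> orb (z, g)} = {orb (z, vadd F f g)}"
      using a orb_self[OF f, of z] orb_self[OF g, of z] by blast
    then show "orb (z, vadd F f g) = vadd (assoc_fibre F (ray z)) (orb (z, f)) (orb (z, g))"
      by (simp add: assoc_fibre_def)
    have "{vinner F f' g' |z' f' g'. (z', f') \<in> orb (z, f) \<and> (z', g') \<in> orb (z, g)} = {vinner F f g}"
      using i orb_self[OF f, of z] orb_self[OF g, of z] by blast
    then show "vinner (assoc_fibre F (ray z)) (orb (z, f)) (orb (z, g)) = vinner F f g"
      by (simp add: assoc_fibre_def)
  qed
qed

abbreviation source :: "('h::complex_hilbert_space \<times> 'f) topology" where
  "source \<equiv> prod_topology (top_of_set (sphere 0 1)) (vtopology F)"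

abbreviation total_top :: "('h::complex_hilbert_space \<times> 'f) set topology" where
  "total_top \<equiv> quotient_topology source orb"

lemma topspace_source: "topspace source = sphere (0::'h::complex_hilbert_space) 1 \<times> vcarrier F"
  by (simp add: topspace_vtopology inner_product_space_axioms)

lemma topspace_total: "topspace total_top = (assoc_total F :: ('h::complex_hilbert_space \<times> 'f) set set)"
  unfolding topspace_quotient_topology topspace_source assoc_total_def ..

lemma continuous_map_assoc_proj:
  "continuous_map total_top projective_topology (assoc_proj :: ('h::complex_hilbert_space \<times> 'f) set \<Rightarrow> 'h set)"
proof (rule continuous_compose_quotient_map[OF quotient_map_quotient_topology])
  have "continuous_map source (top_of_set (sphere (0::'h) 1)) fst" by (rule continuous_map_fst)
  moreover have "continuous_map (top_of_set (sphere (0::'h) 1)) projective_topology ray"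
    using continuous_map_from_subtopology_mono[OF continuous_map_ray, of "sphere 0 1"] by auto
  ultimately have "continuous_map source projective_topology (ray \<circ> fst :: 'h \<times> 'f \<Rightarrow> 'h set)"
    by (rule continuous_map_compose)
  then show "continuous_map source projective_topology (assoc_proj \<circ> orb :: 'h \<times> 'f \<Rightarrow> 'h set)"
    by (rule continuous_map_eq) (auto simp: topspace_vtopology inner_product_space_axioms assoc_proj_orb)
qed

text \<open>The continuous section of the sphere over an affine domain on which the phase of \<open>h\<close> is \<open>1\<close>.\<close>

definition section_at :: "'h::complex_hilbert_space \<Rightarrow> 'h set \<Rightarrow> 'h" where
  "section_at h p = (1 / norm (affine_chart h p + h)) *\<^sub>R (affine_chart h p + h)"

lemma section_at:
  assumes p: "p \<in> affine_domain h"
  shows "norm (section_at h p) = 1" "ray (section_at h p) = p" "hopf_phase h (section_at h p) = 1"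
    "cinner h (section_at h p) \<noteq> 0"
proof -
  define v where "v = affine_chart h p + h"
  have v: "ray v = p" "cinner h v = 1" using ray_affine_chart[OF p] by (auto simp: v_def)
  have nv: "norm v > 0" using v(2) by auto
  have s: "section_at h p = of_real (1 / norm v) *\<^sub>C v" by (simp add: section_at_def v_def scaleR_scaleC)
  show "norm (section_at h p) = 1" using nv by (simp add: s norm_scaleC_hilbert norm_divide)
  show "ray (section_at h p) = p" using nv v(1) unfolding s by (subst ray_scaleC) auto
  have "cinner v h = 1" using cinner_commute[of v h] v(2) by simp
  then show "hopf_phase h (section_at h p) = 1" using nv v(2) by (simp add: s hopf_phase_def cinner_simps norm_divide)
  show "cinner h (section_at h p) \<noteq> 0" using nv v(2) by (simp add: s cinner_simps)
qed

lemma section_at_ray: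
  assumes z: "norm z = 1" and nz: "cinner h z \<noteq> 0"
  shows "section_at h (ray z) = hopf_phase h z *\<^sub>C z"
proof -
  have p: "ray z \<in> affine_domain h" using nz by (simp add: ray_in_affine_domain)
  have r: "ray (section_at h (ray z)) = ray z" by (rule section_at(2)[OF p])
  obtain c where c: "cmod c = 1" "section_at h (ray z) = c *\<^sub>C z"
    using ray_eq_unitE[OF r z section_at(1)[OF p]] .
  have "cnj c * hopf_phase h z = 1" using section_at(3)[OF p] by (simp add: c hopf_phase_scale)
  then have "c * (cnj c * hopf_phase h z) = c" by simp
  then have "hopf_phase h z = c" using cmod_1_cnj(1)[OF c(1)] by (simp add: mult.assoc[symmetric])
  then show ?thesis by (simp add: c)
qed

lemma continuous_map_section:
  "continuous_map (subtopology projective_topology (affine_domain h)) (top_of_set (sphere 0 1)) (section_at (h::'h::complex_hilbert_space))"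
  unfolding continuous_map_in_subtopology
proof
  have top: "topspace (subtopology projective_topology (affine_domain h)) = affine_domain h"
    unfolding topspace_subtopology topspace_projective by (rule Int_absorb1[OF affine_domain_subset])
  show "section_at h \<in> topspace (subtopology projective_topology (affine_domain h)) \<rightarrow> sphere 0 1"
    unfolding top by (auto simp: section_at(1))
  have nz: "continuous_map (subtopology projective_topology (affine_domain h)) (top_of_set (- {0})) (\<lambda>p. affine_chart h p + h)"
    unfolding continuous_map_in_subtopology
  proof
    have "continuous_map euclidean euclidean (\<lambda>w. w + h)" by (auto intro: continuous_intros)
    from continuous_map_compose[OF continuous_map_affine_chart[of h] this]
    show "continuous_map (subtopology projective_topology (affine_domain h)) euclidean (\<lambda>p. affine_chart h p + h)"
      by (simp add: o_def)
    show "(\<lambda>p. affine_chart h p + h) \<in> topspace (subtopology projective_topology (affine_domain h)) \<rightarrow> - {0}"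
      unfolding top
    proof
      fix p assume "p \<in> affine_domain h"
      then have "cinner h (affine_chart h p + h) = 1" by (rule ray_affine_chart(2))
      then show "affine_chart h p + h \<in> - {0}" by auto
    qed
  qed
  have "continuous_map (top_of_set (- {0})) euclidean (\<lambda>v::'h. (1 / norm v) *\<^sub>R v)"
    by (auto intro!: continuous_intros)
  from continuous_map_compose[OF nz this]
  show "continuous_map (subtopology projective_topology (affine_domain h)) euclidean (section_at h)"
    by (simp add: o_def section_at_def[abs_def])
qed

text \<open>The inverse of the trivialization sends \<open>(p, f)\<close> to the orbit of \<open>(s p, f)\<close>, where \<open>s\<close> is the section
  of phase \<open>1\<close>. Continuity of the trivialization itself is checked on the sphere times the fibre.\<close>

lemma local_trivialization_assoc:
  assumes h: "norm (h::'h::complex_hilbert_space) = 1"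
  shows "local_trivialization (associated_bundle F) (affine_domain h) (assoc_triv F h)"
proof -
  let ?U = "affine_domain h"
  let ?D = "{(z, f). cinner h z \<noteq> 0} :: ('h \<times> 'f) set"
  have top: "topspace (subtopology projective_topology ?U) = ?U"
    unfolding topspace_subtopology topspace_projective by (rule Int_absorb1[OF affine_domain_subset])
  have pre: "{x \<in> topspace source. orb x \<in> topspace total_top \<inter> assoc_proj -` ?U} = topspace source \<inter> ?D"
    unfolding topspace_source topspace_total
    by (auto simp: assoc_proj_orb ray_in_affine_domain orb_in_total)
  have opn: "openin total_top (topspace total_top \<inter> assoc_proj -` ?U)"
    using continuous_map_assoc_proj openin_affine_domain[of h] unfolding continuous_map_openin_preimage_eq by blast
  have sub_eq: "subtopology total_top (assoc_proj -` ?U) = subtopology total_top (topspace total_top \<inter> assoc_proj -` ?U)"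
    by (rule subtopology_restrict[symmetric])
  have qm: "quotient_map (subtopology source (topspace source \<inter> ?D)) (subtopology total_top (assoc_proj -` ?U)) orb"
    unfolding sub_eq by (rule quotient_map_restriction[OF quotient_map_quotient_topology pre]) (simp add: opn)
  have topD: "topspace (subtopology source (topspace source \<inter> ?D)) = {(z, f). norm z = 1 \<and> f \<in> vcarrier F \<and> cinner h z \<noteq> 0}"
    unfolding topspace_subtopology topspace_source by auto
  have c1: "continuous_map (subtopology total_top (assoc_proj -` ?U))
      (prod_topology (subtopology projective_topology ?U) (vtopology F)) (assoc_triv F h)"
  proof (rule continuous_compose_quotient_map[OF qm])
    let ?S = "subtopology source (topspace source \<inter> ?D)"
    have fst_c: "continuous_map ?S (top_of_set (sphere 0 1)) fst"
      by (intro continuous_map_from_subtopology continuous_map_fst)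
    have fst_e: "continuous_map ?S euclidean fst" using fst_c by (simp add: continuous_map_in_subtopology)
    have snd_c: "continuous_map ?S (vtopology F) snd"
      by (intro continuous_map_from_subtopology continuous_map_snd)
    have "continuous_map (top_of_set (sphere (0::'h) 1)) projective_topology ray"
      using continuous_map_from_subtopology_mono[OF continuous_map_ray, of "sphere 0 1"] by auto
    from continuous_map_compose[OF fst_c this]
    have r: "continuous_map ?S (subtopology projective_topology ?U) (\<lambda>x. ray (fst x))"
      unfolding continuous_map_in_subtopology topD by (auto simp: o_def ray_in_affine_domain)
    have "continuous_map ?S (top_of_set {z. cinner h z \<noteq> 0}) fst"
      unfolding continuous_map_in_subtopology topD using fst_e by auto
    moreover have "continuous_map (top_of_set {z. cinner h z \<noteq> 0}) euclidean (hopf_phase h)"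
      unfolding hopf_phase_def[abs_def] by (auto intro!: continuous_intros)
    ultimately have "continuous_map ?S euclidean (\<lambda>x. hopf_phase h (fst x))"
      using continuous_map_compose unfolding o_def by blast
    with snd_c have "continuous_map ?S (prod_topology euclidean (vtopology F)) (\<lambda>x. (hopf_phase h (fst x), snd x))"
      by (rule continuous_map_pairedI[rotated])
    from continuous_map_compose[OF this continuous_map_vscale[OF inner_product_space_axioms]]
    have "continuous_map ?S (vtopology F) (\<lambda>x. vscale F (hopf_phase h (fst x)) (snd x))" by (simp add: o_def)
    with r have "continuous_map ?S (prod_topology (subtopology projective_topology ?U) (vtopology F))
        (\<lambda>x. (ray (fst x), vscale F (hopf_phase h (fst x)) (snd x)))"
      by (rule continuous_map_pairedI)
    then show "continuous_map ?S (prod_topology (subtopology projective_topology ?U) (vtopology F)) (assoc_triv F h \<circ> orb)"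
      by (rule continuous_map_eq) (auto simp: topD assoc_triv_orb topspace_vtopology inner_product_space_axioms)
  qed
  define \<iota> where "\<iota> = (\<lambda>(p, f). orb (section_at h p, f))"
  have c2: "continuous_map (prod_topology (subtopology projective_topology ?U) (vtopology F)) (subtopology total_top (assoc_proj -` ?U)) \<iota>"
    unfolding continuous_map_in_subtopology
  proof
    have "continuous_map (prod_topology (subtopology projective_topology ?U) (vtopology F)) source (\<lambda>x. (section_at h (fst x), snd x))"
      by (intro continuous_map_pairedI continuous_map_snd continuous_map_compose[OF continuous_map_fst continuous_map_section, unfolded o_def])
    from continuous_map_compose[OF this quotient_imp_continuous_map[OF quotient_map_quotient_topology]]
    show "continuous_map (prod_topology (subtopology projective_topology ?U) (vtopology F)) total_top \<iota>"
      by (simp add: o_def \<iota>_def case_prod_unfold)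
    show "\<iota> \<in> topspace (prod_topology (subtopology projective_topology ?U) (vtopology F)) \<rightarrow> assoc_proj -` ?U"
      unfolding topspace_prod_topology top
      by (auto simp: \<iota>_def topspace_vtopology inner_product_space_axioms assoc_proj_orb section_at(2))
  qed
  have "homeomorphic_maps (subtopology total_top (assoc_proj -` ?U)) (prod_topology (subtopology projective_topology ?U) (vtopology F))
      (assoc_triv F h) \<iota>"
    unfolding homeomorphic_maps_def
  proof (intro conjI c1 c2 ballI)
    fix w assume "w \<in> topspace (subtopology total_top (assoc_proj -` ?U))"
    then have w: "w \<in> assoc_total F" "assoc_proj w \<in> ?U" unfolding topspace_subtopology topspace_total by auto
    obtain z f where zf: "norm z = 1" "f \<in> vcarrier F" "w = orb (z, f)" using w(1) by (rule assoc_totalE)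
    have nz: "cinner h z \<noteq> 0" using w(2) by (simp add: zf assoc_proj_orb ray_in_affine_domain)
    show "\<iota> (assoc_triv F h w) = w"
      by (simp add: zf assoc_triv_orb \<iota>_def section_at_ray nz orb_scale cmod_hopf_phase)
  next
    fix y assume "y \<in> topspace (prod_topology (subtopology projective_topology ?U) (vtopology F))"
    then obtain p f where y: "y = (p, f)" "p \<in> ?U" "f \<in> vcarrier F"
      unfolding topspace_prod_topology top topspace_vtopology[OF inner_product_space_axioms] by auto
    show "assoc_triv F h (\<iota> y) = y"
      by (simp add: y \<iota>_def assoc_triv_orb section_at scale_one)
  qed
  then have hom: "homeomorphic_map (subtopology total_top (assoc_proj -` ?U)) (prod_topology (subtopology projective_topology ?U) (vtopology F))
      (assoc_triv F h)" unfolding homeomorphic_map_maps by blast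
  have uni: "unitary_map (assoc_fibre F p) F (\<lambda>x. snd (assoc_triv F h x))" if p: "p \<in> ?U" for p
  proof -
    define z where "z = section_at h p"
    have z: "norm z = 1" "ray z = p" "hopf_phase h z = 1" using section_at[OF p] by (auto simp: z_def)
    have u: "unitary_map F (assoc_fibre F p) (\<lambda>f. orb (z, f))" using unitary_map_assoc_fibre[OF z(1)] by (simp add: z)
    have i: "inner_product_space (assoc_fibre F p)"
      by (rule inner_product_space_transport[OF inner_product_space_axioms u])
    show ?thesis
    proof (rule unitary_map_cong[OF unitary_map_inverse[OF u inner_product_space_axioms] _ i])
      fix x assume "x \<in> vcarrier (assoc_fibre F p)"
      then obtain f where f: "f \<in> vcarrier F" "x = orb (z, f)" using unitary_mapD(1)[OF u] by (auto simp: bij_betw_def)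
      have "inv_into (vcarrier F) (\<lambda>f. orb (z, f)) (orb (z, f)) = f"
        using bij_betw_inv_into_left[OF unitary_mapD(1)[OF u] f(1)] .
      then show "snd (assoc_triv F h x) = inv_into (vcarrier F) (\<lambda>f. orb (z, f)) x"
        by (simp add: f assoc_triv_orb z scale_one)
    qed
  qed
  show ?thesis
    unfolding local_trivialization_def associated_bundle_def hilbert_bundle.simps
    using openin_affine_domain hom uni
    by (auto simp: topspace_total elim!: assoc_totalE simp: assoc_triv_orb assoc_proj_orb)
qed

text \<open>This is \<open>\<langle>z|k\<rangle> \<langle>h|z\<rangle> / (\<bar>\<langle>k|z\<rangle>\<bar> \<bar>\<langle>h|z\<rangle>\<bar>)\<close>, the transition function between the trivializations at \<open>h\<close>
  and \<open>k\<close>, with the moduli written so that their smoothness in \<open>z\<close> is visible.\<close>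

lemma hopf_phase_section:
  assumes q: "cinner h z \<noteq> 0" and q': "cinner k z \<noteq> 0"
  shows "hopf_phase k (section_at h (ray z)) = cnj (cinner k z) * cinner h (z::'h::complex_hilbert_space)
    * (of_real (inverse (sqrt (Re (cinner k z * cnj (cinner k z))))) * of_real (inverse (sqrt (Re (cinner h z * cnj (cinner h z))))))"
proof -
  define a where "a = cinner h z"
  define v where "v = inverse a *\<^sub>C z"
  have v: "affine_chart h (ray z) + h = v" using q by (simp add: affine_chart_ray v_def a_def)
  have a0: "a \<noteq> 0" using q by (simp add: a_def)
  have z0: "z \<noteq> 0" using q by auto
  have nv: "norm v > 0" using a0 z0 by (simp add: v_def scaleC_eq_0_iff)
  have c: "section_at h (ray z) = (of_real (1 / norm v) * inverse a) *\<^sub>C z"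
    by (simp add: section_at_def v) (simp add: v_def scaleR_scaleC scaleC_scaleC)
  have s: "sqrt (Re (b * cnj b)) = cmod b" for b
    by (simp add: complex_mult_cnj cmod_def)
  have ia: "cnj (inverse a) / of_real (cmod (inverse a)) = a / of_real (cmod a)"
  proof -
    have "a * cnj a = of_real (cmod a) * of_real (cmod a)"
      using complex_norm_square[of a] by (simp add: power2_eq_square)
    then have "of_real (cmod a) / cnj a = a / of_real (cmod a)" using a0 by (simp add: frac_eq_eq)
    moreover have "cnj (inverse a) / of_real (cmod (inverse a)) = of_real (cmod a) / cnj a"
      unfolding norm_inverse by (simp add: divide_inverse mult.commute)
    ultimately show ?thesis by simp
  qed
  have sc: "hopf_phase k (b *\<^sub>C z) = (cnj b / of_real (cmod b)) * hopf_phase k z" for b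
    by (simp add: hopf_phase_def cinner_simps norm_mult)
  have "hopf_phase k (section_at h (ray z)) = (cnj (inverse a) / of_real (cmod (inverse a))) * hopf_phase k z"
    unfolding c sc using nv by (simp add: norm_mult norm_divide)
  also have "\<dots> = a / of_real (cmod a) * (cnj (cinner k z) / of_real (cmod (cinner k z)))"
    unfolding ia hopf_phase_def using cinner_commute[of z k] by simp
  finally show ?thesis
    unfolding s a_def by (simp add: divide_inverse mult.assoc mult.commute mult.left_commute)
qed

lemma smooth_function_hopf_phase:
  "smooth_function projective_charts (affine_domain h \<inter> affine_domain k) (\<lambda>p. hopf_phase k (section_at (h::'h::complex_hilbert_space) p))"
  unfolding smooth_function_def
proof (rule ballI)
  fix C :: "'h set set \<times> ('h set \<Rightarrow> 'h) \<times> 'h set" assume "C \<in> projective_charts"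
  then obtain g where g: "norm g = 1" "C = (affine_domain g, affine_chart g, {w. cinner g w = 0})"
    by (auto simp: projective_charts_def)
  define K where "K = {w. cinner g w = 0}"
  define U where "U = affine_chart g ` (affine_domain g \<inter> (affine_domain h \<inter> affine_domain k))"
  have "U = affine_chart g ` ((affine_domain g \<inter> affine_domain h) \<inter> (affine_domain g \<inter> affine_domain k))"
    unfolding U_def by (rule arg_cong[of _ _ "image _"]) blast
  also have "\<dots> = affine_chart g ` (affine_domain g \<inter> affine_domain h) \<inter> affine_chart g ` (affine_domain g \<inter> affine_domain k)"
    by (rule inj_on_image_Int[OF inj_on_affine_chart]) auto
  finally have U: "U = affine_chart g ` (affine_domain g \<inter> affine_domain h) \<inter> affine_chart g ` (affine_domain g \<inter> affine_domain k)" .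
  have opU: "openin (top_of_set K) U" unfolding U K_def
    by (intro openin_Int openin_affine_chart_image_Int g)
  have UK: "U \<subseteq> K" and nz: "\<And>w. w \<in> U \<Longrightarrow> cinner h (w + g) \<noteq> 0" "\<And>w. w \<in> U \<Longrightarrow> cinner k (w + g) \<noteq> 0"
    unfolding U affine_chart_image_Int[OF g(1)] K_def by auto
  note mult = differentiable_times_bilinear[OF bounded_bilinear_mult UK]
  have lin: "differentiable_times n K U (\<lambda>w. L (f w))" if "bounded_linear L" "differentiable_times n K U f"
    for n and L :: "'c::real_normed_vector \<Rightarrow> 'd::real_normed_vector" and f :: "'h \<Rightarrow> 'c"
    by (rule differentiable_times_compose_linear[OF that])
  have r: "differentiable_times n K U (\<lambda>w. of_real (inverse (sqrt (Re (cinner l (w + g) * cnj (cinner l (w + g)))))) :: complex)"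
    if l: "\<And>w. w \<in> U \<Longrightarrow> cinner l (w + g) \<noteq> 0" for n l
  proof (rule differentiable_times_compose_linear[OF bounded_linear_of_real differentiable_times_inverse_sqrt[OF UK]])
    show "Re (cinner l (w + g) * cnj (cinner l (w + g))) > 0" if "w \<in> U" for w
      using l[OF that] by (simp add: complex_mult_cnj sum_power2_gt_zero_iff complex_eq_iff)
    show "differentiable_times n K U (\<lambda>w. Re (cinner l (w + g) * cnj (cinner l (w + g))))"
      by (intro differentiable_times_compose_linear[OF bounded_linear_Re] mult
          differentiable_times_compose_linear[OF bounded_linear_cnj] differentiable_times_affine_cinner)
  qed
  have "smooth_on K U ((\<lambda>p. hopf_phase k (section_at h p)) \<circ> inv_into (affine_domain g) (affine_chart g))"
  proof (rule smooth_on_cong[OF opU])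
    fix w assume w: "w \<in> U"
    then have "cinner g w = 0" using UK by (auto simp: K_def)
    then show "cnj (cinner k (w + g)) * cinner h (w + g) * (of_real (inverse (sqrt (Re (cinner k (w + g) * cnj (cinner k (w + g))))))
        * of_real (inverse (sqrt (Re (cinner h (w + g) * cnj (cinner h (w + g)))))))
      = ((\<lambda>p. hopf_phase k (section_at h p)) \<circ> inv_into (affine_domain g) (affine_chart g)) w"
      by (simp only: o_apply inv_into_affine_chart[OF g(1)] hopf_phase_section[OF nz(1)[OF w] nz(2)[OF w]])
  next
    show "smooth_on K U (\<lambda>w. cnj (cinner k (w + g)) * cinner h (w + g) * (of_real (inverse (sqrt (Re (cinner k (w + g) * cnj (cinner k (w + g))))))
        * of_real (inverse (sqrt (Re (cinner h (w + g) * cnj (cinner h (w + g))))))))"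
      unfolding smooth_on_def
      by (intro allI mult r nz differentiable_times_compose_linear[OF bounded_linear_cnj] differentiable_times_affine_cinner)
  qed
  then show "case C of (U, \<beta>, K) \<Rightarrow> smooth_on K (\<beta> ` (U \<inter> (affine_domain h \<inter> affine_domain k)))
      ((\<lambda>p. hopf_phase k (section_at h p)) \<circ> inv_into U \<beta>)"
    by (simp add: g(2) U_def K_def)
qed

text \<open>On the representative \<open>(s p, f)\<close> of an orbit over \<open>p\<close> the trivialization at \<open>h\<close> reads off \<open>f\<close>, so the
  transition to \<open>k\<close> is multiplication by the phase of \<open>s p\<close> at \<open>k\<close>.\<close>

lemma smooth_transition_assoc:
  assumes h: "norm (h::'h::complex_hilbert_space) = 1"
  shows "smooth_transition (associated_bundle F) id id (affine_domain h, assoc_triv F h) (affine_domain k, assoc_triv F k)"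
  unfolding smooth_transition_def prod.case
proof (rule exI[of _ "\<lambda>p. hopf_phase k (section_at h p)"], intro conjI ballI impI)
  show "cmod (hopf_phase k (section_at h p)) = 1" if "p \<in> affine_domain h \<inter> id -` affine_domain k" for p
  proof (rule cmod_hopf_phase)
    have "p \<in> affine_domain h" "p \<in> affine_domain k" using that by simp_all
    then have "ray (section_at h p) \<in> affine_domain k" by (simp only: section_at(2))
    then show "cinner k (section_at h p) \<noteq> 0" by (simp add: ray_in_affine_domain)
  qed
  show "smooth_function (bcharts (associated_bundle F)) (affine_domain h \<inter> id -` affine_domain k) (\<lambda>p. hopf_phase k (section_at h p))"
    using smooth_function_hopf_phase[of h k] by (simp add: associated_bundle_def)
  fix x assume "x \<in> topspace (btotal (associated_bundle F) :: ('h \<times> 'f) set topology)"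
  then have x: "x \<in> assoc_total F" by (simp add: associated_bundle_def topspace_total)
  assume "bproj (associated_bundle F) x \<in> affine_domain h \<inter> id -` affine_domain k"
  then have p: "assoc_proj x \<in> affine_domain h" by (simp add: associated_bundle_def)
  note s = section_at[OF p]
  obtain f where f: "f \<in> vcarrier F" "x = orb (section_at h (assoc_proj x), f)"
    using assoc_total_over[OF x s(2)[symmetric] s(1)] .
  have "snd (assoc_triv F k x) = vscale F (hopf_phase k (section_at h (assoc_proj x))) f"
    "snd (assoc_triv F h x) = f"
    using assoc_triv_orb[OF f(1), of k "section_at h (assoc_proj x)"] assoc_triv_orb[OF f(1), of h "section_at h (assoc_proj x)"]
    by (simp_all add: f(2)[symmetric] s(3) scale_one f(1))
  then show "snd (assoc_triv F k (id x)) = vscale (bmodel (associated_bundle F)) (hopf_phase k (section_at h (bproj (associated_bundle F) x))) (snd (assoc_triv F h x))"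
    by (simp add: associated_bundle_def)
qed

theorem locally_trivial_associated_bundle:
  "locally_trivial_bundle (associated_bundle F :: (('h::complex_hilbert_space \<times> 'f) set, 'h set, 'f, 'h) hilbert_bundle)"
  unfolding locally_trivial_bundle_def
proof (intro conjI)
  let ?E = "associated_bundle F :: (('h \<times> 'f) set, 'h set, 'f, 'h) hilbert_bundle"
  have unit: "\<exists>z. norm z = 1 \<and> p = ray z" if pt: "p \<in> topspace (projective_topology :: 'h set topology)" for p
  proof -
    obtain y where y: "y \<noteq> 0" "p = ray y" using pt unfolding topspace_projective by blast
    have "ray (of_real (1 / norm y) *\<^sub>C y) = p" unfolding y(2) by (rule ray_scaleC) (use y(1) in simp)
    then have "p = ray (of_real (1 / norm y) *\<^sub>C y)" ..
    moreover have "norm (complex_of_real (1 / norm y) *\<^sub>C y) = 1" using y by (simp add: norm_scaleC_hilbert norm_divide)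
    ultimately show ?thesis by blast
  qed
  show "continuous_map (btotal ?E) (bbase ?E) (bproj ?E)"
    using continuous_map_assoc_proj by (simp add: associated_bundle_def)
  show "bproj ?E ` topspace (btotal ?E) = topspace (bbase ?E)"
  proof (intro equalityI subsetI)
    fix p assume "p \<in> bproj ?E ` topspace (btotal ?E)"
    then show "p \<in> topspace (bbase ?E)"
      using continuous_map_image_subset_topspace[OF continuous_map_assoc_proj] by (auto simp: associated_bundle_def)
  next
    fix p assume "p \<in> topspace (bbase ?E)"
    then obtain z where z: "norm z = 1" "p = ray z" using unit by (auto simp: associated_bundle_def)
    then have "p = bproj ?E (orb (z, vzero F))" "orb (z, vzero F) \<in> topspace (btotal ?E)"
      by (simp_all add: associated_bundle_def topspace_total orb_in_total assoc_proj_orb zero_closed)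
    then show "p \<in> bproj ?E ` topspace (btotal ?E)" by blast
  qed
  show "hilbert_space (bmodel ?E)" by (simp add: associated_bundle_def hilbert_space_axioms)
  show "\<forall>p\<in>topspace (bbase ?E). hilbert_space (bfibre ?E p) \<and> vcarrier (bfibre ?E p) = {x \<in> topspace (btotal ?E). bproj ?E x = p}"
  proof
    fix p assume "p \<in> topspace (bbase ?E)"
    then obtain z where z: "norm z = 1" "p = ray z" using unit by (auto simp: associated_bundle_def)
    have "hilbert_space (assoc_fibre F p)"
      unfolding z(2) by (rule hilbert_space_transport[OF hilbert_space_axioms unitary_map_assoc_fibre[OF z(1)]])
    then show "hilbert_space (bfibre ?E p) \<and> vcarrier (bfibre ?E p) = {x \<in> topspace (btotal ?E). bproj ?E x = p}"
      by (simp add: associated_bundle_def topspace_total) (simp add: assoc_fibre_def)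
  qed
  show "smooth_atlas (bbase ?E) (bcharts ?E)" by (simp add: associated_bundle_def smooth_atlas_projective)
  have tr: "btrivs ?E = {(affine_domain h, assoc_triv F h) |h. norm h = 1}" by (simp add: associated_bundle_def)
  have "(\<Union>(U, \<psi>)\<in>btrivs ?E. U) = (\<Union>h\<in>{h::'h. norm h = 1}. affine_domain h)" unfolding tr by blast
  then show "(\<Union>(U, \<psi>)\<in>btrivs ?E. U) = topspace (bbase ?E)"
    by (simp only: affine_domain_cover) (simp add: associated_bundle_def topspace_projective)
  show "\<forall>(U, \<psi>)\<in>btrivs ?E. local_trivialization ?E U \<psi>"
    unfolding tr using local_trivialization_assoc by auto
  show "\<forall>T\<in>btrivs ?E. \<forall>T'\<in>btrivs ?E. smooth_transition ?E id id T T'"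
    unfolding tr using smooth_transition_assoc by auto
qed

end

section \<open>Transport of a bundle along a bijection\<close>

lemma homeomorphic_map_pullback:
  assumes bij: "bij_betw f A (topspace T)"
  shows "homeomorphic_map (pullback_topology A f T) T f"
proof (rule bijective_open_imp_homeomorphic_map)
  have inA: "f -` topspace T \<inter> A = A" using bij by (auto simp: bij_betw_def)
  have top: "topspace (pullback_topology A f T) = A" by (simp add: topspace_pullback_topology inA)
  show "continuous_map (pullback_topology A f T) T f"
    using continuous_map_pullback[of T T id A f] by simp
  show "f ` topspace (pullback_topology A f T) = topspace T" using bij by (simp add: top bij_betw_def)
  show "inj_on f (topspace (pullback_topology A f T))" using bij by (simp add: top bij_betw_def)
  show "open_map (pullback_topology A f T) T f"
    unfolding open_map_def openin_pullback_topology
  proof (intro allI impI)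
    fix S assume "\<exists>U. openin T U \<and> S = f -` U \<inter> A"
    then obtain U where U: "openin T U" "S = f -` U \<inter> A" by blast
    have "f ` S = U \<inter> f ` A" unfolding U(2) by auto
    also have "\<dots> = U" using bij openin_subset[OF U(1)] by (simp add: bij_betw_def inf.absorb1)
    finally have "f ` S = U" .
    then show "openin T (f ` S)" using U(1) by simp
  qed
qed

lemma homeomorphic_map_prod_left:
  assumes "homeomorphic_map X Y f"
  shows "homeomorphic_map (prod_topology X Z) (prod_topology Y Z) (\<lambda>(x, z). (f x, z))"
proof -
  obtain g where "homeomorphic_maps X Y f g" using assms homeomorphic_map_maps by blast
  then have "homeomorphic_maps (prod_topology X Z) (prod_topology Y Z) (\<lambda>(x, z). (f x, z)) (\<lambda>(y, z). (g y, z))"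
    using homeomorphic_maps_prod[of X Z Y Z f "\<lambda>z. z" g "\<lambda>z. z"] by (simp add: homeomorphic_maps_def)
  then show ?thesis using homeomorphic_map_maps by blast
qed

text \<open>Charts and trivializations of the induced bundle are those of \<open>E'\<close> composed with \<open>\<tau>\<close> and \<open>\<Phi>\<close>. Read in
  these charts, all maps between the two bundles become chart transitions and transition functions of
  \<open>E'\<close> itself.\<close>

locale bundle_transport =
  fixes E' :: "('e2, 'b2, 'f, 'm::real_normed_vector) hilbert_bundle"
    and X :: "'e set" and P :: "'b set" and p :: "'e \<Rightarrow> 'b" and fib :: "'b \<Rightarrow> 'e ips"
    and \<Phi> :: "'e \<Rightarrow> 'e2" and \<tau> :: "'b \<Rightarrow> 'b2"
  assumes E': "locally_trivial_bundle E'"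
    and \<Phi>: "bij_betw \<Phi> X (topspace (btotal E'))"
    and \<tau>: "bij_betw \<tau> P (topspace (bbase E'))"
    and p: "\<And>x. x \<in> X \<Longrightarrow> p x \<in> P"
    and cover: "\<And>x. x \<in> X \<Longrightarrow> bproj E' (\<Phi> x) = \<tau> (p x)"
    and fib: "\<And>q. q \<in> P \<Longrightarrow> hilbert_space (fib q)"
    and fib_carrier: "\<And>q. q \<in> P \<Longrightarrow> vcarrier (fib q) = {x \<in> X. p x = q}"
    and fib_unitary: "\<And>q. q \<in> P \<Longrightarrow> unitary_map (fib q) (bfibre E' (\<tau> q)) \<Phi>"
begin

abbreviation E :: "('e, 'b, 'f, 'm) hilbert_bundle" where
  "E \<equiv> induced_bundle E' X P p fib \<Phi> \<tau>"

lemma E_simps: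
  "btotal E = pullback_topology X \<Phi> (btotal E')" "bbase E = pullback_topology P \<tau> (bbase E')"
  "bproj E = p" "bfibre E = fib" "bmodel E = bmodel E'"
  "bcharts E = {(\<tau> -` U \<inter> P, \<beta> \<circ> \<tau>, K) |U \<beta> K. (U, \<beta>, K) \<in> bcharts E'}"
  "btrivs E = {(\<tau> -` U \<inter> P, \<lambda>x. (p x, snd (\<psi> (\<Phi> x)))) |U \<psi>. (U, \<psi>) \<in> btrivs E'}"
  by (simp_all add: induced_bundle_def)

lemma topspace_btotal: "topspace (btotal E) = X"
  using \<Phi> by (auto simp: E_simps topspace_pullback_topology bij_betw_def)

lemma topspace_bbase: "topspace (bbase E) = P"
  using \<tau> by (auto simp: E_simps topspace_pullback_topology bij_betw_def)

lemma hom_\<Phi>: "homeomorphic_map (btotal E) (btotal E') \<Phi>"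
  unfolding E_simps by (rule homeomorphic_map_pullback[OF \<Phi>])

lemma hom_\<tau>: "homeomorphic_map (bbase E) (bbase E') \<tau>"
  unfolding E_simps by (rule homeomorphic_map_pullback[OF \<tau>])

lemma \<Phi>_in: "x \<in> X \<Longrightarrow> \<Phi> x \<in> topspace (btotal E')"
  using \<Phi> by (auto simp: bij_betw_def)

lemma \<tau>_in: "q \<in> P \<Longrightarrow> \<tau> q \<in> topspace (bbase E')"
  using \<tau> by (auto simp: bij_betw_def)

lemma
  shows E'_cont: "continuous_map (btotal E') (bbase E') (bproj E')"
    and E'_surj: "bproj E' ` topspace (btotal E') = topspace (bbase E')"
    and E'_model: "hilbert_space (bmodel E')"
    and E'_atlas: "smooth_atlas (bbase E') (bcharts E')"
    and E'_trivs_cover: "(\<Union>(U, \<psi>)\<in>btrivs E'. U) = topspace (bbase E')"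
    and E'_triv: "\<And>U \<psi>. (U, \<psi>) \<in> btrivs E' \<Longrightarrow> local_trivialization E' U \<psi>"
    and E'_trans: "\<And>T T'. T \<in> btrivs E' \<Longrightarrow> T' \<in> btrivs E' \<Longrightarrow> smooth_transition E' id id T T'"
  using E' unfolding locally_trivial_bundle_def by auto

lemma chart:
  assumes "(U, \<beta>, K) \<in> bcharts E'"
  shows "openin (bbase E') U" "subspace K" "closed K" "openin (top_of_set K) (\<beta> ` U)"
    "homeomorphic_map (subtopology (bbase E') U) (top_of_set (\<beta> ` U)) \<beta>"
    "U \<subseteq> topspace (bbase E')" "inj_on \<beta> U"
proof -
  show o: "openin (bbase E') U" and "subspace K" "closed K" "openin (top_of_set K) (\<beta> ` U)"
    and h: "homeomorphic_map (subtopology (bbase E') U) (top_of_set (\<beta> ` U)) \<beta>"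
    using E'_atlas assms unfolding smooth_atlas_def by auto
  show u: "U \<subseteq> topspace (bbase E')" by (rule openin_subset[OF o])
  have "inj_on \<beta> (topspace (subtopology (bbase E') U))" using h by (simp add: homeomorphic_eq_everything_map)
  then show "inj_on \<beta> U" using u by (simp add: inf.absorb2)
qed

lemma chart_transition:
  assumes "(U, \<beta>, K) \<in> bcharts E'" "(U', \<beta>', K') \<in> bcharts E'"
  shows "smooth_on K (\<beta> ` (U \<inter> U')) (\<beta>' \<circ> inv_into U \<beta>)"
  using E'_atlas assms unfolding smooth_atlas_def by blast

lemma chart_image_open:
  assumes C: "(U, \<beta>, K) \<in> bcharts E'" and V: "openin (bbase E') V"
  shows "openin (top_of_set K) (\<beta> ` (U \<inter> V))"
proof -
  have "openin (subtopology (bbase E') U) (U \<inter> V)" using V by (simp add: openin_subtopology_Int2)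
  then have "openin (top_of_set (\<beta> ` U)) (\<beta> ` (U \<inter> V))"
    using homeomorphic_imp_open_map[OF chart(5)[OF C]] by (simp add: open_map_def)
  then show ?thesis using chart(4)[OF C] by (rule openin_trans)
qed

lemma \<tau>_image: assumes "V \<subseteq> topspace (bbase E')" shows "\<tau> ` (\<tau> -` V \<inter> P) = V"
proof -
  have "\<tau> ` (\<tau> -` V \<inter> P) = V \<inter> \<tau> ` P" by auto
  then show ?thesis using \<tau> assms by (simp add: bij_betw_def inf.absorb1)
qed

lemma inv_into_chart:
  assumes C: "(U, \<beta>, K) \<in> bcharts E'" and w: "w \<in> \<beta> ` U"
  shows "\<tau> (inv_into (\<tau> -` U \<inter> P) (\<beta> \<circ> \<tau>) w) = inv_into U \<beta> w"
    and "inv_into (\<tau> -` U \<inter> P) (\<beta> \<circ> \<tau>) w = inv_into P \<tau> (inv_into U \<beta> w)"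
proof -
  obtain u where u: "u \<in> U" "w = \<beta> u" using w by auto
  then obtain q where q: "q \<in> P" "u = \<tau> q" using \<tau> chart(6)[OF C] by (auto simp: bij_betw_def)
  have "inj_on (\<beta> \<circ> \<tau>) (\<tau> -` U \<inter> P)"
    using \<tau> chart(7)[OF C] by (auto simp: inj_on_def bij_betw_def)
  then have 1: "inv_into (\<tau> -` U \<inter> P) (\<beta> \<circ> \<tau>) w = q"
    using inv_into_f_f[of "\<beta> \<circ> \<tau>" "\<tau> -` U \<inter> P" q] u q by simp
  have 2: "inv_into U \<beta> w = u" using inv_into_f_f[OF chart(7)[OF C] u(1)] u by simp
  have 3: "inv_into P \<tau> u = q" using bij_betw_inv_into_left[OF \<tau> q(1)] q by simp
  show "\<tau> (inv_into (\<tau> -` U \<inter> P) (\<beta> \<circ> \<tau>) w) = inv_into U \<beta> w" by (simp add: 1 2 q)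
  show "inv_into (\<tau> -` U \<inter> P) (\<beta> \<circ> \<tau>) w = inv_into P \<tau> (inv_into U \<beta> w)" by (simp add: 1 2 3)
qed

lemma chart_image:
  assumes "U \<subseteq> topspace (bbase E')"
  shows "(\<beta> \<circ> \<tau>) ` (\<tau> -` (U \<inter> V) \<inter> P) = \<beta> ` (U \<inter> V)"
proof -
  have "\<tau> ` (\<tau> -` (U \<inter> V) \<inter> P) = U \<inter> V" by (rule \<tau>_image) (use assms in blast)
  then show ?thesis by (metis image_comp)
qed

lemma bchartsE:
  assumes "C \<in> bcharts E"
  obtains U \<beta> K where "C = (\<tau> -` U \<inter> P, \<beta> \<circ> \<tau>, K)" "(U, \<beta>, K) \<in> bcharts E'"
  using assms unfolding E_simps by blast

lemma btrivsE:
  assumes "T \<in> btrivs E"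
  obtains U \<psi> where "T = (\<tau> -` U \<inter> P, \<lambda>x. (p x, snd (\<psi> (\<Phi> x))))" "(U, \<psi>) \<in> btrivs E'"
  using assms unfolding E_simps by blast

lemma openin_bbase: "openin (bbase E') U \<Longrightarrow> openin (bbase E) (\<tau> -` U \<inter> P)"
  unfolding E_simps openin_pullback_topology by blast

lemma hom_\<tau>_sub:
  assumes "U \<subseteq> topspace (bbase E')"
  shows "homeomorphic_map (subtopology (bbase E) (\<tau> -` U \<inter> P)) (subtopology (bbase E') U) \<tau>"
proof (rule homeomorphic_map_subtopologies[OF hom_\<tau>])
  have "topspace (bbase E) \<inter> (\<tau> -` U \<inter> P) = \<tau> -` U \<inter> P" unfolding topspace_bbase by blast
  then show "\<tau> ` (topspace (bbase E) \<inter> (\<tau> -` U \<inter> P)) = topspace (bbase E') \<inter> U"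
    using \<tau>_image[OF assms] assms by (simp add: inf.absorb2)
qed

lemma smooth_chart_transition:
  assumes C: "(U, \<beta>, K) \<in> bcharts E'" and C': "(U', \<beta>', K') \<in> bcharts E'"
  shows "smooth_on K (\<beta> ` (U \<inter> U')) (\<beta>' \<circ> \<tau> \<circ> inv_into (\<tau> -` U \<inter> P) (\<beta> \<circ> \<tau>))"
proof (rule smooth_on_cong[OF chart_image_open[OF C chart(1)[OF C']] _ chart_transition[OF C C']])
  fix w assume "w \<in> \<beta> ` (U \<inter> U')"
  then have "w \<in> \<beta> ` U" by blast
  then show "(\<beta>' \<circ> inv_into U \<beta>) w = (\<beta>' \<circ> \<tau> \<circ> inv_into (\<tau> -` U \<inter> P) (\<beta> \<circ> \<tau>)) w"
    by (simp only: o_apply inv_into_chart(1)[OF C])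
qed

lemma smooth_atlas_E: "smooth_atlas (bbase E) (bcharts E)"
  unfolding smooth_atlas_def
proof (intro conjI)
  have c: "(\<Union>(U, \<beta>, K)\<in>bcharts E'. U) = topspace (bbase E')" using E'_atlas by (simp add: smooth_atlas_def)
  have "(\<Union>(U, \<beta>, K)\<in>bcharts E. U) = \<tau> -` (\<Union>(U, \<beta>, K)\<in>bcharts E'. U) \<inter> P" unfolding E_simps by blast
  then show "(\<Union>(U, \<beta>, K)\<in>bcharts E. U) = topspace (bbase E)" unfolding c topspace_bbase using \<tau>_in by auto
  show "\<forall>(U, \<beta>, K)\<in>bcharts E. openin (bbase E) U \<and> subspace K \<and> closed K \<and> openin (top_of_set K) (\<beta> ` U) \<and>
        homeomorphic_map (subtopology (bbase E) U) (top_of_set (\<beta> ` U)) \<beta>"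
  proof
    fix C assume "C \<in> bcharts E"
    then obtain U \<beta> K where eq: "C = (\<tau> -` U \<inter> P, \<beta> \<circ> \<tau>, K)" and C: "(U, \<beta>, K) \<in> bcharts E'" by (rule bchartsE)
    have im: "(\<beta> \<circ> \<tau>) ` (\<tau> -` U \<inter> P) = \<beta> ` U" using chart_image[OF chart(6)[OF C], of \<beta> U] by (simp only: Int_absorb)
    show "case C of (U, \<beta>, K) \<Rightarrow> openin (bbase E) U \<and> subspace K \<and> closed K \<and> openin (top_of_set K) (\<beta> ` U) \<and>
        homeomorphic_map (subtopology (bbase E) U) (top_of_set (\<beta> ` U)) \<beta>"
      unfolding eq prod.case im
      by (intro conjI openin_bbase chart[OF C] homeomorphic_map_compose[OF hom_\<tau>_sub[OF chart(6)[OF C]] chart(5)[OF C]])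
  qed
  show "\<forall>(U, \<beta>, K)\<in>bcharts E. \<forall>(U', \<beta>', K')\<in>bcharts E. smooth_on K (\<beta> ` (U \<inter> U')) (\<beta>' \<circ> inv_into U \<beta>)"
  proof
    fix C assume "C \<in> bcharts E"
    then obtain U \<beta> K where eq: "C = (\<tau> -` U \<inter> P, \<beta> \<circ> \<tau>, K)" and C: "(U, \<beta>, K) \<in> bcharts E'" by (rule bchartsE)
    show "case C of (U, \<beta>, K) \<Rightarrow> \<forall>(U', \<beta>', K')\<in>bcharts E. smooth_on K (\<beta> ` (U \<inter> U')) (\<beta>' \<circ> inv_into U \<beta>)"
      unfolding eq prod.case
    proof
      fix C' assume "C' \<in> bcharts E"
      then obtain U' \<beta>' K' where eq': "C' = (\<tau> -` U' \<inter> P, \<beta>' \<circ> \<tau>, K')" and C': "(U', \<beta>', K') \<in> bcharts E'" by (rule bchartsE)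
      have "\<tau> -` U \<inter> P \<inter> (\<tau> -` U' \<inter> P) = \<tau> -` (U \<inter> U') \<inter> P" by blast
      then have im: "(\<beta> \<circ> \<tau>) ` (\<tau> -` U \<inter> P \<inter> (\<tau> -` U' \<inter> P)) = \<beta> ` (U \<inter> U')"
        by (simp only: chart_image[OF chart(6)[OF C]])
      show "case C' of (U', \<beta>', K') \<Rightarrow> smooth_on K ((\<beta> \<circ> \<tau>) ` (\<tau> -` U \<inter> P \<inter> U')) (\<beta>' \<circ> inv_into (\<tau> -` U \<inter> P) (\<beta> \<circ> \<tau>))"
        unfolding eq' prod.case im by (rule smooth_chart_transition[OF C C'])
    qed
  qed
qed

lemma smooth_function_E:
  assumes c: "smooth_function (bcharts E') D c" and D: "openin (bbase E') D"
  shows "smooth_function (bcharts E) (\<tau> -` D \<inter> P) (c \<circ> \<tau>)"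
  unfolding smooth_function_def
proof
  fix C assume "C \<in> bcharts E"
  then obtain U \<beta> K where eq: "C = (\<tau> -` U \<inter> P, \<beta> \<circ> \<tau>, K)" and C: "(U, \<beta>, K) \<in> bcharts E'" by (rule bchartsE)
  have "\<tau> -` U \<inter> P \<inter> (\<tau> -` D \<inter> P) = \<tau> -` (U \<inter> D) \<inter> P" by blast
  then have im: "(\<beta> \<circ> \<tau>) ` (\<tau> -` U \<inter> P \<inter> (\<tau> -` D \<inter> P)) = \<beta> ` (U \<inter> D)"
    by (simp only: chart_image[OF chart(6)[OF C]])
  have sm: "smooth_on K (\<beta> ` (U \<inter> D)) (c \<circ> inv_into U \<beta>)" using c C unfolding smooth_function_def by blast
  have "smooth_on K (\<beta> ` (U \<inter> D)) (c \<circ> \<tau> \<circ> inv_into (\<tau> -` U \<inter> P) (\<beta> \<circ> \<tau>))"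
  proof (rule smooth_on_cong[OF chart_image_open[OF C D] _ sm])
    fix w assume "w \<in> \<beta> ` (U \<inter> D)"
    then have "w \<in> \<beta> ` U" by blast
    then show "(c \<circ> inv_into U \<beta>) w = (c \<circ> \<tau> \<circ> inv_into (\<tau> -` U \<inter> P) (\<beta> \<circ> \<tau>)) w"
      by (simp only: o_apply inv_into_chart(1)[OF C])
  qed
  then show "case C of (U, \<beta>, K) \<Rightarrow> smooth_on K (\<beta> ` (U \<inter> (\<tau> -` D \<inter> P))) (c \<circ> \<tau> \<circ> inv_into U \<beta>)"
    unfolding eq prod.case im .
qed

lemma triv_open: "(U, \<psi>) \<in> btrivs E' \<Longrightarrow> openin (bbase E') U"
  using E'_triv unfolding local_trivialization_def by blast

text \<open>One function serves both for the transitions inside the induced bundle and for those between it and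
  \<open>E'\<close>.\<close>

lemma transition_function:
  assumes T: "(U, \<psi>) \<in> btrivs E'" and T': "(U', \<psi>') \<in> btrivs E'"
  obtains c where "\<And>q. \<tau> q \<in> U \<inter> U' \<Longrightarrow> cmod (c q) = 1"
    "smooth_function (bcharts E) (\<tau> -` (U \<inter> U') \<inter> P) c"
    "\<And>x. x \<in> X \<Longrightarrow> \<tau> (p x) \<in> U \<inter> U' \<Longrightarrow> snd (\<psi>' (\<Phi> x)) = vscale (bmodel E') (c (p x)) (snd (\<psi> (\<Phi> x)))"
proof -
  obtain c where c: "\<And>q. q \<in> U \<inter> U' \<Longrightarrow> cmod (c q) = 1" "smooth_function (bcharts E') (U \<inter> U') c"
    "\<And>y. y \<in> topspace (btotal E') \<Longrightarrow> bproj E' y \<in> U \<inter> U' \<Longrightarrow> snd (\<psi>' y) = vscale (bmodel E') (c (bproj E' y)) (snd (\<psi> y))"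
    using E'_trans[OF T T'] unfolding smooth_transition_def prod.case vimage_id id_apply by blast
  show ?thesis
  proof (rule that[of "c \<circ> \<tau>"])
    show "smooth_function (bcharts E) (\<tau> -` (U \<inter> U') \<inter> P) (c \<circ> \<tau>)"
      by (rule smooth_function_E[OF c(2) openin_Int[OF triv_open[OF T] triv_open[OF T']]])
    show "cmod ((c \<circ> \<tau>) q) = 1" if "\<tau> q \<in> U \<inter> U'" for q using c(1)[OF that] by simp
    fix x assume x: "x \<in> X" "\<tau> (p x) \<in> U \<inter> U'"
    then show "snd (\<psi>' (\<Phi> x)) = vscale (bmodel E') ((c \<circ> \<tau>) (p x)) (snd (\<psi> (\<Phi> x)))"
      using c(3)[OF \<Phi>_in[OF x(1)]] by (simp add: cover)
  qed
qed

lemma local_trivialization_E: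
  assumes T: "(U, \<psi>) \<in> btrivs E'"
  shows "local_trivialization E (\<tau> -` U \<inter> P) (\<lambda>x. (p x, snd (\<psi> (\<Phi> x))))"
proof -
  note U = openin_subset[OF triv_open[OF T]]
  have L: "homeomorphic_map (subtopology (btotal E') (bproj E' -` U)) (prod_topology (subtopology (bbase E') U) (vtopology (bmodel E'))) \<psi>"
    "\<And>y. y \<in> topspace (btotal E') \<Longrightarrow> bproj E' y \<in> U \<Longrightarrow> fst (\<psi> y) = bproj E' y"
    "\<And>q. q \<in> U \<Longrightarrow> unitary_map (bfibre E' q) (bmodel E') (\<lambda>y. snd (\<psi> y))"
    using E'_triv[OF T] unfolding local_trivialization_def by blast+
  have H1: "homeomorphic_map (subtopology (btotal E) (p -` (\<tau> -` U \<inter> P))) (subtopology (btotal E') (bproj E' -` U)) \<Phi>"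
    by (rule homeomorphic_map_subtopologies_alt[OF hom_\<Phi>]) (simp add: topspace_btotal cover p)
  obtain g where g: "homeomorphic_maps (subtopology (bbase E) (\<tau> -` U \<inter> P)) (subtopology (bbase E') U) \<tau> g"
    using hom_\<tau>_sub[OF U] unfolding homeomorphic_map_maps by blast
  then have "homeomorphic_map (subtopology (bbase E') U) (subtopology (bbase E) (\<tau> -` U \<inter> P)) g"
    using homeomorphic_maps_sym homeomorphic_map_maps by blast
  from homeomorphic_map_compose[OF homeomorphic_map_compose[OF H1 L(1)] homeomorphic_map_prod_left[OF this]]
  have "homeomorphic_map (subtopology (btotal E) (p -` (\<tau> -` U \<inter> P)))
      (prod_topology (subtopology (bbase E) (\<tau> -` U \<inter> P)) (vtopology (bmodel E'))) (\<lambda>x. (p x, snd (\<psi> (\<Phi> x))))"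
  proof (rule homeomorphic_map_eq)
    fix x assume "x \<in> topspace (subtopology (btotal E) (p -` (\<tau> -` U \<inter> P)))"
    then have x: "x \<in> X" "\<tau> (p x) \<in> U" "p x \<in> P" unfolding topspace_subtopology topspace_btotal by auto
    have "fst (\<psi> (\<Phi> x)) = \<tau> (p x)" using L(2)[OF \<Phi>_in[OF x(1)]] x by (simp add: cover)
    moreover have "p x \<in> topspace (subtopology (bbase E) (\<tau> -` U \<inter> P))"
      unfolding topspace_subtopology topspace_bbase using x by blast
    then have "g (\<tau> (p x)) = p x" using g unfolding homeomorphic_maps_def by blast
    ultimately show "((\<lambda>(x, z). (g x, z)) \<circ> (\<psi> \<circ> \<Phi>)) x = (p x, snd (\<psi> (\<Phi> x)))"
      by (simp add: case_prod_unfold)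
  qed
  moreover have "unitary_map (fib q) (bmodel E') (\<lambda>x. snd (\<psi> (\<Phi> x)))" if "q \<in> \<tau> -` U \<inter> P" for q
    using unitary_map_compose[OF fib_unitary L(3)] that by blast
  ultimately show ?thesis
    unfolding local_trivialization_def using openin_bbase[OF triv_open[OF T]] by (auto simp: E_simps)
qed

theorem locally_trivial_E: "locally_trivial_bundle E"
  unfolding locally_trivial_bundle_def
proof (intro conjI)
  show "continuous_map (btotal E) (bbase E) (bproj E)"
  proof -
    obtain g where g: "homeomorphic_maps (bbase E) (bbase E') \<tau> g" using hom_\<tau> homeomorphic_map_maps by blast
    have "continuous_map (btotal E) (bbase E) (g \<circ> (bproj E' \<circ> \<Phi>))"
      using g homeomorphic_imp_continuous_map[OF hom_\<Phi>] E'_cont unfolding homeomorphic_maps_def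
      by (intro continuous_map_compose) auto
    then show ?thesis
    proof (rule continuous_map_eq)
      fix x assume "x \<in> topspace (btotal E)"
      then have x: "x \<in> X" by (simp add: topspace_btotal)
      then have "p x \<in> topspace (bbase E)" by (simp add: topspace_bbase p)
      then have "g (\<tau> (p x)) = p x" using g unfolding homeomorphic_maps_def by blast
      then show "(g \<circ> (bproj E' \<circ> \<Phi>)) x = bproj E x" using x by (simp add: cover E_simps(3))
    qed
  qed
  show "bproj E ` topspace (btotal E) = topspace (bbase E)"
    unfolding topspace_btotal topspace_bbase E_simps(3)
  proof (intro equalityI subsetI)
    fix q assume q: "q \<in> P"
    then have "\<tau> q \<in> bproj E' ` topspace (btotal E')" using \<tau>_in E'_surj by simp
    then obtain y where y: "y \<in> topspace (btotal E')" "\<tau> q = bproj E' y" by blast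
    then obtain x where x: "x \<in> X" "y = \<Phi> x" using \<Phi> by (auto simp: bij_betw_def)
    then have "\<tau> (p x) = \<tau> q" using y by (simp add: cover)
    then have "p x = q" using \<tau> p[OF x(1)] q by (auto simp: bij_betw_def inj_on_def)
    then show "q \<in> p ` X" using x by blast
  qed (use p in blast)
  show "hilbert_space (bmodel E)" by (simp add: E_simps E'_model)
  show "\<forall>q\<in>topspace (bbase E). hilbert_space (bfibre E q) \<and> vcarrier (bfibre E q) = {x \<in> topspace (btotal E). bproj E x = q}"
    unfolding topspace_btotal topspace_bbase E_simps(3,4) using fib fib_carrier by blast
  show "smooth_atlas (bbase E) (bcharts E)" by (rule smooth_atlas_E)
  have "(\<Union>(U, \<psi>)\<in>btrivs E. U) = \<tau> -` (\<Union>(U, \<psi>)\<in>btrivs E'. U) \<inter> P" unfolding E_simps by blast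
  then show "(\<Union>(U, \<psi>)\<in>btrivs E. U) = topspace (bbase E)" unfolding E'_trivs_cover topspace_bbase using \<tau>_in by auto
  show "\<forall>(U, \<psi>)\<in>btrivs E. local_trivialization E U \<psi>"
  proof
    fix T assume "T \<in> btrivs E"
    then obtain U \<psi> where "T = (\<tau> -` U \<inter> P, \<lambda>x. (p x, snd (\<psi> (\<Phi> x))))" "(U, \<psi>) \<in> btrivs E'" by (rule btrivsE)
    then show "case T of (U, \<psi>) \<Rightarrow> local_trivialization E U \<psi>" by (simp only: prod.case local_trivialization_E)
  qed
  show "\<forall>T\<in>btrivs E. \<forall>T'\<in>btrivs E. smooth_transition E id id T T'"
  proof (intro ballI)
    fix T T' assume "T \<in> btrivs E" and T': "T' \<in> btrivs E"
    then obtain U \<psi> where T: "T = (\<tau> -` U \<inter> P, \<lambda>x. (p x, snd (\<psi> (\<Phi> x))))" "(U, \<psi>) \<in> btrivs E'" using btrivsE by blast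
    obtain U' \<psi>' where T': "T' = (\<tau> -` U' \<inter> P, \<lambda>x. (p x, snd (\<psi>' (\<Phi> x))))" "(U', \<psi>') \<in> btrivs E'" using btrivsE[OF T'] by blast
    obtain c where c: "\<And>q. \<tau> q \<in> U \<inter> U' \<Longrightarrow> cmod (c q) = 1"
      "smooth_function (bcharts E) (\<tau> -` (U \<inter> U') \<inter> P) c"
      "\<And>x. x \<in> X \<Longrightarrow> \<tau> (p x) \<in> U \<inter> U' \<Longrightarrow> snd (\<psi>' (\<Phi> x)) = vscale (bmodel E') (c (p x)) (snd (\<psi> (\<Phi> x)))"
      using transition_function[OF T(2) T'(2)] by blast
    have D: "\<tau> -` U \<inter> P \<inter> id -` (\<tau> -` U' \<inter> P) = \<tau> -` (U \<inter> U') \<inter> P" by auto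
    show "smooth_transition E id id T T'"
      unfolding T(1) T'(1) smooth_transition_def prod.case D topspace_btotal E_simps(3,5)
      by (intro exI[of _ c] conjI ballI impI c(2)) (use c(1,3) in auto)
  qed
qed

theorem isomorphism_E: "bundle_isomorphism E E' \<Phi> \<tau>"
  unfolding bundle_isomorphism_def
proof (intro conjI)
  show "bmodel E = bmodel E'" by (simp add: E_simps)
  show "bij_betw \<Phi> (topspace (btotal E)) (topspace (btotal E'))" unfolding topspace_btotal by (rule \<Phi>)
  show "bij_betw \<tau> (topspace (bbase E)) (topspace (bbase E'))" unfolding topspace_bbase by (rule \<tau>)
  show "\<forall>x\<in>topspace (btotal E). bproj E' (\<Phi> x) = \<tau> (bproj E x)" unfolding topspace_btotal E_simps(3) using cover by blast
  show "\<forall>q\<in>topspace (bbase E). unitary_map (bfibre E q) (bfibre E' (\<tau> q)) \<Phi>"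
    unfolding topspace_bbase E_simps(4) using fib_unitary by blast
  show "homeomorphic_map (btotal E) (btotal E') \<Phi>" by (rule hom_\<Phi>)
  show "homeomorphic_map (bbase E) (bbase E') \<tau>" by (rule hom_\<tau>)
  show "smooth_between (bcharts E) (bcharts E') (topspace (bbase E)) \<tau>"
    unfolding smooth_between_def
  proof
    fix C assume "C \<in> bcharts E"
    then obtain U \<beta> K where eq: "C = (\<tau> -` U \<inter> P, \<beta> \<circ> \<tau>, K)" and C: "(U, \<beta>, K) \<in> bcharts E'" by (rule bchartsE)
    have "smooth_on K ((\<beta> \<circ> \<tau>) ` (\<tau> -` U \<inter> P \<inter> P \<inter> \<tau> -` U')) (\<beta>' \<circ> \<tau> \<circ> inv_into (\<tau> -` U \<inter> P) (\<beta> \<circ> \<tau>))"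
      if C': "(U', \<beta>', K') \<in> bcharts E'" for U' \<beta>' K'
    proof -
      have "\<tau> -` U \<inter> P \<inter> P \<inter> \<tau> -` U' = \<tau> -` (U \<inter> U') \<inter> P" by blast
      then show ?thesis using smooth_chart_transition[OF C C'] by (simp only: chart_image[OF chart(6)[OF C]])
    qed
    then show "case C of (U, \<beta>, K) \<Rightarrow> \<forall>(U', \<beta>', K')\<in>bcharts E'. smooth_on K (\<beta> ` (U \<inter> topspace (bbase E) \<inter> \<tau> -` U')) (\<beta>' \<circ> \<tau> \<circ> inv_into U \<beta>)"
      unfolding eq prod.case topspace_bbase by blast
  qed
  show "smooth_between (bcharts E') (bcharts E) (topspace (bbase E')) (inv_into (topspace (bbase E)) \<tau>)"
    unfolding smooth_between_def topspace_bbase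
  proof
    fix C assume C: "C \<in> bcharts E'"
    obtain U \<beta> K where eq: "C = (U, \<beta>, K)" by (cases C)
    note C = C[unfolded eq]
    have I: "inv_into P \<tau> u \<in> P" "\<tau> (inv_into P \<tau> u) = u" if "u \<in> topspace (bbase E')" for u
      using that \<tau> bij_betw_inv_into_right[OF \<tau> that] by (auto simp: bij_betw_def inv_into_into)
    show "case C of (U, \<beta>, K) \<Rightarrow> \<forall>(U', \<beta>', K')\<in>bcharts E. smooth_on K (\<beta> ` (U \<inter> topspace (bbase E') \<inter> inv_into P \<tau> -` U'))
        (\<beta>' \<circ> inv_into P \<tau> \<circ> inv_into U \<beta>)"
      unfolding eq prod.case
    proof
      fix C' assume "C' \<in> bcharts E"
      then obtain U' \<beta>' K' where eq': "C' = (\<tau> -` U' \<inter> P, \<beta>' \<circ> \<tau>, K')" and C': "(U', \<beta>', K') \<in> bcharts E'" by (rule bchartsE)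
      have D: "U \<inter> topspace (bbase E') \<inter> inv_into P \<tau> -` (\<tau> -` U' \<inter> P) = U \<inter> U'"
        using I chart(6)[OF C] by auto
      have "smooth_on K (\<beta> ` (U \<inter> U')) (\<beta>' \<circ> \<tau> \<circ> inv_into P \<tau> \<circ> inv_into U \<beta>)"
      proof (rule smooth_on_cong[OF chart_image_open[OF C chart(1)[OF C']] _ chart_transition[OF C C']])
        fix w assume "w \<in> \<beta> ` (U \<inter> U')"
        then have "inv_into U \<beta> w \<in> U" by (intro inv_into_into) blast
        then have "\<tau> (inv_into P \<tau> (inv_into U \<beta> w)) = inv_into U \<beta> w" using chart(6)[OF C] by (intro I(2)) blast
        then show "(\<beta>' \<circ> inv_into U \<beta>) w = (\<beta>' \<circ> \<tau> \<circ> inv_into P \<tau> \<circ> inv_into U \<beta>) w" by (simp only: o_apply)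
      qed
      then show "case C' of (U', \<beta>', K') \<Rightarrow> smooth_on K (\<beta> ` (U \<inter> topspace (bbase E') \<inter> inv_into P \<tau> -` U'))
          (\<beta>' \<circ> inv_into P \<tau> \<circ> inv_into U \<beta>)"
        unfolding eq' prod.case D .
    qed
  qed
  show "\<forall>T\<in>btrivs E. \<forall>T'\<in>btrivs E'. smooth_transition E \<Phi> \<tau> T T'"
  proof (intro ballI)
    fix T T' assume "T \<in> btrivs E" and T'0: "T' \<in> btrivs E'"
    then obtain U \<psi> where T: "T = (\<tau> -` U \<inter> P, \<lambda>x. (p x, snd (\<psi> (\<Phi> x))))" "(U, \<psi>) \<in> btrivs E'" using btrivsE by blast
    obtain U' \<psi>' where T': "T' = (U', \<psi>')" by (cases T')
    obtain c where c: "\<And>q. \<tau> q \<in> U \<inter> U' \<Longrightarrow> cmod (c q) = 1"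
      "smooth_function (bcharts E) (\<tau> -` (U \<inter> U') \<inter> P) c"
      "\<And>x. x \<in> X \<Longrightarrow> \<tau> (p x) \<in> U \<inter> U' \<Longrightarrow> snd (\<psi>' (\<Phi> x)) = vscale (bmodel E') (c (p x)) (snd (\<psi> (\<Phi> x)))"
      using transition_function[OF T(2) T'0[unfolded T']] by blast
    have D: "\<tau> -` U \<inter> P \<inter> \<tau> -` U' = \<tau> -` (U \<inter> U') \<inter> P" by auto
    show "smooth_transition E \<Phi> \<tau> T T'"
      unfolding T(1) T' smooth_transition_def prod.case D topspace_btotal E_simps(3,5)
      by (intro exI[of _ c] conjI ballI impI c(2)) (use c(1,3) in auto)
  qed
qed

end

section \<open>The atomic bundle over one component\<close>

locale atomic_module = hilbert_cstar_module act ip + irreducible_representation \<pi>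
  for act :: "'x::complex_vector \<Rightarrow> 'a::cstar_algebra \<Rightarrow> 'x" and ip :: "'x \<Rightarrow> 'x \<Rightarrow> 'a"
    and \<pi> :: "'a \<Rightarrow> 'h::complex_hilbert_space \<Rightarrow> 'h"
begin

abbreviation form :: "'h \<Rightarrow> 'x \<Rightarrow> 'x \<Rightarrow> complex" where
  "form h \<equiv> module_form ip (vector_state \<pi> h)"

abbreviation pre_fibre :: "'h \<Rightarrow> 'x set ips" where
  "pre_fibre h \<equiv> null_quotient (form h)"

abbreviation fibre :: "'h \<Rightarrow> (nat \<Rightarrow> 'x set) set ips" where
  "fibre h \<equiv> atomic_fibre ip (vector_state \<pi> h)"

abbreviation F :: "(('a, 'x) atomic_point \<times> 'h) set ips" where
  "F \<equiv> orbit_space act ip \<pi>"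

lemma form_eq: "form h \<xi> \<eta> = cinner h (\<pi> (ip \<xi> \<eta>) h)"
  by (simp add: module_form_def vector_state_def)

lemma semi_inner_product_form: "semi_inner_product (form h)"
proof
  fix \<xi> \<eta> \<zeta> :: 'x and c
  show "form h \<xi> (\<eta> + \<zeta>) = form h \<xi> \<eta> + form h \<xi> \<zeta>" by (simp add: form_eq ip_add_right rep_add cinner_add_right)
  show "form h \<xi> (c *\<^sub>C \<eta>) = c * form h \<xi> \<eta>" by (simp add: form_eq ip_scaleC_right rep_scale cinner_scaleC_right)
  have "cnj (form h \<eta> \<xi>) = cinner (\<pi> (ip \<eta> \<xi>) h) h" unfolding form_eq by (rule cinner_commute[symmetric])
  also have "\<dots> = form h \<xi> \<eta>" unfolding form_eq by (simp add: rep_star_right[symmetric] ip_star)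
  finally show "form h \<xi> \<eta> = cnj (form h \<eta> \<xi>)" ..
  obtain a where "ip \<xi> \<xi> = star a * a" using ip_positive by blast
  then have "form h \<xi> \<xi> = of_real ((norm (\<pi> a h))\<^sup>2)" by (simp only: form_eq norm_rep_square)
  then show "form h \<xi> \<xi> \<in> \<real>\<^sub>\<ge>\<^sub>0" by (simp add: complex_nonneg_Reals_iff del: of_real_power)
qed

lemma ips_pre_fibre: "inner_product_space (pre_fibre h)"
  by (rule semi_inner_product.inner_product_space_null_quotient[OF semi_inner_product_form])

lemma fibre_eq: "fibre h = completion_of (pre_fibre h)"
  by (simp add: atomic_fibre_def pre_atomic_fibre_def)

lemma hilbert_fibre: "hilbert_space (fibre h)"
  unfolding fibre_eq by (rule inner_product_space.hilbert_space_completion[OF ips_pre_fibre])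

lemma ips_fibre: "inner_product_space (fibre h)"
  using hilbert_fibre by (simp add: hilbert_space_def)

lemma fibre_phase: "cmod c = 1 \<Longrightarrow> form (c *\<^sub>C h) = form h" "cmod c = 1 \<Longrightarrow> fibre (c *\<^sub>C h) = fibre h"
  by (simp_all add: vector_state_phase)

lemma ip_act_left: "ip (act \<xi> a) \<eta> = star a * ip \<xi> \<eta>"
proof -
  have "ip (act \<xi> a) \<eta> = star (ip \<eta> (act \<xi> a))" by (simp add: ip_star)
  then show ?thesis by (simp add: ip_act_right star_mult ip_star)
qed

lemma form_act: "form h (act \<xi> a) (act \<eta> b) = cinner (\<pi> a h) (\<pi> (ip \<xi> \<eta>) (\<pi> b h))"
  by (simp add: form_eq ip_act_left ip_act_right rep_mult rep_star_right mult.assoc)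

text \<open>The action \<open>t\<^sub>u\<close> on the fibre over the vector state of \<open>h\<close>. Indexing fibres by vectors instead of
  states makes the target fibre that of \<open>\<pi> u h\<close>.\<close>

definition transport :: "'a \<Rightarrow> 'h \<Rightarrow> (nat \<Rightarrow> 'x set) set \<Rightarrow> (nat \<Rightarrow> 'x set) set" where
  "transport u h = completion_lift (pre_fibre (\<pi> u h)) (quotient_lift (form (\<pi> u h)) (\<lambda>\<xi>. act \<xi> (star u)))"

lemma atomic_act_eq: "atomic_act act ip u (vector_state \<pi> h, S) = (vector_state \<pi> (\<pi> u h), transport u h S)"
  by (simp add: atomic_act_def state_act_vector_state pre_atomic_fibre_def transport_def)

lemma form_transport:
  assumes u: "u \<in> unitaries"
  shows "form (\<pi> u h) (act \<xi> (star u)) (act \<eta> (star u)) = form h \<xi> \<eta>"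
  unfolding form_act rep_star_unitary[OF u] unfolding form_eq ..

lemma unitary_map_pre_transport:
  assumes u: "u \<in> unitaries"
  shows "unitary_map (pre_fibre h) (pre_fibre (\<pi> u h)) (quotient_lift (form (\<pi> u h)) (\<lambda>\<xi>. act \<xi> (star u)))"
proof (rule null_quotient_unitary[OF semi_inner_product_form semi_inner_product_form])
  have "act (act \<xi> u) (star u) = \<xi>" for \<xi> using u by (simp add: act_mult[symmetric] unitaries_def act_one)
  then show "surj (\<lambda>\<xi>. act \<xi> (star u))" by (metis surjI)
qed (simp_all add: act_add_left act_scaleC_left form_transport u)

lemma unitary_map_transport:
  assumes u: "u \<in> unitaries"
  shows "unitary_map (fibre h) (fibre (\<pi> u h)) (transport u h)"
  unfolding fibre_eq transport_def
  by (rule unitary_map_completion_lift[OF ips_pre_fibre unitary_map_pre_transport[OF u]])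

lemma transport_in: "u \<in> unitaries \<Longrightarrow> S \<in> vcarrier (fibre h) \<Longrightarrow> transport u h S \<in> vcarrier (fibre (\<pi> u h))"
  by (rule unitary_mapD(5)[OF unitary_map_transport])

abbreviation Cauchy_seq :: "'h \<Rightarrow> (nat \<Rightarrow> 'x) \<Rightarrow> bool" where
  "Cauchy_seq h \<xi> \<equiv> Metric_space.MCauchy (vcarrier (pre_fibre h)) (vdist (pre_fibre h)) (\<lambda>n. coset (form h) (\<xi> n))"

abbreviation fclass :: "'h \<Rightarrow> (nat \<Rightarrow> 'x) \<Rightarrow> (nat \<Rightarrow> 'x set) set" where
  "fclass h \<xi> \<equiv> cauchy_class (pre_fibre h) (\<lambda>n. coset (form h) (\<xi> n))"

lemma fibreE:
  assumes S: "S \<in> vcarrier (fibre h)"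
  obtains \<xi> where "Cauchy_seq h \<xi>" "S = fclass h \<xi>"
proof -
  interpret V: inner_product_space "pre_fibre h" by (rule ips_pre_fibre)
  obtain s where s: "V.cauchy s" "S = cauchy_class (pre_fibre h) s"
    using S unfolding fibre_eq by (rule V.completionE)
  have "\<forall>n. \<exists>\<xi>. s n = coset (form h) \<xi>"
    using V.cauchy_in[OF s(1)]
    unfolding semi_inner_product.null_quotient_carrier[OF semi_inner_product_form] by blast
  then obtain \<xi> where "\<And>n. s n = coset (form h) (\<xi> n)" by metis
  then have "s = (\<lambda>n. coset (form h) (\<xi> n))" by (intro HOL.ext)
  then show ?thesis using s by (intro that) simp_all
qed

lemma transport_fclass:
  assumes u: "u \<in> unitaries" and \<xi>: "Cauchy_seq h \<xi>"
  shows "transport u h (fclass h \<xi>) = fclass (\<pi> u h) (\<lambda>n. act (\<xi> n) (star u))"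
    and "Cauchy_seq (\<pi> u h) (\<lambda>n. act (\<xi> n) (star u))"
proof -
  note U = unitary_map_pre_transport[OF u, of h]
  have lift: "quotient_lift (form (\<pi> u h)) (\<lambda>\<xi>. act \<xi> (star u)) (coset (form h) \<eta>) = coset (form (\<pi> u h)) (act \<eta> (star u))" for \<eta>
  proof (rule quotient_lift_coset[OF semi_inner_product_form semi_inner_product_form, where K = 1])
    show "act (x - y) (star u) = act x (star u) - act y (star u)" for x y
      using act_add_left[of "x - y" y "star u"] by (simp add: algebra_simps)
  qed (simp add: form_transport u)
  have "vdist (pre_fibre (\<pi> u h)) (quotient_lift (form (\<pi> u h)) (\<lambda>\<xi>. act \<xi> (star u)) v) (quotient_lift (form (\<pi> u h)) (\<lambda>\<xi>. act \<xi> (star u)) w)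
      \<le> 1 * vdist (pre_fibre h) v w" if "v \<in> vcarrier (pre_fibre h)" "w \<in> vcarrier (pre_fibre h)" for v w
    by (simp add: unitary_map_vdist[OF ips_pre_fibre U that])
  note L = completion_lift_class[OF ips_pre_fibre ips_pre_fibre unitary_mapD(5)[OF U] zero_le_one this \<xi>]
  show "transport u h (fclass h \<xi>) = fclass (\<pi> u h) (\<lambda>n. act (\<xi> n) (star u))"
    using L(1) by (simp only: transport_def lift)
  show "Cauchy_seq (\<pi> u h) (\<lambda>n. act (\<xi> n) (star u))" using L(2) by (simp only: lift)
qed

lemma transport_mult:
  assumes u: "u \<in> unitaries" and v: "v \<in> unitaries" and S: "S \<in> vcarrier (fibre h)"
  shows "transport v (\<pi> u h) (transport u h S) = transport (v * u) h S"
proof -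
  obtain \<xi> where \<xi>: "Cauchy_seq h \<xi>" "S = fclass h \<xi>" using S by (rule fibreE)
  show ?thesis
    unfolding \<xi>(2) transport_fclass(1)[OF u \<xi>(1)] transport_fclass(1)[OF v transport_fclass(2)[OF u \<xi>(1)]]
      transport_fclass(1)[OF unitaries_mult[OF v u] \<xi>(1)]
    by (simp add: act_mult star_mult rep_mult)
qed

text \<open>If \<open>\<pi> u h = c h\<close> then \<open>star u - cnj c\<close> annihilates \<open>h\<close>, so \<open>\<xi> u*\<close> and \<open>cnj c \<xi>\<close> have the same
  class.\<close>

lemma transport_eigenvector:
  assumes u: "u \<in> unitaries" and S: "S \<in> vcarrier (fibre h)" and c: "\<pi> u h = c *\<^sub>C h" "cmod c = 1"
  shows "transport u h S = vscale (fibre h) (cnj c) S"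
proof -
  interpret V: inner_product_space "pre_fibre h" by (rule ips_pre_fibre)
  interpret s: semi_inner_product "form h" by (rule semi_inner_product_form)
  obtain \<xi> where \<xi>: "Cauchy_seq h \<xi>" "S = fclass h \<xi>" using S by (rule fibreE)
  have fc: "form (\<pi> u h) = form h" unfolding c(1) by (rule fibre_phase(1)[OF c(2)])
  have star_h: "\<pi> (star u) h = cnj c *\<^sub>C h"
  proof -
    have "h = \<pi> (star u) (c *\<^sub>C h)" using rep_star_unitary(1)[OF u, of h] by (simp add: c)
    also have "\<dots> = c *\<^sub>C \<pi> (star u) h" by (rule rep_clinear)
    finally have "cnj c *\<^sub>C h = cnj c *\<^sub>C c *\<^sub>C \<pi> (star u) h" by simp
    then show ?thesis by (simp add: scaleC_scaleC cmod_1_cnj c scaleC_one)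
  qed
  have d: "\<pi> (star u + (- cnj c) *\<^sub>C 1) h = 0"
    unfolding rep_add rep_scalar star_h by (simp add: scaleC_minus_left)
  have "coset (form h) (act \<eta> (star u)) = coset (form h) (cnj c *\<^sub>C \<eta>)" for \<eta>
  proof -
    have "act \<eta> (star u + (- cnj c) *\<^sub>C 1) = act \<eta> (star u) + (- cnj c) *\<^sub>C \<eta>"
      by (simp only: act_add_right act_scaleC_right act_one)
    then have "act \<eta> (star u) - cnj c *\<^sub>C \<eta> = act \<eta> (star u + (- cnj c) *\<^sub>C 1)"
      by (simp add: scaleC_minus_left)
    then show ?thesis by (simp only: s.coset_eq_iff form_act d) simp
  qed
  then have "transport u h S = cauchy_class (pre_fibre h) (\<lambda>n. vscale (pre_fibre h) (cnj c) (coset (form h) (\<xi> n)))"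
    unfolding \<xi>(2) transport_fclass(1)[OF u \<xi>(1)] fc by (simp only: s.null_quotient_scale)
  then show ?thesis unfolding \<xi>(2) fibre_eq V.completion_scale[OF \<xi>(1)] .
qed

lemma transport_fixed:
  assumes "u \<in> unitaries" "S \<in> vcarrier (fibre h)" "\<pi> u h = h"
  shows "transport u h S = S"
  using transport_eigenvector[OF assms(1,2), of 1] assms(2,3) inner_product_space.scale_one[OF ips_fibre]
  by (simp add: scaleC_one)

text \<open>Unitaries with the same effect on \<open>h\<close> differ by one that fixes \<open>h\<close>.\<close>

lemma transport_depends:
  assumes u: "u \<in> unitaries" and v: "v \<in> unitaries" and S: "S \<in> vcarrier (fibre h)" and eq: "\<pi> u h = \<pi> v h"
  shows "transport u h S = transport v h S"
proof -
  define w where "w = star u * v"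
  have w: "w \<in> unitaries" unfolding w_def by (intro unitaries_mult star_unitaries u v)
  have wh: "\<pi> w h = h" by (simp add: w_def rep_mult eq[symmetric] rep_star_unitary u)
  have uw: "u * w = v" using u by (simp add: w_def mult.assoc[symmetric] unitaries_def)
  show ?thesis
    using transport_mult[OF w u S] unfolding wh uw transport_fixed[OF w S wh] .
qed

subsection \<open>The Hilbert space of orbits\<close>

definition orbit :: "'h \<Rightarrow> (nat \<Rightarrow> 'x set) set \<Rightarrow> (('a, 'x) atomic_point \<times> 'h) set" where
  "orbit h S = unitary_orbit act ip \<pi> ((vector_state \<pi> h, S), h)"

lemma in_orbit: "((\<rho>, R), k) \<in> orbit h S \<longleftrightarrow> (\<exists>u\<in>unitaries. k = \<pi> u h \<and> \<rho> = vector_state \<pi> (\<pi> u h) \<and> R = transport u h S)"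
  by (auto simp: orbit_def unitary_orbit_def atomic_act_eq)

lemma orbit_self: "S \<in> vcarrier (fibre h) \<Longrightarrow> ((vector_state \<pi> h, S), h) \<in> orbit h S"
  unfolding in_orbit by (rule bexI[OF _ one_in_unitaries]) (simp add: rep_one transport_fixed[OF one_in_unitaries])

lemma orbit_transport:
  assumes u: "u \<in> unitaries" and S: "S \<in> vcarrier (fibre h)"
  shows "orbit (\<pi> u h) (transport u h S) = orbit h S"
proof -
  have sub: "orbit (\<pi> u h) (transport u h S) \<subseteq> orbit h S" if u: "u \<in> unitaries" and S: "S \<in> vcarrier (fibre h)" for u h S
  proof
    fix y assume y: "y \<in> orbit (\<pi> u h) (transport u h S)"
    obtain \<rho> R k where yy: "y = ((\<rho>, R), k)" by (metis prod.exhaust)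
    obtain v where v: "v \<in> unitaries" "k = \<pi> v (\<pi> u h)" "\<rho> = vector_state \<pi> (\<pi> v (\<pi> u h))"
      "R = transport v (\<pi> u h) (transport u h S)" using y unfolding yy in_orbit by blast
    show "y \<in> orbit h S" unfolding yy in_orbit
      by (rule bexI[OF _ unitaries_mult[OF v(1) u]]) (simp add: v(2,3,4) rep_mult transport_mult[OF u v(1) S])
  qed
  have "star u * u = 1" using u by (simp add: unitaries_def)
  then have inv: "transport (star u) (\<pi> u h) (transport u h S) = S" "\<pi> (star u) (\<pi> u h) = h"
    using transport_mult[OF u star_unitaries[OF u] S] transport_fixed[OF one_in_unitaries S] by (simp_all add: rep_one rep_star_unitary u)
  show ?thesis
    using sub[OF u S] sub[OF star_unitaries[OF u] transport_in[OF u S]] unfolding inv by (rule equalityI)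
qed

lemma orbit_inj:
  assumes "orbit h S = orbit h R" "S \<in> vcarrier (fibre h)" "R \<in> vcarrier (fibre h)"
  shows "S = R"
proof -
  have "((vector_state \<pi> h, S), h) \<in> orbit h R" using orbit_self[OF assms(2)] assms(1) by simp
  then obtain u where "u \<in> unitaries" "h = \<pi> u h" "S = transport u h R" unfolding in_orbit by blast
  then show ?thesis using transport_fixed[OF _ assms(3)] by simp
qed

lemma fibre_product_eq: "fibre_product ip \<pi> = {((vector_state \<pi> h, S), h) |h S. norm h = 1 \<and> S \<in> vcarrier (fibre h)}"
proof (intro equalityI subsetI)
  fix y assume "y \<in> fibre_product ip \<pi>"
  then obtain \<rho> S h where y: "y = ((\<rho>, S), h)" "(\<rho>, S) \<in> atomic_part ip \<pi>" "norm h = 1" "state_ray \<pi> \<rho> = ray h"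
    unfolding fibre_product_def by force
  then have "\<rho> \<in> pure_states_of \<pi>" "S \<in> vcarrier (atomic_fibre ip \<rho>)" by (auto simp: atomic_part_def atomic_total_def)
  moreover from this(1) have "\<rho> = vector_state \<pi> h" using state_ray_eq_iff y by blast
  ultimately show "y \<in> {((vector_state \<pi> h, S), h) |h S. norm h = 1 \<and> S \<in> vcarrier (fibre h)}" using y by blast
next
  fix y assume "y \<in> {((vector_state \<pi> h, S), h) |h S. norm h = 1 \<and> S \<in> vcarrier (fibre h)}"
  then obtain h S where y: "y = ((vector_state \<pi> h, S), h)" "norm h = 1" "S \<in> vcarrier (fibre h)" by blast
  then show "y \<in> fibre_product ip \<pi>"
    by (simp add: fibre_product_def atomic_part_def atomic_total_def vector_state_pure vector_state_in_pure_states_of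
        state_ray_vector_state)
qed

lemma orbit_space_carrier: "vcarrier F = {orbit h S |h S. norm h = 1 \<and> S \<in> vcarrier (fibre h)}"
proof -
  have "vcarrier F = unitary_orbit act ip \<pi> ` fibre_product ip \<pi>" by (simp add: orbit_space_def)
  then show ?thesis unfolding fibre_product_eq orbit_def by blast
qed

lemma orbit_in: "norm h = 1 \<Longrightarrow> S \<in> vcarrier (fibre h) \<Longrightarrow> orbit h S \<in> vcarrier F"
  unfolding orbit_space_carrier by blast

text \<open>Transitivity of the unitary group on unit vectors lets every orbit meet the fibre over \<open>h\<close>.\<close>

lemma orbit_over:
  assumes "f \<in> vcarrier F" and h: "norm h = 1"
  obtains S where "S \<in> vcarrier (fibre h)" "f = orbit h S"
proof -
  obtain k R where k: "f = orbit k R" "norm k = 1" "R \<in> vcarrier (fibre k)"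
    using assms(1) unfolding orbit_space_carrier by blast
  obtain u where u: "u \<in> unitaries" "\<pi> u k = h" using unitary_transitive[OF k(2) h] .
  show ?thesis
    using that[of "transport u k R"] transport_in[OF u(1) k(3)] orbit_transport[OF u(1) k(3)] by (simp add: u(2) k(1))
qed

text \<open>Points of two orbits with the same second component \<open>k\<close> arise from one and the same unitary, which
  makes the operations on orbits well defined.\<close>

lemma common_unitary:
  assumes "((\<rho>, S'), k) \<in> orbit h S" "((\<rho>', R'), k) \<in> orbit h R" "R \<in> vcarrier (fibre h)"
  obtains u where "u \<in> unitaries" "k = \<pi> u h" "\<rho> = vector_state \<pi> (\<pi> u h)" "S' = transport u h S" "R' = transport u h R"
proof -
  obtain u where u: "u \<in> unitaries" "k = \<pi> u h" "\<rho> = vector_state \<pi> (\<pi> u h)" "S' = transport u h S"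
    using assms(1) unfolding in_orbit by blast
  obtain v where v: "v \<in> unitaries" "k = \<pi> v h" "R' = transport v h R"
    using assms(2) unfolding in_orbit by blast
  have "R' = transport u h R" using transport_depends[OF v(1) u(1) assms(3)] u v by simp
  then show ?thesis using that u by blast
qed

theorem unitary_map_orbit:
  assumes h: "norm h = 1"
  shows "unitary_map (fibre h) F (orbit h)"
proof -
  interpret V: inner_product_space "fibre h" by (rule ips_fibre)
  show ?thesis
  proof (rule unitary_mapI)
    show "bij_betw (orbit h) (vcarrier (fibre h)) (vcarrier F)"
      unfolding bij_betw_def
    proof
      show "inj_on (orbit h) (vcarrier (fibre h))" by (rule inj_onI) (rule orbit_inj)
      show "orbit h ` vcarrier (fibre h) = vcarrier F"
      proof (intro equalityI subsetI)
        fix f assume "f \<in> vcarrier F"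
        then obtain S where "S \<in> vcarrier (fibre h)" "f = orbit h S" using h by (rule orbit_over)
        then show "f \<in> orbit h ` vcarrier (fibre h)" by blast
      qed (auto intro: orbit_in h)
    qed
    fix S R c assume S: "S \<in> vcarrier (fibre h)"
    have "unitary_orbit act ip \<pi> ((\<rho>, vscale (atomic_fibre ip \<rho>) c x), k) = orbit h (vscale (fibre h) c S)"
      if x: "((\<rho>, x), k) \<in> orbit h S" for \<rho> x k
    proof -
      obtain u where u: "u \<in> unitaries" "k = \<pi> u h" "\<rho> = vector_state \<pi> (\<pi> u h)" "x = transport u h S"
        using x unfolding in_orbit by blast
      show ?thesis
        using orbit_transport[OF u(1) V.scale_closed[OF S]] unitary_mapD(3)[OF unitary_map_transport[OF u(1)] S]
        by (simp add: u(2-4) orbit_def)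
    qed
    then have "{unitary_orbit act ip \<pi> ((\<rho>, vscale (atomic_fibre ip \<rho>) c x), k) |\<rho> x k. ((\<rho>, x), k) \<in> orbit h S}
        = {orbit h (vscale (fibre h) c S)}"
      using orbit_self[OF S] by blast
    then show "orbit h (vscale (fibre h) c S) = vscale F c (orbit h S)" by (simp add: orbit_space_def)
    assume R: "R \<in> vcarrier (fibre h)"
    have "unitary_orbit act ip \<pi> ((\<rho>, vadd (atomic_fibre ip \<rho>) x y), k) = orbit h (vadd (fibre h) S R)
        \<and> vinner (atomic_fibre ip \<rho>) x y = vinner (fibre h) S R"
      if xy: "((\<rho>, x), k) \<in> orbit h S" "((\<rho>, y), k) \<in> orbit h R" for \<rho> x y k
    proof -
      obtain u where u: "u \<in> unitaries" "k = \<pi> u h" "\<rho> = vector_state \<pi> (\<pi> u h)" "x = transport u h S" "y = transport u h R"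
        by (rule common_unitary[OF xy R])
      show ?thesis
        using orbit_transport[OF u(1) V.add_closed[OF S R]] unitary_mapD(2,4)[OF unitary_map_transport[OF u(1)] S R]
        by (simp add: u(2-5) orbit_def)
    qed
    note xy = this
    have "{unitary_orbit act ip \<pi> ((\<rho>, vadd (atomic_fibre ip \<rho>) x y), k) |\<rho> x y k. ((\<rho>, x), k) \<in> orbit h S \<and> ((\<rho>, y), k) \<in> orbit h R}
        = {orbit h (vadd (fibre h) S R)}"
      using xy orbit_self[OF S] orbit_self[OF R] by blast
    then show "orbit h (vadd (fibre h) S R) = vadd F (orbit h S) (orbit h R)" by (simp add: orbit_space_def)
    have "{vinner (atomic_fibre ip \<rho>) x y |\<rho> x y k. ((\<rho>, x), k) \<in> orbit h S \<and> ((\<rho>, y), k) \<in> orbit h R}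
        = {vinner (fibre h) S R}"
      using xy orbit_self[OF S] orbit_self[OF R] by blast
    then show "vinner F (orbit h S) (orbit h R) = vinner (fibre h) S R" by (simp add: orbit_space_def)
  qed
qed

theorem hilbert_orbit_space: "hilbert_space F"
proof -
  obtain x :: 'h where "x \<noteq> 0" using nonzero by blast
  then have "norm ((1 / norm x) *\<^sub>R x) = 1" by simp
  then show ?thesis by (rule hilbert_space_transport[OF hilbert_fibre unitary_map_orbit])
qed

text \<open>The scalar unitary \<open>c\<close> moves \<open>h\<close> to \<open>c h\<close> and multiplies the fibre by \<open>cnj c\<close>. This is the compatibility
  with the circle action that makes the map into the associated bundle well defined.\<close>

lemma orbit_phase:
  assumes c: "cmod c = 1" and h: "norm h = 1" and S: "S \<in> vcarrier (fibre h)"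
  shows "orbit (c *\<^sub>C h) S = vscale F c (orbit h S)"
proof -
  interpret V: inner_product_space "fibre h" by (rule ips_fibre)
  define u where "u = c *\<^sub>C (1::'a)"
  have u: "u \<in> unitaries" unfolding u_def by (rule scalar_unitary[OF c])
  have uh: "\<pi> u h = c *\<^sub>C h" by (simp add: u_def rep_scalar)
  have cS: "vscale (fibre h) c S \<in> vcarrier (fibre h)" by (rule V.scale_closed[OF S])
  have "transport u h (vscale (fibre h) c S) = S"
    unfolding transport_eigenvector[OF u cS uh c] by (simp add: V.scale_scale[OF S] cmod_1_cnj[OF c] V.scale_one[OF S])
  then have "orbit (c *\<^sub>C h) S = orbit h (vscale (fibre h) c S)"
    using orbit_transport[OF u cS] by (simp add: uh)
  also have "\<dots> = vscale F c (orbit h S)" by (rule unitary_mapD(3)[OF unitary_map_orbit[OF h] S])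
  finally show ?thesis .
qed

sublocale hopf: hopf_associated F
  by (rule hopf_associated.intro) (rule hilbert_orbit_space)

subsection \<open>The isomorphism with the associated bundle\<close>

lemma atomic_part_eq: "atomic_part ip \<pi> = {(vector_state \<pi> h, S) |h S. norm h = 1 \<and> S \<in> vcarrier (fibre h)}"
proof (intro equalityI subsetI)
  fix y assume "y \<in> atomic_part ip \<pi>"
  then obtain \<rho> S where y: "y = (\<rho>, S)" "\<rho> \<in> pure_states_of \<pi>" "S \<in> vcarrier (atomic_fibre ip \<rho>)"
    by (auto simp: atomic_part_def atomic_total_def)
  obtain h where "norm h = 1" "\<rho> = vector_state \<pi> h" using y(2) by (rule pure_states_of_subset)
  then show "y \<in> {(vector_state \<pi> h, S) |h S. norm h = 1 \<and> S \<in> vcarrier (fibre h)}" using y by blast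
qed (auto simp: atomic_part_def atomic_total_def vector_state_pure vector_state_in_pure_states_of)

lemma atomic_to_assoc_eq:
  assumes h: "norm h = 1" and S: "S \<in> vcarrier (fibre h)"
  shows "atomic_to_assoc act ip \<pi> (vector_state \<pi> h, S) = hopf_orbit F (h, orbit h S)"
proof -
  define k where "k = (SOME k. norm k = 1 \<and> ray k = state_ray \<pi> (vector_state \<pi> h))"
  have "norm k = 1 \<and> ray k = state_ray \<pi> (vector_state \<pi> h)"
    unfolding k_def by (rule someI[of _ h]) (simp add: h state_ray_vector_state)
  then have k: "norm k = 1" "ray k = ray h" by (auto simp: h state_ray_vector_state)
  obtain c where c: "cmod c = 1" "k = c *\<^sub>C h" by (rule ray_eq_unitE[OF k(2) h k(1)])
  have "vector_state \<pi> k = vector_state \<pi> h" by (simp add: c vector_state_phase)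
  then have "atomic_to_assoc act ip \<pi> (vector_state \<pi> h, S) = hopf_orbit F (k, orbit k S)"
    by (simp add: atomic_to_assoc_def Let_def k_def[symmetric] orbit_def)
  also have "\<dots> = hopf_orbit F (c *\<^sub>C h, vscale F c (orbit h S))"
    by (simp only: c(2) orbit_phase[OF c(1) h S])
  also have "\<dots> = hopf_orbit F (h, orbit h S)" by (rule hopf.orb_scale[OF c(1) orbit_in[OF h S]])
  finally show ?thesis .
qed

lemma bij_state_ray: "bij_betw (state_ray \<pi>) (pure_states_of \<pi>) (topspace projective_topology)"
  unfolding bij_betw_def
proof
  show "inj_on (state_ray \<pi>) (pure_states_of \<pi>)"
  proof (rule inj_onI)
    fix \<rho> \<sigma> assume \<rho>: "\<rho> \<in> pure_states_of \<pi>" and \<sigma>: "\<sigma> \<in> pure_states_of \<pi>" and eq: "state_ray \<pi> \<rho> = state_ray \<pi> \<sigma>"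
    obtain h where h: "norm h = 1" "\<sigma> = vector_state \<pi> h" using \<sigma> by (rule pure_states_of_subset)
    have "state_ray \<pi> \<rho> = ray h" using eq h by (simp add: state_ray_vector_state)
    then show "\<rho> = \<sigma>" using state_ray_eq_iff[OF \<rho> h(1)] h(2) by simp
  qed
  show "state_ray \<pi> ` pure_states_of \<pi> = topspace projective_topology"
  proof (intro equalityI subsetI)
    fix q assume "q \<in> state_ray \<pi> ` pure_states_of \<pi>"
    then obtain h where h: "norm h = 1" "q = ray h" unfolding pure_states_of_eq by (auto simp: state_ray_vector_state)
    then have "h \<in> - {0}" by auto
    then show "q \<in> topspace projective_topology" unfolding topspace_projective h(2) by (rule imageI)
  next
    fix q :: "'h set" assume "q \<in> topspace projective_topology"
    then obtain z where z: "z \<noteq> 0" "q = ray z" unfolding topspace_projective by blast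
    define h where "h = complex_of_real (1 / norm z) *\<^sub>C z"
    have h: "norm h = 1" using z by (simp add: h_def norm_scaleC_hilbert norm_divide)
    have "ray h = q" unfolding h_def z(2) by (rule ray_scaleC) (use z(1) in simp)
    then have "q = state_ray \<pi> (vector_state \<pi> h)" using h by (simp add: state_ray_vector_state)
    then show "q \<in> state_ray \<pi> ` pure_states_of \<pi>" using vector_state_in_pure_states_of[OF h] by blast
  qed
qed

lemma bij_atomic_to_assoc: "bij_betw (atomic_to_assoc act ip \<pi>) (atomic_part ip \<pi>) (assoc_total F)"
  unfolding bij_betw_def
proof
  show "inj_on (atomic_to_assoc act ip \<pi>) (atomic_part ip \<pi>)"
  proof (rule inj_onI)
    fix x y assume "x \<in> atomic_part ip \<pi>" "y \<in> atomic_part ip \<pi>"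
    then obtain h S k R where x: "x = (vector_state \<pi> h, S)" "norm h = 1" "S \<in> vcarrier (fibre h)"
      and y: "y = (vector_state \<pi> k, R)" "norm k = 1" "R \<in> vcarrier (fibre k)" unfolding atomic_part_eq by blast
    assume "atomic_to_assoc act ip \<pi> x = atomic_to_assoc act ip \<pi> y"
    then have "hopf_orbit F (h, orbit h S) = hopf_orbit F (k, orbit k R)"
      unfolding x(1) y(1) atomic_to_assoc_eq[OF x(2,3)] atomic_to_assoc_eq[OF y(2,3)] .
    then obtain c where c: "cmod c = 1" "h = c *\<^sub>C k" "orbit h S = vscale F c (orbit k R)"
      using orbit_in[OF x(2,3)] by (rule hopf.orb_eqD)
    have f: "fibre h = fibre k" "vector_state \<pi> h = vector_state \<pi> k" unfolding c(2) by (simp_all add: vector_state_phase[OF c(1)])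
    have "orbit h S = orbit h R" using c(3) orbit_phase[OF c(1) y(2,3)] by (simp only: c(2)[symmetric])
    then have "S = R" by (rule orbit_inj) (use x y f in simp_all)
    then show "x = y" using x y f by simp
  qed
  show "atomic_to_assoc act ip \<pi> ` atomic_part ip \<pi> = assoc_total F"
  proof (intro equalityI subsetI)
    fix w assume "w \<in> atomic_to_assoc act ip \<pi> ` atomic_part ip \<pi>"
    then obtain h S where "norm h = 1" "S \<in> vcarrier (fibre h)" "w = hopf_orbit F (h, orbit h S)"
      unfolding atomic_part_eq using atomic_to_assoc_eq by blast
    then show "w \<in> assoc_total F" by (simp add: hopf.orb_in_total orbit_in)
  next
    fix w :: "('h \<times> (('a, 'x) atomic_point \<times> 'h) set) set" assume "w \<in> assoc_total F"
    then obtain z f where z: "norm z = 1" "f \<in> vcarrier F" "w = hopf_orbit F (z, f)" by (rule hopf.assoc_totalE)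
    obtain S where S: "S \<in> vcarrier (fibre z)" "f = orbit z S" using z(2,1) by (rule orbit_over)
    have "w = atomic_to_assoc act ip \<pi> (vector_state \<pi> z, S)" by (simp add: atomic_to_assoc_eq[OF z(1) S(1)] z(3) S(2))
    moreover have "(vector_state \<pi> z, S) \<in> atomic_part ip \<pi>" unfolding atomic_part_eq using z S by blast
    ultimately show "w \<in> atomic_to_assoc act ip \<pi> ` atomic_part ip \<pi>" by blast
  qed
qed

lemma unitary_map_fibre_at: "unitary_map (fibre h) (atomic_fibre_at ip (vector_state \<pi> h)) (Pair (vector_state \<pi> h))"
  by (rule unitary_mapI) (auto simp: atomic_fibre_at_def bij_betw_def inj_on_def)

lemma unitary_map_fibre_snd: "unitary_map (atomic_fibre_at ip (vector_state \<pi> h)) (fibre h) snd"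
  by (rule unitary_mapI) (auto simp: atomic_fibre_at_def bij_betw_def inj_on_def image_image)

sublocale transported: bundle_transport "associated_bundle F" "atomic_part ip \<pi>" "pure_states_of \<pi>" fst
  "atomic_fibre_at ip" "atomic_to_assoc act ip \<pi>" "state_ray \<pi>"
proof (rule bundle_transport.intro)
  show "locally_trivial_bundle (associated_bundle F :: (('h \<times> (('a, 'x) atomic_point \<times> 'h) set) set, 'h set, (('a, 'x) atomic_point \<times> 'h) set, 'h) hilbert_bundle)"
    by (rule hopf.locally_trivial_associated_bundle)
  show "bij_betw (atomic_to_assoc act ip \<pi>) (atomic_part ip \<pi>) (topspace (btotal (associated_bundle F)))"
    using bij_atomic_to_assoc by (simp add: associated_bundle_def hopf.topspace_total)
  show "bij_betw (state_ray \<pi>) (pure_states_of \<pi>) (topspace (bbase (associated_bundle F)))"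
    using bij_state_ray by (simp add: associated_bundle_def)
  show "fst x \<in> pure_states_of \<pi>" if "x \<in> atomic_part ip \<pi>" for x using that by (simp add: atomic_part_def)
  show "bproj (associated_bundle F) (atomic_to_assoc act ip \<pi> x) = state_ray \<pi> (fst x)" if x: "x \<in> atomic_part ip \<pi>" for x
  proof -
    obtain h S where hS: "x = (vector_state \<pi> h, S)" "norm h = 1" "S \<in> vcarrier (fibre h)"
      using x unfolding atomic_part_eq by blast
    show ?thesis
      by (simp add: hS(1) atomic_to_assoc_eq[OF hS(2,3)] associated_bundle_def hopf.assoc_proj_orb orbit_in hS(2,3) state_ray_vector_state)
  qed
  fix q assume q: "q \<in> pure_states_of \<pi>"
  obtain h where h: "norm h = 1" "q = vector_state \<pi> h" using q by (rule pure_states_of_subset)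
  show hq: "hilbert_space (atomic_fibre_at ip q)"
    unfolding h(2) by (rule hilbert_space_transport[OF hilbert_fibre unitary_map_fibre_at])
  have qp: "q \<in> pure_states" using q by (simp add: pure_states_of_def)
  show "vcarrier (atomic_fibre_at ip q) = {x \<in> atomic_part ip \<pi>. fst x = q}"
    using q qp by (auto simp: atomic_fibre_at_def atomic_part_def atomic_total_def)
  have "unitary_map (atomic_fibre_at ip q) (assoc_fibre F (ray h)) (\<lambda>x. hopf_orbit F (h, orbit h (snd x)))"
    unfolding h(2)
    by (rule unitary_map_compose[OF unitary_map_compose[OF unitary_map_fibre_snd unitary_map_orbit[OF h(1)]] hopf.unitary_map_assoc_fibre[OF h(1)]])
  then have "unitary_map (atomic_fibre_at ip q) (assoc_fibre F (ray h)) (atomic_to_assoc act ip \<pi>)"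
  proof (rule unitary_map_cong)
    show "inner_product_space (atomic_fibre_at ip q)" using hq by (simp add: hilbert_space_def)
    fix x assume "x \<in> vcarrier (atomic_fibre_at ip q)"
    then obtain S where S: "x = (vector_state \<pi> h, S)" "S \<in> vcarrier (fibre h)" unfolding h(2) atomic_fibre_at_def by auto
    show "atomic_to_assoc act ip \<pi> x = hopf_orbit F (h, orbit h (snd x))"
      unfolding S(1) snd_conv by (rule atomic_to_assoc_eq[OF h(1) S(2)])
  qed
  then show "unitary_map (atomic_fibre_at ip q) (bfibre (associated_bundle F) (state_ray \<pi> q)) (atomic_to_assoc act ip \<pi>)"
    by (simp add: associated_bundle_def h(2) state_ray_vector_state[OF h(1)])
qed

end

theorem theorem1p5:
  fixes act :: "'x::complex_vector \<Rightarrow> 'a::cstar_algebra \<Rightarrow> 'x"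
    and ip :: "'x \<Rightarrow> 'x \<Rightarrow> 'a"
    and \<pi> :: "'a \<Rightarrow> 'h::complex_hilbert_space \<Rightarrow> 'h"
  assumes "hilbert_cstar_module act ip"
    and "irreducible_representation \<pi>"
  shows "hilbert_space (orbit_space act ip \<pi>) \<and>
    locally_trivial_bundle
      (associated_bundle (orbit_space act ip \<pi>)
        :: (('h \<times> (('a, 'x) atomic_point \<times> 'h) set) set, 'h set,
            (('a, 'x) atomic_point \<times> 'h) set, 'h) hilbert_bundle) \<and>
    (\<forall>x\<in>atomic_part ip \<pi>. \<forall>h. norm h = 1 \<and> ray h = state_ray \<pi> (fst x) \<longrightarrow>
      atomic_to_assoc act ip \<pi> x =
        hopf_orbit (orbit_space act ip \<pi>) (h, unitary_orbit act ip \<pi> (x, h))) \<and>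
    locally_trivial_bundle (atomic_bundle act ip \<pi>) \<and>
    bundle_isomorphism (atomic_bundle act ip \<pi>) (associated_bundle (orbit_space act ip \<pi>))
      (atomic_to_assoc act ip \<pi>) (state_ray \<pi>)"
proof -
  interpret atomic_module act ip \<pi>
    by (intro atomic_module.intro assms)
  have "atomic_to_assoc act ip \<pi> x = hopf_orbit (orbit_space act ip \<pi>) (h, unitary_orbit act ip \<pi> (x, h))"
    if x: "x \<in> atomic_part ip \<pi>" and h: "norm h = 1" "ray h = state_ray \<pi> (fst x)" for x h
  proof -
    obtain \<rho> S where xS: "x = (\<rho>, S)" by (cases x)
    have \<rho>: "\<rho> \<in> pure_states_of \<pi>" "S \<in> vcarrier (atomic_fibre ip \<rho>)" using x by (auto simp: xS atomic_part_def atomic_total_def)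
    have "\<rho> = vector_state \<pi> h" using state_ray_eq_iff[OF \<rho>(1) h(1)] h(2) by (simp add: xS)
    then show ?thesis using atomic_to_assoc_eq[OF h(1), of S] \<rho>(2) by (simp add: xS orbit_def)
  qed
  then show ?thesis
    using hilbert_orbit_space hopf.locally_trivial_associated_bundle transported.locally_trivial_E transported.isomorphism_E
    unfolding atomic_bundle_def by blast
qed

end
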